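(* Let $c(\rho)=1+\alpha\rho$ with $\alpha\ge0$, and let $v$ satisfy the assumptions in the context. Let $\overline\rho\in BV(\mathfrak C;[0,\rho_{\max}])$ with $L:=\|\overline\rho\|_{L^1(\mathfrak C)}>0$, and let $\{(\rho^n,\zeta^n)\}_n$ be the approximate solutions generated by the many-particle scheme for $\overline\rho$ described in the context. Assume that for all $T>0$ there exists a constant $\mathbf{TV}=\mathbf{TV}(T)>0$ such that for any $t\in[0,T]$ and $n\in\mathbb N$ $$\mathrm{TV}(\rho^n(t,\cdot))\le\mathbf{TV}.$$ Then $\{(\rho^n,\zeta^n)\}_n$ converges, up to a subsequence, in $L^1((0,T)\times\mathfrak C)\times C^0([0,T])$ for all $T>0$, to a $\mathbf{BV}$-regular entropy solution $(\rho,\xi)$ of the Hughes initial-boundary value problem with initial datum $\overline\rho$.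
   Context: Let $\mathfrak C=(-1,1)$ and $\rho_{\max}>0$. The velocity $v\in C^2([0,\rho_{\max}];[0,v_{\max}])$ satisfies $v_{\max}:=v(0)>0$, $v(\rho_{\max})=0$, $v$ is strictly decreasing on $[0,\rho_{\max}]$, and $2v'(\rho)+\rho v''(\rho)<0$ for all $\rho\in[0,\rho_{\max}]$. Set $f(\rho):=\rho\,v(\rho)$ and let $\rho_c$ be the unique maximizer of $f$ on $[0,\rho_{\max}]$. Entropy solution: a couple $(\rho,\xi)$ with $\rho\in L^1_{\rm loc}([0,\infty)\times\mathfrak C;[0,\rho_{\max}])$ and $\xi\in\mathrm{Lip}([0,\infty);\mathfrak C)$ is an entropy solution of the Hughes initial-boundary value problem with initial datum $\overline\rho$ and cost $c$ if: (a) $\int_{-1}^{\xi(t)}c(\rho(t,y))\,dy=\int_{\xi(t)}^1c(\rho(t,y))\,dy$ for a.e. $t>0$; (b) for all $\kappa\in[0,\rho_{\max}]$ and all $\varphi\in C_c^\infty((0,\infty)\times\mathfrak C;[0,\infty))$, $$0\le\int_0^\infty\!\!\int_{\mathfrak C}\bigl(|\rho-\kappa|\varphi_t+\mathrm{sign}(x-\xi(t))\,\mathrm{sign}(\rho-\kappa)(f(\rho)-f(\kappa))\varphi_x\bigr)dx\,dt+2\int_0^\infty f(\kappa)\varphi(t,\xi(t))\,dt;$$ (c) for a suitable representative, $\rho\in C^0([0,\infty);L^1(\mathfrak C))$ and $\rho(0,\cdot)=\overline\rho$; (d) the strong one-sided boundary traces satisfy $\rho(t,1^-)\in[0,\rho_c]$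 and $\rho(t,-1^+)\in[0,\rho_c]$ for a.e. $t>0$ (these traces exist because $f$ is strictly concave). It is $\mathbf{BV}$-regular if $\rho\in L^\infty(0,T;BV(\mathfrak C))$ for all $T>0$. Many-particle scheme. Extend $\overline\rho$ by zero outside $\mathfrak C$ and let $[\overline x_{\min},\overline x_{\max}]$ be the convex hull of its support. For $n\in\mathbb N$, $n\geq 1$, put $\ell:=L/n$, $\overline x_0:=\overline x_{\min}$ and $\overline x_i:=\sup\{x>\overline x_{i-1}:\int_{\overline x_{i-1}}^x\overline\rho\,dy<\ell\}$ for $i=1,\dots,n$ (so $\overline x_n=\overline x_{\max}$). Consider unknowns $x_0(t)<\dots<x_n(t)$ and $\zeta^n(t)$; put $x_{-1}:=-\infty$, $x_{n+1}:=+\infty$, and $R_{i+1/2}(t):=\ell/(x_{i+1}(t)-x_i(t))$ for $i=-1,\dots,n$ (thus $R_{-1/2}=R_{n+1/2}=0$). The system is, for $i=0,\dots,n$: $\dot x_i=-v(R_{i-1/2})$ if $x_i(t)<\zeta^n(t)$, $\dot x_i=v(R_{i+1/2})$ if $x_i(t)\ge\zeta^n(t)$, $x_i(0)=\overline x_i$. The approximate density is $\rho^n(t,x):=\sum_{i=0}^{n-1}R_{i+1/2}(t)\mathbf 1_{[x_i(t),x_{i+1}(t))}(x)$. The approximate turning curve $\zeta^n(t)\in\mathbb R$ is the unique solution of $Z_-(t,\zeta^n(t))=Z_+(t,\zeta^n(t))$, where $Z_-(t,x)=x+1+\alpha\int_{x_{I_-}(t)}^x\rho^n(t,y)\,dy$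 if there is $I_-\in\{0,\dots,n\}$ with $x_{I_--1}(t)\le-1<x_{I_-}(t)<x$, and $Z_-(t,x)=x+1$ otherwise; $Z_+(t,x)=1-x+\alpha\int_x^{x_{I_+}(t)}\rho^n(t,y)\,dy$ if there is $I_+\in\{0,\dots,n\}$ with $x<x_{I_+}(t)<1\le x_{I_++1}(t)$, and $Z_+(t,x)=1-x$ otherwise. Solutions are understood as follows: the $x_i$ are continuous on $[0,\infty)$ and there are finitely many times $0<t_1<\dots<t_H$ such that on each of the intervals delimited by $0,t_1,\dots,t_H,\infty$ the restrictions of $x_i$ and $\zeta^n$ to the open interval extend to $C^1$ functions up to the left endpoint; $\dot x_i$ and $\zeta^n$ are normalized to be right-continuous at these times. The pair $(\rho^n,\zeta^n)$ is the one given by the unique global solution of this system. $\mathrm{TV}(\rho^n(t,\cdot))$ is the total variation over $\mathbb R$. Convergence of the piecewise continuous functions $\zeta^n$ in $C^0([0,T])$ means uniform convergence on $[0,T]$. *)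

theory Defs
  imports "HOL-Analysis.Analysis"
begin

abbreviation corridor :: "real set" where
  "corridor \<equiv> {-1<..<1}"

text \<open>Real-valued functions of class \<open>C\<^sup>k\<close> on a whole normed space: all iterated directional
  derivatives up to order \<open>k\<close> exist and are continuous.  It is used here on the line and on the
  plane only.\<close>

fun Ck :: "nat \<Rightarrow> ('a::real_normed_vector \<Rightarrow> real) \<Rightarrow> bool" where
  "Ck 0 f \<longleftrightarrow> continuous_on UNIV f"
| "Ck (Suc k) f \<longleftrightarrow> (\<forall>x. f differentiable (at x)) \<and>
     (\<forall>h. Ck k (\<lambda>x. frechet_derivative f (at x) h))"

definition smooth :: "('a::real_normed_vector \<Rightarrow> real) \<Rightarrow> bool" where
  "smooth f \<longleftrightarrow> (\<forall>k. Ck k f)"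

definition compactly_supported_in :: "('a::real_normed_vector) set \<Rightarrow> ('a \<Rightarrow> real) \<Rightarrow> bool" where
  "compactly_supported_in \<Omega> \<phi> \<longleftrightarrow>
     compact (closure {x. \<phi> x \<noteq> 0}) \<and> closure {x. \<phi> x \<noteq> 0} \<subseteq> \<Omega>"

text \<open>On a subset of the line, with derivatives taken within the set (one-sided at an endpoint
  belonging to it).\<close>

definition C1_on :: "real set \<Rightarrow> (real \<Rightarrow> real) \<Rightarrow> bool" where
  "C1_on I g \<longleftrightarrow>
     (\<exists>g'. (\<forall>t\<in>I. (g has_real_derivative g' t) (at t within I)) \<and> continuous_on I g')"

text \<open>The variation of an integrable function on an open set \<open>\<Omega>\<close> is the total mass of its
  distributional derivative; it depends on the almost-everywhere class only.\<close>

definition total_variation :: "real set \<Rightarrow> (real \<Rightarrow> real) \<Rightarrow> ereal" where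
  "total_variation \<Omega> u =
     (SUP \<phi> \<in> {\<phi>. Ck 1 \<phi> \<and> compactly_supported_in \<Omega> \<phi> \<and> (\<forall>x. \<bar>\<phi> x\<bar> \<le> 1)}.
        ereal (LINT x:\<Omega>|lebesgue. u x * deriv \<phi> x))"

definition L1_norm :: "('a::euclidean_space) set \<Rightarrow> ('a \<Rightarrow> real) \<Rightarrow> real" where
  "L1_norm \<Omega> u = (LINT x:\<Omega>|lebesgue. \<bar>u x\<bar>)"

definition BV_on :: "real set \<Rightarrow> (real \<Rightarrow> real) \<Rightarrow> bool" where
  "BV_on \<Omega> u \<longleftrightarrow> set_integrable lebesgue \<Omega> u \<and> total_variation \<Omega> u < \<infinity>"

definition BV_norm :: "real set \<Rightarrow> (real \<Rightarrow> real) \<Rightarrow> ereal" where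
  "BV_norm \<Omega> u = ereal (L1_norm \<Omega> u) + total_variation \<Omega> u"

text \<open>Integrability is required separately because the Bochner integral of a non-integrable
  function is \<open>0\<close>.\<close>

definition converges_in_L1 ::
  "('a::euclidean_space) set \<Rightarrow> (nat \<Rightarrow> 'a \<Rightarrow> real) \<Rightarrow> ('a \<Rightarrow> real) \<Rightarrow> bool" where
  "converges_in_L1 \<Omega> F f \<longleftrightarrow>
     (\<forall>k. set_integrable lebesgue \<Omega> (F k)) \<and> set_integrable lebesgue \<Omega> f \<and>
     (\<lambda>k. L1_norm \<Omega> (\<lambda>p. F k p - f p)) \<longlonglongrightarrow> 0"

text \<open>The functions \<open>v1\<close> and \<open>v2\<close> below are the first and second derivatives of \<open>v\<close>; they are
  unique because the interval is non-degenerate.  Values of \<open>v\<close> outside of \<open>[0, \<rho>max]\<close> are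
  irrelevant.\<close>

definition admissible_velocity :: "real \<Rightarrow> (real \<Rightarrow> real) \<Rightarrow> bool" where
  "admissible_velocity \<rho>max v \<longleftrightarrow>
     v ` {0..\<rho>max} \<subseteq> {0..v 0} \<and> 0 < v 0 \<and> v \<rho>max = 0 \<and>
     (\<forall>r\<in>{0..\<rho>max}. \<forall>s\<in>{0..\<rho>max}. r < s \<longrightarrow> v s < v r) \<and>
     (\<exists>v1 v2.
        (\<forall>r\<in>{0..\<rho>max}. (v has_real_derivative v1 r) (at r within {0..\<rho>max})) \<and>
        (\<forall>r\<in>{0..\<rho>max}. (v1 has_real_derivative v2 r) (at r within {0..\<rho>max})) \<and>
        continuous_on {0..\<rho>max} v2 \<and>
        (\<forall>r\<in>{0..\<rho>max}. 2 * v1 r + r * v2 r < 0))"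

definition flux :: "(real \<Rightarrow> real) \<Rightarrow> real \<Rightarrow> real" where
  "flux v r = r * v r"

definition critical_density :: "real \<Rightarrow> (real \<Rightarrow> real) \<Rightarrow> real" where
  "critical_density \<rho>max v = (THE r. is_arg_max (flux v) (\<lambda>s. s \<in> {0..\<rho>max}) r)"

text \<open>Space-time densities are written \<open>\<rho> t x\<close>.\<close>

definition turning_condition ::
  "(real \<Rightarrow> real) \<Rightarrow> (real \<Rightarrow> real \<Rightarrow> real) \<Rightarrow> (real \<Rightarrow> real) \<Rightarrow> bool" where
  "turning_condition c \<rho> \<xi> \<longleftrightarrow>
     (AE t in lebesgue. 0 < t \<longrightarrow>
        (LINT y:{-1<..<\<xi> t}|lebesgue. c (\<rho> t y)) = (LINT y:{\<xi> t<..<1}|lebesgue. c (\<rho> t y)))"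

definition entropy_inequality ::
  "real \<Rightarrow> (real \<Rightarrow> real) \<Rightarrow> (real \<Rightarrow> real \<Rightarrow> real) \<Rightarrow> (real \<Rightarrow> real) \<Rightarrow> bool" where
  "entropy_inequality \<rho>max f \<rho> \<xi> \<longleftrightarrow>
     (\<forall>\<kappa>\<in>{0..\<rho>max}. \<forall>\<phi> :: real \<times> real \<Rightarrow> real.
        smooth \<phi> \<and> compactly_supported_in ({0<..} \<times> corridor) \<phi> \<and> (\<forall>p. 0 \<le> \<phi> p) \<longrightarrow>
        0 \<le> (LINT t:{0<..}|lebesgue. LINT x:corridor|lebesgue.
                 \<bar>\<rho> t x - \<kappa>\<bar> * deriv (\<lambda>s. \<phi> (s, x)) t +
                 sgn (x - \<xi> t) * sgn (\<rho> t x - \<kappa>) * (f (\<rho> t x) - f \<kappa>) *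
                   deriv (\<lambda>y. \<phi> (t, y)) x)
            + 2 * (LINT t:{0<..}|lebesgue. f \<kappa> * \<phi> (t, \<xi> t)))"

definition L1_continuous_with_initial_datum ::
  "(real \<Rightarrow> real) \<Rightarrow> (real \<Rightarrow> real \<Rightarrow> real) \<Rightarrow> bool" where
  "L1_continuous_with_initial_datum \<rho>0 \<rho> \<longleftrightarrow>
     (\<exists>r :: real \<Rightarrow> real \<Rightarrow> real.
        (AE (t, x) in lebesgue. 0 \<le> t \<and> x \<in> corridor \<longrightarrow> r t x = \<rho> t x) \<and>
        (\<forall>t\<ge>0. set_integrable lebesgue corridor (r t)) \<and>
        (\<forall>t\<ge>0. ((\<lambda>s. L1_norm corridor (\<lambda>x. r s x - r t x)) \<longlongrightarrow> 0) (at t within {0..})) \<and>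
        (AE x in lebesgue. x \<in> corridor \<longrightarrow> r 0 x = \<rho>0 x))"

text \<open>\<open>\<gamma>\<close> is the strong trace of \<open>\<rho>\<close> at the endpoint \<open>b\<close> of the corridor: the essential limit of
  \<open>\<rho>(\<cdot>, x)\<close>, as \<open>x\<close> tends to \<open>b\<close> inside the corridor, in the topology of \<open>L\<^sup>1(0, T)\<close> for every
  \<open>T\<close>.\<close>

definition strong_trace ::
  "(real \<Rightarrow> real \<Rightarrow> real) \<Rightarrow> real \<Rightarrow> (real \<Rightarrow> real) \<Rightarrow> bool" where
  "strong_trace \<rho> b \<gamma> \<longleftrightarrow>
     \<gamma> \<in> borel_measurable (lebesgue_on {0<..}) \<and>
     (\<forall>T>0. \<forall>\<epsilon>>0. \<exists>\<delta>>0. AE x in lebesgue. x \<in> corridor \<and> \<bar>x - b\<bar> < \<delta> \<longrightarrow>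
        set_integrable lebesgue {0<..<T} (\<lambda>t. \<rho> t x - \<gamma> t) \<and>
        L1_norm {0<..<T} (\<lambda>t. \<rho> t x - \<gamma> t) < \<epsilon>)"

definition boundary_condition :: "real \<Rightarrow> (real \<Rightarrow> real \<Rightarrow> real) \<Rightarrow> bool" where
  "boundary_condition \<rho>c \<rho> \<longleftrightarrow>
     (\<forall>b\<in>{-1, 1}. \<exists>\<gamma>. strong_trace \<rho> b \<gamma> \<and> (AE t in lebesgue. 0 < t \<longrightarrow> \<gamma> t \<in> {0..\<rho>c}))"

definition entropy_solution ::
  "real \<Rightarrow> (real \<Rightarrow> real) \<Rightarrow> (real \<Rightarrow> real) \<Rightarrow> (real \<Rightarrow> real) \<Rightarrow>
   (real \<Rightarrow> real \<Rightarrow> real) \<Rightarrow> (real \<Rightarrow> real) \<Rightarrow> bool" where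
  "entropy_solution \<rho>max v c \<rho>0 \<rho> \<xi> \<longleftrightarrow>
     (\<forall>K. compact K \<and> K \<subseteq> {0..} \<times> corridor \<longrightarrow> set_integrable lebesgue K (\<lambda>(t, x). \<rho> t x)) \<and>
     (AE (t, x) in lebesgue. 0 \<le> t \<and> x \<in> corridor \<longrightarrow> \<rho> t x \<in> {0..\<rho>max}) \<and>
     (\<exists>C. C-lipschitz_on {0..} \<xi>) \<and> \<xi> ` {0..} \<subseteq> corridor \<and>
     turning_condition c \<rho> \<xi> \<and>
     entropy_inequality \<rho>max (flux v) \<rho> \<xi> \<and>
     L1_continuous_with_initial_datum \<rho>0 \<rho> \<and>
     boundary_condition (critical_density \<rho>max v) \<rho>"

definition BV_regular :: "(real \<Rightarrow> real \<Rightarrow> real) \<Rightarrow> bool" where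
  "BV_regular \<rho> \<longleftrightarrow>
     (\<forall>T>0. \<exists>C::real. AE t in lebesgue. t \<in> {0<..<T} \<longrightarrow>
        BV_on corridor (\<rho> t) \<and> BV_norm corridor (\<rho> t) \<le> ereal C)"

definition zero_extension :: "(real \<Rightarrow> real) \<Rightarrow> real \<Rightarrow> real" where
  "zero_extension u x = (if x \<in> corridor then u x else 0)"

text \<open>The support of an almost-everywhere class: the complement of the largest open set on which
  it vanishes almost everywhere.\<close>

definition ess_support :: "(real \<Rightarrow> real) \<Rightarrow> real set" where
  "ess_support u = - \<Union>{U. open U \<and> (AE x in lebesgue. x \<in> U \<longrightarrow> u x = 0)}"

definition particle_mass :: "(real \<Rightarrow> real) \<Rightarrow> nat \<Rightarrow> real" where
  "particle_mass \<rho>0 n = L1_norm corridor \<rho>0 / real n"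

primrec initial_position :: "(real \<Rightarrow> real) \<Rightarrow> nat \<Rightarrow> nat \<Rightarrow> real" where
  "initial_position \<rho>0 n 0 = Inf (convex hull (ess_support (zero_extension \<rho>0)))"
| "initial_position \<rho>0 n (Suc i) =
     Sup {x. initial_position \<rho>0 n i < x \<and>
             (LINT y:{initial_position \<rho>0 n i..x}|lebesgue. zero_extension \<rho>0 y)
               < particle_mass \<rho>0 n}"

text \<open>In the following, \<open>y i\<close> is the position of particle \<open>i \<in> {0..n}\<close> at a given time and \<open>l\<close> the
  mass of a particle.  Half-integer indices are shifted: \<open>local_density l n y k\<close> is \<open>R\<close> with index
  \<open>k - 1/2\<close>, which vanishes for \<open>k = 0\<close> and \<open>k = n + 1\<close> (particles at infinity).\<close>

definition local_density :: "real \<Rightarrow> nat \<Rightarrow> (nat \<Rightarrow> real) \<Rightarrow> nat \<Rightarrow> real" where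
  "local_density l n y k = (if 1 \<le> k \<and> k \<le> n then l / (y k - y (k - 1)) else 0)"

definition discrete_density :: "real \<Rightarrow> nat \<Rightarrow> (nat \<Rightarrow> real) \<Rightarrow> real \<Rightarrow> real" where
  "discrete_density l n y x =
     (\<Sum>i<n. local_density l n y (Suc i) * indicator {y i..<y (Suc i)} x)"

text \<open>The first disjunct in \<open>first_inside\<close> (\<open>last_inside\<close>) is the case in which the preceding
  (following) particle is the one at infinity.\<close>

definition first_inside :: "nat \<Rightarrow> (nat \<Rightarrow> real) \<Rightarrow> nat \<Rightarrow> bool" where
  "first_inside n y i \<longleftrightarrow> i \<le> n \<and> (i = 0 \<or> y (i - 1) \<le> -1) \<and> -1 < y i"

definition last_inside :: "nat \<Rightarrow> (nat \<Rightarrow> real) \<Rightarrow> nat \<Rightarrow> bool" where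
  "last_inside n y i \<longleftrightarrow> i \<le> n \<and> (i = n \<or> 1 \<le> y (Suc i)) \<and> y i < 1"

definition Z_minus :: "real \<Rightarrow> real \<Rightarrow> nat \<Rightarrow> (nat \<Rightarrow> real) \<Rightarrow> real \<Rightarrow> real" where
  "Z_minus \<alpha> l n y x =
     (if \<exists>i. first_inside n y i \<and> y i < x
      then x + 1 + \<alpha> * (LINT z:{y (THE i. first_inside n y i)..x}|lebesgue.
                          discrete_density l n y z)
      else x + 1)"

definition Z_plus :: "real \<Rightarrow> real \<Rightarrow> nat \<Rightarrow> (nat \<Rightarrow> real) \<Rightarrow> real \<Rightarrow> real" where
  "Z_plus \<alpha> l n y x =
     (if \<exists>i. last_inside n y i \<and> x < y i
      then 1 - x + \<alpha> * (LINT z:{x..y (THE i. last_inside n y i)}|lebesgue.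
                          discrete_density l n y z)
      else 1 - x)"

definition particle_velocity ::
  "(real \<Rightarrow> real) \<Rightarrow> real \<Rightarrow> nat \<Rightarrow> (nat \<Rightarrow> real) \<Rightarrow> real \<Rightarrow> nat \<Rightarrow> real" where
  "particle_velocity v l n y \<zeta> i =
     (if y i < \<zeta> then - v (local_density l n y i) else v (local_density l n y (Suc i)))"

text \<open>For a finite set \<open>J\<close> of switching times, the half-open interval from \<open>a\<close> to the next element
  of \<open>J\<close>, or to infinity if there is none.\<close>

definition interval_from :: "real set \<Rightarrow> real \<Rightarrow> real set" where
  "interval_from J a = {t. a \<le> t \<and> (\<forall>s\<in>J. a < s \<longrightarrow> t < s)}"

text \<open>Global solutions with \<open>n + 1\<close> particles, \<open>x i t\<close> being the position of particle \<open>i\<close> at time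
  \<open>t\<close>.  The bound \<open>\<rho>max\<close> on the local densities expresses that \<open>v\<close> is evaluated in its domain only.
  Right-continuity of \<open>\<zeta>\<close> and of the particle velocities at switching times is encoded by requiring
  the regularity and the differential equations on half-open intervals.\<close>

definition scheme_solution ::
  "real \<Rightarrow> (real \<Rightarrow> real) \<Rightarrow> real \<Rightarrow> (real \<Rightarrow> real) \<Rightarrow> nat \<Rightarrow>
   (nat \<Rightarrow> real \<Rightarrow> real) \<Rightarrow> (real \<Rightarrow> real) \<Rightarrow> bool" where
  "scheme_solution \<rho>max v \<alpha> \<rho>0 n x \<zeta> \<longleftrightarrow>
     (let l = particle_mass \<rho>0 n in
       (\<forall>i\<le>n. x i 0 = initial_position \<rho>0 n i) \<and>
       (\<forall>i\<le>n. continuous_on {0..} (x i)) \<and>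
       (\<forall>t\<ge>0. \<forall>i<n. x i t < x (Suc i) t) \<and>
       (\<forall>t\<ge>0. \<forall>k. local_density l n (\<lambda>i. x i t) k \<le> \<rho>max) \<and>
       (\<forall>t\<ge>0. Z_minus \<alpha> l n (\<lambda>i. x i t) (\<zeta> t) = Z_plus \<alpha> l n (\<lambda>i. x i t) (\<zeta> t)) \<and>
       (\<exists>J. finite J \<and> J \<subseteq> {0<..} \<and>
          (\<forall>a\<in>insert 0 J.
             C1_on (interval_from J a) \<zeta> \<and>
             (\<forall>i\<le>n. C1_on (interval_from J a) (x i) \<and>
                (\<forall>t\<in>interval_from J a.
                   (x i has_real_derivative particle_velocity v l n (\<lambda>j. x j t) (\<zeta> t) i)
                     (at t within interval_from J a))))))"

definition approximate_density ::
  "(real \<Rightarrow> real) \<Rightarrow> nat \<Rightarrow> (nat \<Rightarrow> real \<Rightarrow> real) \<Rightarrow> real \<Rightarrow> real \<Rightarrow> real" where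
  "approximate_density \<rho>0 n x t = discrete_density (particle_mass \<rho>0 n) n (\<lambda>i. x i t)"

end

theory Submission
  imports Defs "HOL-Complex_Analysis.Great_Picard"
begin

text \<open>
The proof looks at the mass \<open>F\<^sup>n(t, x)\<close> which the approximate density carries to the left of \<open>x\<close>.
Particles move with speed at most \<open>v 0\<close>, consecutive ones enclose the mass \<open>l = L / n\<close>, and densities are
at most \<open>\<rho>max\<close>; therefore \<open>F\<^sup>n\<close> is Lipschitz in \<open>(t, x)\<close> up to an error \<open>l\<close>, and a diagonal argument
(\<open>almost_Lipschitz_subsequence\<close>) gives a subsequence which converges locally uniformly.

Three facts turn convergence of masses into the claim.  A step function with total jump size \<open>C\<close> is at
\<open>L\<^sup>1\<close>-distance at most \<open>C h\<close> from its averages over windows of length \<open>h\<close>, and these averages are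
difference quotients of the mass; so the variation bound makes the densities converge in \<open>L\<^sup>1\<close>, uniformly
on bounded time intervals (\<open>L1_distance_configurations\<close>), and the same estimate makes the limit
continuous in time.  The turning point is, up to \<open>O(l)\<close>, the zero of
\<open>z \<mapsto> 2 z + \<alpha> (2 F(t, z) - F(t, -1) - F(t, 1))\<close>, whose slope is at least \<open>2\<close>; so turning curves converge
with the masses, jumps included, and the limit curve is Lipschitz.  Finally each scheme satisfies the
Kruzkov inequality on the whole line up to an error \<open>O(l)\<close>.  At a fixed time this is
\<open>discrete_entropy_inequality\<close>: summation by parts reduces it to one inequality per particle, which holds
since \<open>v\<close> decreases, and to a sum that telescopes on both sides of the turning point and leaves
\<open>2 f(\<kappa>) (1 + sgn (R - \<kappa>)) \<phi>(\<zeta>) \<ge> 0\<close> for the density \<open>R\<close> of the cell that contains it.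

The densities live on the whole line, and so does the limit inequality; outside of the corridor the
initial datum vanishes.  This encodes the boundary condition.  Adding the inequalities for
\<open>\<kappa> = \<rho>c\<close>, the maximum point of the flux \<open>f\<close>, and for \<open>\<kappa> = 0\<close> gives an inequality for
\<open>(\<rho> - \<rho>c)\<^sup>+\<close>, whose outward flux at an exit, \<open>f(\<rho>) - f(\<rho>c)\<close> where \<open>\<rho> > \<rho>c\<close>, is nonpositive.  Since none of
this quantity is outside at the initial time, it can only leave the exterior, never enter it; so its flux
vanishes at the exit, and the trace there is at most \<open>\<rho>c\<close>
(\<open>boundary_flux_estimate\<close>, \<open>trace_le_critical\<close>).  The traces exist because the variation bound
in \<open>x\<close>, integrated in time, makes \<open>x \<mapsto> \<rho>(\<cdot>, x)\<close> a function of bounded variation with values in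
\<open>L\<^sup>1(0, T)\<close>.
\<close>

section \<open>Analytic tools\<close>

text \<open>A variant of the theorem of Arzela and Ascoli: the error \<open>e n\<close> replaces equicontinuity.  Convergence on
a countable dense set spreads to compact sets because \<open>e n\<close> is eventually small.\<close>

lemma almost_Lipschitz_subsequence:
  fixes f :: "nat \<Rightarrow> 'a::euclidean_space \<Rightarrow> real"
  assumes bound: "\<And>n p. \<bar>f n p\<bar> \<le> B"
    and lip: "\<And>n p q. \<bar>f n p - f n q\<bar> \<le> K * dist p q + e n"
    and e: "e \<longlonglongrightarrow> 0" and K: "0 \<le> K"
  obtains r g where "strict_mono (r :: nat \<Rightarrow> nat)"
    "\<And>p q. \<bar>g p - g q\<bar> \<le> K * dist p q"
    "\<And>S. compact S \<Longrightarrow> uniform_limit S (\<lambda>k. f (r k)) g sequentially"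
proof -
  obtain D :: "'a set" where D: "countable D" "\<And>X. open X \<Longrightarrow> X \<noteq> {} \<Longrightarrow> \<exists>d\<in>D. d \<in> X"
    using countable_dense_setE by blast
  obtain r :: "nat \<Rightarrow> nat" where r: "strict_mono r"
    and rl: "\<And>x. x \<in> D \<Longrightarrow> \<exists>l. (\<lambda>n. f (r n) x) \<longlonglongrightarrow> l"
    using function_convergent_subsequence[OF D(1), of f B] bound by auto
  have er: "(\<lambda>k. e (r k)) \<longlonglongrightarrow> 0"
    using LIMSEQ_subseq_LIMSEQ[OF e r] by (simp add: o_def)
  define g where "g p = lim (\<lambda>k. f (r k) p)" for p
  have unif: "uniform_limit S (\<lambda>k. f (r k)) g sequentially" if S: "compact S" for S
  proof -
    have "uniformly_Cauchy_on S (\<lambda>k. f (r k))"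
    proof (rule uniformly_Cauchy_onI)
      fix \<epsilon> :: real assume \<epsilon>: "0 < \<epsilon>"
      define \<delta> where "\<delta> = \<epsilon> / (8 * (K + 1))"
      have \<delta>: "0 < \<delta>" "K * \<delta> \<le> \<epsilon> / 8"
        using \<epsilon> K by (auto simp: \<delta>_def field_simps)
      have "S \<subseteq> (\<Union>d\<in>D. ball d \<delta>)"
      proof
        fix p assume "p \<in> S"
        obtain d where "d \<in> D" "d \<in> ball p \<delta>" using D(2)[of "ball p \<delta>"] \<delta> by auto
        then show "p \<in> (\<Union>d\<in>D. ball d \<delta>)" by (auto simp: dist_commute)
      qed
      then obtain D' where D': "D' \<subseteq> D" "finite D'" "S \<subseteq> (\<Union>d\<in>D'. ball d \<delta>)"
        using compactE_image[OF S, of D "\<lambda>d. ball d \<delta>"] by auto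
      have "\<forall>d\<in>D'. \<exists>N. \<forall>m\<ge>N. \<forall>n\<ge>N. \<bar>f (r m) d - f (r n) d\<bar> < \<epsilon> / 4"
      proof
        fix d assume "d \<in> D'"
        then have "Cauchy (\<lambda>n. f (r n) d)" using rl D'(1) LIMSEQ_imp_Cauchy by blast
        then show "\<exists>N. \<forall>m\<ge>N. \<forall>n\<ge>N. \<bar>f (r m) d - f (r n) d\<bar> < \<epsilon> / 4"
          using \<epsilon> unfolding Cauchy_def dist_real_def by (metis zero_less_divide_iff zero_less_numeral)
      qed
      then obtain N where N: "\<And>d. d \<in> D' \<Longrightarrow> \<forall>m\<ge>N d. \<forall>n\<ge>N d. \<bar>f (r m) d - f (r n) d\<bar> < \<epsilon> / 4"
        by metis
      obtain N0 where N0: "\<And>k. k \<ge> N0 \<Longrightarrow> \<bar>e (r k)\<bar> < \<epsilon> / 8"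
        using LIMSEQ_D[OF er, of "\<epsilon>/8"] \<epsilon> by auto
      have "dist (f (r m) p) (f (r n) p) < \<epsilon>"
        if p: "p \<in> S" and mn: "Max (insert N0 (N ` D')) \<le> m" "Max (insert N0 (N ` D')) \<le> n" for p m n
      proof -
        obtain d where d: "d \<in> D'" "dist d p < \<delta>" using D'(3) p by auto
        have "N d \<le> m" "N d \<le> n" "N0 \<le> m" "N0 \<le> n"
          using mn d(1) D'(2) by auto
        then have 1: "\<bar>f (r m) d - f (r n) d\<bar> < \<epsilon> / 4" "\<bar>e (r m)\<bar> < \<epsilon> / 8" "\<bar>e (r n)\<bar> < \<epsilon> / 8"
          using N[OF d(1)] N0 by auto
        have "K * dist d p \<le> \<epsilon> / 8" using d(2) \<delta>(2) K mult_left_mono[of "dist d p" \<delta> K] by linarith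
        then have "\<bar>f (r m) d - f (r m) p\<bar> \<le> \<epsilon>/8 + e (r m)" "\<bar>f (r n) d - f (r n) p\<bar> \<le> \<epsilon>/8 + e (r n)"
          using lip[of "r m" d p] lip[of "r n" d p] by linarith+
        with 1 show ?thesis unfolding dist_real_def by linarith
      qed
      then show "\<exists>M. \<forall>x\<in>S. \<forall>m\<ge>M. \<forall>n\<ge>M. dist (f (r m) x) (f (r n) x) < \<epsilon>" by blast
    qed
    then have "uniformly_convergent_on S (\<lambda>k. f (r k))"
      by (rule Cauchy_uniformly_convergent)
    then show ?thesis
      unfolding g_def by (simp add: uniformly_convergent_uniform_limit_iff)
  qed
  have lim: "(\<lambda>k. f (r k) p) \<longlonglongrightarrow> g p" for p
    using tendsto_uniform_limitI[OF unif[of "{p}"]] by auto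
  have "\<bar>g p - g q\<bar> \<le> K * dist p q" for p q
  proof (rule LIMSEQ_le)
    show "(\<lambda>k. \<bar>f (r k) p - f (r k) q\<bar>) \<longlonglongrightarrow> \<bar>g p - g q\<bar>"
      by (intro tendsto_intros lim)
    show "(\<lambda>k. K * dist p q + e (r k)) \<longlonglongrightarrow> K * dist p q"
      using tendsto_add[OF tendsto_const er, of "K * dist p q"] by simp
  qed (use lip in auto)
  with r unif that show thesis by blast
qed

lemma AE_convergent_of_summable_L1:
  fixes u :: "nat \<Rightarrow> 'a \<Rightarrow> real"
  assumes int: "\<And>k. integrable M (\<lambda>x. u (Suc k) x - u k x)"
    and sm: "summable (\<lambda>k. LINT x|M. \<bar>u (Suc k) x - u k x\<bar>)"
  shows "AE x in M. convergent (\<lambda>k. u k x)"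
proof -
  have m[measurable]: "(\<lambda>x. u (Suc k) x - u k x) \<in> borel_measurable M" for k
    using int by auto
  have "(\<integral>\<^sup>+x. (\<Sum>k. ennreal \<bar>u (Suc k) x - u k x\<bar>) \<partial>M)
      = (\<Sum>k. \<integral>\<^sup>+x. ennreal \<bar>u (Suc k) x - u k x\<bar> \<partial>M)"
    by (rule nn_integral_suminf) simp
  also have "\<dots> = (\<Sum>k. ennreal (LINT x|M. \<bar>u (Suc k) x - u k x\<bar>))"
    by (intro suminf_cong nn_integral_eq_integral integrable_abs int) auto
  also have "\<dots> = ennreal (\<Sum>k. LINT x|M. \<bar>u (Suc k) x - u k x\<bar>)"
    by (intro suminf_ennreal2 sm) auto
  finally have "(\<integral>\<^sup>+x. (\<Sum>k. ennreal \<bar>u (Suc k) x - u k x\<bar>) \<partial>M) \<noteq> \<infinity>" by simp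
  then have "AE x in M. (\<Sum>k. ennreal \<bar>u (Suc k) x - u k x\<bar>) \<noteq> \<infinity>"
    by (intro nn_integral_PInf_AE) auto
  then show ?thesis
  proof (eventually_elim)
    case (elim x)
    then have "summable (\<lambda>k. \<bar>u (Suc k) x - u k x\<bar>)"
      by (intro summable_suminf_not_top) auto
    then have "summable (\<lambda>k. u (Suc k) x - u k x)" by (rule summable_rabs_cancel)
    then have "convergent (\<lambda>n. \<Sum>k<n. u (Suc k) x - u k x)" by (simp add: summable_iff_convergent)
    then have "convergent (\<lambda>n. u n x - u 0 x)" unfolding sum_lessThan_telescope[of "\<lambda>k. u k x"] .
    then show ?case by (simp add: convergent_diff_const_right_iff)
  qed
qed

text \<open>The two functions are densities of finite measures that agree on half-lines.\<close>

lemma AE_eq_of_interval_integrals: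
  fixes f g :: "real \<Rightarrow> real"
  assumes f: "integrable lborel f" "\<And>x. 0 \<le> f x" and g: "integrable lborel g" "\<And>x. 0 \<le> g x"
    and eq: "\<And>a. (LINT x:{a<..}|lborel. f x) = (LINT x:{a<..}|lborel. g x)"
  shows "AE x in lborel. f x = g x"
proof -
  have [measurable]: "f \<in> borel_measurable borel" "g \<in> borel_measurable borel" using f(1) g(1) by auto
  have em: "emeasure (density lborel (\<lambda>x. ennreal (h x))) {a<..} = ennreal (LINT x:{a<..}|lborel. h x)"
    if h: "integrable lborel h" "\<And>x. 0 \<le> h x" for h and a :: real
  proof -
    have [measurable]: "h \<in> borel_measurable borel" using h(1) by auto
    have "emeasure (density lborel (\<lambda>x. ennreal (h x))) {a<..} = (\<integral>\<^sup>+x. ennreal (indicator {a<..} x * h x) \<partial>lborel)"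
      by (subst emeasure_density) (auto intro!: nn_integral_cong simp: indicator_def)
    also have "\<dots> = ennreal (LINT x|lborel. indicator {a<..} x * h x)"
      using integrable_mult_indicator[OF _ h(1), of "{a<..}"] h(2) by (intro nn_integral_eq_integral) auto
    finally show ?thesis by (simp add: set_lebesgue_integral_def)
  qed
  have "density lborel (\<lambda>x. ennreal (f x)) = density lborel (\<lambda>x. ennreal (g x))"
    by (rule measure_eqI_lessThan) (auto simp: em[OF f] em[OF g] eq)
  then have "AE x in lborel. ennreal (f x) = ennreal (g x)"
    by (intro sigma_finite_measure.density_unique[OF lborel.sigma_finite_measure_axioms]) auto
  then show ?thesis
  proof eventually_elim
    case (elim x) then show ?case using f(2)[of x] g(2)[of x] by simp
  qed
qed

text \<open>The test functions that detect the jumps of a step function are sums of rescaled bumps.  Squaring the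
positive part makes the function continuously differentiable.\<close>

definition bump :: "real \<Rightarrow> real" where
  "bump z = (max 0 (1 - z\<^sup>2))\<^sup>2"

definition bump' :: "real \<Rightarrow> real" where
  "bump' z = - 4 * z * max 0 (1 - z\<^sup>2)"

lemma has_derivative_pos_part_squared:
  "((\<lambda>w. (max 0 w)\<^sup>2) has_real_derivative 2 * max 0 w) (at (w::real))"
proof -
  consider "w < 0" | "w = 0" | "0 < w" by linarith
  then show ?thesis
  proof cases
    case 1
    have "((\<lambda>w. 0) has_real_derivative 2 * max 0 w) (at w)" using 1 by simp
    then show ?thesis
      by (rule has_field_derivative_transform_within_open[where S="{..<0}"]) (use 1 in auto)
  next
    case 3
    have "((\<lambda>w. w\<^sup>2) has_real_derivative 2 * max 0 w) (at w)" using 3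
      by (auto intro!: derivative_eq_intros)
    then show ?thesis
      by (rule has_field_derivative_transform_within_open[where S="{0<..}"]) (use 3 in auto)
  next
    case 2
    have "((\<lambda>h. (max 0 h)\<^sup>2 / h) \<longlongrightarrow> 0) (at (0::real))"
    proof (rule tendsto_0_le[where K=1 and f="\<lambda>h. h"])
      show "\<forall>\<^sub>F h in at 0. norm ((max 0 h)\<^sup>2 / h) \<le> norm (h::real) * 1"
        by (rule eventually_at_filter[THEN iffD2], rule always_eventually)
          (auto simp: max_def power2_eq_square)
    qed simp
    then show ?thesis using 2 by (simp add: has_field_derivative_iff)
  qed
qed

lemma bump_has_derivative: "(bump has_real_derivative bump' z) (at z)"
proof -
  have "((\<lambda>z. 1 - z\<^sup>2) has_real_derivative - 2 * z) (at z)"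
    by (auto intro!: derivative_eq_intros)
  from DERIV_chain2[OF has_derivative_pos_part_squared this] show ?thesis
    unfolding bump_def[abs_def] bump'_def by (simp add: algebra_simps)
qed

lemma continuous_bump': "continuous_on UNIV bump'"
  unfolding bump'_def by (intro continuous_intros)

lemma bump_bounds: "0 \<le> bump z" "bump z \<le> 1"
proof -
  have "0 \<le> max 0 (1 - z\<^sup>2)" "max 0 (1 - z\<^sup>2) \<le> 1" by auto
  then show "bump z \<le> 1" unfolding bump_def by (simp add: power_le_one)
qed (simp add: bump_def)

lemma bump_0: "bump 0 = 1" by (simp add: bump_def)

lemma bump_eq_0: "1 \<le> \<bar>z\<bar> \<Longrightarrow> bump z = 0"
  unfolding bump_def by (simp add: max_def) (metis abs_le_square_iff abs_one one_power2 order_antisym)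

section \<open>Velocity, flux and critical density\<close>

text \<open>The entropy flux that belongs to the entropy \<open>\<bar>r - \<kappa>\<bar>\<close>.\<close>

definition kruzkov_flux :: "(real \<Rightarrow> real) \<Rightarrow> real \<Rightarrow> real \<Rightarrow> real" where
  "kruzkov_flux v \<kappa> r = sgn (r - \<kappa>) * (flux v r - flux v \<kappa>)"

locale velocity =
  fixes \<rho>max :: real and v :: "real \<Rightarrow> real"
  assumes \<rho>max_pos: "0 < \<rho>max" and adm: "admissible_velocity \<rho>max v"
begin

lemma v_antimono: "r \<in> {0..\<rho>max} \<Longrightarrow> s \<in> {0..\<rho>max} \<Longrightarrow> r \<le> s \<Longrightarrow> v s \<le> v r"
  using adm unfolding admissible_velocity_def by (metis order_le_less)

lemma v_0_pos: "0 < v 0"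
  using adm unfolding admissible_velocity_def by auto

lemma v_bounds: assumes "r \<in> {0..\<rho>max}" shows "0 \<le> v r" "v r \<le> v 0"
proof -
  have "v r \<in> {0..v 0}"
    using adm assms unfolding admissible_velocity_def by blast
  then show "0 \<le> v r" "v r \<le> v 0" by auto
qed

lemma v_abs_le: "r \<in> {0..\<rho>max} \<Longrightarrow> \<bar>v r\<bar> \<le> v 0"
  using v_bounds[of r] by auto

lemma v_derivatives:
  obtains v1 v2 where
    "\<And>r. r \<in> {0..\<rho>max} \<Longrightarrow> (v has_real_derivative v1 r) (at r within {0..\<rho>max})"
    "\<And>r. r \<in> {0..\<rho>max} \<Longrightarrow> (v1 has_real_derivative v2 r) (at r within {0..\<rho>max})"
    "\<And>r. r \<in> {0..\<rho>max} \<Longrightarrow> 2 * v1 r + r * v2 r < 0"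
  using adm unfolding admissible_velocity_def by blast

lemma v_continuous: "continuous_on {0..\<rho>max} v"
  using v_derivatives by (metis DERIV_continuous_on)

lemma v_Lipschitz:
  "\<exists>K\<ge>0. \<forall>r\<in>{0..\<rho>max}. \<forall>s\<in>{0..\<rho>max}. \<bar>v r - v s\<bar> \<le> K * \<bar>r - s\<bar>"
proof -
  obtain v1 v2 where v1: "\<And>r. r \<in> {0..\<rho>max} \<Longrightarrow> (v has_real_derivative v1 r) (at r within {0..\<rho>max})"
    and v2: "\<And>r. r \<in> {0..\<rho>max} \<Longrightarrow> (v1 has_real_derivative v2 r) (at r within {0..\<rho>max})"
    using v_derivatives by metis
  have "continuous_on {0..\<rho>max} v1" using v2 by (metis DERIV_continuous_on)
  then have "bounded (v1 ` {0..\<rho>max})"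
    by (intro compact_imp_bounded compact_continuous_image) auto
  then obtain K where K: "K > 0" "\<And>r. r \<in> {0..\<rho>max} \<Longrightarrow> norm (v1 r) \<le> K"
    by (auto simp: bounded_pos)
  have "\<bar>v r - v s\<bar> \<le> K * \<bar>r - s\<bar>" if "r \<in> {0..\<rho>max}" "s \<in> {0..\<rho>max}" for r s
    using field_differentiable_bound[of "{0..\<rho>max}" v v1 K r s] v1 K(2) that by auto
  with K(1) show ?thesis by (intro exI[of _ K]) auto
qed

lemma flux_continuous: "continuous_on {0..\<rho>max} (flux v)"
  unfolding flux_def by (intro continuous_intros v_continuous)

lemma flux_bounds: assumes "r \<in> {0..\<rho>max}" shows "0 \<le> flux v r" "flux v r \<le> \<rho>max * v 0"
  using v_bounds[OF assms] assms unfolding flux_def by (auto intro!: mult_mono)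

lemma kruzkov_flux_0: assumes "\<kappa> \<in> {0..\<rho>max}" shows "kruzkov_flux v \<kappa> 0 = flux v \<kappa>"
  using assms unfolding kruzkov_flux_def by (cases "\<kappa> = 0") (auto simp: flux_def)

lemma kruzkov_flux_bound: "\<kappa> \<in> {0..\<rho>max} \<Longrightarrow> r \<in> {0..\<rho>max} \<Longrightarrow> \<bar>kruzkov_flux v \<kappa> r\<bar> \<le> \<rho>max * v 0"
  using flux_bounds[of r] flux_bounds[of \<kappa>] unfolding kruzkov_flux_def
  by (auto simp: abs_mult sgn_if)

lemma kruzkov_flux_continuous: assumes \<kappa>: "\<kappa> \<in> {0..\<rho>max}"
  shows "continuous_on {0..\<rho>max} (kruzkov_flux v \<kappa>)"
proof -
  have "continuous_on ({0..\<kappa>} \<union> {\<kappa>..\<rho>max}) (\<lambda>r. if r \<le> \<kappa> then flux v \<kappa> - flux v r else flux v r - flux v \<kappa>)"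
    by (rule continuous_on_cases)
      (use \<kappa> in \<open>auto intro!: continuous_intros continuous_on_subset[OF flux_continuous]\<close>)
  moreover have "{0..\<kappa>} \<union> {\<kappa>..\<rho>max} = {0..\<rho>max}" using \<kappa> by auto
  moreover have "kruzkov_flux v \<kappa> r = (if r \<le> \<kappa> then flux v \<kappa> - flux v r else flux v r - flux v \<kappa>)" for r
    by (auto simp: kruzkov_flux_def sgn_if)
  ultimately show ?thesis by simp
qed

text \<open>The flux is strictly concave since \<open>(r v)'' = 2 v' + r v'' < 0\<close>; between two maximizers Rolle's theorem
would place a critical point, to the left of which the flux increases strictly.\<close>

lemma critical_density:
  shows "critical_density \<rho>max v \<in> {0..\<rho>max}"
    and "\<And>r. r \<in> {0..\<rho>max} \<Longrightarrow> flux v r \<le> flux v (critical_density \<rho>max v)"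
    and "\<And>r. r \<in> {0..\<rho>max} \<Longrightarrow> flux v r = flux v (critical_density \<rho>max v) \<Longrightarrow> r = critical_density \<rho>max v"
proof -
  obtain v1 v2 where v1: "\<And>r. r \<in> {0..\<rho>max} \<Longrightarrow> (v has_real_derivative v1 r) (at r within {0..\<rho>max})"
    and v2: "\<And>r. r \<in> {0..\<rho>max} \<Longrightarrow> (v1 has_real_derivative v2 r) (at r within {0..\<rho>max})"
    and neg: "\<And>r. r \<in> {0..\<rho>max} \<Longrightarrow> 2 * v1 r + r * v2 r < 0"
    using v_derivatives by metis
  define f1 where "f1 r = v r + r * v1 r" for r
  have f1: "(flux v has_real_derivative f1 r) (at r)" if "0 < r" "r < \<rho>max" for r
  proof -
    have "(flux v has_real_derivative f1 r) (at r within {0..\<rho>max})"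
      unfolding flux_def[abs_def] f1_def using that by (auto intro!: derivative_eq_intros v1)
    then show ?thesis using that by (simp add: at_within_Icc_at)
  qed
  have fd: "flux v differentiable (at r)" if "0 < r" "r < \<rho>max" for r
    using f1[OF that] by (auto simp: real_differentiable_def)
  have f2: "(f1 has_real_derivative 2 * v1 r + r * v2 r) (at r)" if "0 < r" "r < \<rho>max" for r
  proof -
    have "(f1 has_real_derivative 2 * v1 r + r * v2 r) (at r within {0..\<rho>max})"
      unfolding f1_def[abs_def] using that by (auto intro!: derivative_eq_intros v1 v2)
    then show ?thesis using that by (simp add: at_within_Icc_at)
  qed
  have f1_dec: "f1 s < f1 r" if "0 < r" "r < s" "s < \<rho>max" for r s
  proof (rule DERIV_neg_imp_decreasing[OF that(2)])
    fix w assume w: "r \<le> w" "w \<le> s"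
    show "\<exists>d. DERIV f1 w :> d \<and> d < 0"
      using f2[of w] neg[of w] w that by auto
  qed
  have uniq: "a = b" if asm: "a \<in> {0..\<rho>max}" "b \<in> {0..\<rho>max}"
    "\<And>r. r \<in> {0..\<rho>max} \<Longrightarrow> flux v r \<le> flux v a" "flux v a = flux v b" "a \<le> b" for a b
  proof (rule ccontr)
    assume "a \<noteq> b" then have ab: "a < b" using asm(5) by simp
    obtain z where z: "a < z" "z < b" "(flux v has_real_derivative 0) (at z)"
    proof -
      have "\<exists>z. a < z \<and> z < b \<and> DERIV (flux v) z :> 0"
        using ab asm(1,2,4) 
        by (intro Rolle) (auto intro!: continuous_on_subset[OF flux_continuous] fd)
      with that show thesis by blast
    qed
    have "f1 z = 0" using DERIV_unique[OF z(3) f1] z asm(1,2) by auto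
    define m where "m = (a + z) / 2"
    have m: "a < m" "m < z" using z by (auto simp: m_def)
    obtain w where w: "m < w" "w < z" "flux v z - flux v m = (z - m) * f1 w"
      using MVT2[of m z "flux v" f1] m z asm(1,2) f1 by auto
    have "0 < f1 w" using f1_dec[of w z] \<open>f1 z = 0\<close> w z m asm(1,2) by auto
    have "flux v m < flux v z" using w \<open>0 < f1 w\<close> m by (smt (verit) mult_pos_pos)
    moreover have "flux v a \<le> flux v m"
    proof -
      obtain w where w: "a < w" "w < m" "flux v m - flux v a = (m - a) * f1 w"
      proof -
        have "\<exists>l w. a < w \<and> w < m \<and> DERIV (flux v) w :> l \<and> flux v m - flux v a = (m - a) * l"
          using m z asm(1,2) 
          by (intro MVT) (auto intro!: continuous_on_subset[OF flux_continuous] fd)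
        then obtain l w where "a < w" "w < m" "DERIV (flux v) w :> l" "flux v m - flux v a = (m - a) * l" by blast
        moreover from this have "l = f1 w" using DERIV_unique[OF _ f1] m z asm(1,2) by auto
        ultimately show thesis using that by blast
      qed
      have "0 < f1 w" using f1_dec[of w z] \<open>f1 z = 0\<close> w m z asm(1,2) by auto
      with w m show ?thesis by (smt (verit) mult_pos_pos)
    qed
    ultimately show False using asm(3)[of z] z asm(1,2) by auto
  qed
  obtain c where c: "c \<in> {0..\<rho>max}" "\<And>r. r \<in> {0..\<rho>max} \<Longrightarrow> flux v r \<le> flux v c"
    using continuous_attains_sup[OF _ _ flux_continuous] \<rho>max_pos by auto
  have uc: "r = c" if "r \<in> {0..\<rho>max}" "flux v r = flux v c" for r
    using uniq[of r c] uniq[of c r] c that by (metis linear)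
  have "critical_density \<rho>max v = c"
    unfolding critical_density_def
  proof (rule the_equality)
    show "is_arg_max (flux v) (\<lambda>s. s \<in> {0..\<rho>max}) c"
      using c by (auto simp: is_arg_max_def not_less)
    fix r assume "is_arg_max (flux v) (\<lambda>s. s \<in> {0..\<rho>max}) r"
    then have "r \<in> {0..\<rho>max}" "\<not> flux v r < flux v c" using c(1) by (auto simp: is_arg_max_def)
    then show "r = c" using uc c(2)[of r] by auto
  qed
  then show "critical_density \<rho>max v \<in> {0..\<rho>max}"
    and "\<And>r. r \<in> {0..\<rho>max} \<Longrightarrow> flux v r \<le> flux v (critical_density \<rho>max v)"
    and "\<And>r. r \<in> {0..\<rho>max} \<Longrightarrow> flux v r = flux v (critical_density \<rho>max v) \<Longrightarrow> r = critical_density \<rho>max v"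
    using c uc by auto
qed


text \<open>The only place where entropy is produced: a particle between a cell of density \<open>a\<close> and the cell of
density \<open>b\<close> ahead of it, which fixes its speed \<open>v b\<close>.  The difference of both sides is
\<open>\<kappa> (sgn (b - \<kappa>) - sgn (a - \<kappa>)) (v \<kappa> - v b)\<close>, and the last two factors have the same sign because \<open>v\<close>
decreases.  The right-hand side is the part that the deformation of the cell behind balances.\<close>

lemma node_entropy_forward:
  assumes "a \<in> {0..\<rho>max}" "b \<in> {0..\<rho>max}" "\<kappa> \<in> {0..\<rho>max}"
  shows "(kruzkov_flux v \<kappa> a - kruzkov_flux v \<kappa> b) - v b * (\<bar>a - \<kappa>\<bar> - \<bar>b - \<kappa>\<bar>)
       \<ge> sgn (a - \<kappa>) * a * (v a - v b)"
proof -
  have "(kruzkov_flux v \<kappa> a - kruzkov_flux v \<kappa> b) - v b * (\<bar>a - \<kappa>\<bar> - \<bar>b - \<kappa>\<bar>)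
      - sgn (a - \<kappa>) * a * (v a - v b) = \<kappa> * ((sgn (b - \<kappa>) - sgn (a - \<kappa>)) * (v \<kappa> - v b))"
    unfolding kruzkov_flux_def flux_def abs_sgn[of "a - \<kappa>"] abs_sgn[of "b - \<kappa>"]
    by (simp add: algebra_simps)
  moreover have "0 \<le> (sgn (b - \<kappa>) - sgn (a - \<kappa>)) * (v \<kappa> - v b)"
  proof (cases b \<kappa> rule: linorder_cases)
    case less
    then have "v \<kappa> \<le> v b" using v_antimono assms by auto
    moreover have "sgn (b - \<kappa>) - sgn (a - \<kappa>) \<le> 0" using less by (auto simp: sgn_if)
    ultimately show ?thesis by (simp add: mult_nonpos_nonpos)
  next
    case greater
    then have "v b \<le> v \<kappa>" using v_antimono assms by auto
    moreover have "sgn (b - \<kappa>) - sgn (a - \<kappa>) \<ge> 0" using greater by (auto simp: sgn_if)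
    ultimately show ?thesis by simp
  qed simp
  ultimately show ?thesis using assms(3) by (smt (verit) atLeastAtMost_iff mult_nonneg_nonneg)
qed

end

section \<open>Particle configurations at a fixed time\<close>

lemma integrable_indicator_Ico: "integrable lborel (indicator {a..<b} :: real \<Rightarrow> real)"
  by (rule integrable_real_indicator) (cases "a \<le> b"; simp)+

text \<open>Positions of the particles at one time.  The index \<open>k\<close> of \<open>local_density\<close> stands for the cell between the
particles \<open>k - 1\<close> and \<open>k\<close>, so that \<open>0\<close> and \<open>n + 1\<close> are the empty cells that reach to infinity.\<close>

locale configuration =
  fixes n :: nat and l \<rho>max :: real and y :: "nat \<Rightarrow> real"
  assumes n_pos: "1 \<le> n" and l_pos: "0 < l"
    and y_step: "\<And>i. i < n \<Longrightarrow> y i < y (Suc i)"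
    and density_le: "\<And>k. local_density l n y k \<le> \<rho>max"
begin

abbreviation "R \<equiv> local_density l n y"
abbreviation "u \<equiv> discrete_density l n y"

text \<open>The integral of the density over the half-line to the left of \<open>x\<close>: cell \<open>i\<close> contributes its density times the
length of its part that lies to the left of \<open>x\<close>.\<close>

definition mass_left :: "real \<Rightarrow> real" where
  "mass_left x = (\<Sum>i<n. R (Suc i) * (max 0 (x - y i) - max 0 (x - y (Suc i))))"

definition jump :: "nat \<Rightarrow> real" where "jump i = R (Suc i) - R i"

lemma y_less: "i < j \<Longrightarrow> j \<le> n \<Longrightarrow> y i < y j"
proof (induction j)
  case (Suc j)
  then show ?case using y_step[of j] by (cases "i = j") auto
qed simp

lemma y_le: "i \<le> j \<Longrightarrow> j \<le> n \<Longrightarrow> y i \<le> y j"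
  using y_less[of i j] by (cases "i = j") auto

lemma R_0 [simp]: "R 0 = 0" and R_Suc_n [simp]: "R (Suc n) = 0"
  by (auto simp: local_density_def)

lemma R_Suc: "i < n \<Longrightarrow> R (Suc i) = l / (y (Suc i) - y i)"
  by (auto simp: local_density_def)

lemma R_width: "i < n \<Longrightarrow> R (Suc i) * (y (Suc i) - y i) = l"
  using y_step[of i] by (simp add: R_Suc)

lemma R_nonneg: "0 \<le> R k"
proof (cases "1 \<le> k \<and> k \<le> n")
  case True
  then obtain j where "k = Suc j" "j < n" by (cases k) auto
  then show ?thesis using y_step[of j] l_pos by (simp add: R_Suc)
qed (auto simp: local_density_def)

lemma R_range: "R k \<in> {0..\<rho>max}"
  using R_nonneg density_le by auto

lemma \<rho>max_nonneg: "0 \<le> \<rho>max" using R_range[of 0] by simp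

lemma u_cell:
  assumes "k < n" "y k \<le> x" "x < y (Suc k)" shows "u x = R (Suc k)"
proof -
  have "u x = (\<Sum>i<n. if i = k then R (Suc k) else 0)"
    unfolding discrete_density_def
  proof (rule sum.cong)
    fix i assume "i \<in> {..<n}"
    then have i: "i < n" by simp
    show "R (Suc i) * indicator {y i..<y (Suc i)} x = (if i = k then R (Suc k) else 0)"
    proof (cases i k rule: linorder_cases)
      case less
      then have "y (Suc i) \<le> y k" using assms(1) y_le[of "Suc i" k] by auto
      then show ?thesis using assms less by auto
    next
      case greater
      then have "y (Suc k) \<le> y i" using i y_le[of "Suc k" i] by auto
      then show ?thesis using assms greater by auto
    qed (use assms in auto)
  qed simp
  then show ?thesis using assms(1) by simp
qed

lemma u_outside: assumes "x < y 0 \<or> y n \<le> x" shows "u x = 0"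
proof -
  have "indicator {y i..<y (Suc i)} x = (0::real)" if "i < n" for i
    using assms y_le[of 0 i] y_le[of "Suc i" n] that by auto
  then show ?thesis unfolding discrete_density_def by simp
qed

lemma cell_exists:
  assumes "y 0 \<le> x" "x < y n" shows "\<exists>k<n. y k \<le> x \<and> x < y (Suc k)"
proof -
  define k where "k = Max {i. i \<le> n \<and> y i \<le> x}"
  have fin: "finite {i. i \<le> n \<and> y i \<le> x}" "{i. i \<le> n \<and> y i \<le> x} \<noteq> {}" using assms(1) by auto
  have k: "k \<le> n" "y k \<le> x" using Max_in[OF fin] by (auto simp: k_def)
  have "k \<noteq> n" using k assms(2) by auto
  then have kn: "k < n" using k by simp
  moreover have "x < y (Suc k)"
  proof (rule ccontr)
    assume "\<not> x < y (Suc k)"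
    then have "Suc k \<in> {i. i \<le> n \<and> y i \<le> x}" using kn by auto
    from Max_ge[OF fin(1) this] have "Suc k \<le> k" by (simp add: k_def)
    then show False by simp
  qed
  ultimately show ?thesis using k by auto
qed

lemma u_range: "u x \<in> {0..\<rho>max}"
proof (cases "x < y 0 \<or> y n \<le> x")
  case True then show ?thesis using u_outside \<rho>max_nonneg by auto
next
  case False
  then obtain k where "k < n" "y k \<le> x" "x < y (Suc k)" using cell_exists[of x] by auto
  then show ?thesis using u_cell R_range by metis
qed

lemma sum_jump:
  fixes h :: "nat \<Rightarrow> real"
  shows "(\<Sum>i\<le>n. jump i * h i) = (\<Sum>i<n. R (Suc i) * (h i - h (Suc i)))"
proof -
  have "(\<Sum>i\<le>n. jump i * h i) = (\<Sum>i\<le>n. R (Suc i) * h i) - (\<Sum>i\<le>n. R i * h i)"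
    by (simp add: jump_def algebra_simps sum_subtractf)
  also have "(\<Sum>i\<le>n. R (Suc i) * h i) = (\<Sum>i<n. R (Suc i) * h i)"
    by (simp add: lessThan_Suc_atMost[symmetric])
  also have "(\<Sum>i\<le>n. R i * h i) = (\<Sum>i<n. R (Suc i) * h (Suc i))"
    by (subst sum.atMost_shift) simp
  finally show ?thesis by (simp add: sum_subtractf algebra_simps)
qed

lemma u_jumps: "u x = (\<Sum>i\<le>n. jump i * indicator {y i..} x)"
  unfolding sum_jump discrete_density_def
proof (rule sum.cong)
  fix i assume "i \<in> {..<n}"
  then have "y i < y (Suc i)" using y_step by simp
  then show "R (Suc i) * indicator {y i..<y (Suc i)} x
      = R (Suc i) * (indicator {y i..} x - indicator {y (Suc i)..} x)"
    by (auto simp: indicator_def)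
qed simp

lemma mass_left_jumps: "mass_left x = (\<Sum>i\<le>n. jump i * max 0 (x - y i))"
  unfolding sum_jump mass_left_def ..

lemma u_borel [measurable]: "u \<in> borel_measurable borel"
  unfolding discrete_density_def[abs_def] by measurable

lemma mass_left_continuous: "continuous_on S mass_left"
  unfolding mass_left_def[abs_def] by (intro continuous_intros)

lemma mass_left_deriv:
  assumes "x \<notin> y ` {..n}" shows "(mass_left has_vector_derivative u x) (at x)"
proof -
  have "((\<lambda>x. max 0 (x - y i)) has_real_derivative indicator {y i..} x) (at x)" if "i \<le> n" for i
  proof (cases "x < y i")
    case True
    have "((\<lambda>x. 0) has_real_derivative indicator {y i..} x) (at x)" using True by simp
    then show ?thesis
      by (rule has_field_derivative_transform_within_open[where S="{..<y i}"]) (use True in auto)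
  next
    case False
    then have *: "y i < x" using assms that by force
    have "((\<lambda>x. x - y i) has_real_derivative indicator {y i..} x) (at x)"
      using * by (auto intro!: derivative_eq_intros)
    then show ?thesis
      by (rule has_field_derivative_transform_within_open[where S="{y i<..}"]) (use * in auto)
  qed
  then have "((\<lambda>x. \<Sum>i\<le>n. jump i * max 0 (x - y i)) has_real_derivative (\<Sum>i\<le>n. jump i * indicator {y i..} x)) (at x)"
    by (intro DERIV_sum DERIV_cmult) auto
  then show ?thesis
    unfolding u_jumps mass_left_jumps[abs_def] has_real_derivative_iff_has_vector_derivative .
qed

lemma u_has_integral: "a \<le> b \<Longrightarrow> (u has_integral (mass_left b - mass_left a)) {a..b}"
  by (rule fundamental_theorem_of_calculus_interior_strong[where S="y ` {..n}"])
    (auto intro: mass_left_deriv mass_left_continuous)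

lemma u_integrable_lborel: "integrable lborel u"
proof -
  have "integrable lborel (\<lambda>x. R (Suc i) * indicator {y i..<y (Suc i)} x)" for i
    by (intro integrable_mult_right integrable_indicator_Ico)
  then show ?thesis unfolding discrete_density_def[abs_def] by (intro Bochner_Integration.integrable_sum) auto
qed

lemma u_set_integrable: "S \<in> sets borel \<Longrightarrow> set_integrable lborel S u"
  unfolding set_integrable_def using integrable_mult_indicator[OF _ u_integrable_lborel, of S] by auto

lemma u_LINT: assumes "a \<le> b" shows "(LINT x:{a..b}|lborel. u x) = mass_left b - mass_left a"
  using set_borel_integral_eq_integral(2)[OF u_set_integrable[of "{a..b}"]]
    integral_unique[OF u_has_integral[OF assms]] by simp

lemma u_LINT_lebesgue: assumes "a \<le> b" shows "(LINT x:{a..b}|lebesgue. u x) = mass_left b - mass_left a"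
proof -
  have "(LINT x:{a..b}|lebesgue. u x) = (LINT x:{a..b}|lborel. u x)"
    unfolding set_lebesgue_integral_def by (rule integral_completion) measurable
  then show ?thesis using u_LINT[OF assms] by simp
qed

lemma mass_left_mono: "a \<le> b \<Longrightarrow> mass_left a \<le> mass_left b"
  using has_integral_nonneg[OF u_has_integral[of a b]] u_range by auto

lemma mass_left_Lipschitz_le: "a \<le> b \<Longrightarrow> mass_left b - mass_left a \<le> \<rho>max * (b - a)"
proof -
  assume ab: "a \<le> b"
  have "((\<lambda>x. \<rho>max) has_integral \<rho>max * (b - a)) {a..b}"
    using has_integral_const_real[of \<rho>max a b] ab by (simp add: mult.commute)
  then show ?thesis using has_integral_le[OF u_has_integral[OF ab]] u_range by auto
qed

lemma mass_left_Lipschitz: "\<bar>mass_left a - mass_left b\<bar> \<le> \<rho>max * \<bar>a - b\<bar>"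
  using mass_left_Lipschitz_le[of a b] mass_left_Lipschitz_le[of b a]
    mass_left_mono[of a b] mass_left_mono[of b a] by (cases "a \<le> b") auto

lemma mass_left_y: assumes "j \<le> n" shows "mass_left (y j) = real j * l"
proof -
  have "mass_left (y j) = (\<Sum>i<n. if i < j then l else 0)"
    unfolding mass_left_def
  proof (rule sum.cong)
    fix i assume "i \<in> {..<n}"
    then have i: "i < n" by simp
    show "R (Suc i) * (max 0 (y j - y i) - max 0 (y j - y (Suc i))) = (if i < j then l else 0)"
    proof (cases "i < j")
      case True
      then have "y (Suc i) \<le> y j" "y i \<le> y j" using assms y_le[of "Suc i" j] y_le[of i j] by auto
      then show ?thesis using True R_width[OF i] by (simp add: max_def algebra_simps)
    next
      case False
      then have "y j \<le> y i" "y j \<le> y (Suc i)" using i y_le[of j i] y_le[of j "Suc i"] by auto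
      then show ?thesis using False by (simp add: max_def)
    qed
  qed simp
  also have "\<dots> = (\<Sum>i\<in>{..<j}. l)"
    by (rule sum.mono_neutral_cong_right) (use assms in auto)
  finally show ?thesis by simp
qed

lemma mass_left_low: assumes "x \<le> y 0" shows "mass_left x = 0"
  unfolding mass_left_def
proof (intro sum.neutral ballI)
  fix i assume "i \<in> {..<n}"
  then have "x \<le> y i" "x \<le> y (Suc i)" using y_le[of 0 i] y_le[of 0 "Suc i"] assms by auto
  then show "R (Suc i) * (max 0 (x - y i) - max 0 (x - y (Suc i))) = 0" by simp
qed

lemma mass_left_high: assumes "y n \<le> x" shows "mass_left x = real n * l"
proof -
  have "u z = 0" if "z \<in> {y n..x}" for z using u_outside that by auto
  then have "(u has_integral 0) {y n..x}" by (rule has_integral_is_0)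
  from has_integral_unique[OF this u_has_integral[OF assms]]
  show ?thesis using mass_left_y[of n] by simp
qed

lemma mass_left_ge: "j \<le> n \<Longrightarrow> y j \<le> x \<Longrightarrow> real j * l \<le> mass_left x"
  using mass_left_mono[of "y j" x] mass_left_y by auto

lemma mass_left_le: "j \<le> n \<Longrightarrow> x \<le> y j \<Longrightarrow> mass_left x \<le> real j * l"
  using mass_left_mono[of x "y j"] mass_left_y by auto

lemma mass_left_bounds: "0 \<le> mass_left x" "mass_left x \<le> real n * l"
proof -
  have "mass_left (min x (y 0)) \<le> mass_left x" by (rule mass_left_mono) simp
  then show "0 \<le> mass_left x" using mass_left_low[of "min x (y 0)"] by simp
  have "mass_left x \<le> mass_left (max x (y n))" by (rule mass_left_mono) simp
  then show "mass_left x \<le> real n * l" using mass_left_high[of "max x (y n)"] by simp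
qed

lemma mass_left_index:
  obtains (low) "x < y 0" "mass_left x = 0"
    | (cell) k where "k < n" "y k \<le> x" "x < y (Suc k)" "real k * l \<le> mass_left x" "mass_left x \<le> real (Suc k) * l"
    | (high) "y n \<le> x" "mass_left x = real n * l"
proof -
  consider "x < y 0" | "y n \<le> x" | "y 0 \<le> x" "x < y n" by linarith
  then show ?thesis
  proof cases
    case 1 then show ?thesis using low mass_left_low[of x] by simp
  next
    case 2 then show ?thesis using high mass_left_high[of x] by simp
  next
    case 3
    then obtain k where k: "k < n" "y k \<le> x" "x < y (Suc k)" using cell_exists by blast
    then show ?thesis using cell[OF k] mass_left_ge[of k x] mass_left_le[of "Suc k" x] by auto
  qed
qed

text \<open>The average of \<open>u\<close> over \<open>[x, x + h]\<close> differs from \<open>u x\<close> only because of the jumps in between.\<close>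

lemma u_average:
  assumes h: "0 < h"
  shows "\<bar>u x - (mass_left (x + h) - mass_left x) / h\<bar> \<le> (\<Sum>i\<le>n. \<bar>jump i\<bar> * indicator {y i - h..<y i} x)"
proof -
  have 1: "\<bar>indicator {a..} x - (max 0 (x + h - a) - max 0 (x - a)) / h\<bar> \<le> (indicator {a - h..<a} x :: real)" for a
  proof -
    consider "a \<le> x" | "x < a - h" | "a - h \<le> x" "x < a" by linarith
    then show ?thesis
    proof cases
      case 3
      then have "max 0 (x + h - a) = x + h - a" "max 0 (x - a) = 0" by auto
      then show ?thesis using 3 h by (simp add: abs_le_iff field_simps)
    qed (use h in \<open>auto simp: max_def\<close>)
  qed
  have "u x - (mass_left (x + h) - mass_left x) / h
      = (\<Sum>i\<le>n. jump i * (indicator {y i..} x - (max 0 (x + h - y i) - max 0 (x - y i)) / h))"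
    unfolding u_jumps mass_left_jumps sum_subtractf[symmetric] sum_divide_distrib
    by (intro sum.cong refl) (simp add: right_diff_distrib)
  also have "\<bar>\<dots>\<bar> \<le> (\<Sum>i\<le>n. \<bar>jump i\<bar> * indicator {y i - h..<y i} x)"
    by (rule order_trans[OF sum_abs]) (intro sum_mono, simp only: abs_mult, intro mult_left_mono 1 abs_ge_zero)
  finally show ?thesis .
qed

lemma u_average_L1:
  assumes h: "0 < h"
  shows "integrable lborel (\<lambda>x. \<Sum>i\<le>n. \<bar>jump i\<bar> * indicator {y i - h..<y i} x)"
    and "(LINT x|lborel. (\<Sum>i\<le>n. \<bar>jump i\<bar> * indicator {y i - h..<y i} x)) = h * (\<Sum>i\<le>n. \<bar>jump i\<bar>)"
proof -
  have i: "integrable lborel (\<lambda>x. \<bar>jump i\<bar> * indicator {y i - h..<y i} x)" for i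
    by (intro integrable_mult_right integrable_indicator_Ico)
  then show "integrable lborel (\<lambda>x. \<Sum>i\<le>n. \<bar>jump i\<bar> * indicator {y i - h..<y i} x)"
    by (intro Bochner_Integration.integrable_sum)
  have "(LINT x|lborel. (\<Sum>i\<le>n. \<bar>jump i\<bar> * indicator {y i - h..<y i} x))
      = (\<Sum>i\<le>n. LINT x|lborel. \<bar>jump i\<bar> * indicator {y i - h..<y i} x)"
    by (rule Bochner_Integration.integral_sum) (rule i)
  also have "\<dots> = (\<Sum>i\<le>n. \<bar>jump i\<bar> * h)" using h by (intro sum.cong) auto
  also have "\<dots> = h * (\<Sum>i\<le>n. \<bar>jump i\<bar>)" by (simp add: sum_distrib_left mult.commute)
  finally show "(LINT x|lborel. (\<Sum>i\<le>n. \<bar>jump i\<bar> * indicator {y i - h..<y i} x)) = h * (\<Sum>i\<le>n. \<bar>jump i\<bar>)" .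
qed


lemma u_variation:
  fixes z :: "nat \<Rightarrow> real"
  assumes z: "\<And>j. j < m \<Longrightarrow> z j \<le> z (Suc j)"
  shows "(\<Sum>j<m. \<bar>u (z (Suc j)) - u (z j)\<bar>) \<le> (\<Sum>i\<le>n. \<bar>jump i\<bar>)"
proof -
  have "\<bar>u (z (Suc j)) - u (z j)\<bar>
      \<le> (\<Sum>i\<le>n. \<bar>jump i\<bar> * (indicator {y i..} (z (Suc j)) - indicator {y i..} (z j)))" if "j < m" for j
  proof -
    have "u (z (Suc j)) - u (z j) = (\<Sum>i\<le>n. jump i * (indicator {y i..} (z (Suc j)) - indicator {y i..} (z j)))"
      unfolding u_jumps sum_subtractf[symmetric] right_diff_distrib ..
    also have "\<bar>\<dots>\<bar> \<le> (\<Sum>i\<le>n. \<bar>jump i\<bar> * (indicator {y i..} (z (Suc j)) - indicator {y i..} (z j)))"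
      by (rule order_trans[OF sum_abs])
        (use z[OF that] in \<open>auto intro!: sum_mono simp: abs_mult indicator_def\<close>)
    finally show ?thesis .
  qed
  then have "(\<Sum>j<m. \<bar>u (z (Suc j)) - u (z j)\<bar>)
      \<le> (\<Sum>j<m. \<Sum>i\<le>n. \<bar>jump i\<bar> * (indicator {y i..} (z (Suc j)) - indicator {y i..} (z j)))"
    by (intro sum_mono) auto
  also have "\<dots> = (\<Sum>i\<le>n. \<bar>jump i\<bar> * (\<Sum>j<m. indicator {y i..} (z (Suc j)) - indicator {y i..} (z j)))"
    by (subst sum.swap) (simp add: sum_distrib_left)
  also have "\<dots> \<le> (\<Sum>i\<le>n. \<bar>jump i\<bar> * 1)"
    by (intro sum_mono mult_left_mono, subst sum_lessThan_telescope) (auto simp: indicator_def)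
  finally show ?thesis by simp
qed


text \<open>The test function takes the value \<open>- sgn (jump i)\<close> at the particle \<open>i\<close>; bumps that are narrower than half of the
smallest cell have disjoint supports, so it stays between \<open>-1\<close> and \<open>1\<close>.\<close>

lemma jumps_le_total_variation:
  assumes tv: "total_variation UNIV u \<le> ereal C"
  shows "(\<Sum>i\<le>n. \<bar>jump i\<bar>) \<le> C"
proof -
  define w where "w = Min ((\<lambda>i. y (Suc i) - y i) ` {..<n})"
  have fin: "finite ((\<lambda>i. y (Suc i) - y i) ` {..<n})" "(\<lambda>i. y (Suc i) - y i) ` {..<n} \<noteq> {}"
    using n_pos by (auto simp: lessThan_empty_iff)
  have w: "0 < w" using Min_in[OF fin] y_step by (auto simp: w_def)
  have w_le: "w \<le> y (Suc i) - y i" if "i < n" for i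
    unfolding w_def using fin that by (intro Min_le) auto
  define h where "h = w / 2"
  have h: "0 < h" using w by (simp add: h_def)
  have gap: "2 * h \<le> y j - y i" if "i < j" "j \<le> n" for i j
    using w_le[of i] y_le[of "Suc i" j] that by (auto simp: h_def)
  define b where "b i x = bump ((x - y i) / h)" for i x
  define b' where "b' i x = bump' ((x - y i) / h) / h" for i x
  have b_deriv: "(b i has_real_derivative b' i x) (at x)" for i x
    unfolding b_def[abs_def] b'_def
    by (rule DERIV_chain2[OF bump_has_derivative, THEN DERIV_cong, of _ "1/h"]) 
      (use h in \<open>auto intro!: derivative_eq_intros simp: field_simps\<close>)
  have b_zero: "b i x = 0" if "h \<le> \<bar>x - y i\<bar>" for i x
    unfolding b_def using that h by (intro bump_eq_0) (auto simp: abs_divide)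
  have b_self: "b i (y i) = 1" for i by (simp add: b_def bump_0)
  define \<phi> where "\<phi> x = - (\<Sum>i\<le>n. sgn (jump i) * b i x)" for x
  define \<phi>' where "\<phi>' x = - (\<Sum>i\<le>n. sgn (jump i) * b' i x)" for x
  have \<phi>_deriv: "(\<phi> has_real_derivative \<phi>' x) (at x)" for x
    unfolding \<phi>_def[abs_def] \<phi>'_def by (intro DERIV_minus DERIV_sum DERIV_cmult b_deriv)
  have \<phi>'_cont: "continuous_on UNIV \<phi>'"
    unfolding \<phi>'_def[abs_def] b'_def[abs_def]
    by (intro continuous_intros continuous_on_compose2[OF continuous_bump']) (use h in auto)
  have \<phi>_y: "\<phi> (y i) = - sgn (jump i)" if "i \<le> n" for i
  proof -
    have "(\<Sum>j\<le>n. sgn (jump j) * b j (y i)) = (\<Sum>j\<le>n. if j = i then sgn (jump i) else 0)"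
    proof (rule sum.cong)
      fix j assume "j \<in> {..n}"
      then show "sgn (jump j) * b j (y i) = (if j = i then sgn (jump i) else 0)"
        using gap[of i j] gap[of j i] that h
        by (cases i j rule: linorder_cases) (auto simp: b_zero b_self)
    qed simp
    then show ?thesis using that by (simp add: \<phi>_def)
  qed
  have \<phi>_bound: "\<bar>\<phi> x\<bar> \<le> 1" for x
  proof (cases "\<exists>i\<le>n. \<bar>x - y i\<bar> < h")
    case True
    then obtain i where i: "i \<le> n" "\<bar>x - y i\<bar> < h" by blast
    have "(\<Sum>j\<le>n. sgn (jump j) * b j x) = (\<Sum>j\<le>n. if j = i then sgn (jump i) * b i x else 0)"
    proof (rule sum.cong)
      fix j assume j: "j \<in> {..n}"
      have "b j x = 0" if "j \<noteq> i"
      proof (rule b_zero)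
        show "h \<le> \<bar>x - y j\<bar>" using that i j gap[of i j] gap[of j i] by (cases i j rule: linorder_cases) auto
      qed
      then show "sgn (jump j) * b j x = (if j = i then sgn (jump i) * b i x else 0)" by auto
    qed simp
    then have "\<phi> x = - sgn (jump i) * b i x" using i(1) by (simp add: \<phi>_def)
    then show ?thesis using bump_bounds[of "(x - y i) / h"]
      by (auto simp: abs_mult b_def sgn_if)
  next
    case False
    then have "b i x = 0" if "i \<le> n" for i using that b_zero by force
    then show ?thesis by (simp add: \<phi>_def)
  qed
  define M where "M = max \<bar>y 0\<bar> \<bar>y n\<bar> + h"
  have \<phi>_out: "\<phi> x = 0" if "M \<le> \<bar>x\<bar>" for x
  proof -
    have "b i x = 0" if "i \<le> n" for i
      using that y_le[of 0 i] y_le[of i n] \<open>M \<le> \<bar>x\<bar>\<close> by (intro b_zero) (auto simp: M_def)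
    then show ?thesis by (simp add: \<phi>_def)
  qed
  have frech: "frechet_derivative \<phi> (at x) = (\<lambda>k. \<phi>' x * k)" for x
    using frechet_derivative_at[OF \<phi>_deriv[unfolded has_field_derivative_def]] by simp
  have "Ck 1 \<phi>"
  proof -
    have "\<phi> differentiable at x" for x using \<phi>_deriv[of x] by (auto simp: real_differentiable_def)
    moreover have "continuous_on UNIV (\<lambda>x. \<phi>' x * k)" for k by (intro continuous_intros \<phi>'_cont)
    ultimately show ?thesis by (simp add: frech)
  qed
  moreover have "compactly_supported_in UNIV \<phi>"
  proof -
    have "closure {x. \<phi> x \<noteq> 0} \<subseteq> {-M..M}"
    proof (intro closure_minimal subsetI)
      fix x assume "x \<in> {x. \<phi> x \<noteq> 0}"
      then have "\<bar>x\<bar> < M" using \<phi>_out[of x] by (metis mem_Collect_eq not_le)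
      then show "x \<in> {-M..M}" by auto
    qed simp
    then have "compact (closure {x. \<phi> x \<noteq> 0})"
      by (meson bounded_closed_interval bounded_subset closed_closure compact_eq_bounded_closed)
    then show ?thesis unfolding compactly_supported_in_def by simp
  qed
  ultimately have in_set: "\<phi> \<in> {\<phi>. Ck 1 \<phi> \<and> compactly_supported_in UNIV \<phi> \<and> (\<forall>x. \<bar>\<phi> x\<bar> \<le> 1)}"
    using \<phi>_bound by auto
  have cell: "(LINT x:{a..<b}|lborel. \<phi>' x) = \<phi> b - \<phi> a" if "a \<le> b" for a b
  proof -
    have "(\<phi>' has_integral \<phi> b - \<phi> a) {a..b}"
      using that \<phi>_deriv by (intro fundamental_theorem_of_calculus)
        (auto simp: has_real_derivative_iff_has_vector_derivative[symmetric] has_field_derivative_at_within)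
    moreover have "set_integrable lborel {a..b} \<phi>'"
      by (intro borel_integrable_atLeastAtMost' continuous_on_subset[OF \<phi>'_cont]) auto
    ultimately have "(LINT x:{a..b}|lborel. \<phi>' x) = \<phi> b - \<phi> a"
      by (metis integral_unique set_borel_integral_eq_integral(2))
    moreover have "(LINT x:{a..<b}|lborel. \<phi>' x) = (LINT x:{a..b}|lborel. \<phi>' x)"
    proof -
      have [measurable]: "\<phi>' \<in> borel_measurable borel"
        using \<phi>'_cont by (simp add: borel_measurable_continuous_onI)
      show ?thesis
        unfolding set_lebesgue_integral_def
        by (intro integral_cong_AE) (auto intro: AE_mp[OF AE_lborel_singleton[of b]] simp: indicator_def)
    qed
    ultimately show ?thesis by simp
  qed
  have [measurable]: "\<phi>' \<in> borel_measurable borel"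
    using \<phi>'_cont by (simp add: borel_measurable_continuous_onI)
  have deriv\<phi>: "deriv \<phi> x = \<phi>' x" for x using \<phi>_deriv by (rule DERIV_imp_deriv)
  have "(LINT x:UNIV|lebesgue. u x * deriv \<phi> x) = (LINT x|lborel. u x * \<phi>' x)"
    unfolding set_lebesgue_integral_def deriv\<phi> by (simp, rule integral_completion) measurable
  also have "\<dots> = (LINT x|lborel. (\<Sum>i<n. R (Suc i) * (indicator {y i..<y (Suc i)} x * \<phi>' x)))"
    unfolding discrete_density_def sum_distrib_right mult.assoc ..
  also have "\<dots> = (\<Sum>i<n. LINT x|lborel. R (Suc i) * (indicator {y i..<y (Suc i)} x * \<phi>' x))"
  proof (intro Bochner_Integration.integral_sum integrable_mult_right)
    fix i
    have "set_integrable lborel {y i..y (Suc i)} \<phi>'"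
      by (intro borel_integrable_atLeastAtMost' continuous_on_subset[OF \<phi>'_cont]) auto
    then have "set_integrable lborel {y i..<y (Suc i)} \<phi>'"
      by (rule set_integrable_subset) auto
    then show "integrable lborel (\<lambda>x. indicator {y i..<y (Suc i)} x * \<phi>' x)"
      by (simp add: set_integrable_def)
  qed
  also have "\<dots> = (\<Sum>i<n. R (Suc i) * (\<phi> (y (Suc i)) - \<phi> (y i)))"
    using cell y_step by (intro sum.cong) (auto simp: set_lebesgue_integral_def less_imp_le)
  also have "\<dots> = - (\<Sum>i\<le>n. jump i * \<phi> (y i))"
    unfolding sum_jump by (simp add: sum_negf[symmetric] algebra_simps)
  also have "\<dots> = (\<Sum>i\<le>n. \<bar>jump i\<bar>)"
    by (simp add: \<phi>_y sum_negf[symmetric] abs_sgn)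
  finally have "ereal (\<Sum>i\<le>n. \<bar>jump i\<bar>) \<le> total_variation UNIV u"
    unfolding total_variation_def using in_set by (intro SUP_upper2[OF in_set]) auto
  with tv show ?thesis using order_trans by fastforce
qed

end

section \<open>Distances, turning points and entropy of configurations\<close>

lemma integrable_indicator_Icc: "integrable lborel (indicator {a..b} :: real \<Rightarrow> real)"
  by (rule integrable_real_indicator) (auto simp: emeasure_lborel_Icc_eq)

text \<open>Both densities are replaced by their averages over windows of length \<open>h\<close>, which are difference quotients
of the masses.  The choice \<open>h = sqrt \<epsilon>\<close> shows that densities of bounded variation are close in \<open>L\<^sup>1\<close> as soon as
their masses are uniformly close.\<close>

lemma L1_distance_configurations:
  assumes c1: "configuration n1 l1 \<rho>max y1" and c2: "configuration n2 l2 \<rho>max y2"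
    and j1: "(\<Sum>i\<le>n1. \<bar>configuration.jump n1 l1 y1 i\<bar>) \<le> C"
    and j2: "(\<Sum>i\<le>n2. \<bar>configuration.jump n2 l2 y2 i\<bar>) \<le> C"
    and \<epsilon>: "\<And>x. x \<in> {-M..M+1} \<Longrightarrow> \<bar>configuration.mass_left n1 l1 y1 x - configuration.mass_left n2 l2 y2 x\<bar> \<le> \<epsilon>"
    and h: "0 < h" "h \<le> 1" and M: "0 \<le> M"
  shows "(LINT x:{-M..M}|lborel. \<bar>discrete_density l1 n1 y1 x - discrete_density l2 n2 y2 x\<bar>)
    \<le> 2 * C * h + 4 * M * \<epsilon> / h"
proof -
  interpret c1: configuration n1 l1 \<rho>max y1 by fact
  interpret c2: configuration n2 l2 \<rho>max y2 by fact
  let ?S1 = "\<lambda>x. \<Sum>i\<le>n1. \<bar>c1.jump i\<bar> * indicator {y1 i - h..<y1 i} x"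
  let ?S2 = "\<lambda>x. \<Sum>i\<le>n2. \<bar>c2.jump i\<bar> * indicator {y2 i - h..<y2 i} x"
  have pt: "\<bar>c1.u x - c2.u x\<bar> \<le> ?S1 x + ?S2 x + 2 * \<epsilon> / h" if x: "x \<in> {-M..M}" for x
  proof -
    have "\<bar>(c1.mass_left (x + h) - c1.mass_left x) - (c2.mass_left (x + h) - c2.mass_left x)\<bar> \<le> 2 * \<epsilon>"
      using \<epsilon>[of x] \<epsilon>[of "x + h"] x h by fastforce
    then have "\<bar>(c1.mass_left (x + h) - c1.mass_left x) / h - (c2.mass_left (x + h) - c2.mass_left x) / h\<bar> \<le> 2 * \<epsilon> / h"
      using h by (simp add: diff_divide_distrib[symmetric] abs_divide divide_right_mono)
    with c1.u_average[OF h(1), of x] c2.u_average[OF h(1), of x] show ?thesis by linarith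
  qed
  have nonneg: "0 \<le> ?S1 x" "0 \<le> ?S2 x" for x by (auto intro!: sum_nonneg)
  have int: "integrable lborel (\<lambda>x. ?S1 x + ?S2 x + indicator {-M..M} x * (2 * \<epsilon> / h))"
    by (intro Bochner_Integration.integrable_add integrable_mult_left c1.u_average_L1[OF h(1)] c2.u_average_L1[OF h(1)] integrable_indicator_Icc)
  have "(LINT x:{-M..M}|lborel. \<bar>c1.u x - c2.u x\<bar>)
      \<le> (LINT x|lborel. ?S1 x + ?S2 x + indicator {-M..M} x * (2 * \<epsilon> / h))"
    unfolding set_lebesgue_integral_def
  proof (rule integral_mono[OF _ int])
    show "integrable lborel (\<lambda>x. indicat_real {- M..M} x *\<^sub>R \<bar>c1.u x - c2.u x\<bar>)"
      by (intro integrable_mult_indicator integrable_abs Bochner_Integration.integrable_diff c1.u_integrable_lborel c2.u_integrable_lborel) auto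
    show "indicat_real {- M..M} x *\<^sub>R \<bar>c1.u x - c2.u x\<bar> \<le> ?S1 x + ?S2 x + indicator {-M..M} x * (2 * \<epsilon> / h)" for x
      using pt[of x] nonneg[of x] by (cases "x \<in> {-M..M}") (simp_all del: sum_mult_indicator)
  qed
  also have "\<dots> = h * (\<Sum>i\<le>n1. \<bar>c1.jump i\<bar>) + h * (\<Sum>i\<le>n2. \<bar>c2.jump i\<bar>) + (2 * M) * (2 * \<epsilon> / h)"
  proof -
    have "(LINT x|lborel. indicator {-M..M} x * (2 * \<epsilon> / h)) = (2 * M) * (2 * \<epsilon> / h)"
      using M by simp
    then show ?thesis
      by (subst Bochner_Integration.integral_add[OF Bochner_Integration.integrable_add[OF c1.u_average_L1(1)[OF h(1)] c2.u_average_L1(1)[OF h(1)]]],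
          intro integrable_mult_left integrable_indicator_Icc)
        (subst Bochner_Integration.integral_add[OF c1.u_average_L1(1)[OF h(1)] c2.u_average_L1(1)[OF h(1)]],
          simp only: c1.u_average_L1(2)[OF h(1)] c2.u_average_L1(2)[OF h(1)])
  qed
  also have "\<dots> \<le> h * C + h * C + (2 * M) * (2 * \<epsilon> / h)"
    using mult_left_mono[OF j1, of h] mult_left_mono[OF j2, of h] h by linarith
  also have "\<dots> = 2 * C * h + 4 * M * \<epsilon> / h" by simp
  finally show ?thesis .
qed

text \<open>The sign changes at the turning point only, so two telescoping sums remain, with the value at the cell
\<open>j\<close> of the turning point counted twice.\<close>

lemma sum_sign_telescope:
  fixes e :: "nat \<Rightarrow> real"
  assumes "j \<le> Suc n"
  shows "(\<Sum>i\<le>n. (if i < j then -1 else 1) * (e i - e (Suc i))) = 2 * e j - e 0 - e (Suc n)"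
proof -
  have 1: "(\<Sum>i\<le>m. (if i < j then -1 else 1) * (e i - e (Suc i))) = e (Suc m) - e 0" if "m < j" for m
    using that by (induction m) auto
  show ?thesis
  proof (cases "j = Suc n")
    case True then show ?thesis using 1[of n] by simp
  next
    case False
    then have "j \<le> n" using assms by simp
    then show ?thesis
    proof (induction n)
      case 0 then show ?case by simp
    next
      case (Suc n)
      show ?case
      proof (cases "j = Suc n")
        case True then show ?thesis using 1[of n] by simp
      next
        case False then show ?thesis using Suc by simp
      qed
    qed
  qed
qed

lemma sum_by_parts_zero_ends:
  fixes G h :: "nat \<Rightarrow> real"
  assumes "G 0 = 0" "G (Suc n) = 0"
  shows "(\<Sum>k<n. G (Suc k) * (h (Suc k) - h k)) = (\<Sum>i\<le>n. (G i - G (Suc i)) * h i)"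
proof -
  have "(\<Sum>i\<le>n. G i * h i) = (\<Sum>k<n. G (Suc k) * h (Suc k))"
    using assms(1) by (subst sum.atMost_shift) simp
  moreover have "(\<Sum>i\<le>n. G (Suc i) * h i) = (\<Sum>k<n. G (Suc k) * h k)"
    using assms(2) by (simp add: lessThan_Suc_atMost[symmetric])
  ultimately show ?thesis by (simp add: left_diff_distrib right_diff_distrib sum_subtractf)
qed

context configuration
begin

text \<open>A function of a step function is a step function; the constant \<open>g 0\<close> is its value on the two empty cells.\<close>

lemma compose_u: "g (u x) = g 0 + (\<Sum>k<n. (g (R (Suc k)) - g 0) * indicator {y k..<y (Suc k)} x)" for g :: "real \<Rightarrow> real"
proof (cases "x < y 0 \<or> y n \<le> x")
  case True
  have "indicator {y i..<y (Suc i)} x = (0::real)" if "i < n" for i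
    using True y_le[of 0 i] y_le[of "Suc i" n] that by auto
  then have "(\<Sum>k<n. (g (R (Suc k)) - g 0) * indicator {y k..<y (Suc k)} x) = 0" by (intro sum.neutral) auto
  then show ?thesis using u_outside[OF True] by simp
next
  case False
  then obtain k where k: "k < n" "y k \<le> x" "x < y (Suc k)" using cell_exists[of x] by auto
  have "(\<Sum>i<n. (g (R (Suc i)) - g 0) * indicator {y i..<y (Suc i)} x)
      = (\<Sum>i<n. if i = k then g (R (Suc k)) - g 0 else 0)"
  proof (rule sum.cong)
    fix i assume "i \<in> {..<n}"
    then have i: "i < n" by simp
    show "(g (R (Suc i)) - g 0) * indicator {y i..<y (Suc i)} x = (if i = k then g (R (Suc k)) - g 0 else 0)"
      using y_le[of "Suc i" k] y_le[of "Suc k" i] i k by (cases i k rule: linorder_cases) auto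
  qed simp
  then show ?thesis using u_cell[OF k] k(1) by simp
qed

lemma LINT_compose_u:
  fixes g \<psi> :: "real \<Rightarrow> real"
  assumes \<psi>: "\<And>a b. set_integrable lborel {a..<b} \<psi>"
  shows "integrable lborel (\<lambda>x. (g (u x) - g 0) * \<psi> x)"
    and "(LINT x|lborel. (g (u x) - g 0) * \<psi> x)
      = (\<Sum>k<n. (g (R (Suc k)) - g 0) * (LINT x:{y k..<y (Suc k)}|lborel. \<psi> x))"
proof -
  have eq: "(g (u x) - g 0) * \<psi> x = (\<Sum>k<n. (g (R (Suc k)) - g 0) * (indicator {y k..<y (Suc k)} x * \<psi> x))" for x
  proof -
    have "g (u x) - g 0 = (\<Sum>k<n. (g (R (Suc k)) - g 0) * indicator {y k..<y (Suc k)} x)"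
      using compose_u[of g x] by linarith
    then show ?thesis by (simp only: sum_distrib_right mult.assoc)
  qed
  have int: "integrable lborel (\<lambda>x. (g (R (Suc k)) - g 0) * (indicator {y k..<y (Suc k)} x * \<psi> x))" for k
    using \<psi>[of "y k" "y (Suc k)"] by (intro integrable_mult_right) (simp add: set_integrable_def)
  show "integrable lborel (\<lambda>x. (g (u x) - g 0) * \<psi> x)"
    unfolding eq by (intro Bochner_Integration.integrable_sum int)
  show "(LINT x|lborel. (g (u x) - g 0) * \<psi> x)
      = (\<Sum>k<n. (g (R (Suc k)) - g 0) * (LINT x:{y k..<y (Suc k)}|lborel. \<psi> x))"
    unfolding eq set_lebesgue_integral_def
    by (subst Bochner_Integration.integral_sum[OF int]) simp
qed

lemma sign_index:
  obtains j where "j \<le> Suc n" "\<And>i. i \<le> n \<Longrightarrow> y i < \<zeta> \<longleftrightarrow> i < j"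
proof -
  define j where "j = (LEAST i. i = Suc n \<or> \<zeta> \<le> y i)"
  have j: "j = Suc n \<or> \<zeta> \<le> y j" unfolding j_def by (rule LeastI[of _ "Suc n"]) simp
  have jn: "j \<le> Suc n" unfolding j_def by (rule Least_le) simp
  have "y i < \<zeta> \<longleftrightarrow> i < j" if "i \<le> n" for i
  proof
    assume "y i < \<zeta>"
    show "i < j"
    proof (rule ccontr)
      assume "\<not> i < j"
      then show False using j y_le[of j i] that \<open>y i < \<zeta>\<close> by auto
    qed
  next
    assume "i < j"
    then have "\<not> (i = Suc n \<or> \<zeta> \<le> y i)" unfolding j_def by (rule not_less_Least)
    then show "y i < \<zeta>" by simp
  qed
  with jn that show thesis by blast
qed


text \<open>The costs \<open>Z_minus\<close> and \<open>Z_plus\<close> leave out the cells that contain \<open>-1\<close> and \<open>1\<close>, each of mass at most \<open>l\<close>.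
Up to this error they are the costs computed with the full mass between \<open>\<zeta>\<close> and the exits.\<close>

lemma turning_point_bounds:
  assumes \<alpha>: "0 \<le> \<alpha>" and Z: "Z_minus \<alpha> l n y \<zeta> = Z_plus \<alpha> l n y \<zeta>"
  shows "-1 < \<zeta>" "\<zeta> < 1" "\<bar>2 * \<zeta> + \<alpha> * (2 * mass_left \<zeta> - mass_left (-1) - mass_left 1)\<bar> \<le> 2 * \<alpha> * l"
proof -
  have first_unique: "(THE i. first_inside n y i) = i" if "first_inside n y i" for i
  proof (rule the_equality[where P = "first_inside n y", OF that])
    fix k assume k: "first_inside n y k"
    show "k = i"
    proof (cases k i rule: linorder_cases)
      case less
      then have "y k \<le> y (i - 1)" using that by (intro y_le) (auto simp: first_inside_def)
      then show ?thesis using k that less by (auto simp: first_inside_def)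
    next
      case greater
      then have "y i \<le> y (k - 1)" using k by (intro y_le) (auto simp: first_inside_def)
      then show ?thesis using k that greater by (auto simp: first_inside_def)
    qed
  qed
  have last_unique: "(THE i. last_inside n y i) = i" if "last_inside n y i" for i
  proof (rule the_equality[where P = "last_inside n y", OF that])
    fix k assume k: "last_inside n y k"
    show "k = i"
    proof (cases k i rule: linorder_cases)
      case less
      then have "y (Suc k) \<le> y i" using that by (intro y_le) (auto simp: last_inside_def)
      then show ?thesis using k that less by (auto simp: last_inside_def)
    next
      case greater
      then have "y (Suc i) \<le> y k" using k by (intro y_le) (auto simp: last_inside_def)
      then show ?thesis using k that greater by (auto simp: last_inside_def)
    qed
  qed
  have first_mass: "mass_left (-1) \<le> mass_left (y i)" "mass_left (y i) \<le> mass_left (-1) + l" if "first_inside n y i" for i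
  proof -
    show "mass_left (-1) \<le> mass_left (y i)" using that by (intro mass_left_mono) (auto simp: first_inside_def)
    show "mass_left (y i) \<le> mass_left (-1) + l"
    proof (cases i)
      case 0
      then show ?thesis using mass_left_y[of 0] mass_left_bounds(1)[of "-1"] l_pos by simp
    next
      case (Suc k)
      then have "real k * l \<le> mass_left (-1)" using that by (intro mass_left_ge) (auto simp: first_inside_def)
      then show ?thesis using mass_left_y[of i] Suc that by (auto simp: first_inside_def algebra_simps)
    qed
  qed
  have last_mass: "mass_left (y i) \<le> mass_left 1" "mass_left 1 \<le> mass_left (y i) + l" if "last_inside n y i" for i
  proof -
    show "mass_left (y i) \<le> mass_left 1" using that by (intro mass_left_mono) (auto simp: last_inside_def)
    show "mass_left 1 \<le> mass_left (y i) + l"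
    proof (cases "i = n")
      case True
      then show ?thesis using mass_left_y[of n] mass_left_bounds(2)[of 1] l_pos by simp
    next
      case False
      then have "mass_left 1 \<le> real (Suc i) * l" using that by (intro mass_left_le) (auto simp: last_inside_def)
      then show ?thesis using mass_left_y[of i] that by (auto simp: last_inside_def algebra_simps)
    qed
  qed
  have first_ex: "\<exists>i. first_inside n y i" if "-1 < y n"
  proof -
    define i where "i = (LEAST i. -1 < y i)"
    have i: "-1 < y i" "i \<le> n" unfolding i_def using that by (auto intro: LeastI Least_le)
    moreover have "y (i - 1) \<le> -1" if "i \<noteq> 0"
      using not_less_Least[of "i - 1" "\<lambda>i. -1 < y i"] that by (auto simp: i_def)
    ultimately show ?thesis unfolding first_inside_def by auto
  qed
  have last_ex: "\<exists>i. last_inside n y i" if "y 0 < 1"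
  proof -
    define i where "i = Max {i. i \<le> n \<and> y i < 1}"
    have fin: "finite {i. i \<le> n \<and> y i < 1}" "{i. i \<le> n \<and> y i < 1} \<noteq> {}" using that by auto
    have i: "i \<le> n" "y i < 1" using Max_in[OF fin] by (auto simp: i_def)
    moreover have "1 \<le> y (Suc i)" if "i \<noteq> n"
    proof (rule ccontr)
      assume "\<not> 1 \<le> y (Suc i)"
      then have "Suc i \<in> {i. i \<le> n \<and> y i < 1}" using that i by auto
      from Max_ge[OF fin(1) this] show False by (simp add: i_def)
    qed
    ultimately show ?thesis unfolding last_inside_def by auto
  qed
  have minus: "\<zeta> + 1 \<le> Z_minus \<alpha> l n y \<zeta>"
      "-1 < \<zeta> \<Longrightarrow> \<bar>Z_minus \<alpha> l n y \<zeta> - (\<zeta> + 1 + \<alpha> * (mass_left \<zeta> - mass_left (-1)))\<bar> \<le> \<alpha> * l"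
      "\<zeta> \<le> -1 \<Longrightarrow> Z_minus \<alpha> l n y \<zeta> = \<zeta> + 1"
  proof -
    have "\<zeta> + 1 \<le> Z_minus \<alpha> l n y \<zeta> \<and> (-1 < \<zeta> \<longrightarrow> 
        \<bar>Z_minus \<alpha> l n y \<zeta> - (\<zeta> + 1 + \<alpha> * (mass_left \<zeta> - mass_left (-1)))\<bar> \<le> \<alpha> * l)
      \<and> (\<zeta> \<le> -1 \<longrightarrow> Z_minus \<alpha> l n y \<zeta> = \<zeta> + 1)"
    proof (cases "\<exists>i. first_inside n y i \<and> y i < \<zeta>")
      case True
      then obtain i where i: "first_inside n y i" "y i < \<zeta>" by blast
      have Zm: "Z_minus \<alpha> l n y \<zeta> = \<zeta> + 1 + \<alpha> * (mass_left \<zeta> - mass_left (y i))"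
        using True u_LINT_lebesgue[of "y i" \<zeta>] i(2) by (simp add: Z_minus_def first_unique[OF i(1)])
      have "0 \<le> \<alpha> * (mass_left \<zeta> - mass_left (y i))" using \<alpha> mass_left_mono[of "y i" \<zeta>] i by auto
      moreover have "0 \<le> \<alpha> * (mass_left (y i) - mass_left (-1))" "\<alpha> * (mass_left (y i) - mass_left (-1)) \<le> \<alpha> * l"
        using \<alpha> first_mass[OF i(1)] by (auto intro!: mult_left_mono)
      moreover have "-1 < \<zeta>" using i by (auto simp: first_inside_def)
      ultimately show ?thesis unfolding Zm by (auto simp: algebra_simps abs_le_iff)
    next
      case False
      then have Zm: "Z_minus \<alpha> l n y \<zeta> = \<zeta> + 1" by (simp only: Z_minus_def if_False)
      have "mass_left \<zeta> \<le> mass_left (-1) + l" if "-1 < \<zeta>"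
      proof (cases "-1 < y n")
        case True
        then obtain i where i: "first_inside n y i" using first_ex by blast
        then have "\<zeta> \<le> y i" using False by (auto simp: not_less)
        then show ?thesis using mass_left_mono first_mass[OF i] by fastforce
      next
        case False
        then show ?thesis using mass_left_high[of "-1"] mass_left_bounds(2)[of \<zeta>] l_pos by auto
      qed
      then have "0 \<le> \<alpha> * (mass_left \<zeta> - mass_left (-1))" "\<alpha> * (mass_left \<zeta> - mass_left (-1)) \<le> \<alpha> * l" if "-1 < \<zeta>"
        using \<alpha> that mass_left_mono[of "-1" \<zeta>] by (auto intro!: mult_left_mono)
      then show ?thesis unfolding Zm by auto
    qed
    then show "\<zeta> + 1 \<le> Z_minus \<alpha> l n y \<zeta>"
      "-1 < \<zeta> \<Longrightarrow> \<bar>Z_minus \<alpha> l n y \<zeta> - (\<zeta> + 1 + \<alpha> * (mass_left \<zeta> - mass_left (-1)))\<bar> \<le> \<alpha> * l"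
      "\<zeta> \<le> -1 \<Longrightarrow> Z_minus \<alpha> l n y \<zeta> = \<zeta> + 1" by blast+
  qed
  have plus: "1 - \<zeta> \<le> Z_plus \<alpha> l n y \<zeta>"
      "\<zeta> < 1 \<Longrightarrow> \<bar>Z_plus \<alpha> l n y \<zeta> - (1 - \<zeta> + \<alpha> * (mass_left 1 - mass_left \<zeta>))\<bar> \<le> \<alpha> * l"
      "1 \<le> \<zeta> \<Longrightarrow> Z_plus \<alpha> l n y \<zeta> = 1 - \<zeta>"
  proof -
    have "1 - \<zeta> \<le> Z_plus \<alpha> l n y \<zeta> \<and> (\<zeta> < 1 \<longrightarrow> 
        \<bar>Z_plus \<alpha> l n y \<zeta> - (1 - \<zeta> + \<alpha> * (mass_left 1 - mass_left \<zeta>))\<bar> \<le> \<alpha> * l)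
      \<and> (1 \<le> \<zeta> \<longrightarrow> Z_plus \<alpha> l n y \<zeta> = 1 - \<zeta>)"
    proof (cases "\<exists>i. last_inside n y i \<and> \<zeta> < y i")
      case True
      then obtain i where i: "last_inside n y i" "\<zeta> < y i" by blast
      have Zm: "Z_plus \<alpha> l n y \<zeta> = 1 - \<zeta> + \<alpha> * (mass_left (y i) - mass_left \<zeta>)"
        using True u_LINT_lebesgue[of \<zeta> "y i"] i(2) by (simp add: Z_plus_def last_unique[OF i(1)])
      have "0 \<le> \<alpha> * (mass_left (y i) - mass_left \<zeta>)" using \<alpha> mass_left_mono[of \<zeta> "y i"] i by auto
      moreover have "0 \<le> \<alpha> * (mass_left 1 - mass_left (y i))" "\<alpha> * (mass_left 1 - mass_left (y i)) \<le> \<alpha> * l"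
        using \<alpha> last_mass[OF i(1)] by (auto intro!: mult_left_mono)
      moreover have "\<zeta> < 1" using i by (auto simp: last_inside_def)
      ultimately show ?thesis unfolding Zm by (auto simp: algebra_simps abs_le_iff)
    next
      case False
      then have Zm: "Z_plus \<alpha> l n y \<zeta> = 1 - \<zeta>" by (simp only: Z_plus_def if_False)
      have "mass_left 1 \<le> mass_left \<zeta> + l" if "\<zeta> < 1"
      proof (cases "y 0 < 1")
        case True
        then obtain i where i: "last_inside n y i" using last_ex by blast
        then have "y i \<le> \<zeta>" using False by (auto simp: not_less)
        then show ?thesis using mass_left_mono last_mass[OF i] by fastforce
      next
        case False
        then show ?thesis using mass_left_low[of 1] mass_left_bounds(1)[of \<zeta>] l_pos by auto
      qed
      then have "0 \<le> \<alpha> * (mass_left 1 - mass_left \<zeta>)" "\<alpha> * (mass_left 1 - mass_left \<zeta>) \<le> \<alpha> * l" if "\<zeta> < 1"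
        using \<alpha> that mass_left_mono[of \<zeta> 1] by (auto intro!: mult_left_mono)
      then show ?thesis unfolding Zm by auto
    qed
    then show "1 - \<zeta> \<le> Z_plus \<alpha> l n y \<zeta>"
      "\<zeta> < 1 \<Longrightarrow> \<bar>Z_plus \<alpha> l n y \<zeta> - (1 - \<zeta> + \<alpha> * (mass_left 1 - mass_left \<zeta>))\<bar> \<le> \<alpha> * l"
      "1 \<le> \<zeta> \<Longrightarrow> Z_plus \<alpha> l n y \<zeta> = 1 - \<zeta>" by blast+
  qed
  show 1: "-1 < \<zeta>" using minus(3) plus(1) Z by (cases "\<zeta> \<le> -1") auto
  show 2: "\<zeta> < 1" using minus(1) plus(3) Z by (cases "1 \<le> \<zeta>") auto
  have "2 * \<zeta> + \<alpha> * (2 * mass_left \<zeta> - mass_left (-1) - mass_left 1)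
      = (\<zeta> + 1 + \<alpha> * (mass_left \<zeta> - mass_left (-1))) - (1 - \<zeta> + \<alpha> * (mass_left 1 - mass_left \<zeta>))"
    by (simp add: algebra_simps)
  then show "\<bar>2 * \<zeta> + \<alpha> * (2 * mass_left \<zeta> - mass_left (-1) - mass_left 1)\<bar> \<le> 2 * \<alpha> * l"
    using minus(2)[OF 1] plus(2)[OF 2] Z by linarith
qed

end

locale moving_configuration = velocity \<rho>max v + configuration n l \<rho>max y
  for \<rho>max v n l y
begin


text \<open>Here \<open>P\<close> is the primitive of \<open>sgn (x - \<zeta>) \<phi>'(x)\<close> that vanishes at \<open>\<zeta>\<close>, so the first sum is the entropy flux
term, and the second one is the part of the time derivative of the entropy that is due to the motion of
the particles.  Summation by parts writes both as sums over particles.  With the averages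
\<open>A k\<close> of \<open>\<phi>\<close> over the cells, the terms from the deformation of the cells become the differences of
\<open>e k\<close>, which telescope, up to errors \<open>l \<bar>v (R i) - v (R (Suc i))\<bar>\<close> that come from \<open>\<bar>\<phi> (y i) - A k\<bar> \<le> M (y k - y (k - 1))\<close>.\<close>

lemma discrete_entropy_inequality:
  fixes \<phi> \<Phi> :: "real \<Rightarrow> real" and \<zeta> :: real
  assumes \<kappa>: "\<kappa> \<in> {0..\<rho>max}"
    and \<phi>_nonneg: "\<And>x. 0 \<le> \<phi> x" and \<phi>_lip: "\<And>a b. \<bar>\<phi> a - \<phi> b\<bar> \<le> M * \<bar>a - b\<bar>"
    and \<Phi>: "\<And>x. y 0 \<le> x \<Longrightarrow> (\<Phi> has_real_derivative \<phi> x) (at x)"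
  defines "w \<equiv> particle_velocity v l n y \<zeta>"
    and "P \<equiv> \<lambda>x. (if x < \<zeta> then -1 else 1) * (\<phi> x - \<phi> \<zeta>)"
  shows "(\<Sum>k<n. (kruzkov_flux v \<kappa> (R (Suc k)) - flux v \<kappa>) * (P (y (Suc k)) - P (y k)))
      - (\<Sum>k<n. sgn (R (Suc k) - \<kappa>) * (- (R (Suc k))\<^sup>2 / l * (w (Suc k) - w k)) * (\<Phi> (y (Suc k)) - \<Phi> (y k))
            + (\<bar>R (Suc k) - \<kappa>\<bar> - \<kappa>) * (\<phi> (y (Suc k)) * w (Suc k) - \<phi> (y k) * w k))
      \<ge> - M * l * ((\<Sum>i\<le>n. \<bar>v (R i) - v (R (Suc i))\<bar>) + 2 * v 0)"
    (is "?Q - ?B \<ge> _")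
proof -
  have M: "0 \<le> M" using order_trans[OF abs_ge_zero \<phi>_lip[of 1 0]] by simp
  define A where "A k = R k * (\<Phi> (y k) - \<Phi> (y (k - 1))) / l" for k
  define c where "c k = sgn (R k - \<kappa>) * R k * A k" for k
  let ?q = "\<lambda>k. kruzkov_flux v \<kappa> (R k)"
  let ?a = "\<lambda>k. \<bar>R k - \<kappa>\<bar>"
  define e where "e k = c k * v (R k) - \<phi> \<zeta> * ?q k" for k
  have A_near: "\<bar>R k * (\<phi> x - A k)\<bar> \<le> M * l" if "k \<le> Suc n" "1 \<le> k \<Longrightarrow> k \<le> n \<Longrightarrow> y (k - 1) \<le> x \<and> x \<le> y k" for k x
  proof (cases "1 \<le> k \<and> k \<le> n")
    case False
    then have "R k = 0" by (auto simp: local_density_def)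
    then show ?thesis using M l_pos by simp
  next
    case True
    then obtain m where m: "k = Suc m" "m < n" by (cases k) auto
    obtain z where z: "y m < z" "z < y (Suc m)" "\<Phi> (y (Suc m)) - \<Phi> (y m) = (y (Suc m) - y m) * \<phi> z"
      using MVT2[of "y m" "y (Suc m)" \<Phi> \<phi>] y_step[OF m(2)] \<Phi> y_le[of 0 m] m(2)
      by (meson less_imp_le_nat order_trans zero_le)
    have "A k = (R (Suc m) * (y (Suc m) - y m)) * \<phi> z / l"
      unfolding A_def m(1) by (simp add: z(3))
    then have A: "A k = \<phi> z" using R_width[OF m(2)] l_pos by simp
    have "\<bar>\<phi> x - \<phi> z\<bar> \<le> M * (y (Suc m) - y m)"
    proof -
      have "\<bar>x - z\<bar> \<le> y (Suc m) - y m" using that(2) True z m by auto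
      then show ?thesis using \<phi>_lip[of x z] M mult_left_mono by fastforce
    qed
    then have "R k * \<bar>\<phi> x - \<phi> z\<bar> \<le> R k * (M * (y (Suc m) - y m))"
      using R_nonneg by (intro mult_left_mono)
    also have "\<dots> = M * l" using R_width[OF m(2)] m by (simp add: mult.left_commute)
    finally show ?thesis unfolding A using R_nonneg[of k] by (simp add: abs_mult)
  qed
  have c_0: "c 0 = 0" "c (Suc n) = 0" by (simp_all add: c_def)
  have q_0: "?q 0 - flux v \<kappa> = 0" "?q (Suc n) - flux v \<kappa> = 0"
    using kruzkov_flux_0[OF \<kappa>] by simp_all
  have a_0: "?a 0 - \<kappa> = 0" "?a (Suc n) - \<kappa> = 0" using \<kappa> by simp_all
  have "?Q = (\<Sum>i\<le>n. ((?q i - flux v \<kappa>) - (?q (Suc i) - flux v \<kappa>)) * P (y i))"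
    by (rule sum_by_parts_zero_ends[where G="\<lambda>k. ?q k - flux v \<kappa>" and h="\<lambda>k. P (y k)"]) (fact q_0)+
  moreover have "?B = - (\<Sum>k<n. c (Suc k) * (w (Suc k) - w k))
      + (\<Sum>k<n. (?a (Suc k) - \<kappa>) * (\<phi> (y (Suc k)) * w (Suc k) - \<phi> (y k) * w k))"
    unfolding sum_negf[symmetric] sum.distrib[symmetric]
    by (intro sum.cong refl) (simp add: c_def A_def power2_eq_square mult_ac)
  moreover have "(\<Sum>k<n. c (Suc k) * (w (Suc k) - w k)) = (\<Sum>i\<le>n. (c i - c (Suc i)) * w i)"
    by (rule sum_by_parts_zero_ends) (fact c_0)+
  moreover have "(\<Sum>k<n. (?a (Suc k) - \<kappa>) * (\<phi> (y (Suc k)) * w (Suc k) - \<phi> (y k) * w k))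
      = (\<Sum>i\<le>n. ((?a i - \<kappa>) - (?a (Suc i) - \<kappa>)) * (\<phi> (y i) * w i))"
    by (rule sum_by_parts_zero_ends[where G="\<lambda>k. ?a k - \<kappa>" and h="\<lambda>k. \<phi> (y k) * w k"]) (fact a_0)+
  ultimately have QB: "?Q - ?B = (\<Sum>i\<le>n. (?q i - ?q (Suc i)) * P (y i) + (c i - c (Suc i)) * w i
      - (?a i - ?a (Suc i)) * (\<phi> (y i) * w i))"
    by (simp add: sum.distrib sum_subtractf)
  obtain j where j: "j \<le> Suc n" "\<And>i. i \<le> n \<Longrightarrow> y i < \<zeta> \<longleftrightarrow> i < j" using sign_index by blast
  \<comment> \<open>The inequality per particle; the first case is a particle that moves to the right, the second one its mirror image.\<close>
  have node: "(?q i - ?q (Suc i)) * P (y i) + (c i - c (Suc i)) * w i - (?a i - ?a (Suc i)) * (\<phi> (y i) * w i)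
      \<ge> (if i < j then -1 else 1) * (e i - e (Suc i)) - M * l * \<bar>v (R i) - v (R (Suc i))\<bar>" if i: "i \<le> n" for i
  proof (cases "i < j")
    case False
    then have "\<not> y i < \<zeta>" using j(2)[OF i] by simp
    then have P: "P (y i) = \<phi> (y i) - \<phi> \<zeta>" and w: "w i = v (R (Suc i))"
      by (simp_all add: P_def w_def particle_velocity_def)
    have g: "\<phi> (y i) * (sgn (R i - \<kappa>) * R i * (v (R i) - v (R (Suc i))))
        \<le> \<phi> (y i) * ((?q i - ?q (Suc i)) - v (R (Suc i)) * (?a i - ?a (Suc i)))"
      using node_entropy_forward[OF R_range R_range \<kappa>] \<phi>_nonneg by (intro mult_left_mono) auto
    have near: "\<bar>R i * (\<phi> (y i) - A i)\<bar> \<le> M * l" using i by (intro A_near) (auto intro: y_le)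
    have err: "- (M * l * \<bar>v (R i) - v (R (Suc i))\<bar>)
        \<le> sgn (R i - \<kappa>) * (R i * (\<phi> (y i) - A i)) * (v (R i) - v (R (Suc i)))" (is "_ \<le> ?E")
    proof -
      have "\<bar>?E\<bar> = \<bar>sgn (R i - \<kappa>)\<bar> * \<bar>R i * (\<phi> (y i) - A i)\<bar> * \<bar>v (R i) - v (R (Suc i))\<bar>"
        by (simp only: abs_mult)
      also have "\<dots> \<le> 1 * (M * l) * \<bar>v (R i) - v (R (Suc i))\<bar>"
        using near M l_pos by (intro mult_mono) (auto simp: sgn_if)
      finally show ?thesis by linarith
    qed
    have "(?q i - ?q (Suc i)) * P (y i) + (c i - c (Suc i)) * w i - (?a i - ?a (Suc i)) * (\<phi> (y i) * w i)
       = \<phi> (y i) * ((?q i - ?q (Suc i)) - v (R (Suc i)) * (?a i - ?a (Suc i)))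
         - \<phi> (y i) * (sgn (R i - \<kappa>) * R i * (v (R i) - v (R (Suc i))))
         + (e i - e (Suc i)) + sgn (R i - \<kappa>) * (R i * (\<phi> (y i) - A i)) * (v (R i) - v (R (Suc i)))"
      unfolding P w e_def c_def by (simp add: algebra_simps)
    with g err False show ?thesis by simp
  next
    case True
    then have "y i < \<zeta>" using j(2)[OF i] by simp
    then have P: "P (y i) = - (\<phi> (y i) - \<phi> \<zeta>)" and w: "w i = - v (R i)"
      by (simp_all add: P_def w_def particle_velocity_def)
    have g: "\<phi> (y i) * (sgn (R (Suc i) - \<kappa>) * R (Suc i) * (v (R (Suc i)) - v (R i)))
        \<le> \<phi> (y i) * ((?q (Suc i) - ?q i) - v (R i) * (?a (Suc i) - ?a i))"
      using node_entropy_forward[OF R_range R_range \<kappa>] \<phi>_nonneg by (intro mult_left_mono) auto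
    have near: "\<bar>R (Suc i) * (\<phi> (y i) - A (Suc i))\<bar> \<le> M * l" using i by (intro A_near) (auto intro: y_le)
    have err: "- (M * l * \<bar>v (R i) - v (R (Suc i))\<bar>)
        \<le> sgn (R (Suc i) - \<kappa>) * (R (Suc i) * (\<phi> (y i) - A (Suc i))) * (v (R (Suc i)) - v (R i))" (is "_ \<le> ?E")
    proof -
      have "\<bar>?E\<bar> = \<bar>sgn (R (Suc i) - \<kappa>)\<bar> * \<bar>R (Suc i) * (\<phi> (y i) - A (Suc i))\<bar> * \<bar>v (R (Suc i)) - v (R i)\<bar>"
        by (simp only: abs_mult)
      also have "\<dots> \<le> 1 * (M * l) * \<bar>v (R (Suc i)) - v (R i)\<bar>"
        using near M l_pos by (intro mult_mono) (auto simp: sgn_if)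
      finally show ?thesis by (simp add: abs_minus_commute)
    qed
    have "(?q i - ?q (Suc i)) * P (y i) + (c i - c (Suc i)) * w i - (?a i - ?a (Suc i)) * (\<phi> (y i) * w i)
       = \<phi> (y i) * ((?q (Suc i) - ?q i) - v (R i) * (?a (Suc i) - ?a i))
         - \<phi> (y i) * (sgn (R (Suc i) - \<kappa>) * R (Suc i) * (v (R (Suc i)) - v (R i)))
         - (e i - e (Suc i)) + sgn (R (Suc i) - \<kappa>) * (R (Suc i) * (\<phi> (y i) - A (Suc i))) * (v (R (Suc i)) - v (R i))"
      unfolding P w e_def c_def by (simp add: algebra_simps)
    with g err True show ?thesis by simp
  qed
  have "?Q - ?B \<ge> (\<Sum>i\<le>n. (if i < j then -1 else 1) * (e i - e (Suc i)) - M * l * \<bar>v (R i) - v (R (Suc i))\<bar>)"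
    unfolding QB using node by (intro sum_mono) auto
  also have "(\<Sum>i\<le>n. (if i < j then -1 else 1) * (e i - e (Suc i)) - M * l * \<bar>v (R i) - v (R (Suc i))\<bar>)
      = (2 * e j - e 0 - e (Suc n)) - M * l * (\<Sum>i\<le>n. \<bar>v (R i) - v (R (Suc i))\<bar>)"
    by (simp only: sum_subtractf sum_sign_telescope[OF j(1)] sum_distrib_left)
  finally have 1: "?Q - ?B \<ge> (2 * e j - e 0 - e (Suc n)) - M * l * (\<Sum>i\<le>n. \<bar>v (R i) - v (R (Suc i))\<bar>)" .
  have e_ends: "e 0 = - \<phi> \<zeta> * flux v \<kappa>" "e (Suc n) = - \<phi> \<zeta> * flux v \<kappa>"
    using c_0 q_0 by (simp_all add: e_def)
  \<comment> \<open>The cell of the turning point: the term with the sign is nonnegative, the rest is small since the average of the test function over this cell is close to its value at the turning point.\<close>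
  have "2 * e j + 2 * \<phi> \<zeta> * flux v \<kappa>
      = 2 * (\<phi> \<zeta> * flux v \<kappa> * (1 + sgn (R j - \<kappa>))) - 2 * (sgn (R j - \<kappa>) * v (R j) * (R j * (\<phi> \<zeta> - A j)))"
    by (simp add: e_def c_def kruzkov_flux_def flux_def algebra_simps)
  moreover have "0 \<le> \<phi> \<zeta> * flux v \<kappa> * (1 + sgn (R j - \<kappa>))"
    using \<phi>_nonneg flux_bounds[OF \<kappa>] by (intro mult_nonneg_nonneg) (auto simp: sgn_if)
  moreover have "\<bar>sgn (R j - \<kappa>) * v (R j) * (R j * (\<phi> \<zeta> - A j))\<bar> \<le> v 0 * (M * l)"
  proof -
    have "\<bar>R j * (\<phi> \<zeta> - A j)\<bar> \<le> M * l"
    proof (rule A_near[OF j(1)])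
      assume "1 \<le> j" "j \<le> n"
      then show "y (j - 1) \<le> \<zeta> \<and> \<zeta> \<le> y j" using j(2)[of "j - 1"] j(2)[of j] by (cases j) auto
    qed
    moreover have "\<bar>sgn (R j - \<kappa>) * v (R j)\<bar> \<le> v 0"
      using v_abs_le[OF R_range, of j] v_0_pos by (auto simp: abs_mult sgn_if)
    ultimately show ?thesis unfolding abs_mult[of "sgn (R j - \<kappa>) * v (R j)"]
      using v_0_pos by (intro mult_mono) auto
  qed
  ultimately have "2 * e j - e 0 - e (Suc n) \<ge> - 2 * (v 0 * (M * l))"
    unfolding e_ends by linarith
  with 1 have "?Q - ?B \<ge> - (M * l * (\<Sum>i\<le>n. \<bar>v (R i) - v (R (Suc i))\<bar>)) - 2 * (v 0 * (M * l))" by linarith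
  then show ?thesis by (simp add: algebra_simps)
qed

end

section \<open>Test functions and their primitives\<close>

text \<open>Continuously differentiable functions, supported in \<open>\<bar>x\<bar> \<le> M\<close> and before the time \<open>T\<close>.  They may be nonzero at
the time \<open>0\<close>, which brings the initial datum into the inequalities.\<close>

locale test_function =
  fixes \<phi> \<phi>t \<phi>x :: "real \<Rightarrow> real \<Rightarrow> real" and T M :: real
  assumes T_pos: "0 < T" and M_pos: "0 < M"
    and \<phi>_t: "\<And>t x. ((\<lambda>s. \<phi> s x) has_real_derivative \<phi>t t x) (at t)"
    and \<phi>_x: "\<And>t x. ((\<lambda>z. \<phi> t z) has_real_derivative \<phi>x t x) (at x)"
    and \<phi>_cont: "continuous_on UNIV (\<lambda>(t, x). \<phi> t x)"
    and \<phi>t_cont: "continuous_on UNIV (\<lambda>(t, x). \<phi>t t x)"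
    and \<phi>x_cont: "continuous_on UNIV (\<lambda>(t, x). \<phi>x t x)"
    and \<phi>_nonneg: "\<And>t x. 0 \<le> \<phi> t x"
    and \<phi>_support: "\<And>t x. T \<le> t \<or> M \<le> \<bar>x\<bar> \<Longrightarrow> \<phi> t x = 0 \<and> \<phi>t t x = 0 \<and> \<phi>x t x = 0"
begin

lemma \<phi>_continuous [continuous_intros]:
  "continuous_on S f \<Longrightarrow> continuous_on S g \<Longrightarrow> continuous_on S (\<lambda>p. \<phi> (f p) (g p))"
  using continuous_on_compose2[OF \<phi>_cont, of S "\<lambda>p. (f p, g p)"] by (auto intro: continuous_intros)

lemma \<phi>t_continuous [continuous_intros]:
  "continuous_on S f \<Longrightarrow> continuous_on S g \<Longrightarrow> continuous_on S (\<lambda>p. \<phi>t (f p) (g p))"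
  using continuous_on_compose2[OF \<phi>t_cont, of S "\<lambda>p. (f p, g p)"] by (auto intro: continuous_intros)

lemma \<phi>x_continuous [continuous_intros]:
  "continuous_on S f \<Longrightarrow> continuous_on S g \<Longrightarrow> continuous_on S (\<lambda>p. \<phi>x (f p) (g p))"
  using continuous_on_compose2[OF \<phi>x_cont, of S "\<lambda>p. (f p, g p)"] by (auto intro: continuous_intros)

lemma test_bound:
  obtains B where "0 < B"
    "\<And>t x. t \<in> {0..T} \<Longrightarrow> \<bar>\<phi> t x\<bar> \<le> B \<and> \<bar>\<phi>t t x\<bar> \<le> B \<and> \<bar>\<phi>x t x\<bar> \<le> B"
proof -
  have *: "\<exists>B>0. \<forall>t\<in>{0..T}. \<forall>x\<in>{-M..M}. \<bar>g t x\<bar> \<le> B" if "continuous_on UNIV (\<lambda>(t, x). g t x)" for g :: "real \<Rightarrow> real \<Rightarrow> real"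
  proof -
    have "bounded ((\<lambda>(t, x). g t x) ` ({0..T} \<times> {-M..M}))"
      by (intro compact_imp_bounded compact_continuous_image continuous_on_subset[OF that] compact_Times) auto
    then obtain B where "B > 0" "\<forall>z\<in>(\<lambda>(t, x). g t x) ` ({0..T} \<times> {-M..M}). norm z \<le> B"
      by (auto simp: bounded_pos)
    then show ?thesis by (intro exI[of _ B]) force
  qed
  obtain B1 where B1: "B1 > 0" "\<forall>t\<in>{0..T}. \<forall>x\<in>{-M..M}. \<bar>\<phi> t x\<bar> \<le> B1" using *[OF \<phi>_cont] by blast
  obtain B2 where B2: "B2 > 0" "\<forall>t\<in>{0..T}. \<forall>x\<in>{-M..M}. \<bar>\<phi>t t x\<bar> \<le> B2" using *[OF \<phi>t_cont] by blast
  obtain B3 where B3: "B3 > 0" "\<forall>t\<in>{0..T}. \<forall>x\<in>{-M..M}. \<bar>\<phi>x t x\<bar> \<le> B3" using *[OF \<phi>x_cont] by blast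
  have "\<bar>\<phi> t x\<bar> \<le> B1 + B2 + B3 \<and> \<bar>\<phi>t t x\<bar> \<le> B1 + B2 + B3 \<and> \<bar>\<phi>x t x\<bar> \<le> B1 + B2 + B3"
    if "t \<in> {0..T}" for t x
  proof (cases "x \<in> {-M..M}")
    case True
    have "\<bar>\<phi> t x\<bar> \<le> B1" "\<bar>\<phi>t t x\<bar> \<le> B2" "\<bar>\<phi>x t x\<bar> \<le> B3" using B1 B2 B3 that True by blast+
    then show ?thesis using B1(1) B2(1) B3(1) by linarith
  next
    case False
    then have "M \<le> \<bar>x\<bar>" by auto
    then show ?thesis using \<phi>_support[of t x] B1(1) B2(1) B3(1) by auto
  qed
  then show thesis using that[of "B1 + B2 + B3"] B1(1) B2(1) B3(1) by auto
qed

lemma \<phi>_Lipschitz: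
  assumes B: "\<And>x. \<bar>\<phi>x t x\<bar> \<le> B" shows "\<bar>\<phi> t a - \<phi> t b\<bar> \<le> B * \<bar>a - b\<bar>"
  using field_differentiable_bound[of UNIV "\<phi> t" "\<phi>x t" B a b] \<phi>_x B by auto

definition \<Phi> :: "real \<Rightarrow> real \<Rightarrow> real \<Rightarrow> real" where
  "\<Phi> b t x = integral {b..x} (\<phi> t)"

definition \<Phi>t :: "real \<Rightarrow> real \<Rightarrow> real \<Rightarrow> real" where
  "\<Phi>t b t x = integral {b..x} (\<phi>t t)"

lemma \<Phi>_x: assumes "b < x" shows "(\<Phi> b t has_real_derivative \<phi> t x) (at x)"
proof -
  have "((\<lambda>u. integral {b..u} (\<phi> t)) has_real_derivative \<phi> t x) (at x within {b..x+1})"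
    by (rule integral_has_real_derivative) (use assms in \<open>auto intro!: continuous_intros\<close>)
  moreover have "at x within {b..x+1} = at x"
    using assms by (intro at_within_Icc_at) auto
  ultimately show ?thesis unfolding \<Phi>_def[abs_def] by simp
qed

lemma \<Phi>_t: "((\<lambda>t. \<Phi> b t x) has_real_derivative \<Phi>t b t x) (at t)"
proof -
  have "((\<lambda>t. integral (cbox b x) (\<phi> t)) has_field_derivative integral (cbox b x) (\<phi>t t)) (at t within UNIV)"
  proof (rule leibniz_rule_field_derivative)
    show "continuous_on (UNIV \<times> cbox b x) (\<lambda>(x, t). \<phi>t x t)"
      by (rule continuous_on_subset[OF \<phi>t_cont]) auto
  qed (auto intro!: integrable_continuous_real continuous_intros \<phi>_t)
  then show ?thesis unfolding \<Phi>_def \<Phi>t_def by simp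
qed

lemma \<Phi>_has_derivative:
  assumes b: "b < x"
  shows "((\<lambda>p. \<Phi> b (fst p) (snd p)) has_derivative (\<lambda>p. fst p * \<Phi>t b t x + snd p * \<phi> t x)) (at (t, x))"
proof -
  have partials: "((\<lambda>(t, x). \<Phi> b t x) has_derivative (\<lambda>(h, k). h * \<Phi>t b t x + blinfun_mult_left (\<phi> t x) k))
      (at (t, x) within UNIV \<times> {b<..})"
  proof (rule has_derivative_partialsI)
    show "((\<lambda>s. \<Phi> b s x) has_derivative (\<lambda>h. h * \<Phi>t b t x)) (at t)"
      using \<Phi>_t[of b x t] by (simp add: has_field_derivative_def mult_commute_abs)
    show "(\<Phi> b s has_derivative blinfun_apply (blinfun_mult_left (\<phi> s z))) (at z within {b<..})"
      if "z \<in> {b<..}" for s z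
      using \<Phi>_x[of b z s] that
      by (auto simp: has_field_derivative_def mult_commute_abs intro: has_derivative_at_withinI)
    have "continuous_on UNIV (\<lambda>(t, x). blinfun_mult_left (\<phi> t x))"
      unfolding split_beta by (intro continuous_intros bounded_linear.continuous_on[OF bounded_linear_blinfun_mult_left])
    then show "continuous (at (t, x) within UNIV \<times> {b<..}) (\<lambda>(t, x). blinfun_mult_left (\<phi> t x))"
      by (auto simp: continuous_on_eq_continuous_at intro: continuous_at_imp_continuous_at_within)
  qed (use b in auto)
  have at_eq: "at (t, x) within UNIV \<times> {b<..} = at (t, x)"
    by (rule at_within_open) (use b in \<open>auto simp: open_Times\<close>)
  show ?thesis using partials unfolding at_eq split_beta blinfun_mult_left.rep_eq .
qed

lemma \<Phi>_continuous:
  assumes "continuous_on S f" "continuous_on S g" "\<And>p. p \<in> S \<Longrightarrow> b < g p"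
  shows "continuous_on S (\<lambda>p. \<Phi> b (f p) (g p))"
proof -
  have "continuous_on (UNIV \<times> {b<..}) (\<lambda>p. \<Phi> b (fst p) (snd p))"
  proof (rule continuous_at_imp_continuous_on, rule ballI)
    fix p :: "real \<times> real" assume "p \<in> UNIV \<times> {b<..}"
    then have "b < snd p" by auto
    from has_derivative_continuous[OF \<Phi>_has_derivative[OF this, of "fst p"]]
    show "isCont (\<lambda>p. \<Phi> b (fst p) (snd p)) p" by simp
  qed
  from continuous_on_compose2[OF this, of S "\<lambda>p. (f p, g p)"] show ?thesis
    using assms by (auto intro: continuous_on_Pair)
qed

text \<open>How the integral of \<open>\<phi>\<close> up to a moving particle changes in time.\<close>

lemma \<Phi>_chain:
  assumes g: "(g has_real_derivative g') (at t)" and b: "b < g t"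
  shows "((\<lambda>s. \<Phi> b s (g s)) has_real_derivative \<Phi>t b t (g t) + \<phi> t (g t) * g') (at t)"
proof -
  have "((\<lambda>s. (s, g s)) has_derivative (\<lambda>h. (h, h * g'))) (at t)"
    using g by (auto intro!: derivative_eq_intros simp: has_field_derivative_def mult.commute)
  from has_derivative_compose[OF this \<Phi>_has_derivative[OF b]]
  have "((\<lambda>s. \<Phi> b s (g s)) has_derivative (\<lambda>h. h * \<Phi>t b t (g t) + h * g' * \<phi> t (g t))) (at t)" by simp
  moreover have "(\<lambda>h. h * \<Phi>t b t (g t) + h * g' * \<phi> t (g t)) = (*) (\<Phi>t b t (g t) + \<phi> t (g t) * g')"
    by (auto simp: algebra_simps)
  ultimately show ?thesis by (simp only: has_field_derivative_def)
qed

lemma \<Phi>_increment_bound: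
  assumes B: "\<And>x. \<bar>\<phi> t x\<bar> \<le> B" "\<And>x. \<bar>\<phi>t t x\<bar> \<le> B" and "b \<le> a" "a \<le> c"
  shows "\<bar>\<Phi> b t c - \<Phi> b t a\<bar> \<le> B * (c - a)" "\<bar>\<Phi>t b t c - \<Phi>t b t a\<bar> \<le> B * (c - a)"
    "\<Phi>t b t c - \<Phi>t b t a = (LINT x:{a..<c}|lborel. \<phi>t t x)"
    "\<Phi> b t c - \<Phi> b t a = (LINT x:{a..<c}|lborel. \<phi> t x)"
proof -
  have *: "integral {b..c} f - integral {b..a} f = integral {a..c} f" if "continuous_on UNIV f" for f :: "real \<Rightarrow> real"
    using Henstock_Kurzweil_Integration.integral_combine[OF assms(3,4), of f]
      integrable_continuous_real[OF continuous_on_subset[OF that, of "{b..c}"]] by simp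
  have c: "continuous_on UNIV (\<phi> t)" "continuous_on UNIV (\<phi>t t)" by (auto intro!: continuous_intros)
  have bd: "\<bar>integral {a..c} f\<bar> \<le> B * (c - a)" if "continuous_on UNIV f" "\<And>x. \<bar>f x\<bar> \<le> B" for f :: "real \<Rightarrow> real"
    using integral_bound[OF assms(4) continuous_on_subset[OF that(1)]] that(2) by auto
  have half: "(LINT x:{a..<c}|lborel. f x) = integral {a..c} f" if f: "continuous_on UNIV f" for f :: "real \<Rightarrow> real"
  proof -
    have [measurable]: "f \<in> borel_measurable borel" using f by (simp add: borel_measurable_continuous_onI)
    have "(LINT x:{a..<c}|lborel. f x) = (LINT x:{a..c}|lborel. f x)"
      unfolding set_lebesgue_integral_def
      by (intro integral_cong_AE) (auto intro: AE_mp[OF AE_lborel_singleton[of c]] simp: indicator_def)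
    also have "\<dots> = integral {a..c} f"
      by (intro set_borel_integral_eq_integral borel_integrable_atLeastAtMost' continuous_on_subset[OF f]) auto
    finally show ?thesis .
  qed
  show "\<bar>\<Phi> b t c - \<Phi> b t a\<bar> \<le> B * (c - a)" "\<bar>\<Phi>t b t c - \<Phi>t b t a\<bar> \<le> B * (c - a)"
    "\<Phi>t b t c - \<Phi>t b t a = (LINT x:{a..<c}|lborel. \<phi>t t x)"
    "\<Phi> b t c - \<Phi> b t a = (LINT x:{a..<c}|lborel. \<phi> t x)"
    unfolding \<Phi>_def \<Phi>t_def using *[OF c(1)] *[OF c(2)] bd[OF c(1) B(1)] bd[OF c(2) B(2)] half[OF c(1)] half[OF c(2)]
    by simp_all
qed


lemma set_integrable_\<phi>x_sign: "set_integrable lborel {a..<c} (\<lambda>x. sgn (x - \<zeta>) * \<phi>x t x)"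
  and LINT_\<phi>x_sign: "a \<le> c \<Longrightarrow> (LINT x:{a..<c}|lborel. sgn (x - \<zeta>) * \<phi>x t x)
      = (if c < \<zeta> then -1 else 1) * (\<phi> t c - \<phi> t \<zeta>) - (if a < \<zeta> then -1 else 1) * (\<phi> t a - \<phi> t \<zeta>)"
proof -
  have c: "continuous_on UNIV (\<phi>x t)" by (auto intro!: continuous_intros)
  have [measurable]: "\<phi>x t \<in> borel_measurable borel" using c by (simp add: borel_measurable_continuous_onI)
  have int: "set_integrable lborel {a..c} (\<lambda>x. sgn (x - \<zeta>) * \<phi>x t x)" for a c
    unfolding set_integrable_def
  proof (rule Bochner_Integration.integrable_bound)
    have "set_integrable lborel {a..c} (\<phi>x t)"
      by (intro borel_integrable_atLeastAtMost' continuous_on_subset[OF c]) auto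
    then show "integrable lborel (\<lambda>x. indicat_real {a..c} x *\<^sub>R \<phi>x t x)" by (simp add: set_integrable_def)
  qed (auto simp: abs_mult sgn_if indicator_def)
  show "set_integrable lborel {a..<c} (\<lambda>x. sgn (x - \<zeta>) * \<phi>x t x)" for a c
    by (rule set_integrable_subset[OF int[of a c]]) auto
  assume ac: "a \<le> c"
  let ?P = "\<lambda>x. (if x < \<zeta> then -1 else 1) * (\<phi> t x - \<phi> t \<zeta>)"
  have f1: "continuous_on ({..\<zeta>} \<union> {\<zeta>..}) (\<lambda>x. if x \<le> \<zeta> then -1 * (\<phi> t x - \<phi> t \<zeta>) else \<phi> t x - \<phi> t \<zeta>)"
    by (rule continuous_on_cases) (auto intro!: continuous_intros)
  have f2: "(\<lambda>x. if x \<le> \<zeta> then -1 * (\<phi> t x - \<phi> t \<zeta>) else \<phi> t x - \<phi> t \<zeta>) = ?P" by auto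
  have f3: "{..\<zeta>} \<union> {\<zeta>..} = UNIV" by auto
  have P_cont: "continuous_on UNIV ?P" using f1 unfolding f2 f3 .
  have P_deriv: "(?P has_vector_derivative sgn (x - \<zeta>) * \<phi>x t x) (at x)" if "x \<noteq> \<zeta>" for x
  proof (cases "x < \<zeta>")
    case True
    have "((\<lambda>x. -1 * (\<phi> t x - \<phi> t \<zeta>)) has_real_derivative sgn (x - \<zeta>) * \<phi>x t x) (at x)"
      using True by (auto intro!: derivative_eq_intros \<phi>_x)
    then have "(?P has_real_derivative sgn (x - \<zeta>) * \<phi>x t x) (at x)"
      by (rule has_field_derivative_transform_within_open[where S="{..<\<zeta>}"]) (use True in auto)
    then show ?thesis by (simp add: has_real_derivative_iff_has_vector_derivative)
  next
    case False
    have "((\<lambda>x. \<phi> t x - \<phi> t \<zeta>) has_real_derivative sgn (x - \<zeta>) * \<phi>x t x) (at x)"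
      using False that by (auto intro!: derivative_eq_intros \<phi>_x)
    then have "(?P has_real_derivative sgn (x - \<zeta>) * \<phi>x t x) (at x)"
      by (rule has_field_derivative_transform_within_open[where S="{\<zeta><..}"]) (use False that in auto)
    then show ?thesis by (simp add: has_real_derivative_iff_has_vector_derivative)
  qed
  have hk: "((\<lambda>x. sgn (x - \<zeta>) * \<phi>x t x) has_integral ?P c - ?P a) {a..c}"
    by (rule fundamental_theorem_of_calculus_interior_strong[where S="{\<zeta>}"])
      (use ac P_deriv in \<open>auto intro: continuous_on_subset[OF P_cont]\<close>)
  have "(LINT x:{a..<c}|lborel. sgn (x - \<zeta>) * \<phi>x t x) = (LINT x:{a..c}|lborel. sgn (x - \<zeta>) * \<phi>x t x)"
    unfolding set_lebesgue_integral_def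
    by (intro integral_cong_AE) (auto intro: AE_mp[OF AE_lborel_singleton[of c]] simp: indicator_def)
  also have "\<dots> = ?P c - ?P a"
    using set_borel_integral_eq_integral(2)[OF int] integral_unique[OF hk] by simp
  finally show "(LINT x:{a..<c}|lborel. sgn (x - \<zeta>) * \<phi>x t x) = ?P c - ?P a" .
qed

lemma integrable_\<phi>x_sign: "integrable lborel (\<lambda>x. sgn (x - \<zeta>) * \<phi>x t x)"
  and LINT_\<phi>x_sign_line: "(LINT x|lborel. sgn (x - \<zeta>) * \<phi>x t x) = - 2 * \<phi> t \<zeta>"
proof -
  define N where "N = max M \<bar>\<zeta>\<bar> + 1"
  have N: "M \<le> N" "-N < \<zeta>" "\<zeta> < N" by (auto simp: N_def)
  have eq: "sgn (x - \<zeta>) * \<phi>x t x = indicator {-N..<N} x * (sgn (x - \<zeta>) * \<phi>x t x)" for x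
  proof (cases "M \<le> \<bar>x\<bar>")
    case True then show ?thesis using \<phi>_support[of t x] by simp
  next
    case False then show ?thesis using N by (auto simp: indicator_def)
  qed
  show "integrable lborel (\<lambda>x. sgn (x - \<zeta>) * \<phi>x t x)"
    by (subst eq) (use set_integrable_\<phi>x_sign[of "-N" N \<zeta> t] in \<open>simp add: set_integrable_def\<close>)
  have "(LINT x|lborel. sgn (x - \<zeta>) * \<phi>x t x) = (LINT x:{-N..<N}|lborel. sgn (x - \<zeta>) * \<phi>x t x)"
    unfolding set_lebesgue_integral_def by (subst eq) simp
  also have "\<dots> = - 2 * \<phi> t \<zeta>"
    using N M_pos \<phi>_support[of t N] \<phi>_support[of t "-N"] by (subst LINT_\<phi>x_sign) auto
  finally show "(LINT x|lborel. sgn (x - \<zeta>) * \<phi>x t x) = - 2 * \<phi> t \<zeta>" .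
qed

end

section \<open>Initial positions and motion of the particles\<close>

locale initial_datum =
  fixes \<rho>max :: real and \<rho>0 :: "real \<Rightarrow> real"
  assumes \<rho>max_positive: "0 < \<rho>max"
    and \<rho>0_integrable: "set_integrable lebesgue corridor \<rho>0"
    and \<rho>0_range: "AE y in lebesgue. y \<in> corridor \<longrightarrow> \<rho>0 y \<in> {0..\<rho>max}"
    and \<rho>0_mass: "0 < L1_norm corridor \<rho>0"
begin

definition initial_mass_left :: "real \<Rightarrow> real" where
  "initial_mass_left x = (LINT y:{..x}|lebesgue. zero_extension \<rho>0 y)"

lemma ext_eq: "zero_extension \<rho>0 y = indicator corridor y *\<^sub>R \<rho>0 y"
  by (simp add: zero_extension_def indicator_def)

lemma ext_integrable: "integrable lebesgue (zero_extension \<rho>0)"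
  using \<rho>0_integrable unfolding set_integrable_def ext_eq[abs_def] .

lemma ext_measurable [measurable]: "zero_extension \<rho>0 \<in> borel_measurable lebesgue"
  using ext_integrable by auto

lemma ext_range: "AE y in lebesgue. zero_extension \<rho>0 y \<in> {0..\<rho>max}"
  using \<rho>0_range by eventually_elim (use \<rho>max_positive in \<open>auto simp: zero_extension_def\<close>)

lemma ext_set_integrable: "S \<in> sets lebesgue \<Longrightarrow> set_integrable lebesgue S (zero_extension \<rho>0)"
  unfolding set_integrable_def by (rule integrable_mult_indicator[OF _ ext_integrable])

lemma ext_total: "(LINT y|lebesgue. zero_extension \<rho>0 y) = L1_norm corridor \<rho>0"
  unfolding L1_norm_def set_lebesgue_integral_def
proof (rule integral_cong_AE)
  show "(\<lambda>x. indicat_real corridor x *\<^sub>R \<bar>\<rho>0 x\<bar>) \<in> borel_measurable lebesgue"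
  proof -
    have "(\<lambda>x. \<bar>indicat_real corridor x *\<^sub>R \<rho>0 x\<bar>) \<in> borel_measurable lebesgue"
      using \<rho>0_integrable unfolding set_integrable_def by measurable
    moreover have "(\<lambda>x. \<bar>indicat_real corridor x *\<^sub>R \<rho>0 x\<bar>) = (\<lambda>x. indicat_real corridor x *\<^sub>R \<bar>\<rho>0 x\<bar>)"
      by (auto simp: indicator_def)
    ultimately show ?thesis by simp
  qed
  show "AE x in lebesgue. zero_extension \<rho>0 x = indicat_real corridor x *\<^sub>R \<bar>\<rho>0 x\<bar>"
    using \<rho>0_range by eventually_elim (auto simp: zero_extension_def indicator_def)
qed simp

lemma initial_mass_diff: assumes "a \<le> b"
  shows "(LINT y:{a..b}|lebesgue. zero_extension \<rho>0 y) = initial_mass_left b - initial_mass_left a"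
proof -
  have "(LINT y:{..b}|lebesgue. zero_extension \<rho>0 y)
      = (LINT y:{..a}|lebesgue. zero_extension \<rho>0 y) + (LINT y:{a<..b}|lebesgue. zero_extension \<rho>0 y)"
  proof -
    have split: "{..b} = {..a} \<union> {a<..b}" using assms by auto
    show ?thesis unfolding split by (rule set_integral_Un) (auto intro!: ext_set_integrable)
  qed
  moreover have "(LINT y:{a<..b}|lebesgue. zero_extension \<rho>0 y) = (LINT y:{a..b}|lebesgue. zero_extension \<rho>0 y)"
  proof -
    have "AE x in lebesgue. x \<noteq> a" by (rule AE_completion) (rule AE_lborel_singleton)
    then have "AE x in lebesgue. indicat_real {a<..b} x *\<^sub>R zero_extension \<rho>0 x = indicat_real {a..b} x *\<^sub>R zero_extension \<rho>0 x"
      by eventually_elim (auto simp: indicator_def)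
    then show ?thesis unfolding set_lebesgue_integral_def
      by (intro integral_cong_AE borel_measurable_integrable ext_set_integrable[unfolded set_integrable_def]) auto
  qed
  ultimately show ?thesis by (simp add: initial_mass_left_def)
qed

lemma initial_mass_mono: assumes "a \<le> b" shows "initial_mass_left a \<le> initial_mass_left b"
proof -
  have "0 \<le> (LINT y:{a..b}|lebesgue. zero_extension \<rho>0 y)"
    unfolding set_lebesgue_integral_def
    by (intro integral_nonneg_AE) (use ext_range in \<open>auto elim!: eventually_mono\<close>)
  then show ?thesis using initial_mass_diff[OF assms] by simp
qed

lemma initial_mass_Lipschitz: assumes "a \<le> b" shows "initial_mass_left b - initial_mass_left a \<le> \<rho>max * (b - a)"
proof -
  have "(LINT y:{a..b}|lebesgue. zero_extension \<rho>0 y) \<le> (LINT y:{a..b}|lebesgue. \<rho>max)"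
    unfolding set_lebesgue_integral_def
  proof (rule integral_mono_AE)
    show "integrable lebesgue (\<lambda>x. indicat_real {a..b} x *\<^sub>R zero_extension \<rho>0 x)"
      using ext_set_integrable[of "{a..b}"] by (simp add: set_integrable_def)
    show "integrable lebesgue (\<lambda>x. indicat_real {a..b} x *\<^sub>R \<rho>max)"
      by (intro integrable_scaleR_left integrable_real_indicator) (auto simp: emeasure_lborel_Icc_eq)
    show "AE x in lebesgue. indicat_real {a..b} x *\<^sub>R zero_extension \<rho>0 x \<le> indicat_real {a..b} x *\<^sub>R \<rho>max"
      using ext_range by eventually_elim (auto simp: indicator_def)
  qed
  also have "\<dots> = \<rho>max * (b - a)"
    using assms by (simp add: set_lebesgue_integral_def mult.commute)
  finally show ?thesis using initial_mass_diff[OF assms] by simp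
qed

lemma initial_mass_low: assumes "x \<le> -1" shows "initial_mass_left x = 0"
proof -
  have "(LINT y:{..x}|lebesgue. zero_extension \<rho>0 y) = (LINT y:{..x}|lebesgue. 0)"
    by (rule set_lebesgue_integral_cong) (use assms in \<open>auto simp: zero_extension_def\<close>)
  then show ?thesis by (simp add: initial_mass_left_def)
qed

lemma initial_mass_high: assumes "1 \<le> x" shows "initial_mass_left x = L1_norm corridor \<rho>0"
proof -
  have "initial_mass_left x = (LINT y|lebesgue. zero_extension \<rho>0 y)"
    unfolding initial_mass_left_def set_lebesgue_integral_def
    by (rule Bochner_Integration.integral_cong) (use assms in \<open>auto simp: zero_extension_def indicator_def\<close>)
  then show ?thesis using ext_total by simp
qed

lemma initial_mass_bounds: "0 \<le> initial_mass_left x" "initial_mass_left x \<le> L1_norm corridor \<rho>0"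
  using initial_mass_mono[of "min x (-1)" x] initial_mass_low[of "min x (-1)"]
    initial_mass_mono[of x "max x 1"] initial_mass_high[of "max x 1"] by simp_all

text \<open>By Lindelof's theorem countably many null open sets suffice.\<close>

lemma AE_zero_outside_ess_support:
  fixes w :: "real \<Rightarrow> real"
  shows "AE x in lebesgue. x \<notin> ess_support w \<longrightarrow> w x = 0"
proof -
  let ?F = "{U. open U \<and> (AE x in lebesgue. x \<in> U \<longrightarrow> w x = 0)}"
  obtain F' where F': "F' \<subseteq> ?F" "countable F'" "\<Union>F' = \<Union>?F"
    using Lindelof[of ?F] by auto
  have "AE x in lebesgue. \<forall>U\<in>F'. x \<in> U \<longrightarrow> w x = 0"
    using F'(1,2) by (subst AE_ball_countable) auto
  then show ?thesis
  proof eventually_elim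
    case (elim x)
    show ?case
    proof
      assume "x \<notin> ess_support w"
      then have "x \<in> \<Union>F'" unfolding F'(3) ess_support_def by blast
      with elim show "w x = 0" by blast
    qed
  qed
qed

lemma initial_position_0: "-1 \<le> initial_position \<rho>0 n 0" "initial_mass_left (initial_position \<rho>0 n 0) = 0"
proof -
  let ?w = "zero_extension \<rho>0"
  let ?S = "ess_support ?w"
  let ?m = "initial_position \<rho>0 n 0"
  have "{..<-1} \<union> {1<..} \<subseteq> - ?S"
  proof -
    have "open ({..<-1} \<union> {1<..} :: real set)" by (intro open_Un) auto
    moreover have "AE x in lebesgue. x \<in> {..<-1} \<union> {1<..} \<longrightarrow> ?w x = 0" by (auto simp: zero_extension_def)
    ultimately show ?thesis unfolding ess_support_def by blast
  qed
  then have S: "?S \<subseteq> {-1..1}" by (force simp: not_less[symmetric])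
  have ne: "?S \<noteq> {}"
  proof
    assume "?S = {}"
    then have "AE x in lebesgue. ?w x = 0" using AE_zero_outside_ess_support[of ?w] by simp
    then have "(LINT y|lebesgue. ?w y) = 0" by (intro integral_eq_zero_AE)
    with ext_total \<rho>0_mass show False by simp
  qed
  have hull: "convex hull ?S \<subseteq> {-1..1}" "convex hull ?S \<noteq> {}"
    using S ne by (auto simp: hull_minimal)
  show "-1 \<le> ?m" using hull by (auto intro!: cInf_greatest)
  have m_le: "?m \<le> x" if "x \<in> ?S" for x
  proof -
    have "x \<in> convex hull ?S" using that by (rule hull_inc)
    moreover have "bdd_below (convex hull ?S)" using hull(1) by (meson bdd_below_Icc bdd_below_mono)
    ultimately show ?thesis by (auto intro: cInf_lower)
  qed
  have "AE x in lebesgue. indicat_real {..?m} x *\<^sub>R ?w x = 0"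
  proof -
    have "AE x in lebesgue. x \<noteq> ?m" by (rule AE_completion) (rule AE_lborel_singleton)
    with AE_zero_outside_ess_support[of ?w] show ?thesis
    proof eventually_elim
      case (elim x)
      then show ?case using m_le[of x] by (auto simp: indicator_def)
    qed
  qed
  then show "initial_mass_left ?m = 0"
    unfolding initial_mass_left_def set_lebesgue_integral_def by (intro integral_eq_zero_AE)
qed

text \<open>The mass to the left of \<open>x\<close> is Lipschitz in \<open>x\<close>, so the supremum that defines the next position encloses exactly
one unit.  To the right of the particle \<open>i < n\<close> there remain \<open>n - i\<close> units, which is why the set is bounded by \<open>1\<close>.\<close>

lemma initial_mass_position:
  assumes n: "1 \<le> n"
  shows "i \<le> n \<Longrightarrow> initial_mass_left (initial_position \<rho>0 n i) = real i * particle_mass \<rho>0 n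
    \<and> (1 \<le> i \<longrightarrow> initial_position \<rho>0 n i \<le> 1)"
proof (induction i)
  case 0
  then show ?case using initial_position_0(2) by simp
next
  case (Suc i)
  define l where "l = particle_mass \<rho>0 n"
  have l: "0 < l" "real n * l = L1_norm corridor \<rho>0" using \<rho>0_mass n by (auto simp: l_def particle_mass_def)
  define p where "p = initial_position \<rho>0 n i"
  have p: "initial_mass_left p = real i * l" using Suc by (simp add: p_def l_def)
  define S where "S = {x. p < x \<and> initial_mass_left x - initial_mass_left p < l}"
  define X where "X = initial_position \<rho>0 n (Suc i)"
  have X: "X = Sup S"
  proof -
    have "S = {x. p < x \<and> (LINT y:{p..x}|lebesgue. zero_extension \<rho>0 y) < l}"
      unfolding S_def using initial_mass_diff[of p] by force
    then show ?thesis unfolding X_def p_def l_def by simp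
  qed
  have S_lt: "x < 1" if "x \<in> S" for x
  proof (rule ccontr)
    assume "\<not> x < 1"
    then have "initial_mass_left x = real n * l" using initial_mass_high l by simp
    moreover have "real (Suc i) * l \<le> real n * l" using Suc.prems l by (intro mult_right_mono) auto
    ultimately show False using that p by (simp add: S_def algebra_simps)
  qed
  have bdd: "bdd_above S" using S_lt by (auto intro!: bdd_aboveI[of _ 1] less_imp_le)
  have pS: "p + l / (2 * \<rho>max) \<in> S"
    using initial_mass_Lipschitz[of p "p + l / (2 * \<rho>max)"] l \<rho>max_positive by (auto simp: S_def)
  have X_gt: "p < X" unfolding X using cSup_upper[OF pS bdd] l \<rho>max_positive by (smt (verit) divide_pos_pos)
  have X_le: "X \<le> 1" unfolding X using pS S_lt by (intro cSup_least) (auto intro: less_imp_le)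
  have "initial_mass_left X \<le> initial_mass_left p + l"
  proof (rule ccontr)
    assume neg: "\<not> ?thesis"
    define \<delta> where "\<delta> = (initial_mass_left X - initial_mass_left p - l) / \<rho>max"
    have \<delta>: "0 < \<delta>" "\<rho>max * \<delta> = initial_mass_left X - initial_mass_left p - l"
      using neg \<rho>max_positive by (auto simp: \<delta>_def)
    obtain x where x: "x \<in> S" "X - \<delta> < x"
      using less_cSup_iff[of S "X - \<delta>"] pS bdd \<delta>(1) unfolding X by auto
    have "x \<le> X" unfolding X by (rule cSup_upper[OF x(1) bdd])
    have "initial_mass_left X - initial_mass_left x \<le> \<rho>max * (X - x)" by (rule initial_mass_Lipschitz) fact
    also have "\<dots> \<le> \<rho>max * \<delta>" using x \<rho>max_positive by (intro mult_left_mono) auto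
    finally show False using x(1) \<delta>(2) by (auto simp: S_def)
  qed
  moreover have "initial_mass_left X \<ge> initial_mass_left p + l"
  proof (rule ccontr)
    assume neg: "\<not> ?thesis"
    define \<delta> where "\<delta> = (initial_mass_left p + l - initial_mass_left X) / (2 * \<rho>max)"
    have \<delta>: "0 < \<delta>" "\<rho>max * \<delta> = (initial_mass_left p + l - initial_mass_left X) / 2"
      using neg \<rho>max_positive by (auto simp: \<delta>_def)
    have "initial_mass_left (X + \<delta>) - initial_mass_left X \<le> \<rho>max * \<delta>"
      using initial_mass_Lipschitz[of X "X + \<delta>"] \<delta>(1) by simp
    then have "X + \<delta> \<in> S" using X_gt \<delta> neg by (auto simp: S_def)
    then have "X + \<delta> \<le> X" unfolding X by (rule cSup_upper[OF _ bdd])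
    with \<delta>(1) show False by simp
  qed
  ultimately have "initial_mass_left X = real (Suc i) * l" using p by (simp add: algebra_simps)
  with X_le show ?case unfolding X_def l_def by simp
qed

end


locale scheme = velocity \<rho>max v + initial_datum \<rho>max \<rho>0 for \<rho>max v \<rho>0 +
  fixes \<alpha> :: real and n :: nat and x :: "nat \<Rightarrow> real \<Rightarrow> real" and \<zeta> :: "real \<Rightarrow> real"
  assumes \<alpha>_nonneg: "0 \<le> \<alpha>" and n_ge_1: "1 \<le> n"
    and solution: "scheme_solution \<rho>max v \<alpha> \<rho>0 n x \<zeta>"
begin

definition l :: real where "l = particle_mass \<rho>0 n"

lemma l_positive: "0 < l" and n_l: "real n * l = L1_norm corridor \<rho>0"
  using \<rho>0_mass n_ge_1 by (auto simp: l_def particle_mass_def)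

abbreviation "pos t \<equiv> (\<lambda>i. x i t)"
abbreviation "F t \<equiv> configuration.mass_left n l (pos t)"
abbreviation "U t \<equiv> discrete_density l n (pos t)"
abbreviation "w t \<equiv> particle_velocity v l n (pos t) (\<zeta> t)"

lemma config: assumes "0 \<le> t" shows "moving_configuration \<rho>max v n l (pos t)"
proof -
  have "configuration n l \<rho>max (pos t)"
    using solution assms n_ge_1 l_positive unfolding scheme_solution_def Let_def l_def[symmetric]
    by unfold_locales auto
  then show ?thesis unfolding moving_configuration_def using velocity_axioms by blast
qed

lemma config0: "0 \<le> t \<Longrightarrow> configuration n l \<rho>max (pos t)"
  using config by (simp add: moving_configuration_def)

lemma x_continuous: "i \<le> n \<Longrightarrow> continuous_on {0..} (x i)"
  using solution unfolding scheme_solution_def Let_def by auto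

lemma velocity_bound: assumes "0 \<le> t" shows "\<bar>w t i\<bar> \<le> v 0"
proof -
  interpret moving_configuration \<rho>max v n l "pos t" by (rule config[OF assms])
  show ?thesis unfolding particle_velocity_def using v_abs_le[OF R_range] by auto
qed

text \<open>A half-open interval between switching times contains a neighbourhood of each of its inner points; there the
one-sided derivatives are derivatives.\<close>

lemma regular_times:
  obtains J where "finite J" "J \<subseteq> {0<..}"
    "\<And>t i. 0 < t \<Longrightarrow> t \<notin> J \<Longrightarrow> i \<le> n \<Longrightarrow> (x i has_real_derivative w t i) (at t)"
    "continuous_on ({0<..} - J) \<zeta>"
proof -
  have "\<exists>J. finite J \<and> J \<subseteq> {0<..} \<and> (\<forall>a\<in>insert 0 J. C1_on (interval_from J a) \<zeta> \<and>
             (\<forall>i\<le>n. C1_on (interval_from J a) (x i) \<and>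
                (\<forall>t\<in>interval_from J a. (x i has_real_derivative w t i) (at t within interval_from J a))))"
    using solution unfolding scheme_solution_def Let_def l_def[symmetric] by (elim conjE)
  then obtain J where J: "finite J" "J \<subseteq> {0<..}"
    and sol0: "\<forall>a\<in>insert 0 J. C1_on (interval_from J a) \<zeta> \<and>
             (\<forall>i\<le>n. C1_on (interval_from J a) (x i) \<and>
                (\<forall>t\<in>interval_from J a. (x i has_real_derivative w t i) (at t within interval_from J a)))"
    by (elim exE conjE)
  have sol1: "C1_on (interval_from J a) \<zeta>" if "a \<in> insert 0 J" for a
    using bspec[OF sol0 that] by (rule conjunct1)
  have sol2: "(x i has_real_derivative w t i) (at t within interval_from J a)"
    if "a \<in> insert 0 J" "i \<le> n" "t \<in> interval_from J a" for a i t
    using bspec[OF sol0 that(1)] that(2,3) by simp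
  have nbhd: "\<exists>a\<in>insert 0 J. \<exists>S. open S \<and> t \<in> S \<and> S \<subseteq> interval_from J a" if t: "0 < t" "t \<notin> J" for t
  proof -
    let ?A = "{s\<in>insert 0 J. s < t}"
    define a where "a = Max ?A"
    have A: "finite ?A" "?A \<noteq> {}" using J(1) t by auto
    have a: "a \<in> insert 0 J" "a < t" using Max_in[OF A] by (auto simp: a_def)
    have above: "t < s" if "s \<in> J" "a < s" for s
    proof (rule ccontr)
      assume "\<not> t < s"
      then have "s \<in> ?A" using that t by (cases "s = t") auto
      then have "s \<le> a" unfolding a_def by (rule Max_ge[OF A(1)])
      with that show False by simp
    qed
    let ?S = "{a<..} \<inter> (\<Inter>s\<in>{s\<in>J. a < s}. {..<s})"
    have "open ?S" using J(1) by (intro open_Int open_INT) auto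
    moreover have "t \<in> ?S" using a above by auto
    moreover have "?S \<subseteq> interval_from J a" unfolding interval_from_def by auto
    ultimately show ?thesis using a(1) by (intro bexI[of _ a] exI[of _ ?S] conjI)
  qed
  have d: "(x i has_real_derivative w t i) (at t)" if asm: "0 < t" "t \<notin> J" "i \<le> n" for t i
  proof -
    obtain a S where S: "a \<in> insert 0 J" "open S" "t \<in> S" "S \<subseteq> interval_from J a" using nbhd[OF asm(1,2)] by (elim bexE exE conjE)
    then have "(x i has_real_derivative w t i) (at t within interval_from J a)"
      using asm(3) by (intro sol2) auto
    then have "(x i has_real_derivative w t i) (at t within S)" by (rule DERIV_subset[OF _ S(4)])
    then show ?thesis unfolding at_within_open[OF S(3,2)] .
  qed
  have c: "continuous_on ({0<..} - J) \<zeta>"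
  proof (rule continuous_at_imp_continuous_on, rule ballI)
    fix t assume t: "t \<in> {0<..} - J"
    obtain a S where S: "a \<in> insert 0 J" "open S" "t \<in> S" "S \<subseteq> interval_from J a" using nbhd[of t] t by auto
    obtain g where g: "\<forall>t\<in>interval_from J a. (\<zeta> has_real_derivative g t) (at t within interval_from J a)"
      using sol1[OF S(1)] unfolding C1_on_def by blast
    then have "(\<zeta> has_real_derivative g t) (at t within interval_from J a)" using S(3,4) by auto
    then have "(\<zeta> has_real_derivative g t) (at t within S)" by (rule DERIV_subset[OF _ S(4)])
    then have "(\<zeta> has_real_derivative g t) (at t)" unfolding at_within_open[OF S(3,2)] .
    then show "isCont \<zeta> t" by (rule DERIV_isCont)
  qed
  show thesis using that[OF J d c] .
qed

lemma x_Lipschitz: assumes "0 \<le> s" "0 \<le> t" "i \<le> n" shows "\<bar>x i t - x i s\<bar> \<le> v 0 * \<bar>t - s\<bar>"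
proof -
  obtain J where J: "finite J" "J \<subseteq> {0<..}"
    "\<And>t i. 0 < t \<Longrightarrow> t \<notin> J \<Longrightarrow> i \<le> n \<Longrightarrow> (x i has_real_derivative w t i) (at t)"
    "continuous_on ({0<..} - J) \<zeta>"
    by (rule regular_times) (rule that)
  have *: "\<bar>x i b - x i a\<bar> \<le> v 0 * (b - a)" if ab: "0 \<le> a" "a \<le> b" for a b
  proof -
    have hk: "((\<lambda>t. w t i) has_integral x i b - x i a) {a..b}"
    proof (rule fundamental_theorem_of_calculus_interior_strong[OF J(1) ab(2)])
      show "continuous_on {a..b} (x i)" by (rule continuous_on_subset[OF x_continuous]) (use assms ab in auto)
      fix t assume "t \<in> {a<..<b} - J"
      then show "(x i has_vector_derivative w t i) (at t)"
        using J(3)[of t i] assms ab by (auto simp: has_real_derivative_iff_has_vector_derivative)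
    qed
    have "norm (x i b - x i a) \<le> v 0 * measure lborel {a..b}"
    proof (rule has_integral_bound_real[where S="{}", OF _ _ hk])
      fix t assume "t \<in> {a..b} - {}"
      then show "norm (w t i) \<le> v 0" using velocity_bound[of t i] ab by simp
    qed (use v_0_pos in auto)
    then show ?thesis using ab by simp
  qed
  show ?thesis
  proof (cases "s \<le> t")
    case True then show ?thesis using *[of s t] assms by simp
  next
    case False then show ?thesis using *[of t s] assms by (simp add: abs_minus_commute)
  qed
qed

lemma x_range: assumes "0 \<le> t" "i \<le> n" shows "-1 - v 0 * t \<le> x i t" "x i t \<le> 1 + v 0 * t"
proof -
  interpret c: configuration n l \<rho>max "pos 0" by (rule config0) simp
  have init: "x i 0 = initial_position \<rho>0 n i" if "i \<le> n" for i
    using solution that unfolding scheme_solution_def Let_def by auto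
  have "-1 \<le> x 0 0" using init[of 0] initial_position_0(1)[of n] by simp
  moreover have "x n 0 \<le> 1" using init[of n] initial_mass_position[OF n_ge_1, of n] n_ge_1 by simp
  ultimately have "-1 \<le> x i 0" "x i 0 \<le> 1" using c.y_le[of 0 i] c.y_le[of i n] assms by auto
  then show "-1 - v 0 * t \<le> x i t" "x i t \<le> 1 + v 0 * t"
    using x_Lipschitz[of 0 t i] assms by auto
qed

lemma F_initial: "\<bar>F 0 z - initial_mass_left z\<bar> \<le> l"
proof -
  interpret c: configuration n l \<rho>max "pos 0" by (rule config0) simp
  have init: "initial_mass_left (x i 0) = real i * l" if "i \<le> n" for i
    using solution that initial_mass_position[OF n_ge_1, of i] unfolding scheme_solution_def Let_def l_def by auto
  show ?thesis
  proof (cases rule: c.mass_left_index[of z])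
    case low
    then show ?thesis using init[of 0] initial_mass_mono[of z "x 0 0"] initial_mass_bounds(1)[of z] l_positive by auto
  next
    case (cell k)
    then have "real k * l \<le> initial_mass_left z" "initial_mass_left z \<le> real (Suc k) * l"
      using init[of k] init[of "Suc k"] initial_mass_mono[of "x k 0" z] initial_mass_mono[of z "x (Suc k) 0"] by auto
    with cell show ?thesis by (simp add: abs_le_iff algebra_simps)
  next
    case high
    then show ?thesis using init[of n] initial_mass_mono[of "x n 0" z] initial_mass_bounds(2)[of z] n_l l_positive by auto
  qed
qed

text \<open>A particle to the left of \<open>z\<close> at one time is to the left of \<open>z + v 0 \<bar>t - s\<bar>\<close> at the other.  Counting particles
determines the mass up to \<open>l\<close>.\<close>

lemma F_time:
  assumes "0 \<le> s" "0 \<le> t"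
  shows "\<bar>F t z - F s z\<bar> \<le> \<rho>max * v 0 * \<bar>t - s\<bar> + l"
proof -
  have *: "F t z \<le> F s z + \<rho>max * v 0 * \<bar>t - s\<bar> + l" if st: "0 \<le> s" "0 \<le> t" for s t
  proof -
    interpret t: configuration n l \<rho>max "pos t" by (rule config0) fact
    interpret s: configuration n l \<rho>max "pos s" by (rule config0) fact
    let ?z = "z + v 0 * \<bar>t - s\<bar>"
    have "z \<le> ?z" using v_0_pos by simp
    then have "s.mass_left ?z - s.mass_left z \<le> \<rho>max * (v 0 * \<bar>t - s\<bar>)"
      using s.mass_left_Lipschitz_le[of z ?z] by simp
    moreover have "t.mass_left z \<le> s.mass_left ?z + l"
    proof (cases rule: t.mass_left_index[of z])
      case low then show ?thesis using s.mass_left_bounds(1)[of ?z] l_positive by simp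
    next
      case (cell k)
      then have "x k s \<le> ?z" using x_Lipschitz[OF st, of k] by auto
      then have "real k * l \<le> s.mass_left ?z" using cell by (intro s.mass_left_ge) auto
      with cell show ?thesis by (simp add: algebra_simps)
    next
      case high
      then have "x n s \<le> ?z" using x_Lipschitz[OF st, of n] by auto
      then have "real n * l \<le> s.mass_left ?z" by (intro s.mass_left_ge) auto
      with high l_positive show ?thesis by simp
    qed
    ultimately show ?thesis by (simp add: mult.assoc)
  qed
  show ?thesis using *[OF assms] *[OF assms(2,1)] by (simp add: abs_le_iff abs_minus_commute)
qed

lemma F_space_time:
  assumes "0 \<le> s" "0 \<le> t"
  shows "\<bar>F t z - F s z'\<bar> \<le> \<rho>max * v 0 * \<bar>t - s\<bar> + \<rho>max * \<bar>z - z'\<bar> + l"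
proof -
  interpret s: configuration n l \<rho>max "pos s" by (rule config0) fact
  show ?thesis using F_time[OF assms, of z] s.mass_left_Lipschitz[of z z'] by linarith
qed

lemma F_bounds: assumes "0 \<le> t" shows "0 \<le> F t z" "F t z \<le> L1_norm corridor \<rho>0"
proof -
  interpret configuration n l \<rho>max "pos t" by (rule config0) fact
  show "0 \<le> F t z" "F t z \<le> L1_norm corridor \<rho>0" using mass_left_bounds n_l by auto
qed

lemma turning_bounds:
  assumes "0 \<le> t"
  shows "-1 < \<zeta> t" "\<zeta> t < 1" "\<bar>2 * \<zeta> t + \<alpha> * (2 * F t (\<zeta> t) - F t (-1) - F t 1)\<bar> \<le> 2 * \<alpha> * l"
proof -
  interpret configuration n l \<rho>max "pos t" by (rule config0) fact
  have "Z_minus \<alpha> l n (pos t) (\<zeta> t) = Z_plus \<alpha> l n (pos t) (\<zeta> t)"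
    using solution assms unfolding scheme_solution_def Let_def l_def by auto
  from turning_point_bounds[OF \<alpha>_nonneg this]
  show "-1 < \<zeta> t" "\<zeta> t < 1" "\<bar>2 * \<zeta> t + \<alpha> * (2 * F t (\<zeta> t) - F t (-1) - F t 1)\<bar> \<le> 2 * \<alpha> * l" .
qed

end

section \<open>The Kruzkov inequality of a scheme\<close>

text \<open>Velocities are controlled on \<open>[0, \<rho>max]\<close> only; clamping the argument extends \<open>g\<close> continuously to the line.\<close>

lemma measurable_compose_range:
  fixes g f and a b :: real
  assumes g: "continuous_on {a..b} g" and f: "f \<in> borel_measurable N" and r: "\<And>p. f p \<in> {a..b}"
  shows "(\<lambda>p. g (f p) :: real) \<in> borel_measurable N"
proof -
  have ab: "a \<le> b" using r by (meson atLeastAtMost_iff order_trans)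
  have "continuous_on UNIV (\<lambda>r. g (max a (min b r)))"
    by (rule continuous_on_compose2[OF g]) (use ab in \<open>auto intro!: continuous_intros\<close>)
  then have "(\<lambda>r. g (max a (min b r))) \<in> borel_measurable borel" by (simp add: borel_measurable_continuous_onI)
  from measurable_compose[OF f this] have "(\<lambda>p. g (max a (min b (f p)))) \<in> borel_measurable N" .
  moreover have "g (max a (min b (f p))) = g (f p)" for p using r[of p] by (simp add: min_absorb2 max_absorb2)
  ultimately show ?thesis by simp
qed

lemma set_integrable_Icc_bounded:
  fixes f :: "real \<Rightarrow> real"
  assumes [measurable]: "f \<in> borel_measurable borel" and B: "\<And>z. z \<in> {a..b} \<Longrightarrow> \<bar>f z\<bar> \<le> B"
  shows "set_integrable lborel {a..b} f"
  unfolding set_integrable_def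
proof (rule Bochner_Integration.integrable_bound)
  show "integrable lborel (\<lambda>z. B * indicator {a..b} z)" by (intro integrable_mult_right integrable_indicator_Icc)
  show "AE z in lborel. norm (indicat_real {a..b} z *\<^sub>R f z) \<le> norm (B * indicator {a..b} z)"
  proof (rule AE_I2)
    fix z
    show "norm (indicat_real {a..b} z *\<^sub>R f z) \<le> norm (B * indicator {a..b} z)"
    proof (cases "z \<in> {a..b}")
      case True
      then show ?thesis using order_trans[OF B[OF True] abs_ge_self] by simp
    qed simp
  qed
qed measurable

locale entropy_test = velocity \<rho>max v + test_function \<phi> \<phi>t \<phi>x T M
  for \<rho>max v \<phi> \<phi>t \<phi>x T M +
  fixes \<kappa> :: real
  assumes \<kappa>: "\<kappa> \<in> {0..\<rho>max}"
begin

text \<open>The integrand in time of the Kruzkov inequality.  Subtracting \<open>\<kappa>\<close> from the entropy makes its value vanish where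
the density does, so that infinite cells do not contribute.\<close>

definition production :: "(real \<Rightarrow> real) \<Rightarrow> real \<Rightarrow> real \<Rightarrow> real" where
  "production u \<zeta> t =
     (LINT z|lborel. (\<bar>u z - \<kappa>\<bar> - \<kappa>) * \<phi>t t z + sgn (z - \<zeta>) * kruzkov_flux v \<kappa> (u z) * \<phi>x t z)
     + 2 * flux v \<kappa> * \<phi> t \<zeta>"

lemma test_borel [measurable]:
  "(\<lambda>p. \<phi> (fst p) (snd p)) \<in> borel_measurable (borel \<Otimes>\<^sub>M borel)"
  "(\<lambda>p. \<phi>t (fst p) (snd p)) \<in> borel_measurable (borel \<Otimes>\<^sub>M borel)"
  "(\<lambda>p. \<phi>x (fst p) (snd p)) \<in> borel_measurable (borel \<Otimes>\<^sub>M borel)"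
  unfolding borel_prod by (auto intro!: borel_measurable_continuous_onI continuous_intros)

lemma test_borel_slice [measurable]:
  "\<phi> t \<in> borel_measurable borel" "\<phi>t t \<in> borel_measurable borel" "\<phi>x t \<in> borel_measurable borel"
  by (auto intro!: borel_measurable_continuous_onI continuous_intros)

lemma kruzkov_flux_measurable [measurable (raw)]:
  "f \<in> borel_measurable N \<Longrightarrow> (\<And>p. f p \<in> {0..\<rho>max}) \<Longrightarrow> (\<lambda>p. kruzkov_flux v \<kappa> (f p)) \<in> borel_measurable N"
  by (rule measurable_compose_range[OF kruzkov_flux_continuous[OF \<kappa>]])

lemma integrand_bound:
  assumes "r \<in> {0..\<rho>max}" "\<bar>\<phi>t t z\<bar> \<le> B" "\<bar>\<phi>x t z\<bar> \<le> B"
  shows "\<bar>(\<bar>r - \<kappa>\<bar> - \<kappa>) * \<phi>t t z + sgn (z - \<zeta>) * kruzkov_flux v \<kappa> r * \<phi>x t z\<bar>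
    \<le> (2 * \<rho>max + \<rho>max * v 0) * B * indicator {-M..M} z"
proof (cases "M \<le> \<bar>z\<bar>")
  case True
  have "0 \<le> B" using assms by linarith
  then have "0 \<le> (2 * \<rho>max + \<rho>max * v 0) * B" using \<rho>max_pos v_0_pos by auto
  then show ?thesis using \<phi>_support[of t z] True by (auto simp: indicator_def)
next
  case False
  have B: "0 \<le> B" using assms by linarith
  have "\<bar>(\<bar>r - \<kappa>\<bar> - \<kappa>) * \<phi>t t z\<bar> \<le> (2 * \<rho>max) * B"
    unfolding abs_mult using assms \<kappa> by (intro mult_mono) auto
  moreover have "\<bar>sgn (z - \<zeta>) * kruzkov_flux v \<kappa> r * \<phi>x t z\<bar> \<le> (\<rho>max * v 0) * B"
  proof -
    have "\<bar>sgn (z - \<zeta>) * kruzkov_flux v \<kappa> r\<bar> \<le> 1 * (\<rho>max * v 0)"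
      unfolding abs_mult using kruzkov_flux_bound[OF \<kappa> assms(1)] by (intro mult_mono) (auto simp: sgn_if)
    then show ?thesis unfolding abs_mult[of _ "\<phi>x t z"] using assms(3) B \<rho>max_pos v_0_pos
      by (intro mult_mono) auto
  qed
  ultimately have "\<bar>(\<bar>r - \<kappa>\<bar> - \<kappa>) * \<phi>t t z + sgn (z - \<zeta>) * kruzkov_flux v \<kappa> r * \<phi>x t z\<bar> \<le> (2 * \<rho>max + \<rho>max * v 0) * B"
    by (simp add: algebra_simps abs_le_iff)
  moreover have "z \<in> {-M..M}" using False by auto
  ultimately show ?thesis by simp
qed

lemma production_bound:
  assumes u: "\<And>z. u z \<in> {0..\<rho>max}" and [measurable]: "u \<in> borel_measurable borel"
    and B: "\<And>z. \<bar>\<phi> t z\<bar> \<le> B \<and> \<bar>\<phi>t t z\<bar> \<le> B \<and> \<bar>\<phi>x t z\<bar> \<le> B"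
  shows "integrable lborel (\<lambda>z. (\<bar>u z - \<kappa>\<bar> - \<kappa>) * \<phi>t t z + sgn (z - \<zeta>) * kruzkov_flux v \<kappa> (u z) * \<phi>x t z)"
    and "\<bar>production u \<zeta> t\<bar> \<le> (2 * \<rho>max + \<rho>max * v 0) * B * (2 * M) + 2 * (\<rho>max * v 0) * B"
proof -
  let ?I = "\<lambda>z. (\<bar>u z - \<kappa>\<bar> - \<kappa>) * \<phi>t t z + sgn (z - \<zeta>) * kruzkov_flux v \<kappa> (u z) * \<phi>x t z"
  let ?D = "\<lambda>z. (2 * \<rho>max + \<rho>max * v 0) * B * indicator {-M..M} z"
  have [measurable]: "(\<lambda>z. kruzkov_flux v \<kappa> (u z)) \<in> borel_measurable borel" using u by measurable
  have D: "integrable lborel ?D" by (intro integrable_mult_right integrable_indicator_Icc)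
  have bd: "\<bar>?I z\<bar> \<le> ?D z" for z using integrand_bound u B by blast
  have dominated: "AE z in lborel. norm (?I z) \<le> norm (?D z)" using bd by (intro AE_I2) (simp, smt (verit))
  show int: "integrable lborel ?I" by (rule Bochner_Integration.integrable_bound[OF D _ dominated]) measurable
  have "\<bar>LINT z|lborel. ?I z\<bar> \<le> (LINT z|lborel. \<bar>?I z\<bar>)" by (rule integral_abs_bound)
  also have "\<dots> \<le> (LINT z|lborel. ?D z)" using bd by (intro integral_mono integrable_abs int D)
  also have "\<dots> = (2 * \<rho>max + \<rho>max * v 0) * B * (2 * M)" using M_pos by simp
  finally have 1: "\<bar>LINT z|lborel. ?I z\<bar> \<le> (2 * \<rho>max + \<rho>max * v 0) * B * (2 * M)" .
  have "\<bar>2 * flux v \<kappa> * \<phi> t \<zeta>\<bar> \<le> 2 * (\<rho>max * v 0) * B"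
    unfolding abs_mult using flux_bounds[OF \<kappa>] B[of \<zeta>] by (intro mult_mono) auto
  with 1 show "\<bar>production u \<zeta> t\<bar> \<le> (2 * \<rho>max + \<rho>max * v 0) * B * (2 * M) + 2 * (\<rho>max * v 0) * B"
    unfolding production_def by linarith
qed

lemma production_measurable:
  assumes u: "\<And>t z. u t z \<in> {0..\<rho>max}"
    and [measurable]: "(\<lambda>p. u (fst p) (snd p)) \<in> borel_measurable (borel \<Otimes>\<^sub>M borel)" "\<zeta> \<in> borel_measurable borel"
  shows "(\<lambda>t. production (u t) (\<zeta> t) t) \<in> borel_measurable borel"
proof -
  have [measurable]: "(\<lambda>p. kruzkov_flux v \<kappa> (u (fst p) (snd p))) \<in> borel_measurable (borel \<Otimes>\<^sub>M borel)"
    using u by measurable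
  have "(\<lambda>(t, z). (\<bar>u t z - \<kappa>\<bar> - \<kappa>) * \<phi>t t z + sgn (z - \<zeta> t) * kruzkov_flux v \<kappa> (u t z) * \<phi>x t z)
      \<in> borel_measurable (borel \<Otimes>\<^sub>M lborel)"
    unfolding split_beta by measurable
  from lborel.borel_measurable_lebesgue_integral[OF this]
  have 1: "(\<lambda>t. LINT z|lborel. (\<bar>u t z - \<kappa>\<bar> - \<kappa>) * \<phi>t t z + sgn (z - \<zeta> t) * kruzkov_flux v \<kappa> (u t z) * \<phi>x t z)
      \<in> borel_measurable borel" by simp
  have "(\<lambda>t. (t, \<zeta> t)) \<in> borel \<rightarrow>\<^sub>M borel \<Otimes>\<^sub>M borel" by measurable
  from measurable_compose[OF this test_borel(1)] have 2: "(\<lambda>t. \<phi> t (\<zeta> t)) \<in> borel_measurable borel" by simp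
  show ?thesis unfolding production_def using 1 2 by measurable
qed

lemma production_tendsto:
  assumes u: "\<And>k z. u k z \<in> {0..\<rho>max}" "\<And>z. u' z \<in> {0..\<rho>max}"
    and [measurable]: "\<And>k. u k \<in> borel_measurable borel" "u' \<in> borel_measurable borel"
    and conv: "AE z in lborel. (\<lambda>k. u k z) \<longlonglongrightarrow> u' z" and \<zeta>: "\<zeta> \<longlonglongrightarrow> \<zeta>'"
    and B: "\<And>z. \<bar>\<phi> t z\<bar> \<le> B \<and> \<bar>\<phi>t t z\<bar> \<le> B \<and> \<bar>\<phi>x t z\<bar> \<le> B"
  shows "(\<lambda>k. production (u k) (\<zeta> k) t) \<longlonglongrightarrow> production u' \<zeta>' t"
  unfolding production_def
proof (intro tendsto_add tendsto_mult tendsto_const)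
  have [measurable]: "(\<lambda>z. kruzkov_flux v \<kappa> (u k z)) \<in> borel_measurable borel" for k using u by measurable
  have [measurable]: "(\<lambda>z. kruzkov_flux v \<kappa> (u' z)) \<in> borel_measurable borel" using u by measurable
  show "(\<lambda>k. \<phi> t (\<zeta> k)) \<longlonglongrightarrow> \<phi> t \<zeta>'"
    using \<phi>_x[of t \<zeta>'] \<zeta> by (intro isCont_tendsto_compose[OF _ \<zeta>] DERIV_isCont)
  show "(\<lambda>k. LINT z|lborel. (\<bar>u k z - \<kappa>\<bar> - \<kappa>) * \<phi>t t z + sgn (z - \<zeta> k) * kruzkov_flux v \<kappa> (u k z) * \<phi>x t z)
      \<longlonglongrightarrow> (LINT z|lborel. (\<bar>u' z - \<kappa>\<bar> - \<kappa>) * \<phi>t t z + sgn (z - \<zeta>') * kruzkov_flux v \<kappa> (u' z) * \<phi>x t z)"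
  proof (rule integral_dominated_convergence)
    show "integrable lborel (\<lambda>z. (2 * \<rho>max + \<rho>max * v 0) * B * indicator {-M..M} z)"
      by (intro integrable_mult_right integrable_indicator_Icc)
    show "AE z in lborel. norm ((\<bar>u k z - \<kappa>\<bar> - \<kappa>) * \<phi>t t z + sgn (z - \<zeta> k) * kruzkov_flux v \<kappa> (u k z) * \<phi>x t z)
        \<le> (2 * \<rho>max + \<rho>max * v 0) * B * indicator {-M..M} z" for k
      using integrand_bound u B by (intro AE_I2) (simp only: real_norm_def)
    have "AE z in lborel. z \<noteq> \<zeta>'" by (rule AE_lborel_singleton)
    with conv show "AE z in lborel. (\<lambda>k. (\<bar>u k z - \<kappa>\<bar> - \<kappa>) * \<phi>t t z + sgn (z - \<zeta> k) * kruzkov_flux v \<kappa> (u k z) * \<phi>x t z)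
        \<longlonglongrightarrow> (\<bar>u' z - \<kappa>\<bar> - \<kappa>) * \<phi>t t z + sgn (z - \<zeta>') * kruzkov_flux v \<kappa> (u' z) * \<phi>x t z"
    proof eventually_elim
      case (elim z)
      have q: "(\<lambda>k. kruzkov_flux v \<kappa> (u k z)) \<longlonglongrightarrow> kruzkov_flux v \<kappa> (u' z)"
        by (rule continuous_on_tendsto_compose[OF kruzkov_flux_continuous[OF \<kappa>] elim(1)])
          (use u in \<open>auto simp del: atLeastAtMost_iff\<close>)
      have sg: "(\<lambda>k. sgn (z - \<zeta> k)) \<longlonglongrightarrow> sgn (z - \<zeta>')"
        using elim(2) by (intro tendsto_sgn tendsto_diff tendsto_const \<zeta>) auto
      show ?case by (intro tendsto_add tendsto_mult tendsto_diff tendsto_rabs tendsto_const elim(1) q sg)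
    qed
  qed measurable
qed

end


text \<open>The derivative \<open>u / smooth_abs d u\<close> tends to \<open>sgn u\<close> as \<open>d\<close> tends to \<open>0\<close>, also at \<open>u = 0\<close>.  This is the value that
the Kruzkov flux needs.\<close>

definition smooth_abs :: "real \<Rightarrow> real \<Rightarrow> real" where
  "smooth_abs d u = sqrt (u\<^sup>2 + d\<^sup>2)"

lemma smooth_abs_deriv: "d \<noteq> 0 \<Longrightarrow> (smooth_abs d has_real_derivative u / smooth_abs d u) (at u)"
  unfolding smooth_abs_def[abs_def]
  by (auto intro!: derivative_eq_intros simp: add_nonneg_pos field_simps not_sum_power2_lt_zero)

lemma smooth_abs_le: "\<bar>smooth_abs d u\<bar> \<le> \<bar>u\<bar> + \<bar>d\<bar>"
  unfolding smooth_abs_def using sqrt_sum_squares_le_sum_abs[of u d] by simp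

lemma smooth_abs_quotient_le: "\<bar>u / smooth_abs d u\<bar> \<le> 1"
proof -
  have "\<bar>u\<bar> \<le> smooth_abs d u" unfolding smooth_abs_def
    using real_sqrt_le_mono[of "u\<^sup>2" "u\<^sup>2 + d\<^sup>2"] by simp
  then show ?thesis by (auto simp: abs_divide divide_le_eq_1)
qed

lemma smooth_abs_tendsto:
  assumes "d \<longlonglongrightarrow> 0" shows "(\<lambda>m. smooth_abs (d m) u) \<longlonglongrightarrow> \<bar>u\<bar>"
proof -
  have "(\<lambda>m. sqrt (u\<^sup>2 + (d m)\<^sup>2)) \<longlonglongrightarrow> sqrt (u\<^sup>2 + 0\<^sup>2)" by (intro tendsto_intros assms)
  then show ?thesis by (simp add: smooth_abs_def)
qed

lemma smooth_abs_quotient_tendsto: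
  assumes "d \<longlonglongrightarrow> 0" shows "(\<lambda>m. u / smooth_abs (d m) u) \<longlonglongrightarrow> sgn u"
proof (cases "u = 0")
  case False
  then have "(\<lambda>m. u / smooth_abs (d m) u) \<longlonglongrightarrow> u / \<bar>u\<bar>"
    by (intro tendsto_divide tendsto_const smooth_abs_tendsto assms) auto
  moreover have "u / \<bar>u\<bar> = sgn u" using False by (auto simp: sgn_if)
  ultimately show ?thesis by simp
qed simp

locale scheme_test = entropy_test \<rho>max v \<phi> \<phi>t \<phi>x T M \<kappa> + scheme \<rho>max v \<rho>0 \<alpha> n x \<zeta>
  for \<rho>max v \<phi> \<phi>t \<phi>x T M \<kappa> \<rho>0 \<alpha> n x \<zeta>
begin

text \<open>A point to the left of all particles up to the time \<open>T\<close>, from which primitives of the test function are taken.\<close>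

definition base :: real where "base = - 2 - v 0 * T"

lemma base_less: "0 \<le> t \<Longrightarrow> t \<le> T \<Longrightarrow> i \<le> n \<Longrightarrow> base < x i t"
  using x_range(1)[of t i] mult_left_mono[of t T "v 0"] v_0_pos unfolding base_def by linarith

abbreviation "Rt t k \<equiv> local_density l n (pos t) k"

text \<open>The formal time derivative of \<open>\<integral> (\<bar>U t z - \<kappa>\<bar> - \<kappa>) \<phi> t z dz\<close>, written cell by cell: the density of a cell changes
with its length, and its ends move.\<close>

definition evolution :: "real \<Rightarrow> real" where
  "evolution t = (\<Sum>k<n.
     sgn (Rt t (Suc k) - \<kappa>) * (- (Rt t (Suc k))\<^sup>2 / l * (w t (Suc k) - w t k))
       * (\<Phi> base t (x (Suc k) t) - \<Phi> base t (x k t))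
     + (\<bar>Rt t (Suc k) - \<kappa>\<bar> - \<kappa>) * ((\<Phi>t base t (x (Suc k) t) - \<Phi>t base t (x k t))
         + (\<phi> t (x (Suc k) t) * w t (Suc k) - \<phi> t (x k t) * w t k)))"

lemma production_ge_evolution:
  assumes t: "0 \<le> t" "t \<le> T"
    and B: "\<And>z. \<bar>\<phi> t z\<bar> \<le> B \<and> \<bar>\<phi>t t z\<bar> \<le> B \<and> \<bar>\<phi>x t z\<bar> \<le> B"
    and K: "0 \<le> K" "\<And>r s. r \<in> {0..\<rho>max} \<Longrightarrow> s \<in> {0..\<rho>max} \<Longrightarrow> \<bar>v r - v s\<bar> \<le> K * \<bar>r - s\<bar>"
    and C: "(\<Sum>i\<le>n. \<bar>configuration.jump n l (pos t) i\<bar>) \<le> C"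
  shows "evolution t - B * l * (K * C + 2 * v 0) \<le> production (U t) (\<zeta> t) t"
proof -
  interpret c: moving_configuration \<rho>max v n l "pos t" by (rule config[OF t(1)])
  have B0: "0 \<le> B" using B[of 0] by linarith
  have ct: "set_integrable lborel {a..<b} (\<phi>t t)" for a b
    by (rule set_integrable_subset[of lborel "{a..b}"])
      (auto intro!: borel_integrable_atLeastAtMost' continuous_intros)
  let ?P = "\<lambda>z. (if z < \<zeta> t then -1 else 1) * (\<phi> t z - \<phi> t (\<zeta> t))"
  let ?g = "\<lambda>r. \<bar>r - \<kappa>\<bar>"
  have g0: "?g 0 = \<kappa>" using \<kappa> by simp
  have q0: "kruzkov_flux v \<kappa> 0 = flux v \<kappa>" by (rule kruzkov_flux_0[OF \<kappa>])
  note L1 = c.LINT_compose_u[of "\<phi>t t" ?g, OF ct, unfolded g0]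
  note L2 = c.LINT_compose_u[of "\<lambda>z. sgn (z - \<zeta> t) * \<phi>x t z" "kruzkov_flux v \<kappa>", OF set_integrable_\<phi>x_sign, unfolded q0]
  have split: "(\<bar>U t z - \<kappa>\<bar> - \<kappa>) * \<phi>t t z + sgn (z - \<zeta> t) * kruzkov_flux v \<kappa> (U t z) * \<phi>x t z
      = (\<bar>U t z - \<kappa>\<bar> - \<kappa>) * \<phi>t t z + ((kruzkov_flux v \<kappa> (U t z) - flux v \<kappa>) * (sgn (z - \<zeta> t) * \<phi>x t z)
        + flux v \<kappa> * (sgn (z - \<zeta> t) * \<phi>x t z))" for z by (simp add: algebra_simps)
  have "production (U t) (\<zeta> t) t
      = (\<Sum>k<n. (\<bar>Rt t (Suc k) - \<kappa>\<bar> - \<kappa>) * (LINT z:{x k t..<x (Suc k) t}|lborel. \<phi>t t z))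
      + ((\<Sum>k<n. (kruzkov_flux v \<kappa> (Rt t (Suc k)) - flux v \<kappa>) * (LINT z:{x k t..<x (Suc k) t}|lborel. sgn (z - \<zeta> t) * \<phi>x t z))
        + flux v \<kappa> * (- 2 * \<phi> t (\<zeta> t))) + 2 * flux v \<kappa> * \<phi> t (\<zeta> t)"
    unfolding production_def split
    by (subst Bochner_Integration.integral_add Bochner_Integration.integral_add[OF L2(1)],
        (intro L1(1) L2(1) Bochner_Integration.integrable_add integrable_mult_right integrable_\<phi>x_sign)+)+
      (simp add: L1(2) L2(2) LINT_\<phi>x_sign_line)
  also have "\<dots> = (\<Sum>k<n. (\<bar>Rt t (Suc k) - \<kappa>\<bar> - \<kappa>) * (\<Phi>t base t (x (Suc k) t) - \<Phi>t base t (x k t)))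
      + (\<Sum>k<n. (kruzkov_flux v \<kappa> (Rt t (Suc k)) - flux v \<kappa>) * (?P (x (Suc k) t) - ?P (x k t)))"
  proof -
    have "(LINT z:{x k t..<x (Suc k) t}|lborel. \<phi>t t z) = \<Phi>t base t (x (Suc k) t) - \<Phi>t base t (x k t)" if "k < n" for k
      using \<Phi>_increment_bound(3)[of t B base "x k t" "x (Suc k) t"] base_less[OF t, of k] c.y_step[OF that] that B by auto
    moreover have "(LINT z:{x k t..<x (Suc k) t}|lborel. sgn (z - \<zeta> t) * \<phi>x t z) = ?P (x (Suc k) t) - ?P (x k t)" if "k < n" for k
      using LINT_\<phi>x_sign[of "x k t" "x (Suc k) t" "\<zeta> t" t] c.y_step[OF that] by simp
    ultimately show ?thesis by simp
  qed
  finally have prod_eq: "production (U t) (\<zeta> t) t = \<dots>" .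
  have "(\<Sum>i\<le>n. \<bar>v (Rt t i) - v (Rt t (Suc i))\<bar>) \<le> (\<Sum>i\<le>n. K * \<bar>c.jump i\<bar>)"
    using K(2)[OF c.R_range c.R_range] by (intro sum_mono) (simp add: c.jump_def abs_minus_commute)
  also have "\<dots> \<le> K * C" using C K(1) by (simp add: sum_distrib_left[symmetric] mult_left_mono)
  finally have "B * l * ((\<Sum>i\<le>n. \<bar>v (Rt t i) - v (Rt t (Suc i))\<bar>) + 2 * v 0) \<le> B * l * (K * C + 2 * v 0)"
    using B0 l_positive by (intro mult_left_mono) auto
  moreover have "(\<Sum>k<n. (kruzkov_flux v \<kappa> (Rt t (Suc k)) - flux v \<kappa>) * (?P (x (Suc k) t) - ?P (x k t)))
      - (\<Sum>k<n. sgn (Rt t (Suc k) - \<kappa>) * (- (Rt t (Suc k))\<^sup>2 / l * (w t (Suc k) - w t k)) * (\<Phi> base t (x (Suc k) t) - \<Phi> base t (x k t))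
            + (\<bar>Rt t (Suc k) - \<kappa>\<bar> - \<kappa>) * (\<phi> t (x (Suc k) t) * w t (Suc k) - \<phi> t (x k t) * w t k))
      \<ge> - B * l * ((\<Sum>i\<le>n. \<bar>v (Rt t i) - v (Rt t (Suc i))\<bar>) + 2 * v 0)"
  proof (rule c.discrete_entropy_inequality[OF \<kappa> \<phi>_nonneg])
    show "\<bar>\<phi> t a - \<phi> t b\<bar> \<le> B * \<bar>a - b\<bar>" for a b using B by (intro \<phi>_Lipschitz) auto
    fix z assume "x 0 t \<le> z"
    then have "base < z" using base_less[OF t, of 0] by simp
    then show "(\<Phi> base t has_real_derivative \<phi> t z) (at z)" by (rule \<Phi>_x)
  qed
  moreover have "evolution t = (\<Sum>k<n. sgn (Rt t (Suc k) - \<kappa>) * (- (Rt t (Suc k))\<^sup>2 / l * (w t (Suc k) - w t k)) * (\<Phi> base t (x (Suc k) t) - \<Phi> base t (x k t))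
            + (\<bar>Rt t (Suc k) - \<kappa>\<bar> - \<kappa>) * (\<phi> t (x (Suc k) t) * w t (Suc k) - \<phi> t (x k t) * w t k))
      + (\<Sum>k<n. (\<bar>Rt t (Suc k) - \<kappa>\<bar> - \<kappa>) * (\<Phi>t base t (x (Suc k) t) - \<Phi>t base t (x k t)))"
    unfolding evolution_def sum.distrib[symmetric] by (intro sum.cong refl) (simp only: distrib_left add_ac)
  ultimately show ?thesis unfolding prod_eq by linarith
qed

text \<open>The entropy \<open>\<bar>R - \<kappa>\<bar>\<close> of a cell need not be differentiable in time where \<open>R = \<kappa>\<close>.  The fundamental theorem is applied to
\<open>smooth_abs d (R - \<kappa>)\<close>, and \<open>d\<close> tends to \<open>0\<close> with the number of particles fixed.  At the time \<open>T\<close> the test function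
vanishes, so only the initial value remains.\<close>

lemma evolution_has_integral:
  "(evolution has_integral - (LINT z|lborel. (\<bar>U 0 z - \<kappa>\<bar> - \<kappa>) * \<phi> 0 z)) {0..T}"
proof -
  obtain J where J: "finite J" "J \<subseteq> {0<..}"
    "\<And>t i. 0 < t \<Longrightarrow> t \<notin> J \<Longrightarrow> i \<le> n \<Longrightarrow> (x i has_real_derivative w t i) (at t)"
    "continuous_on ({0<..} - J) \<zeta>"
    by (rule regular_times) (rule that)
  obtain B where B: "0 < B" "\<And>t x. t \<in> {0..T} \<Longrightarrow> \<bar>\<phi> t x\<bar> \<le> B \<and> \<bar>\<phi>t t x\<bar> \<le> B \<and> \<bar>\<phi>x t x\<bar> \<le> B"
    by (rule test_bound) (rule that)
  have R_eq: "Rt t (Suc k) = l / (x (Suc k) t - x k t)" if "k < n" for t k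
    using that by (simp add: local_density_def)
  have ordered: "x k t < x (Suc k) t" if "k < n" "0 \<le> t" for k t
    using configuration.y_step[OF config0[OF that(2)] that(1)] .
  define d where "d m = 1 / real (Suc m)" for m
  have d: "d \<longlonglongrightarrow> 0" "d m \<noteq> 0" "\<bar>d m\<bar> \<le> 1" for m
    using LIMSEQ_inverse_real_of_nat by (auto simp: d_def[abs_def] inverse_eq_divide)
  define H where "H m t = (\<Sum>k<n. (smooth_abs (d m) (Rt t (Suc k) - \<kappa>) - \<kappa>)
      * (\<Phi> base t (x (Suc k) t) - \<Phi> base t (x k t)))" for m t
  define E where "E m t = (\<Sum>k<n.
     (Rt t (Suc k) - \<kappa>) / smooth_abs (d m) (Rt t (Suc k) - \<kappa>) * (- (Rt t (Suc k))\<^sup>2 / l * (w t (Suc k) - w t k))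
       * (\<Phi> base t (x (Suc k) t) - \<Phi> base t (x k t))
     + (smooth_abs (d m) (Rt t (Suc k) - \<kappa>) - \<kappa>) * ((\<Phi>t base t (x (Suc k) t) - \<Phi>t base t (x k t))
         + (\<phi> t (x (Suc k) t) * w t (Suc k) - \<phi> t (x k t) * w t k)))" for m t
  have H_deriv: "(H m has_real_derivative E m t) (at t)" if t: "0 < t" "t < T" "t \<notin> J" for m t
    unfolding H_def[abs_def] E_def
  proof (intro DERIV_sum)
    fix k assume "k \<in> {..<n}"
    then have k: "k < n" by simp
    have dx: "(x k has_real_derivative w t k) (at t)" "(x (Suc k) has_real_derivative w t (Suc k)) (at t)"
      using J(3)[OF t(1,3)] k by auto
    have ne: "x (Suc k) t - x k t \<noteq> 0" using ordered[OF k, of t] t by simp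
    have "((\<lambda>t. l / (x (Suc k) t - x k t)) has_real_derivative - (Rt t (Suc k))\<^sup>2 / l * (w t (Suc k) - w t k)) (at t)"
      unfolding R_eq[OF k] using ne l_positive
      by (auto intro!: derivative_eq_intros dx simp: power2_eq_square divide_simps)
    from DERIV_diff[OF this DERIV_const[of \<kappa>]]
    have dR: "((\<lambda>t. Rt t (Suc k) - \<kappa>) has_real_derivative - (Rt t (Suc k))\<^sup>2 / l * (w t (Suc k) - w t k)) (at t)"
      unfolding R_eq[OF k] by simp
    have d\<Phi>: "((\<lambda>s. \<Phi> base s (x j s)) has_real_derivative \<Phi>t base t (x j t) + \<phi> t (x j t) * w t j) (at t)"
      if "j \<in> {k, Suc k}" for j
      using that k dx t base_less[of t j] by (intro \<Phi>_chain) auto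
    note d1 = DERIV_diff[OF DERIV_chain2[OF smooth_abs_deriv[OF d(2)[of m]] dR] DERIV_const[of \<kappa>]]
    note d2 = DERIV_diff[OF d\<Phi>[of "Suc k"] d\<Phi>[of k]]
    show "((\<lambda>t. (smooth_abs (d m) (Rt t (Suc k) - \<kappa>) - \<kappa>) * (\<Phi> base t (x (Suc k) t) - \<Phi> base t (x k t)))
      has_real_derivative
        (Rt t (Suc k) - \<kappa>) / smooth_abs (d m) (Rt t (Suc k) - \<kappa>) * (- (Rt t (Suc k))\<^sup>2 / l * (w t (Suc k) - w t k))
       * (\<Phi> base t (x (Suc k) t) - \<Phi> base t (x k t))
     + (smooth_abs (d m) (Rt t (Suc k) - \<kappa>) - \<kappa>) * ((\<Phi>t base t (x (Suc k) t) - \<Phi>t base t (x k t))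
         + (\<phi> t (x (Suc k) t) * w t (Suc k) - \<phi> t (x k t) * w t k))) (at t)"
      by (rule DERIV_cong[OF DERIV_mult[OF d1 d2]]) (simp_all add: algebra_simps)
  qed
  have x_cont: "continuous_on {0..T} (x k)" if "k \<le> n" for k
    using x_continuous[OF that] by (rule continuous_on_subset) auto
  have H_cont: "continuous_on {0..T} (H m)" for m
    unfolding H_def[abs_def]
  proof (intro continuous_on_sum continuous_on_mult continuous_on_diff continuous_on_const)
    fix k assume "k \<in> {..<n}"
    then have k: "k < n" by simp
    have "continuous_on {0..T} (\<lambda>t. l / (x (Suc k) t - x k t))"
    proof (intro continuous_intros x_cont ballI)
      fix t assume "t \<in> {0..T}"
      then show "x (Suc k) t - x k t \<noteq> 0" using ordered[OF k, of t] by simp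
    qed (use k in auto)
    then have "continuous_on {0..T} (\<lambda>t. Rt t (Suc k))" by (simp only: R_eq[OF k])
    then show "continuous_on {0..T} (\<lambda>t. smooth_abs (d m) (Rt t (Suc k) - \<kappa>))"
      unfolding smooth_abs_def by (intro continuous_intros)
    show "continuous_on {0..T} (\<lambda>t. \<Phi> base t (x k t))" "continuous_on {0..T} (\<lambda>t. \<Phi> base t (x (Suc k) t))"
      using k base_less by (auto intro!: \<Phi>_continuous x_cont continuous_on_id)
  qed
  have E_int: "(E m has_integral H m T - H m 0) {0..T}" for m
  proof (rule fundamental_theorem_of_calculus_interior_strong[OF J(1)])
    show "(H m has_vector_derivative E m t) (at t)" if "t \<in> {0<..<T} - J" for t
      using H_deriv[of t m] that by (simp add: has_real_derivative_iff_has_vector_derivative)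
  qed (use T_pos H_cont in auto)
  have \<Phi>_T: "\<Phi> base T z = 0" for z
  proof -
    have "\<phi> T = (\<lambda>z. 0)" using \<phi>_support[of T] by auto
    then show ?thesis by (simp add: \<Phi>_def)
  qed
  have H_T: "H m T = 0" for m by (simp add: H_def \<Phi>_T)
  \<comment> \<open>An upper bound of the lengths of all cells up to the time T.\<close>
  define W where "W = 2 + 2 * v 0 * T"
  define D where "D = real n * (\<rho>max\<^sup>2 / l * (2 * v 0) * (B * W) + (\<rho>max + 1 + \<rho>max) * (B * W + 2 * (B * v 0)))"
  have E_bound: "norm (E m t) \<le> D" if t: "t \<in> {0..T}" for m t
  proof -
    interpret c: configuration n l \<rho>max "pos t" using t by (intro config0) simp
    have summand: "\<bar>(Rt t (Suc k) - \<kappa>) / smooth_abs (d m) (Rt t (Suc k) - \<kappa>) * (- (Rt t (Suc k))\<^sup>2 / l * (w t (Suc k) - w t k))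
       * (\<Phi> base t (x (Suc k) t) - \<Phi> base t (x k t))
     + (smooth_abs (d m) (Rt t (Suc k) - \<kappa>) - \<kappa>) * ((\<Phi>t base t (x (Suc k) t) - \<Phi>t base t (x k t))
         + (\<phi> t (x (Suc k) t) * w t (Suc k) - \<phi> t (x k t) * w t k))\<bar>
       \<le> \<rho>max\<^sup>2 / l * (2 * v 0) * (B * W) + (\<rho>max + 1 + \<rho>max) * (B * W + 2 * (B * v 0))" if k: "k < n" for k
    proof -
      have width: "x (Suc k) t - x k t \<le> W"
      proof -
        have "v 0 * t \<le> v 0 * T" using t v_0_pos by (intro mult_left_mono) auto
        then show ?thesis using x_range(1)[of t k] x_range(2)[of t "Suc k"] k t by (simp add: W_def)
      qed
      have inc: "\<bar>\<Phi> base t (x (Suc k) t) - \<Phi> base t (x k t)\<bar> \<le> B * W" "\<bar>\<Phi>t base t (x (Suc k) t) - \<Phi>t base t (x k t)\<bar> \<le> B * W"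
      proof -
        have le: "base \<le> x k t" "x k t \<le> x (Suc k) t" using base_less[of t k] ordered[OF k, of t] t k by auto
        have "B * (x (Suc k) t - x k t) \<le> B * W" using width B(1) by (intro mult_left_mono) auto
        then show "\<bar>\<Phi> base t (x (Suc k) t) - \<Phi> base t (x k t)\<bar> \<le> B * W" "\<bar>\<Phi>t base t (x (Suc k) t) - \<Phi>t base t (x k t)\<bar> \<le> B * W"
          using \<Phi>_increment_bound(1,2)[of t B, OF _ _ le] B(2)[OF t] by (meson order_trans)+
      qed
      have R: "0 \<le> Rt t (Suc k)" "Rt t (Suc k) \<le> \<rho>max" using c.R_range[of "Suc k"] by auto
      have wv: "\<bar>w t (Suc k) - w t k\<bar> \<le> 2 * v 0" using velocity_bound[of t k] velocity_bound[of t "Suc k"] t by auto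
      have Rb: "\<bar>- (Rt t (Suc k))\<^sup>2 / l * (w t (Suc k) - w t k)\<bar> \<le> \<rho>max\<^sup>2 / l * (2 * v 0)"
        unfolding abs_mult using R wv l_positive by (intro mult_mono) (auto simp: abs_divide intro!: divide_right_mono power_mono)
      have 1: "\<bar>(Rt t (Suc k) - \<kappa>) / smooth_abs (d m) (Rt t (Suc k) - \<kappa>) * (- (Rt t (Suc k))\<^sup>2 / l * (w t (Suc k) - w t k))\<bar>
         \<le> 1 * (\<rho>max\<^sup>2 / l * (2 * v 0))"
        by (subst abs_mult) (rule mult_mono[OF smooth_abs_quotient_le Rb]; simp)
      have 2: "\<bar>(Rt t (Suc k) - \<kappa>) / smooth_abs (d m) (Rt t (Suc k) - \<kappa>) * (- (Rt t (Suc k))\<^sup>2 / l * (w t (Suc k) - w t k))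
         * (\<Phi> base t (x (Suc k) t) - \<Phi> base t (x k t))\<bar> \<le> (1 * (\<rho>max\<^sup>2 / l * (2 * v 0))) * (B * W)"
        unfolding abs_mult[of _ "\<Phi> base t (x (Suc k) t) - \<Phi> base t (x k t)"]
        using 1 inc(1) l_positive v_0_pos by (intro mult_mono) auto
      have "\<bar>\<phi> t (x j t) * w t j\<bar> \<le> B * v 0" for j
        unfolding abs_mult using B(2)[OF t] velocity_bound[of t j] B(1) t by (intro mult_mono) auto
      from this[of k] this[of "Suc k"] have "\<bar>(\<Phi>t base t (x (Suc k) t) - \<Phi>t base t (x k t))
         + (\<phi> t (x (Suc k) t) * w t (Suc k) - \<phi> t (x k t) * w t k)\<bar> \<le> B * W + 2 * (B * v 0)"
        using inc(2) by linarith
      moreover have "\<bar>smooth_abs (d m) (Rt t (Suc k) - \<kappa>) - \<kappa>\<bar> \<le> \<rho>max + 1 + \<rho>max"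
      proof -
        have "\<bar>Rt t (Suc k) - \<kappa>\<bar> \<le> \<rho>max" "0 \<le> \<kappa>" "\<kappa> \<le> \<rho>max" using R \<kappa> by auto
        then show ?thesis using smooth_abs_le[of "d m" "Rt t (Suc k) - \<kappa>"] d(3)[of m] by linarith
      qed
      ultimately have "\<bar>(smooth_abs (d m) (Rt t (Suc k) - \<kappa>) - \<kappa>) * ((\<Phi>t base t (x (Suc k) t) - \<Phi>t base t (x k t))
         + (\<phi> t (x (Suc k) t) * w t (Suc k) - \<phi> t (x k t) * w t k))\<bar> \<le> (\<rho>max + 1 + \<rho>max) * (B * W + 2 * (B * v 0))"
        unfolding abs_mult[of "_ - \<kappa>"] using \<rho>max_pos by (intro mult_mono) auto
      with 2 show ?thesis by linarith
    qed
    have "\<bar>E m t\<bar> \<le> (\<Sum>k<n. \<rho>max\<^sup>2 / l * (2 * v 0) * (B * W) + (\<rho>max + 1 + \<rho>max) * (B * W + 2 * (B * v 0)))"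
      unfolding E_def by (rule order_trans[OF sum_abs]) (intro sum_mono summand, simp)
    then show ?thesis by (simp add: D_def)
  qed
  have E_lim: "(\<lambda>m. E m t) \<longlonglongrightarrow> evolution t" for t
    unfolding E_def evolution_def
    by (intro tendsto_sum tendsto_add tendsto_mult tendsto_diff tendsto_const
        smooth_abs_tendsto smooth_abs_quotient_tendsto d(1))
  have H_lim: "(\<lambda>m. H m T - H m 0) \<longlonglongrightarrow> 0 - (\<Sum>k<n. (\<bar>Rt 0 (Suc k) - \<kappa>\<bar> - \<kappa>) * (\<Phi> base 0 (x (Suc k) 0) - \<Phi> base 0 (x k 0)))"
    unfolding H_T unfolding H_def
    by (intro tendsto_sum tendsto_mult tendsto_diff tendsto_const smooth_abs_tendsto d(1))
  have "(evolution has_integral 0 - (\<Sum>k<n. (\<bar>Rt 0 (Suc k) - \<kappa>\<bar> - \<kappa>) * (\<Phi> base 0 (x (Suc k) 0) - \<Phi> base 0 (x k 0)))) {0..T}"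
  proof (rule has_integral_dominated_convergence[OF E_int _ _ _ H_lim])
    show "(\<lambda>t. D) integrable_on {0..T}" by (rule integrable_const_ivl)
  qed (use E_bound E_lim in auto)
  moreover have "(LINT z|lborel. (\<bar>U 0 z - \<kappa>\<bar> - \<kappa>) * \<phi> 0 z)
      = (\<Sum>k<n. (\<bar>Rt 0 (Suc k) - \<kappa>\<bar> - \<kappa>) * (\<Phi> base 0 (x (Suc k) 0) - \<Phi> base 0 (x k 0)))"
  proof -
    interpret c: configuration n l \<rho>max "pos 0" by (rule config0) simp
    have c0: "set_integrable lborel {a..<b} (\<phi> 0)" for a b
      by (rule set_integrable_subset[of lborel "{a..b}"])
        (auto intro!: borel_integrable_atLeastAtMost' continuous_intros)
    have g0: "\<bar>0 - \<kappa>\<bar> = \<kappa>" using \<kappa> by simp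
    have "(LINT z:{x k 0..<x (Suc k) 0}|lborel. \<phi> 0 z) = \<Phi> base 0 (x (Suc k) 0) - \<Phi> base 0 (x k 0)" if "k < n" for k
      using \<Phi>_increment_bound(4)[of 0 B base "x k 0" "x (Suc k) 0"] base_less[of 0 k] ordered[OF that, of 0] that B(2)[of 0] T_pos by auto
    then show ?thesis
      using c.LINT_compose_u(2)[of "\<phi> 0" "\<lambda>r. \<bar>r - \<kappa>\<bar>", OF c0, unfolded g0] by simp
  qed
  ultimately show ?thesis by simp
qed

end

context scheme
begin

lemma extended_density_measurable:
  "(\<lambda>p. U (max (fst p) 0) (snd p)) \<in> borel_measurable (borel \<Otimes>\<^sub>M borel)"
proof -
  have pos: "(\<lambda>t. x i (max t 0)) \<in> borel_measurable borel" if "i \<le> n" for i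
    by (rule borel_measurable_continuous_onI, rule continuous_on_compose2[OF x_continuous[OF that]])
      (auto intro!: continuous_intros)
  have "(\<lambda>p. local_density l n (pos (max (fst p) 0)) (Suc i)
      * (if x i (max (fst p) 0) \<le> snd p \<and> snd p < x (Suc i) (max (fst p) 0) then 1 else 0)) \<in> borel_measurable (borel \<Otimes>\<^sub>M borel)"
    if "i < n" for i
  proof -
    have [measurable]: "(\<lambda>t. x i (max t 0)) \<in> borel_measurable borel" "(\<lambda>t. x (Suc i) (max t 0)) \<in> borel_measurable borel"
      using pos that by auto
    have "local_density l n (pos (max (fst p) 0)) (Suc i) = l / (x (Suc i) (max (fst p) 0) - x i (max (fst p) 0))"
      for p :: "real \<times> real" using that by (simp add: local_density_def)
    then show ?thesis by (simp only:) measurable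
  qed
  then have "(\<lambda>p. \<Sum>i<n. local_density l n (pos (max (fst p) 0)) (Suc i)
      * (if x i (max (fst p) 0) \<le> snd p \<and> snd p < x (Suc i) (max (fst p) 0) then 1 else 0)) \<in> borel_measurable (borel \<Otimes>\<^sub>M borel)"
    by (intro borel_measurable_sum) auto
  then show ?thesis
    unfolding discrete_density_def indicator_def atLeastLessThan_iff of_bool_def .
qed

lemma extended_turning_measurable: "(\<lambda>t. \<zeta> (max t 0)) \<in> borel_measurable borel"
proof -
  obtain J where J: "finite J" "J \<subseteq> {0<..}"
    "\<And>t i. 0 < t \<Longrightarrow> t \<notin> J \<Longrightarrow> i \<le> n \<Longrightarrow> (x i has_real_derivative w t i) (at t)"
    "continuous_on ({0<..} - J) \<zeta>"
    by (rule regular_times) (rule that)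
  have "open ({0<..} - J)" using J(1) by (simp add: open_Diff finite_imp_closed)
  then have "(\<lambda>t. indicator ({0<..} - J) t *\<^sub>R \<zeta> t) \<in> borel_measurable borel"
    using J(4) by (intro borel_measurable_continuous_on_indicator) auto
  then have "(\<lambda>t. indicator ({0<..} - J) t *\<^sub>R \<zeta> t + indicator {..0} t * \<zeta> 0) \<in> borel_measurable borel" by measurable
  then show ?thesis
  proof (rule measurable_discrete_difference[where X=J])
    show "countable J" using J(1) by (rule countable_finite)
    fix t assume "t \<notin> J"
    then show "indicator ({0<..} - J) t *\<^sub>R \<zeta> t + indicator {..0} t * \<zeta> 0 = \<zeta> (max t 0)"
      by (cases "0 < t") (auto simp: max_def indicator_def)
  qed auto
qed

end

context scheme_test
begin

text \<open>The error is of the order of the mass \<open>l\<close> of a particle since the total jump \<open>C\<close> is bounded.\<close>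

lemma scheme_entropy_inequality:
  assumes K: "0 \<le> K" "\<And>r s. r \<in> {0..\<rho>max} \<Longrightarrow> s \<in> {0..\<rho>max} \<Longrightarrow> \<bar>v r - v s\<bar> \<le> K * \<bar>r - s\<bar>"
    and C: "\<And>t. t \<in> {0..T} \<Longrightarrow> (\<Sum>i\<le>n. \<bar>configuration.jump n l (pos t) i\<bar>) \<le> C"
    and B: "\<And>t z. t \<in> {0..T} \<Longrightarrow> \<bar>\<phi> t z\<bar> \<le> B \<and> \<bar>\<phi>t t z\<bar> \<le> B \<and> \<bar>\<phi>x t z\<bar> \<le> B"
  shows "- (LINT z|lborel. (\<bar>U 0 z - \<kappa>\<bar> - \<kappa>) * \<phi> 0 z) - T * (B * l * (K * C + 2 * v 0))
    \<le> (LINT t:{0..T}|lborel. production (U (max t 0)) (\<zeta> (max t 0)) t)"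
proof -
  let ?p = "\<lambda>t. production (U (max t 0)) (\<zeta> (max t 0)) t"
  have range: "U (max t 0) z \<in> {0..\<rho>max}" for t z
    by (rule configuration.u_range[OF config0]) simp
  have [measurable]: "?p \<in> borel_measurable borel"
    using production_measurable[of "\<lambda>t. U (max t 0)" "\<lambda>t. \<zeta> (max t 0)"] range
      extended_density_measurable extended_turning_measurable by auto
  have bound: "\<bar>?p t\<bar> \<le> (2 * \<rho>max + \<rho>max * v 0) * B * (2 * M) + 2 * (\<rho>max * v 0) * B" (is "_ \<le> ?D") if "t \<in> {0..T}" for t
    by (rule production_bound(2)[OF range configuration.u_borel[OF config0] B[OF that]]) simp
  have int: "set_integrable lborel {0..T} ?p"
    by (rule set_integrable_Icc_bounded[OF _ bound]) measurable
  have hk: "(?p has_integral (LINT t:{0..T}|lborel. ?p t)) {0..T}"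
    using set_borel_integral_eq_integral[OF int] by (simp add: has_integral_integral)
  have "((\<lambda>t. evolution t - B * l * (K * C + 2 * v 0)) has_integral
      - (LINT z|lborel. (\<bar>U 0 z - \<kappa>\<bar> - \<kappa>) * \<phi> 0 z) - T * (B * l * (K * C + 2 * v 0))) {0..T}"
    using has_integral_diff[OF evolution_has_integral has_integral_const_real[of "B * l * (K * C + 2 * v 0)" 0 T]] T_pos by simp
  from this hk show ?thesis
  proof (rule has_integral_le)
    fix t assume t: "t \<in> {0..T}"
    then have "max t 0 = t" by simp
    then show "evolution t - B * l * (K * C + 2 * v 0) \<le> ?p t"
      using production_ge_evolution[of t B K C] t K C[OF t] B[OF t] by simp
  qed
qed

end

section \<open>Compactness of masses and densities\<close>

lemma lebesgue_integral_eq_lborel: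
  fixes f :: "'a::euclidean_space \<Rightarrow> real"
  shows "f \<in> borel_measurable borel \<Longrightarrow> (LINT x|lebesgue. f x) = (LINT x|lborel. f x)"
  by (rule integral_completion) simp

locale particle_schemes = velocity \<rho>max v + initial_datum \<rho>max \<rho>0 for \<rho>max v \<rho>0 +
  fixes \<alpha> :: real and x :: "nat \<Rightarrow> nat \<Rightarrow> real \<Rightarrow> real" and \<zeta> :: "nat \<Rightarrow> real \<Rightarrow> real"
  assumes \<alpha>0: "0 \<le> \<alpha>"
    and solutions: "\<And>n. 1 \<le> n \<Longrightarrow> scheme_solution \<rho>max v \<alpha> \<rho>0 n (x n) (\<zeta> n)"
    and TV_bound: "\<And>T. 0 < T \<Longrightarrow> \<exists>TV>0. \<forall>t\<in>{0..T}. \<forall>n\<ge>1.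
           total_variation UNIV (approximate_density \<rho>0 n (x n) t) \<le> ereal TV"
begin

abbreviation "unit_mass \<equiv> particle_mass \<rho>0"

text \<open>The time is clamped at \<open>0\<close> because particle positions are arbitrary at negative times.\<close>

definition dens :: "nat \<Rightarrow> real \<Rightarrow> real \<Rightarrow> real" where
  "dens n t z = discrete_density (unit_mass n) n (\<lambda>i. x n i (max t 0)) z"

definition mass :: "nat \<Rightarrow> real \<Rightarrow> real \<Rightarrow> real" where
  "mass n t z = configuration.mass_left n (unit_mass n) (\<lambda>i. x n i (max t 0)) z"

definition turn :: "nat \<Rightarrow> real \<Rightarrow> real" where
  "turn n t = \<zeta> n (max t 0)"

definition jumps :: "nat \<Rightarrow> real \<Rightarrow> real" where
  "jumps n t = (\<Sum>i\<le>n. \<bar>configuration.jump n (unit_mass n) (\<lambda>i. x n i (max t 0)) i\<bar>)"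

definition tv_bound :: "real \<Rightarrow> real" where
  "tv_bound T = (SOME C. 0 < C \<and> (\<forall>t\<in>{0..T}. \<forall>n\<ge>1.
           total_variation UNIV (approximate_density \<rho>0 n (x n) t) \<le> ereal C))"

lemma tv_bound: assumes "0 < T"
  shows "0 < tv_bound T" "\<And>t n. t \<in> {0..T} \<Longrightarrow> 1 \<le> n \<Longrightarrow> total_variation UNIV (approximate_density \<rho>0 n (x n) t) \<le> ereal (tv_bound T)"
proof -
  have "\<exists>C. 0 < C \<and> (\<forall>t\<in>{0..T}. \<forall>n\<ge>1. total_variation UNIV (approximate_density \<rho>0 n (x n) t) \<le> ereal C)"
    using TV_bound[OF assms] by blast
  from someI_ex[OF this, folded tv_bound_def]
  show "0 < tv_bound T" "\<And>t n. t \<in> {0..T} \<Longrightarrow> 1 \<le> n \<Longrightarrow> total_variation UNIV (approximate_density \<rho>0 n (x n) t) \<le> ereal (tv_bound T)"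
    by blast+
qed

lemma scheme: "1 \<le> n \<Longrightarrow> scheme \<rho>max v \<rho>0 \<alpha> n (x n) (\<zeta> n)"
  using solutions \<alpha>0 by unfold_locales auto

lemma configs: assumes "1 \<le> n" shows "configuration n (unit_mass n) \<rho>max (\<lambda>i. x n i (max t 0))"
proof -
  interpret scheme \<rho>max v \<rho>0 \<alpha> n "x n" "\<zeta> n" by (rule scheme[OF assms])
  show ?thesis using config0[of "max t 0"] by (simp add: l_def)
qed

lemma dens_range: "1 \<le> n \<Longrightarrow> dens n t z \<in> {0..\<rho>max}"
  unfolding dens_def by (rule configuration.u_range[OF configs])

lemma dens_slice [measurable]: "dens n t \<in> borel_measurable borel"
  unfolding dens_def[abs_def] discrete_density_def by measurable

lemma dens_measurable: assumes "1 \<le> n" shows "(\<lambda>p. dens n (fst p) (snd p)) \<in> borel_measurable (borel \<Otimes>\<^sub>M borel)"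
proof -
  interpret scheme \<rho>max v \<rho>0 \<alpha> n "x n" "\<zeta> n" by (rule scheme[OF assms])
  show ?thesis using extended_density_measurable unfolding dens_def l_def .
qed

lemma turn_measurable: assumes "1 \<le> n" shows "turn n \<in> borel_measurable borel"
proof -
  interpret scheme \<rho>max v \<rho>0 \<alpha> n "x n" "\<zeta> n" by (rule scheme[OF assms])
  show ?thesis using extended_turning_measurable unfolding turn_def[abs_def] .
qed

lemma mass_Lipschitz:
  assumes "1 \<le> n"
  shows "\<bar>mass n t z - mass n s z'\<bar> \<le> \<rho>max * v 0 * \<bar>t - s\<bar> + \<rho>max * \<bar>z - z'\<bar> + unit_mass n"
proof -
  interpret scheme \<rho>max v \<rho>0 \<alpha> n "x n" "\<zeta> n" by (rule scheme[OF assms])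
  have "\<rho>max * v 0 * \<bar>max t 0 - max s 0\<bar> \<le> \<rho>max * v 0 * \<bar>t - s\<bar>"
    using \<rho>max_pos v_0_pos by (intro mult_left_mono) auto
  moreover have "\<bar>F (max t 0) z - F (max s 0) z'\<bar> \<le> \<rho>max * v 0 * \<bar>max t 0 - max s 0\<bar> + \<rho>max * \<bar>z - z'\<bar> + l"
    by (rule F_space_time) auto
  ultimately show ?thesis by (simp only: mass_def l_def)
qed

lemma mass_space: "1 \<le> n \<Longrightarrow> \<bar>mass n t z - mass n t z'\<bar> \<le> \<rho>max * \<bar>z - z'\<bar>"
  unfolding mass_def by (rule configuration.mass_left_Lipschitz[OF configs])

lemma mass_mono: "1 \<le> n \<Longrightarrow> a \<le> b \<Longrightarrow> mass n t a \<le> mass n t b"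
  unfolding mass_def by (rule configuration.mass_left_mono[OF configs])

lemma mass_bounds: assumes "1 \<le> n" shows "\<bar>mass n t z\<bar> \<le> L1_norm corridor \<rho>0"
proof -
  interpret scheme \<rho>max v \<rho>0 \<alpha> n "x n" "\<zeta> n" by (rule scheme[OF assms])
  show ?thesis using F_bounds[of "max t 0" z] by (auto simp: mass_def l_def)
qed

lemma mass_initial: assumes "1 \<le> n" shows "\<bar>mass n 0 z - initial_mass_left z\<bar> \<le> unit_mass n"
proof -
  interpret scheme \<rho>max v \<rho>0 \<alpha> n "x n" "\<zeta> n" by (rule scheme[OF assms])
  show ?thesis using F_initial[of z] by (simp add: mass_def l_def)
qed

lemma dens_LINT: "1 \<le> n \<Longrightarrow> a \<le> b \<Longrightarrow> (LINT z:{a..b}|lborel. dens n t z) = mass n t b - mass n t a"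
  unfolding dens_def mass_def by (rule configuration.u_LINT[OF configs])

lemma turn_bounds:
  assumes "1 \<le> n"
  shows "turn n t \<in> {-1..1}"
    "\<bar>2 * turn n t + \<alpha> * (2 * mass n t (turn n t) - mass n t (-1) - mass n t 1)\<bar> \<le> 2 * \<alpha> * unit_mass n"
proof -
  interpret scheme \<rho>max v \<rho>0 \<alpha> n "x n" "\<zeta> n" by (rule scheme[OF assms])
  show "turn n t \<in> {-1..1}"
    "\<bar>2 * turn n t + \<alpha> * (2 * mass n t (turn n t) - mass n t (-1) - mass n t 1)\<bar> \<le> 2 * \<alpha> * unit_mass n"
    using turning_bounds[of "max t 0"] by (auto simp: turn_def mass_def l_def)
qed

lemma dens_eq: "0 \<le> t \<Longrightarrow> approximate_density \<rho>0 n (x n) t z = dens n t z"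
  by (simp add: approximate_density_def dens_def)

lemma dens_outside: assumes "1 \<le> n" "0 \<le> t" "1 + v 0 * t < \<bar>z\<bar>" shows "dens n t z = 0"
proof -
  interpret scheme \<rho>max v \<rho>0 \<alpha> n "x n" "\<zeta> n" by (rule scheme[OF assms(1)])
  have "z < x n 0 t \<or> x n n t \<le> z" using x_range(1)[of t 0] x_range(2)[of t n] assms(2,3) by auto
  then show ?thesis using configuration.u_outside[OF configs[OF assms(1), of t], of z] assms(2) by (simp add: dens_def)
qed

lemma dens_total_variation:
  assumes "1 \<le> n" "t \<in> {0..T}" "0 < T" shows "total_variation UNIV (dens n t) \<le> ereal (tv_bound T)"
proof -
  have "dens n t = approximate_density \<rho>0 n (x n) t" using assms(2) dens_eq by (intro ext) auto
  then show ?thesis using tv_bound(2)[OF assms(3,2,1)] by simp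
qed

lemma jumps_bound: assumes "1 \<le> n" "t \<in> {0..T}" "0 < T" shows "jumps n t \<le> tv_bound T"
  unfolding jumps_def
  by (rule configuration.jumps_le_total_variation[OF configs[OF assms(1)]])
    (use dens_total_variation[OF assms] in \<open>simp add: dens_def[abs_def]\<close>)

lemma dens_variation:
  assumes "1 \<le> n" "t \<in> {0..T}" "0 < T" "\<And>j. j < m \<Longrightarrow> z j \<le> z (Suc j)"
  shows "(\<Sum>j<m. \<bar>dens n t (z (Suc j)) - dens n t (z j)\<bar>) \<le> tv_bound T"
  unfolding dens_def
  by (rule order_trans[OF configuration.u_variation[OF configs[OF assms(1)]] jumps_bound[OF assms(1-3), unfolded jumps_def]])
    (fact assms(4))

lemma dens_L1_distance:
  assumes n: "1 \<le> n1" "1 \<le> n2" and T: "t1 \<in> {0..T}" "t2 \<in> {0..T}" "0 < T"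
    and \<epsilon>: "\<And>z. z \<in> {-M..M+1} \<Longrightarrow> \<bar>mass n1 t1 z - mass n2 t2 z\<bar> \<le> \<epsilon>"
    and h: "0 < h" "h \<le> 1" and M: "0 \<le> M"
  shows "(LINT z:{-M..M}|lborel. \<bar>dens n1 t1 z - dens n2 t2 z\<bar>) \<le> 2 * tv_bound T * h + 4 * M * \<epsilon> / h"
  unfolding dens_def
  by (rule L1_distance_configurations[OF configs configs]) (use assms jumps_bound in \<open>auto simp: mass_def jumps_def\<close>)

lemma unit_mass_tendsto: "(\<lambda>n. unit_mass (Suc n)) \<longlonglongrightarrow> 0"
  unfolding particle_mass_def
  using tendsto_mult[OF tendsto_const[of "L1_norm corridor \<rho>0"] LIMSEQ_inverse_real_of_nat] by (simp add: divide_inverse)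

lemma dens_window_integrable: assumes "1 \<le> n" shows "integrable lborel (\<lambda>z. indicator {-M..M} z * dens n t z)"
  using integrable_mult_indicator[OF _ configuration.u_integrable_lborel[OF configs[OF assms]], of "{-M..M}" t]
  by (simp add: dens_def)


lemma mass_subsequence:
  obtains s g where "strict_mono (s :: nat \<Rightarrow> nat)"
    "\<And>p q :: real \<times> real. \<bar>g p - g q\<bar> \<le> (\<rho>max * v 0 + \<rho>max) * dist p q"
    "\<And>S. compact S \<Longrightarrow> uniform_limit S (\<lambda>k p. mass (Suc (s k)) (fst p) (snd p)) g sequentially"
proof (rule almost_Lipschitz_subsequence[of "\<lambda>n p. mass (Suc n) (fst p) (snd p)" "L1_norm corridor \<rho>0" "\<rho>max * v 0 + \<rho>max" "\<lambda>n. unit_mass (Suc n)"])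
  show "\<bar>mass (Suc n) (fst p) (snd p)\<bar> \<le> L1_norm corridor \<rho>0" for n and p :: "real \<times> real"
    by (rule mass_bounds) simp
  show "\<bar>mass (Suc n) (fst p) (snd p) - mass (Suc n) (fst q) (snd q)\<bar> \<le> (\<rho>max * v 0 + \<rho>max) * dist p q + unit_mass (Suc n)"
    for n and p q :: "real \<times> real"
  proof -
    have "\<bar>fst p - fst q\<bar> \<le> dist p q" "\<bar>snd p - snd q\<bar> \<le> dist p q"
      using dist_fst_le[of p q] dist_snd_le[of p q] by (auto simp: dist_real_def)
    then have "\<rho>max * v 0 * \<bar>fst p - fst q\<bar> \<le> \<rho>max * v 0 * dist p q" "\<rho>max * \<bar>snd p - snd q\<bar> \<le> \<rho>max * dist p q"
      using \<rho>max_pos v_0_pos by (auto intro!: mult_left_mono)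
    then show ?thesis using mass_Lipschitz[of "Suc n" "fst p" "snd p" "fst q" "snd q"] by (simp add: distrib_right)
  qed
  show "0 \<le> \<rho>max * v 0 + \<rho>max" using \<rho>max_pos v_0_pos by auto
qed (use unit_mass_tendsto that in auto)

text \<open>Summable distances in \<open>L\<^sup>1\<close>, uniform in time, give pointwise convergence almost everywhere in space at
\<^emph>\<open>every\<close> time, and not just at almost every time.\<close>

lemma fast_subsequence:
  assumes s: "strict_mono (s :: nat \<Rightarrow> nat)"
    and unif: "\<And>S. compact S \<Longrightarrow> uniform_limit S (\<lambda>k p. mass (Suc (s k)) (fst p) (snd p)) g sequentially"
  obtains s' where "strict_mono (s' :: nat \<Rightarrow> nat)"
    "\<And>m t. t \<in> {0..real m} \<Longrightarrow>
      (LINT z:{-real m..real m}|lborel. \<bar>dens (Suc (s (s' (Suc m)))) t z - dens (Suc (s (s' m))) t z\<bar>) \<le> (1/2)^m"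
proof -
  have ex: "\<exists>N. \<forall>j\<ge>N. \<forall>k\<ge>N. \<forall>t\<in>{0..real m}.
      (LINT z:{-real m..real m}|lborel. \<bar>dens (Suc (s j)) t z - dens (Suc (s k)) t z\<bar>) \<le> (1/2)^m" for m
  proof -
    define C where "C = tv_bound (real m + 1)"
    have C: "0 < C" unfolding C_def by (rule tv_bound) simp
    define e :: real where "e = (1/2)^m"
    have e: "0 < e" by (simp add: e_def)
    define h where "h = min 1 (e / (4 * C))"
    have h: "0 < h" "h \<le> 1" "2 * C * h \<le> e / 2"
      using C e by (auto simp: h_def min_def field_simps)
    define \<epsilon> where "\<epsilon> = e * h / (16 * (real m + 1))"
    have \<epsilon>: "0 < \<epsilon>" "4 * real m * (2 * \<epsilon>) / h \<le> e / 2"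
    proof -
      show "0 < \<epsilon>" using e h by (simp add: \<epsilon>_def)
      have eh: "\<epsilon> / h = e / (16 * (real m + 1))" using h(1) by (simp add: \<epsilon>_def)
      have gen: "8 * p * (e / (16 * a)) = (e / 2) * (p / a)" for p a :: real by simp
      have "8 * real m * (\<epsilon> / h) = (e / 2) * (real m / (real m + 1))" unfolding eh gen ..
      then have "4 * real m * (2 * \<epsilon>) / h = (e / 2) * (real m / (real m + 1))" by simp
      also have "\<dots> \<le> (e / 2) * 1" using e by (intro mult_left_mono) (auto simp: divide_le_eq_1)
      finally show "4 * real m * (2 * \<epsilon>) / h \<le> e / 2" by simp
    qed
    have "compact ({0..real m} \<times> {-real m..real m + 1})" by (intro compact_Times) auto
    from uniform_limitD[OF unif[OF this] \<epsilon>(1)] obtain N where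
      N: "\<And>k p. k \<ge> N \<Longrightarrow> p \<in> {0..real m} \<times> {-real m..real m + 1} \<Longrightarrow> dist (mass (Suc (s k)) (fst p) (snd p)) (g p) < \<epsilon>"
      unfolding eventually_sequentially by blast
    have "(LINT z:{-real m..real m}|lborel. \<bar>dens (Suc (s j)) t z - dens (Suc (s k)) t z\<bar>) \<le> e"
      if jk: "N \<le> j" "N \<le> k" and t: "t \<in> {0..real m}" for j k t
    proof -
      have "(LINT z:{-real m..real m}|lborel. \<bar>dens (Suc (s j)) t z - dens (Suc (s k)) t z\<bar>)
         \<le> 2 * tv_bound (real m + 1) * h + 4 * real m * (2 * \<epsilon>) / h"
      proof (rule dens_L1_distance)
        fix z assume "z \<in> {-real m..real m + 1}"
        then have "(t, z) \<in> {0..real m} \<times> {-real m..real m + 1}" using t by simp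
        from N[OF jk(1) this] N[OF jk(2) this] show "\<bar>mass (Suc (s j)) t z - mass (Suc (s k)) t z\<bar> \<le> 2 * \<epsilon>"
          unfolding dist_real_def fst_conv snd_conv by linarith
      qed (use t h in auto)
      then show ?thesis using h(3) \<epsilon>(2) unfolding C_def by linarith
    qed
    then show ?thesis unfolding e_def by blast
  qed
  then obtain N where N: "\<And>m j k t. N m \<le> j \<Longrightarrow> N m \<le> k \<Longrightarrow> t \<in> {0..real m} \<Longrightarrow>
      (LINT z:{-real m..real m}|lborel. \<bar>dens (Suc (s j)) t z - dens (Suc (s k)) t z\<bar>) \<le> (1/2)^m"
    by metis
  define s' where "s' = rec_nat (N 0) (\<lambda>m a. max (Suc a) (N (Suc m)))"
  have s'_Suc: "s' (Suc m) = max (Suc (s' m)) (N (Suc m))" for m by (simp add: s'_def)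
  have mono: "strict_mono s'" unfolding strict_mono_Suc_iff by (simp add: s'_Suc less_max_iff_disj)
  have ge: "N m \<le> s' m" for m by (cases m) (simp_all add: s'_Suc, simp add: s'_def)
  have "N m \<le> s' (Suc m)" for m using ge[of m] s'_Suc[of m] by simp
  with ge N mono that show thesis by blast
qed

end

section \<open>The limit density and the limit turning curve\<close>

lemma AE_Cauchy_of_fast_windows:
  fixes f :: "nat \<Rightarrow> real \<Rightarrow> real"
  assumes int: "\<And>k M. integrable lborel (\<lambda>z. indicator {-M..M} z * f k z)"
    and fast: "\<And>m. N0 \<le> m \<Longrightarrow> (LINT z:{-real m..real m}|lborel. \<bar>f (Suc m) z - f m z\<bar>) \<le> (1/2)^m"
  shows "AE z in lborel. Cauchy (\<lambda>k. f k z)"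
proof -
  have window: "AE z in lborel. z \<in> {-real N..real N} \<longrightarrow> Cauchy (\<lambda>k. f k z)" if N: "N0 \<le> N" for N
  proof -
    let ?w = "\<lambda>k z. indicator {-real N..real N} z * f (N + k) z"
    have intw: "integrable lborel (\<lambda>z. ?w (Suc k) z - ?w k z)" for k
      by (intro Bochner_Integration.integrable_diff int)
    have le: "(LINT z|lborel. \<bar>?w (Suc k) z - ?w k z\<bar>) \<le> (1/2)^(N + k)" for k
    proof -
      have "(LINT z|lborel. \<bar>?w (Suc k) z - ?w k z\<bar>)
        \<le> (LINT z:{-real (N + k)..real (N + k)}|lborel. \<bar>f (Suc (N + k)) z - f (N + k) z\<bar>)"
        unfolding set_lebesgue_integral_def
      proof (rule integral_mono)
        show "integrable lborel (\<lambda>z. \<bar>?w (Suc k) z - ?w k z\<bar>)" by (intro integrable_abs intw)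
        have "integrable lborel (\<lambda>z. \<bar>indicator {-real (N + k)..real (N + k)} z * f (Suc (N + k)) z
            - indicator {-real (N + k)..real (N + k)} z * f (N + k) z\<bar>)"
          by (intro integrable_abs Bochner_Integration.integrable_diff int)
        moreover have "\<bar>indicator {-real (N + k)..real (N + k)} z * f (Suc (N + k)) z
            - indicator {-real (N + k)..real (N + k)} z * f (N + k) z\<bar>
          = indicat_real {-real (N + k)..real (N + k)} z *\<^sub>R \<bar>f (Suc (N + k)) z - f (N + k) z\<bar>" for z
          by (cases "z \<in> {-real (N + k)..real (N + k)}") simp_all
        ultimately show "integrable lborel (\<lambda>z. indicat_real {-real (N + k)..real (N + k)} z *\<^sub>R
            \<bar>f (Suc (N + k)) z - f (N + k) z\<bar>)" by simp
        fix z
        show "\<bar>?w (Suc k) z - ?w k z\<bar> \<le> indicat_real {-real (N + k)..real (N + k)} z *\<^sub>R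
            \<bar>f (Suc (N + k)) z - f (N + k) z\<bar>"
          by (cases "z \<in> {-real N..real N}") (auto simp: indicator_def)
      qed
      also have "\<dots> \<le> (1/2)^(N + k)" by (rule fast) (use N in auto)
      finally show ?thesis .
    qed
    have sm: "summable (\<lambda>k. LINT z|lborel. \<bar>?w (Suc k) z - ?w k z\<bar>)"
    proof (rule summable_comparison_test')
      show "summable (\<lambda>k. (1/2::real)^(N + k))" using summable_geometric[of "1/2::real"]
        by (simp add: power_add summable_mult)
      show "norm (LINT z|lborel. \<bar>?w (Suc k) z - ?w k z\<bar>) \<le> (1/2)^(N + k)" if "0 \<le> k" for k
        using le[of k] by simp
    qed
    from AE_convergent_of_summable_L1[OF intw sm] show ?thesis
    proof eventually_elim
      case (elim z)
      show ?case
      proof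
        assume "z \<in> {-real N..real N}"
        then have "convergent (\<lambda>k. f (k + N) z)" using elim by (simp add: add.commute)
        then have "convergent (\<lambda>k. f k z)" by (subst (asm) convergent_ignore_initial_segment)
        then show "Cauchy (\<lambda>k. f k z)" by (simp add: Cauchy_convergent_iff)
      qed
    qed
  qed
  have "AE z in lborel. \<forall>N. N0 \<le> N \<longrightarrow> z \<in> {-real N..real N} \<longrightarrow> Cauchy (\<lambda>k. f k z)"
    unfolding AE_all_countable using window by (auto intro: AE_I2)
  then show ?thesis
  proof eventually_elim
    case (elim z)
    obtain N where "\<bar>z\<bar> \<le> real N" using real_arch_simple by blast
    then have "z \<in> {-real (max N N0)..real (max N N0)}" by auto
    then show ?case using elim[rule_format, of "max N N0"] by simp
  qed
qed

locale convergent_schemes = particle_schemes \<rho>max v \<rho>0 \<alpha> x \<zeta> for \<rho>max v \<rho>0 \<alpha> x \<zeta> +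
  fixes r :: "nat \<Rightarrow> nat" and g :: "real \<times> real \<Rightarrow> real"
  assumes r_pos: "\<And>k. 1 \<le> r k" and r_mono: "strict_mono r"
    and g_Lipschitz: "\<And>p q. \<bar>g p - g q\<bar> \<le> (\<rho>max * v 0 + \<rho>max) * dist p q"
    and mass_uniform: "\<And>S. compact S \<Longrightarrow> uniform_limit S (\<lambda>k p. mass (r k) (fst p) (snd p)) g sequentially"
    and fast: "\<And>m t. t \<in> {0..real m} \<Longrightarrow>
      (LINT z:{-real m..real m}|lborel. \<bar>dens (r (Suc m)) t z - dens (r m) t z\<bar>) \<le> (1/2)^m"
begin

text \<open>Clamping gives a value in \<open>[0, \<rho>max]\<close> also at the points of the null set where the sequence diverges.\<close>

definition \<rho> :: "real \<Rightarrow> real \<Rightarrow> real" where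
  "\<rho> t z = max 0 (min \<rho>max (lim (\<lambda>k. dens (r k) t z)))"

definition \<xi> :: "real \<Rightarrow> real" where
  "\<xi> t = lim (\<lambda>k. turn (r k) t)"

definition good :: "real \<Rightarrow> real \<Rightarrow> bool" where
  "good t z \<longleftrightarrow> Cauchy (\<lambda>k. dens (r k) t z)"

lemma \<rho>_range: "\<rho> t z \<in> {0..\<rho>max}"
  using \<rho>max_pos by (auto simp: \<rho>_def)

lemma \<rho>_measurable: "(\<lambda>p. \<rho> (fst p) (snd p)) \<in> borel_measurable (borel \<Otimes>\<^sub>M borel)"
proof -
  have [measurable]: "(\<lambda>p. dens (r k) (fst p) (snd p)) \<in> borel_measurable (borel \<Otimes>\<^sub>M borel)" for k
    by (rule dens_measurable[OF r_pos])
  show ?thesis unfolding \<rho>_def by measurable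
qed

lemma \<rho>_slices [measurable]: "\<rho> t \<in> borel_measurable borel" "(\<lambda>t. \<rho> t z) \<in> borel_measurable borel"
proof -
  have "(\<lambda>z. (t, z)) \<in> borel \<rightarrow>\<^sub>M borel \<Otimes>\<^sub>M borel" "(\<lambda>t. (t, z)) \<in> borel \<rightarrow>\<^sub>M borel \<Otimes>\<^sub>M borel" by measurable
  from measurable_compose[OF this(1) \<rho>_measurable] measurable_compose[OF this(2) \<rho>_measurable]
  show "\<rho> t \<in> borel_measurable borel" "(\<lambda>t. \<rho> t z) \<in> borel_measurable borel" by simp_all
qed

lemma good_tendsto: assumes "good t z" shows "(\<lambda>k. dens (r k) t z) \<longlonglongrightarrow> \<rho> t z"
proof -
  have lim: "(\<lambda>k. dens (r k) t z) \<longlonglongrightarrow> lim (\<lambda>k. dens (r k) t z)"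
    using assms unfolding good_def by (simp add: Cauchy_convergent_iff convergent_LIMSEQ_iff)
  moreover have "lim (\<lambda>k. dens (r k) t z) \<in> {0..\<rho>max}"
    using closed_sequentially[OF closed_atLeastAtMost _ lim] dens_range[OF r_pos] by blast
  ultimately show ?thesis by (simp add: \<rho>_def)
qed

lemma AE_good: "AE z in lborel. good t z"
proof -
  have nonneg: "AE z in lborel. good t z" if t: "0 \<le> t" for t
    unfolding good_def
  proof (rule AE_Cauchy_of_fast_windows)
    show "integrable lborel (\<lambda>z. indicator {-M..M} z * dens (r k) t z)" for k M
      by (rule dens_window_integrable[OF r_pos])
    fix m assume "nat \<lceil>t\<rceil> \<le> m"
    then have "t \<in> {0..real m}" using t by (auto simp: nat_le_iff ceiling_le_iff)
    then show "(LINT z:{-real m..real m}|lborel. \<bar>dens (r (Suc m)) t z - dens (r m) t z\<bar>) \<le> (1/2)^m"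
      by (rule fast)
  qed
  have "dens n t = dens n (max t 0)" for n by (simp add: dens_def[abs_def])
  then have "good t = good (max t 0)" by (simp add: good_def[abs_def])
  then show ?thesis using nonneg[of "max t 0"] by simp
qed

lemma AE_tendsto: "AE z in lborel. (\<lambda>k. dens (r k) t z) \<longlonglongrightarrow> \<rho> t z"
  using AE_good by (rule eventually_mono) (rule good_tendsto)

lemma window_tendsto:
  fixes f :: "nat \<Rightarrow> real \<Rightarrow> real"
  assumes [measurable]: "\<And>k. f k \<in> borel_measurable borel" "f' \<in> borel_measurable borel"
    and B: "\<And>k z. \<bar>f k z\<bar> \<le> B" and lim: "AE z in lborel. (\<lambda>k. f k z) \<longlonglongrightarrow> f' z"
  shows "(\<lambda>k. LINT z:{a..b}|lborel. f k z) \<longlonglongrightarrow> (LINT z:{a..b}|lborel. f' z)"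
  unfolding set_lebesgue_integral_def
proof (rule integral_dominated_convergence)
  show "integrable lborel (\<lambda>z. B * indicator {a..b} z)" by (intro integrable_mult_right integrable_indicator_Icc)
  have "0 \<le> B" using B[of 0 0] by linarith
  then show "AE z in lborel. norm (indicat_real {a..b} z *\<^sub>R f k z) \<le> B * indicator {a..b} z" for k
    using B by (intro AE_I2) (auto simp: indicator_def)
  show "AE z in lborel. (\<lambda>k. indicat_real {a..b} z *\<^sub>R f k z) \<longlonglongrightarrow> indicat_real {a..b} z *\<^sub>R f' z"
    using lim by eventually_elim (intro tendsto_intros)
qed measurable

lemma dens_abs_le: "\<bar>dens (r k) t z\<bar> \<le> \<rho>max"
  using dens_range[OF r_pos, of k t z] by auto

lemma \<rho>_abs_le: "\<bar>\<rho> t z\<bar> \<le> \<rho>max"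
  using \<rho>_range[of t z] by auto

lemma mass_tendsto: "(\<lambda>k. mass (r k) t z) \<longlonglongrightarrow> g (t, z)"
  using tendsto_uniform_limitI[OF mass_uniform[of "{(t, z)}"]] by auto

lemma \<rho>_LINT: assumes "a \<le> b" shows "(LINT z:{a..b}|lborel. \<rho> t z) = g (t, b) - g (t, a)"
proof (rule LIMSEQ_unique)
  show "(\<lambda>k. LINT z:{a..b}|lborel. dens (r k) t z) \<longlonglongrightarrow> (LINT z:{a..b}|lborel. \<rho> t z)"
    by (rule window_tendsto[OF _ _ dens_abs_le AE_tendsto]) measurable
  show "(\<lambda>k. LINT z:{a..b}|lborel. dens (r k) t z) \<longlonglongrightarrow> g (t, b) - g (t, a)"
    unfolding dens_LINT[OF r_pos assms] by (intro tendsto_diff mass_tendsto)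
qed

lemma \<rho>_outside: assumes "0 \<le> t" shows "AE z in lborel. 1 + v 0 * t < \<bar>z\<bar> \<longrightarrow> \<rho> t z = 0"
  using AE_tendsto[of t]
proof eventually_elim
  case (elim z)
  then show ?case using dens_outside[OF r_pos assms] LIMSEQ_unique[OF elim, of 0] by auto
qed

lemma unit_mass_r: "(\<lambda>k. unit_mass (r k)) \<longlonglongrightarrow> 0"
proof -
  have "(\<lambda>n. unit_mass n) \<longlonglongrightarrow> 0" using unit_mass_tendsto by (rule LIMSEQ_imp_Suc)
  from LIMSEQ_subseq_LIMSEQ[OF this r_mono] show ?thesis by (simp add: o_def)
qed

lemma unit_mass_nonneg: "0 \<le> unit_mass n"
  using \<rho>0_mass by (simp add: particle_mass_def)

lemma \<rho>_L1_distance: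
  assumes T: "s \<in> {0..T}" "t \<in> {0..T}" "0 < T" and h: "0 < h" "h \<le> 1"
  shows "(LINT z:{-1..1}|lborel. \<bar>\<rho> s z - \<rho> t z\<bar>) \<le> 2 * tv_bound T * h + 4 * (\<rho>max * v 0 * \<bar>s - t\<bar>) / h"
proof (rule LIMSEQ_le)
  show "(\<lambda>k. LINT z:{-1..1}|lborel. \<bar>dens (r k) s z - dens (r k) t z\<bar>) \<longlonglongrightarrow> (LINT z:{-1..1}|lborel. \<bar>\<rho> s z - \<rho> t z\<bar>)"
  proof (rule window_tendsto)
    show "\<bar>\<bar>dens (r k) s z - dens (r k) t z\<bar>\<bar> \<le> 2 * \<rho>max" for k z
      using dens_abs_le[of k s z] dens_abs_le[of k t z] by linarith
    show "AE z in lborel. (\<lambda>k. \<bar>dens (r k) s z - dens (r k) t z\<bar>) \<longlonglongrightarrow> \<bar>\<rho> s z - \<rho> t z\<bar>"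
      using AE_tendsto[of s] AE_tendsto[of t] by eventually_elim (intro tendsto_intros)
  qed measurable
  show "(\<lambda>k. 2 * tv_bound T * h + 4 * 1 * (\<rho>max * v 0 * \<bar>s - t\<bar> + unit_mass (r k)) / h)
      \<longlonglongrightarrow> 2 * tv_bound T * h + 4 * (\<rho>max * v 0 * \<bar>s - t\<bar>) / h"
    using h(1) by (auto intro!: tendsto_eq_intros unit_mass_r)
  show "\<exists>N. \<forall>k\<ge>N. (LINT z:{-1..1}|lborel. \<bar>dens (r k) s z - dens (r k) t z\<bar>)
      \<le> 2 * tv_bound T * h + 4 * 1 * (\<rho>max * v 0 * \<bar>s - t\<bar> + unit_mass (r k)) / h"
  proof (intro exI allI impI)
    fix k
    show "(LINT z:{-1..1}|lborel. \<bar>dens (r k) s z - dens (r k) t z\<bar>)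
      \<le> 2 * tv_bound T * h + 4 * 1 * (\<rho>max * v 0 * \<bar>s - t\<bar> + unit_mass (r k)) / h"
    proof (rule dens_L1_distance[OF r_pos r_pos T])
      show "\<bar>mass (r k) s z - mass (r k) t z\<bar> \<le> \<rho>max * v 0 * \<bar>s - t\<bar> + unit_mass (r k)" for z
        using mass_Lipschitz[OF r_pos, of k s z t z] by simp
    qed (use h in auto)
  qed
qed

lemma g_initial: "g (0, z) = initial_mass_left z"
proof (rule LIMSEQ_unique[OF mass_tendsto])
  have "(\<lambda>k. mass (r k) 0 z - initial_mass_left z) \<longlonglongrightarrow> 0"
    by (rule tendsto_0_le[OF unit_mass_r, of _ 1])
      (use mass_initial[OF r_pos] unit_mass_nonneg in \<open>auto intro!: always_eventually\<close>)
  then show "(\<lambda>k. mass (r k) 0 z) \<longlonglongrightarrow> initial_mass_left z" by (simp add: LIM_zero_iff)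
qed

text \<open>Both sides have the same mass to the left of each point.\<close>

lemma initial_density: "AE z in lebesgue. \<rho> 0 z = zero_extension \<rho>0 z"
proof -
  obtain w where [measurable]: "w \<in> borel_measurable lborel" and w: "AE z in lborel. zero_extension \<rho>0 z = w z"
    using completion_ex_borel_measurable_real[OF ext_measurable] by blast
  have w': "AE z in lebesgue. zero_extension \<rho>0 z = w z" using w by (rule AE_completion)
  define w1 where "w1 z = indicator {-1..1} z * max 0 (min \<rho>max (w z))" for z
  have w1m [measurable]: "w1 \<in> borel_measurable borel" unfolding w1_def[abs_def] by measurable
  have w1: "AE z in lebesgue. zero_extension \<rho>0 z = w1 z"
    using w' ext_range
  proof eventually_elim
    case (elim z)
    have wz: "w z = zero_extension \<rho>0 z" using elim by simp
    show ?case
    proof (cases "z \<in> {-1..1}")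
      case True
      then show ?thesis using elim(2) by (simp add: w1_def wz min_absorb2 max_absorb2)
    next
      case False
      then have "zero_extension \<rho>0 z = 0" by (auto simp: zero_extension_def)
      then show ?thesis using False by (simp add: w1_def)
    qed
  qed
  define p where "p z = indicator {-1..1} z * \<rho> 0 z" for z
  have pm [measurable]: "p \<in> borel_measurable borel" unfolding p_def[abs_def] by measurable
  have p_out: "AE z in lborel. p z = \<rho> 0 z"
    using \<rho>_outside[of 0, OF order_refl]
  proof eventually_elim
    case (elim z)
    show ?case
    proof (cases "z \<in> {-1..1}")
      case False
      then have "1 + v 0 * 0 < \<bar>z\<bar>" by auto
      then show ?thesis using elim False by (simp add: p_def)
    qed (simp add: p_def)
  qed
  have p_int: "integrable lborel p"
    using set_integrable_Icc_bounded[of "\<rho> 0" "-1" 1 \<rho>max] \<rho>_abs_le by (auto simp: p_def[abs_def] set_integrable_def)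
  have w1_int: "integrable lborel w1"
    using set_integrable_Icc_bounded[of "\<lambda>z. max 0 (min \<rho>max (w z))" "-1" 1 \<rho>max] \<rho>max_pos
    by (auto simp: w1_def[abs_def] set_integrable_def)
  have "AE z in lborel. p z = w1 z"
  proof (rule AE_eq_of_interval_integrals[OF p_int _ w1_int])
    show "0 \<le> p z" "0 \<le> w1 z" for z using \<rho>_range[of 0 z] by (auto simp: p_def w1_def indicator_def)
    fix a :: real
    define b where "b = max a 1 + 1"
    have ab: "a \<le> b" by (simp add: b_def)
    have conv: "(LINT z:{a<..}|lborel. f z) = (LINT z:{a..b}|lborel. f z)"
      if [measurable]: "f \<in> borel_measurable borel" and "\<And>z. 1 < z \<Longrightarrow> f z = 0" for f :: "real \<Rightarrow> real"
      unfolding set_lebesgue_integral_def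
    proof (rule integral_cong_AE)
      show "AE z in lborel. indicat_real {a<..} z *\<^sub>R f z = indicat_real {a..b} z *\<^sub>R f z"
        using AE_lborel_singleton[of a]
      proof eventually_elim
        case (elim z)
        show ?case
        proof (cases "z \<le> b")
          case True
          then have "indicat_real {a<..} z = indicat_real {a..b} z" using elim by (auto simp: indicator_def)
          then show ?thesis by simp
        next
          case False
          then have "1 < z" by (simp add: b_def)
          then show ?thesis using that(2) by simp
        qed
      qed
    qed measurable
    have "(LINT z:{a<..}|lborel. p z) = (LINT z:{a..b}|lborel. p z)" by (rule conv) (auto simp: p_def)
    also have "\<dots> = (LINT z:{a..b}|lborel. \<rho> 0 z)"
      unfolding set_lebesgue_integral_def
    proof (rule integral_cong_AE)
      show "AE z in lborel. indicat_real {a..b} z *\<^sub>R p z = indicat_real {a..b} z *\<^sub>R \<rho> 0 z"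
        using p_out by eventually_elim simp
    qed measurable
    also have "\<dots> = initial_mass_left b - initial_mass_left a" by (simp add: \<rho>_LINT[OF ab] g_initial)
    also have "\<dots> = (LINT z:{a..b}|lebesgue. zero_extension \<rho>0 z)" by (rule initial_mass_diff[OF ab, symmetric])
    also have "\<dots> = (LINT z:{a..b}|lebesgue. w1 z)"
      unfolding set_lebesgue_integral_def using w1
    proof (intro integral_cong_AE borel_measurable_integrable[OF ext_set_integrable[unfolded set_integrable_def]])
      have "(\<lambda>z. indicat_real {a..b} z *\<^sub>R w1 z) \<in> borel_measurable lborel" by measurable
      then show "(\<lambda>z. indicat_real {a..b} z *\<^sub>R w1 z) \<in> borel_measurable lebesgue" by (rule measurable_completion)
      show "AE z in lebesgue. indicat_real {a..b} z *\<^sub>R zero_extension \<rho>0 z = indicat_real {a..b} z *\<^sub>R w1 z"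
        using w1 by eventually_elim simp
    qed simp
    also have "\<dots> = (LINT z:{a..b}|lborel. w1 z)"
      unfolding set_lebesgue_integral_def by (rule lebesgue_integral_eq_lborel) measurable
    also have "\<dots> = (LINT z:{a<..}|lborel. w1 z)" by (rule conv[symmetric]) (auto simp: w1_def)
    finally show "(LINT z:{a<..}|lborel. p z) = (LINT z:{a<..}|lborel. w1 z)" .
  qed
  with p_out have "AE z in lborel. \<rho> 0 z = w1 z" by eventually_elim simp
  then have "AE z in lebesgue. \<rho> 0 z = w1 z" by (rule AE_completion)
  with w1 show ?thesis by eventually_elim simp
qed


lemma g_lip_time: "\<bar>g (t, a) - g (s, a)\<bar> \<le> (\<rho>max * v 0 + \<rho>max) * \<bar>t - s\<bar>"
  using g_Lipschitz[of "(t, a)" "(s, a)"] by (simp add: dist_Pair_Pair dist_real_def)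

lemma g_mono: "a \<le> b \<Longrightarrow> g (t, a) \<le> g (t, b)"
  by (rule LIMSEQ_le[OF mass_tendsto mass_tendsto]) (use mass_mono[OF r_pos] in auto)

text \<open>If \<open>\<zeta>\<^sup>j(t) > \<zeta>\<^sup>k(t)\<close>, then the turning equations of both schemes and the monotonicity of the mass bound twice the
difference by the distance of the masses and by the errors of both equations.\<close>

lemma turn_uniform: "uniform_limit {0..T} (\<lambda>k. turn (r k)) \<xi> sequentially"
proof -
  have "uniformly_Cauchy_on {0..T} (\<lambda>k. turn (r k))"
  proof (rule uniformly_Cauchy_onI)
    fix e :: real assume e: "0 < e"
    define \<epsilon> where "\<epsilon> = e / (8 * (\<alpha> + 1))"
    have \<epsilon>: "0 < \<epsilon>" "\<alpha> * \<epsilon> \<le> e / 8" using e \<alpha>0 by (auto simp: \<epsilon>_def field_simps)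
    have "compact ({0..T} \<times> {-1..1::real})" by (intro compact_Times) auto
    from uniform_limitD[OF mass_uniform[OF this] \<epsilon>(1)] obtain N1 where
      N1: "\<And>k p. k \<ge> N1 \<Longrightarrow> p \<in> {0..T} \<times> {-1..1} \<Longrightarrow> dist (mass (r k) (fst p) (snd p)) (g p) < \<epsilon>"
      unfolding eventually_sequentially by blast
    obtain N2 where N2: "\<And>k. k \<ge> N2 \<Longrightarrow> \<bar>unit_mass (r k)\<bar> < \<epsilon>"
      using LIMSEQ_D[OF unit_mass_r \<epsilon>(1)] by auto
    have half: "turn (r j) t - turn (r k) t < e" if jk: "max N1 N2 \<le> j" "max N1 N2 \<le> k" and t: "t \<in> {0..T}" for j k t
    proof (cases "turn (r j) t \<le> turn (r k) t")
      case True then show ?thesis using e by simp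
    next
      case False
      let ?a = "turn (r j) t" and ?b = "turn (r k) t"
      have diff: "\<bar>mass (r j) t z - mass (r k) t z\<bar> \<le> 2 * \<epsilon>" if "z \<in> {-1..1}" for z
      proof -
        have "(t, z) \<in> {0..T} \<times> {-1..1}" using t that by simp
        with N1[of j "(t, z)"] N1[of k "(t, z)"] jk show ?thesis by (auto simp: dist_real_def)
      qed
      have "mass (r j) t ?b \<le> mass (r j) t ?a" using False by (intro mass_mono r_pos) auto
      then have up: "2 * mass (r k) t ?b - mass (r k) t (-1) - mass (r k) t 1 - (2 * mass (r j) t ?a - mass (r j) t (-1) - mass (r j) t 1) \<le> 8 * \<epsilon>"
        using diff[of ?b] diff[of "-1"] diff[of 1] turn_bounds(1)[OF r_pos, of k t] by (auto simp: abs_le_iff)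
      have "\<alpha> * (2 * mass (r k) t ?b - mass (r k) t (-1) - mass (r k) t 1) - \<alpha> * (2 * mass (r j) t ?a - mass (r j) t (-1) - mass (r j) t 1) \<le> \<alpha> * (8 * \<epsilon>)"
        using mult_left_mono[OF up \<alpha>0] by (simp add: right_diff_distrib)
      moreover have "\<alpha> * unit_mass (r j) \<le> \<alpha> * \<epsilon>" "\<alpha> * unit_mass (r k) \<le> \<alpha> * \<epsilon>"
        using N2[of j] N2[of k] jk \<alpha>0 by (auto intro!: mult_left_mono)
      ultimately have "2 * ?a - 2 * ?b \<le> 12 * (\<alpha> * \<epsilon>)"
        using turn_bounds(2)[OF r_pos, of j t] turn_bounds(2)[OF r_pos, of k t] by (simp add: abs_le_iff)
      then show ?thesis using \<epsilon>(2) e by linarith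
    qed
    show "\<exists>M. \<forall>x\<in>{0..T}. \<forall>m\<ge>M. \<forall>n\<ge>M. dist (turn (r m) x) (turn (r n) x) < e"
    proof (intro exI[of _ "max N1 N2"] ballI allI impI)
      fix t m n assume "t \<in> {0..T}" "max N1 N2 \<le> m" "max N1 N2 \<le> n"
      then show "dist (turn (r m) t) (turn (r n) t) < e" using half[of m n t] half[of n m t] by (auto simp: dist_real_def abs_less_iff)
    qed
  qed
  then have "uniformly_convergent_on {0..T} (\<lambda>k. turn (r k))" by (rule Cauchy_uniformly_convergent)
  then show ?thesis unfolding \<xi>_def[abs_def] by (simp add: uniformly_convergent_uniform_limit_iff)
qed

lemma turn_tendsto: "(\<lambda>k. turn (r k) t) \<longlonglongrightarrow> \<xi> t"
proof -
  have "(\<lambda>k. turn (r k) (max t 0)) \<longlonglongrightarrow> \<xi> (max t 0)"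
    using tendsto_uniform_limitI[OF turn_uniform[of "max t 0"]] by auto
  then show ?thesis by (simp add: turn_def \<xi>_def)
qed

lemma turning_equation: "2 * \<xi> t + \<alpha> * (2 * g (t, \<xi> t) - g (t, -1) - g (t, 1)) = 0"
proof (rule LIMSEQ_unique)
  have "(\<lambda>k. mass (r k) t (turn (r k) t) - mass (r k) t (\<xi> t)) \<longlonglongrightarrow> 0"
  proof (rule tendsto_0_le)
    show "(\<lambda>k. turn (r k) t - \<xi> t) \<longlonglongrightarrow> 0" using turn_tendsto by (simp add: LIM_zero_iff)
    show "\<forall>\<^sub>F k in sequentially. norm (mass (r k) t (turn (r k) t) - mass (r k) t (\<xi> t)) \<le> norm (turn (r k) t - \<xi> t) * \<rho>max"
      using mass_space[OF r_pos] by (intro always_eventually) (simp add: mult.commute)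
  qed
  from tendsto_add[OF this mass_tendsto[of t "\<xi> t"]]
  have "(\<lambda>k. mass (r k) t (turn (r k) t)) \<longlonglongrightarrow> g (t, \<xi> t)" by simp
  then show "(\<lambda>k. 2 * turn (r k) t + \<alpha> * (2 * mass (r k) t (turn (r k) t) - mass (r k) t (-1) - mass (r k) t 1))
      \<longlonglongrightarrow> 2 * \<xi> t + \<alpha> * (2 * g (t, \<xi> t) - g (t, -1) - g (t, 1))"
    by (intro tendsto_intros turn_tendsto mass_tendsto)
  show "(\<lambda>k. 2 * turn (r k) t + \<alpha> * (2 * mass (r k) t (turn (r k) t) - mass (r k) t (-1) - mass (r k) t 1)) \<longlonglongrightarrow> 0"
  proof (rule tendsto_0_le[OF unit_mass_r])
    show "\<forall>\<^sub>F k in sequentially. norm (2 * turn (r k) t + \<alpha> * (2 * mass (r k) t (turn (r k) t) - mass (r k) t (-1) - mass (r k) t 1))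
        \<le> norm (unit_mass (r k)) * (2 * \<alpha>)"
      using turn_bounds(2)[OF r_pos] unit_mass_nonneg by (intro always_eventually) (simp add: mult_ac)
  qed
qed

lemma \<xi>_range: "-1 < \<xi> t" "\<xi> t < 1"
proof -
  have "\<xi> t \<in> {-1..1}"
    using closed_sequentially[OF closed_atLeastAtMost _ turn_tendsto[of t]] turn_bounds(1)[OF r_pos] by blast
  moreover have "\<xi> t \<noteq> 1"
  proof
    assume "\<xi> t = 1"
    then have "2 + \<alpha> * (g (t, 1) - g (t, -1)) = 0" using turning_equation[of t] by simp
    moreover have "0 \<le> \<alpha> * (g (t, 1) - g (t, -1))" using \<alpha>0 g_mono[of "-1" 1 t] by simp
    ultimately show False by simp
  qed
  moreover have "\<xi> t \<noteq> -1"
  proof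
    assume "\<xi> t = -1"
    then have "\<alpha> * (g (t, 1) - g (t, -1)) = - 2" using turning_equation[of t] by (simp add: algebra_simps)
    moreover have "0 \<le> \<alpha> * (g (t, 1) - g (t, -1))" using \<alpha>0 g_mono[of "-1" 1 t] by simp
    ultimately show False by simp
  qed
  ultimately show "-1 < \<xi> t" "\<xi> t < 1" by auto
qed

text \<open>The slope of the turning equation in \<open>\<xi>\<close> is at least \<open>2\<close>, and its time dependence is Lipschitz.\<close>

lemma \<xi>_Lipschitz: "\<bar>\<xi> t - \<xi> s\<bar> \<le> (2 * \<alpha> * (\<rho>max * v 0 + \<rho>max)) * \<bar>t - s\<bar>"
proof -
  have *: "\<xi> t - \<xi> s \<le> (2 * \<alpha> * (\<rho>max * v 0 + \<rho>max)) * \<bar>t - s\<bar>" for t s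
  proof (cases "\<xi> t \<le> \<xi> s")
    case True
    moreover have "0 \<le> (2 * \<alpha> * (\<rho>max * v 0 + \<rho>max)) * \<bar>t - s\<bar>" using \<alpha>0 \<rho>max_pos v_0_pos by auto
    ultimately show ?thesis by linarith
  next
    case False
    let ?K = "\<rho>max * v 0 + \<rho>max"
    have "g (t, \<xi> s) \<le> g (t, \<xi> t)" using False by (intro g_mono) auto
    then have "(2 * g (s, \<xi> s) - g (s, -1) - g (s, 1)) - (2 * g (t, \<xi> t) - g (t, -1) - g (t, 1)) \<le> 4 * (?K * \<bar>t - s\<bar>)"
      using g_lip_time[of t "\<xi> s" s] g_lip_time[of t "-1" s] g_lip_time[of t 1 s] by (simp only: abs_le_iff) linarith
    from mult_left_mono[OF this \<alpha>0]
    have "\<alpha> * (2 * g (s, \<xi> s) - g (s, -1) - g (s, 1)) - \<alpha> * (2 * g (t, \<xi> t) - g (t, -1) - g (t, 1)) \<le> \<alpha> * (4 * (?K * \<bar>t - s\<bar>))"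
      by (simp only: right_diff_distrib)
    then show ?thesis using turning_equation[of t] turning_equation[of s] by (simp add: algebra_simps)
  qed
  show ?thesis using *[of t s] *[of s t] by (auto simp: abs_le_iff abs_minus_commute)
qed

lemma \<xi>_measurable [measurable]: "\<xi> \<in> borel_measurable borel"
proof -
  have [measurable]: "turn (r k) \<in> borel_measurable borel" for k by (rule turn_measurable[OF r_pos])
  show ?thesis unfolding \<xi>_def[abs_def] by measurable
qed

lemma turning_condition_limit: "turning_condition (\<lambda>u. 1 + \<alpha> * u) \<rho> \<xi>"
proof -
  have cost: "(LINT y:{a<..<b}|lebesgue. 1 + \<alpha> * \<rho> t y) = (b - a) + \<alpha> * (g (t, b) - g (t, a))" if ab: "a \<le> b" for a b t
  proof -
    have "(LINT y:{a<..<b}|lebesgue. 1 + \<alpha> * \<rho> t y) = (LINT y:{a<..<b}|lborel. 1 + \<alpha> * \<rho> t y)"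
      unfolding set_lebesgue_integral_def by (rule lebesgue_integral_eq_lborel) measurable
    also have "\<dots> = (LINT y:{a..b}|lborel. 1 + \<alpha> * \<rho> t y)"
      unfolding set_lebesgue_integral_def
    proof (rule integral_cong_AE)
      show "AE y in lborel. indicat_real {a<..<b} y *\<^sub>R (1 + \<alpha> * \<rho> t y) = indicat_real {a..b} y *\<^sub>R (1 + \<alpha> * \<rho> t y)"
        using AE_lborel_singleton[of a] AE_lborel_singleton[of b] by eventually_elim (auto simp: indicator_def)
    qed measurable
    also have "\<dots> = (LINT y:{a..b}|lborel. 1) + (LINT y:{a..b}|lborel. \<alpha> * \<rho> t y)"
    proof (rule set_integral_add(2))
      show "set_integrable lborel {a..b} (\<lambda>y. 1)" by (simp add: set_integrable_def integrable_indicator_Icc)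
      show "set_integrable lborel {a..b} (\<lambda>y. \<alpha> * \<rho> t y)"
        by (rule set_integrable_mult_right) (rule set_integrable_Icc_bounded[OF \<rho>_slices(1) \<rho>_abs_le])
    qed
    also have "(LINT y:{a..b}|lborel. \<alpha> * \<rho> t y) = \<alpha> * (g (t, b) - g (t, a))" by (simp add: \<rho>_LINT[OF ab])
    also have "(LINT y:{a..b}|lborel. 1) = b - a" using ab by (simp add: set_lebesgue_integral_def)
    finally show ?thesis .
  qed
  show ?thesis unfolding turning_condition_def
  proof (intro AE_I2 impI)
    fix t :: real
    show "(LINT y:{-1<..<\<xi> t}|lebesgue. 1 + \<alpha> * \<rho> t y) = (LINT y:{\<xi> t<..<1}|lebesgue. 1 + \<alpha> * \<rho> t y)"
      using cost[of "-1" "\<xi> t" t] cost[of "\<xi> t" 1 t] \<xi>_range[of t] turning_equation[of t]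
      by (simp add: algebra_simps)
  qed
qed

end

section \<open>The Kruzkov inequality of the limit\<close>

lemma (in test_function) outside_window: "z \<notin> {-M..M} \<Longrightarrow> \<phi> t z = 0 \<and> \<phi>t t z = 0 \<and> \<phi>x t z = 0"
  by (rule \<phi>_support) auto

context convergent_schemes
begin

text \<open>All terms converge by dominated convergence; the sign \<open>sgn (z - \<xi> t)\<close> converges except at the single point
\<open>z = \<xi> t\<close>.\<close>

lemma limit_entropy_inequality:
  assumes "entropy_test \<rho>max v \<phi> \<phi>t \<phi>x T M \<kappa>"
  shows "0 \<le> (LINT t:{0..T}|lborel. entropy_test.production v \<phi> \<phi>t \<phi>x \<kappa> (\<rho> t) (\<xi> t) t)
      + (LINT z|lborel. (\<bar>\<rho> 0 z - \<kappa>\<bar> - \<kappa>) * \<phi> 0 z)"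
proof -
  interpret entropy_test \<rho>max v \<phi> \<phi>t \<phi>x T M \<kappa> by fact
  obtain K where K: "0 \<le> K" "\<And>r s. r \<in> {0..\<rho>max} \<Longrightarrow> s \<in> {0..\<rho>max} \<Longrightarrow> \<bar>v r - v s\<bar> \<le> K * \<bar>r - s\<bar>"
    using v_Lipschitz by blast
  obtain B where B: "0 < B" "\<And>t x. t \<in> {0..T} \<Longrightarrow> \<bar>\<phi> t x\<bar> \<le> B \<and> \<bar>\<phi>t t x\<bar> \<le> B \<and> \<bar>\<phi>x t x\<bar> \<le> B"
    by (rule test_bound) (rule that)
  have scheme_ineq: "- (LINT z|lborel. (\<bar>dens (r k) 0 z - \<kappa>\<bar> - \<kappa>) * \<phi> 0 z)
      - T * (B * unit_mass (r k) * (K * tv_bound T + 2 * v 0))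
    \<le> (LINT t:{0..T}|lborel. production (dens (r k) t) (turn (r k) t) t)" for k
  proof -
    interpret s: scheme \<rho>max v \<rho>0 \<alpha> "r k" "x (r k)" "\<zeta> (r k)" by (rule scheme[OF r_pos])
    interpret st: scheme_test \<rho>max v \<phi> \<phi>t \<phi>x T M \<kappa> \<rho>0 \<alpha> "r k" "x (r k)" "\<zeta> (r k)" ..
    have D: "s.U (max t 0) = dens (r k) t" for t by (simp add: dens_def[abs_def] s.l_def)
    have D0: "s.U 0 = dens (r k) 0" using D[of 0] by simp
    have "- (LINT z|lborel. (\<bar>s.U 0 z - \<kappa>\<bar> - \<kappa>) * \<phi> 0 z) - T * (B * s.l * (K * tv_bound T + 2 * v 0))
      \<le> (LINT t:{0..T}|lborel. production (s.U (max t 0)) (\<zeta> (r k) (max t 0)) t)"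
    proof (rule st.scheme_entropy_inequality[OF K])
      fix t assume t: "t \<in> {0..T}"
      show "(\<Sum>i\<le>r k. \<bar>configuration.jump (r k) s.l (\<lambda>i. x (r k) i t) i\<bar>) \<le> tv_bound T"
        using jumps_bound[OF r_pos t T_pos, of k] t by (simp add: jumps_def s.l_def)
    qed (use B in auto)
    from this[unfolded D D0 turn_def[symmetric], unfolded s.l_def] show ?thesis .
  qed
  have prod_bound: "\<bar>production (dens (r k) t) (turn (r k) t) t\<bar> \<le> (2 * \<rho>max + \<rho>max * v 0) * B * (2 * M) + 2 * (\<rho>max * v 0) * B"
    (is "_ \<le> ?D") if "t \<in> {0..T}" for k t
    by (rule production_bound(2)[OF dens_range[OF r_pos] dens_slice B(2)[OF that]])
  have D0: "0 \<le> ?D" using \<rho>max_pos v_0_pos M_pos B(1) by auto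
  have pm [measurable]: "(\<lambda>t. production (dens (r k) t) (turn (r k) t) t) \<in> borel_measurable borel" for k
    by (rule production_measurable[OF dens_range[OF r_pos] dens_measurable[OF r_pos] turn_measurable[OF r_pos]])
  have pm' [measurable]: "(\<lambda>t. production (\<rho> t) (\<xi> t) t) \<in> borel_measurable borel"
    by (rule production_measurable[OF \<rho>_range \<rho>_measurable \<xi>_measurable])
  have rhs: "(\<lambda>k. LINT t:{0..T}|lborel. production (dens (r k) t) (turn (r k) t) t)
      \<longlonglongrightarrow> (LINT t:{0..T}|lborel. production (\<rho> t) (\<xi> t) t)"
    unfolding set_lebesgue_integral_def
  proof (rule integral_dominated_convergence)
    show "integrable lborel (\<lambda>t. ?D * indicator {0..T} t)" by (intro integrable_mult_right integrable_indicator_Icc)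
    show "AE t in lborel. norm (indicat_real {0..T} t *\<^sub>R production (dens (r k) t) (turn (r k) t) t) \<le> ?D * indicator {0..T} t" for k
      using prod_bound by (intro AE_I2) (auto simp: indicator_def)
    show "AE t in lborel. (\<lambda>k. indicat_real {0..T} t *\<^sub>R production (dens (r k) t) (turn (r k) t) t)
        \<longlonglongrightarrow> indicat_real {0..T} t *\<^sub>R production (\<rho> t) (\<xi> t) t"
    proof (rule AE_I2)
      fix t
      show "(\<lambda>k. indicat_real {0..T} t *\<^sub>R production (dens (r k) t) (turn (r k) t) t)
        \<longlonglongrightarrow> indicat_real {0..T} t *\<^sub>R production (\<rho> t) (\<xi> t) t"
      proof (cases "t \<in> {0..T}")
        case True
        have "(\<lambda>k. production (dens (r k) t) (turn (r k) t) t) \<longlonglongrightarrow> production (\<rho> t) (\<xi> t) t"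
          by (rule production_tendsto[OF dens_range[OF r_pos] \<rho>_range dens_slice \<rho>_slices(1) AE_tendsto turn_tendsto B(2)[OF True]])
        then show ?thesis using True by simp
      qed simp
    qed
  qed measurable
  have window: "(LINT z|lborel. (\<bar>u z - \<kappa>\<bar> - \<kappa>) * \<phi> 0 z) = (LINT z:{-M..M}|lborel. (\<bar>u z - \<kappa>\<bar> - \<kappa>) * \<phi> 0 z)" for u :: "real \<Rightarrow> real"
    unfolding set_lebesgue_integral_def
  proof (rule Bochner_Integration.integral_cong[OF refl])
    fix z
    show "(\<bar>u z - \<kappa>\<bar> - \<kappa>) * \<phi> 0 z = indicat_real {-M..M} z *\<^sub>R ((\<bar>u z - \<kappa>\<bar> - \<kappa>) * \<phi> 0 z)"
      using outside_window[of z 0] by (cases "z \<in> {-M..M}") simp_all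
  qed
  have ini: "(\<lambda>k. LINT z|lborel. (\<bar>dens (r k) 0 z - \<kappa>\<bar> - \<kappa>) * \<phi> 0 z) \<longlonglongrightarrow> (LINT z|lborel. (\<bar>\<rho> 0 z - \<kappa>\<bar> - \<kappa>) * \<phi> 0 z)"
    unfolding window
  proof (rule window_tendsto)
    show "\<bar>(\<bar>dens (r k) 0 z - \<kappa>\<bar> - \<kappa>) * \<phi> 0 z\<bar> \<le> (2 * \<rho>max) * B" for k z
      unfolding abs_mult using dens_range[OF r_pos, of k 0 z] \<kappa> B(2)[of 0 z] T_pos by (intro mult_mono) auto
    show "AE z in lborel. (\<lambda>k. (\<bar>dens (r k) 0 z - \<kappa>\<bar> - \<kappa>) * \<phi> 0 z) \<longlonglongrightarrow> (\<bar>\<rho> 0 z - \<kappa>\<bar> - \<kappa>) * \<phi> 0 z"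
      using AE_tendsto[of 0] by eventually_elim (intro tendsto_intros)
  qed measurable
  have "(\<lambda>k. - (LINT z|lborel. (\<bar>dens (r k) 0 z - \<kappa>\<bar> - \<kappa>) * \<phi> 0 z) - T * (B * unit_mass (r k) * (K * tv_bound T + 2 * v 0)))
      \<longlonglongrightarrow> - (LINT z|lborel. (\<bar>\<rho> 0 z - \<kappa>\<bar> - \<kappa>) * \<phi> 0 z) - T * (B * 0 * (K * tv_bound T + 2 * v 0))"
    by (intro tendsto_intros ini unit_mass_r)
  from LIMSEQ_le[OF this rhs] scheme_ineq show ?thesis by auto
qed

text \<open>A test function in the corridor that vanishes near the time \<open>0\<close> has no initial term.  The constant
\<open>\<kappa>\<close> subtracted in \<open>production\<close> contributes \<open>\<kappa> \<integral>\<integral> \<phi>\<^sub>t = 0\<close>.\<close>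

lemma entropy_inequality_limit: "entropy_inequality \<rho>max (flux v) \<rho> \<xi>"
  unfolding entropy_inequality_def
proof (intro ballI allI impI, elim conjE)
  fix \<kappa> and \<phi> :: "real \<times> real \<Rightarrow> real"
  assume \<kappa>: "\<kappa> \<in> {0..\<rho>max}" and smooth: "smooth \<phi>" and supp: "compactly_supported_in ({0<..} \<times> corridor) \<phi>"
    and nonneg: "\<forall>p. 0 \<le> \<phi> p"
  define f where "f t x = \<phi> (t, x)" for t x
  define ft where "ft t x = frechet_derivative \<phi> (at (t, x)) (1, 0)" for t x
  define fx where "fx t x = frechet_derivative \<phi> (at (t, x)) (0, 1)" for t x
  have "Ck 1 \<phi>" using smooth by (simp add: smooth_def)
  then have diff: "\<phi> differentiable (at p)" and cont: "continuous_on UNIV (\<lambda>p. frechet_derivative \<phi> (at p) h)" for p h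
    unfolding One_nat_def Ck.simps by blast+
  have D: "(\<phi> has_derivative frechet_derivative \<phi> (at p)) (at p)" for p
    using diff frechet_derivative_works by blast
  interpret lin: bounded_linear "frechet_derivative \<phi> (at p)" for p using D by (rule has_derivative_bounded_linear)
  have d_t: "((\<lambda>s. f s x) has_real_derivative ft t x) (at t)" for t x
  proof -
    have "((\<lambda>s. (s, x)) has_derivative (\<lambda>h. (h, 0))) (at t)" by (auto intro!: derivative_eq_intros)
    from has_derivative_compose[OF this D]
    have "((\<lambda>s. f s x) has_derivative (\<lambda>h. frechet_derivative \<phi> (at (t, x)) (h, 0))) (at t)" by (simp add: f_def)
    moreover have "frechet_derivative \<phi> (at (t, x)) (h, 0) = ft t x * h" for h
      using lin.scaleR[of "(t, x)" h "(1, 0)"] by (simp add: ft_def)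
    ultimately show ?thesis by (simp add: has_field_derivative_def)
  qed
  have d_x: "((\<lambda>z. f t z) has_real_derivative fx t x) (at x)" for t x
  proof -
    have "((\<lambda>z. (t, z)) has_derivative (\<lambda>h. (0, h))) (at x)" by (auto intro!: derivative_eq_intros)
    from has_derivative_compose[OF this D]
    have "((\<lambda>z. f t z) has_derivative (\<lambda>h. frechet_derivative \<phi> (at (t, x)) (0, h))) (at x)" by (simp add: f_def)
    moreover have "frechet_derivative \<phi> (at (t, x)) (0, h) = fx t x * h" for h
      using lin.scaleR[of "(t, x)" h "(0, 1)"] by (simp add: fx_def)
    ultimately show ?thesis by (simp add: has_field_derivative_def)
  qed
  define S where "S = closure {p. \<phi> p \<noteq> 0}"
  have S: "compact S" "S \<subseteq> {0<..} \<times> corridor" using supp by (auto simp: compactly_supported_in_def S_def)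
  have outside: "f t x = 0 \<and> ft t x = 0 \<and> fx t x = 0" if "(t, x) \<notin> S" for t x
  proof -
    have "\<phi> (t, x) = 0" using that closure_subset[of "{p. \<phi> p \<noteq> 0}"] by (auto simp: S_def)
    moreover have "frechet_derivative \<phi> (at (t, x)) = (\<lambda>h. 0)"
    proof -
      have "open (- S)" using S(1) by (simp add: compact_imp_closed open_Compl)
      moreover have "\<phi> p = 0" if "p \<in> - S" for p
        using that closure_subset[of "{p. \<phi> p \<noteq> 0}"] by (auto simp: S_def)
      ultimately have "(\<phi> has_derivative (\<lambda>h. 0)) (at (t, x))"
        using has_derivative_transform_within_open[of "\<lambda>p. 0" "\<lambda>h. 0" "(t, x)" UNIV "- S" \<phi>] that
        by (auto intro: has_derivative_const)
      then show ?thesis by (rule frechet_derivative_at[symmetric])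
    qed
    ultimately show ?thesis by (simp add: f_def ft_def fx_def)
  qed
  obtain b where b: "0 < b" "\<And>p. p \<in> S \<Longrightarrow> norm p \<le> b"
    using compact_imp_bounded[OF S(1)] by (auto simp: bounded_pos)
  define T where "T = b + 1"
  define M where "M = T + 1"
  have T: "0 < T" "1 < M" "T \<le> M" using b by (auto simp: T_def M_def)
  have out: "(t, x) \<notin> S" if "T \<le> t \<or> M \<le> \<bar>x\<bar> \<or> t \<le> 0 \<or> x \<notin> corridor" for t x
  proof
    assume *: "(t, x) \<in> S"
    then have "norm (t, x) \<le> b" using b by auto
    then have "\<bar>t\<bar> \<le> b" "\<bar>x\<bar> \<le> b" using norm_fst_le[of t x] norm_snd_le[of x t] by auto
    then show False using that * S(2) by (auto simp: T_def M_def)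
  qed
  interpret entropy_test \<rho>max v f ft fx T M \<kappa>
  proof
    show "continuous_on UNIV (\<lambda>(t, x). f t x)"
    proof -
      have "continuous_on UNIV \<phi>" using D has_derivative_continuous continuous_at_imp_continuous_on by blast
      then show ?thesis by (simp add: f_def)
    qed
    show "continuous_on UNIV (\<lambda>(t, x). ft t x)" "continuous_on UNIV (\<lambda>(t, x). fx t x)"
      using cont[of "(1, 0)"] cont[of "(0, 1)"] by (simp_all add: ft_def fx_def)
    show "0 \<le> f t x" for t x using nonneg by (simp add: f_def)
    show "f t x = 0 \<and> ft t x = 0 \<and> fx t x = 0" if "T \<le> t \<or> M \<le> \<bar>x\<bar>" for t x
      using out[of t x] outside[of t x] that by blast
  qed (use T \<kappa> d_t d_x in auto)
  have entropy: "0 \<le> (LINT t:{0..T}|lborel. production (\<rho> t) (\<xi> t) t)"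
  proof -
    have "f 0 z = 0" for z using out[of 0 z] outside[of 0 z] by blast
    then show ?thesis using limit_entropy_inequality[OF entropy_test_axioms] by simp
  qed
  obtain B where B: "0 < B" "\<And>t x. t \<in> {0..T} \<Longrightarrow> \<bar>f t x\<bar> \<le> B \<and> \<bar>ft t x\<bar> \<le> B \<and> \<bar>fx t x\<bar> \<le> B"
    by (rule test_bound) (rule that)
  have derivs: "deriv (\<lambda>s. \<phi> (s, x)) t = ft t x" "deriv (\<lambda>y. \<phi> (t, y)) x = fx t x" for t x
    using d_t[of x t] d_x[of t x] by (auto simp: f_def intro!: DERIV_imp_deriv)
  have [measurable]: "(\<lambda>z. kruzkov_flux v \<kappa> (\<rho> t z)) \<in> borel_measurable borel" for t using \<rho>_range by measurable
  define m where "m t = (LINT z|lborel. ft t z)" for t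
  define inner where "inner t = (LINT x:corridor|lebesgue.
                 \<bar>\<rho> t x - \<kappa>\<bar> * deriv (\<lambda>s. \<phi> (s, x)) t +
                 sgn (x - \<xi> t) * sgn (\<rho> t x - \<kappa>) * (flux v (\<rho> t x) - flux v \<kappa>) *
                   deriv (\<lambda>y. \<phi> (t, y)) x)" for t
  have ft_int: "integrable lborel (ft t)" for t
  proof -
    have "set_integrable lborel {-M..M} (ft t)"
      by (intro borel_integrable_atLeastAtMost' continuous_intros)
    moreover have "(\<lambda>z. indicat_real {-M..M} z *\<^sub>R ft t z) = ft t"
    proof
      fix z show "indicat_real {-M..M} z *\<^sub>R ft t z = ft t z"
        using outside_window[of z t] by (cases "z \<in> {-M..M}") simp_all
    qed
    ultimately show ?thesis by (simp only: set_integrable_def)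
  qed
  have inner_eq: "inner t + 2 * flux v \<kappa> * f t (\<xi> t) = production (\<rho> t) (\<xi> t) t + \<kappa> * m t" if t: "t \<in> {0..T}" for t
  proof -
    let ?I = "\<lambda>z. (\<bar>\<rho> t z - \<kappa>\<bar> - \<kappa>) * ft t z + sgn (z - \<xi> t) * kruzkov_flux v \<kappa> (\<rho> t z) * fx t z"
    have int: "integrable lborel ?I" by (rule production_bound(1)[OF \<rho>_range \<rho>_slices(1) B(2)[OF t]])
    have "inner t = (LINT z|lebesgue. ?I z + \<kappa> * ft t z)"
      unfolding inner_def set_lebesgue_integral_def derivs
    proof (rule Bochner_Integration.integral_cong[OF refl])
      fix z
      show "indicat_real corridor z *\<^sub>R (\<bar>\<rho> t z - \<kappa>\<bar> * ft t z +
            sgn (z - \<xi> t) * sgn (\<rho> t z - \<kappa>) * (flux v (\<rho> t z) - flux v \<kappa>) * fx t z) = ?I z + \<kappa> * ft t z"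
      proof (cases "z \<in> corridor")
        case True then show ?thesis by (simp add: kruzkov_flux_def algebra_simps)
      next
        case False
        then have "ft t z = 0" "fx t z = 0" using out[of t z] outside[of t z] by blast+
        then show ?thesis using False by simp
      qed
    qed
    also have "\<dots> = (LINT z|lborel. ?I z + \<kappa> * ft t z)" by (rule lebesgue_integral_eq_lborel) measurable
    also have "\<dots> = (LINT z|lborel. ?I z) + \<kappa> * m t"
      using int ft_int[of t] by (simp add: m_def)
    finally show ?thesis by (simp add: production_def)
  qed
  have m_zero: "inner t = 0" "f t (\<xi> t) = 0" if "t \<le> 0 \<or> T \<le> t" for t
  proof -
    have z: "f t z = 0 \<and> ft t z = 0 \<and> fx t z = 0" for z using out[of t z] outside[of t z] that by blast
    then show "f t (\<xi> t) = 0" by blast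
    show "inner t = 0" unfolding inner_def derivs using z by (simp add: set_lebesgue_integral_def)
  qed
  have m_meas [measurable]: "m \<in> borel_measurable borel"
  proof -
    have "(\<lambda>(t, z). ft t z) \<in> borel_measurable (borel \<Otimes>\<^sub>M lborel)" using test_borel(2) unfolding split_beta by measurable
    from lborel.borel_measurable_lebesgue_integral[OF this] show ?thesis unfolding m_def[abs_def] by simp
  qed
  have m_eq: "m t = \<Phi>t (-M) t M" for t
  proof -
    have "m t = integral {-M..M} (ft t)"
    proof -
      have "m t = (LINT z:{-M..M}|lborel. ft t z)"
        unfolding m_def set_lebesgue_integral_def
      proof (rule Bochner_Integration.integral_cong[OF refl])
        fix z show "ft t z = indicat_real {-M..M} z *\<^sub>R ft t z"
          using outside_window[of z t] by (cases "z \<in> {-M..M}") simp_all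
      qed
      also have "\<dots> = integral {-M..M} (ft t)"
        by (intro set_borel_integral_eq_integral borel_integrable_atLeastAtMost' continuous_intros)
      finally show ?thesis .
    qed
    then show ?thesis by (simp add: \<Phi>t_def)
  qed
  have m_bound: "\<bar>m t\<bar> \<le> B * (2 * M)" if "t \<in> {0..T}" for t
  proof -
    have "norm (integral {-M..M} (ft t)) \<le> B * (M - (-M))"
      using B(2)[OF that] T by (intro integral_bound continuous_intros) auto
    then show ?thesis by (simp add: m_eq \<Phi>t_def)
  qed
  have m_set: "set_integrable lborel {0..T} m" by (rule set_integrable_Icc_bounded[OF m_meas m_bound])
  have m_int: "(LINT t:{0..T}|lborel. m t) = 0"
  proof -
    have "(m has_integral \<Phi> (-M) T M - \<Phi> (-M) 0 M) {0..T}"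
    proof (rule fundamental_theorem_of_calculus)
      show "((\<lambda>t. \<Phi> (-M) t M) has_vector_derivative m t) (at t within {0..T})" for t
        unfolding m_eq using \<Phi>_t[of "-M" M t]
        by (auto simp: has_real_derivative_iff_has_vector_derivative[symmetric] intro: has_field_derivative_at_within)
    qed (use T in simp)
    moreover have "f 0 = (\<lambda>z. 0)" "f T = (\<lambda>z. 0)" using outside out[of 0] out[of T] by auto
    ultimately have "(m has_integral 0) {0..T}" by (simp add: \<Phi>_def)
    then show ?thesis using set_borel_integral_eq_integral(2)[OF m_set] by (simp add: integral_unique)
  qed
  have pm [measurable]: "(\<lambda>t. production (\<rho> t) (\<xi> t) t) \<in> borel_measurable borel"
    by (rule production_measurable[OF \<rho>_range \<rho>_measurable \<xi>_measurable])
  have f\<xi> [measurable]: "(\<lambda>t. f t (\<xi> t)) \<in> borel_measurable borel"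
  proof -
    have "(\<lambda>t. (t, \<xi> t)) \<in> borel \<rightarrow>\<^sub>M borel \<Otimes>\<^sub>M borel" by measurable
    from measurable_compose[OF this test_borel(1)] show ?thesis by simp
  qed
  have p_set: "set_integrable lborel {0..T} (\<lambda>t. production (\<rho> t) (\<xi> t) t)"
    by (rule set_integrable_Icc_bounded[OF pm production_bound(2)[OF \<rho>_range \<rho>_slices(1) B(2)]])
  have f_set: "set_integrable lborel {0..T} (\<lambda>t. flux v \<kappa> * f t (\<xi> t))"
    by (rule set_integrable_mult_right, rule set_integrable_Icc_bounded[OF f\<xi>, of _ _ B]) (use B in auto)
  have restrict: "(LINT t:{0<..}|lebesgue. h t) = (LINT t:{0..T}|lborel. h t)"
    if "\<And>t. t \<le> 0 \<or> T \<le> t \<Longrightarrow> h t = 0" and hm: "(\<lambda>t. indicator {0..T} t * h t) \<in> borel_measurable borel" for h :: "real \<Rightarrow> real"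
  proof -
    have "(LINT t:{0<..}|lebesgue. h t) = (LINT t|lebesgue. indicator {0..T} t * h t)"
      unfolding set_lebesgue_integral_def
    proof (rule Bochner_Integration.integral_cong[OF refl])
      fix t show "indicat_real {0<..} t *\<^sub>R h t = indicator {0..T} t * h t"
        using that(1)[of t] by (cases "t \<le> 0 \<or> T \<le> t") (auto simp: indicator_def)
    qed
    also have "\<dots> = (LINT t|lborel. indicator {0..T} t * h t)" by (rule lebesgue_integral_eq_lborel[OF hm])
    finally show ?thesis by (simp add: set_lebesgue_integral_def)
  qed
  have ind_inner: "indicator {0..T} t * inner t = indicator {0..T} t * (production (\<rho> t) (\<xi> t) t + \<kappa> * m t - 2 * flux v \<kappa> * f t (\<xi> t))" for t
    using inner_eq[of t] by (cases "t \<in> {0..T}") (simp_all del: atLeastAtMost_iff)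
  have "(LINT t:{0<..}|lebesgue. inner t) = (LINT t:{0..T}|lborel. inner t)"
  proof (rule restrict)
    show "(\<lambda>t. indicator {0..T} t * inner t) \<in> borel_measurable borel" unfolding ind_inner by measurable
  qed (rule m_zero(1))
  also have "\<dots> = (LINT t:{0..T}|lborel. (production (\<rho> t) (\<xi> t) t + \<kappa> * m t) - 2 * (flux v \<kappa> * f t (\<xi> t)))"
    by (simp only: set_lebesgue_integral_def real_scaleR_def ind_inner mult.assoc)
  also have "\<dots> = (LINT t:{0..T}|lborel. production (\<rho> t) (\<xi> t) t) + \<kappa> * 0 - 2 * (LINT t:{0..T}|lborel. flux v \<kappa> * f t (\<xi> t))"
    by (subst set_integral_diff(2)[OF set_integral_add(1)], (intro p_set f_set m_set set_integrable_mult_right)+)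
      (subst set_integral_add(2), (intro p_set m_set set_integrable_mult_right)+, simp add: m_int)
  finally have 1: "(LINT t:{0<..}|lebesgue. inner t) = (LINT t:{0..T}|lborel. production (\<rho> t) (\<xi> t) t)
      - 2 * (LINT t:{0..T}|lborel. flux v \<kappa> * f t (\<xi> t))" by simp
  have 2: "(LINT t:{0<..}|lebesgue. flux v \<kappa> * \<phi> (t, \<xi> t)) = (LINT t:{0..T}|lborel. flux v \<kappa> * f t (\<xi> t))"
    unfolding f_def[symmetric]
  proof (rule restrict)
    show "(\<lambda>t. indicator {0..T} t * (flux v \<kappa> * f t (\<xi> t))) \<in> borel_measurable borel" by measurable
  qed (use m_zero(2) in simp)
  show "0 \<le> (LINT t:{0<..}|lebesgue. LINT x:corridor|lebesgue.
                 \<bar>\<rho> t x - \<kappa>\<bar> * deriv (\<lambda>s. \<phi> (s, x)) t +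
                 sgn (x - \<xi> t) * sgn (\<rho> t x - \<kappa>) * (flux v (\<rho> t x) - flux v \<kappa>) *
                   deriv (\<lambda>y. \<phi> (t, y)) x)
            + 2 * (LINT t:{0<..}|lebesgue. flux v \<kappa> * \<phi> (t, \<xi> t))"
    unfolding inner_def[symmetric] 2 1 using entropy by simp
qed

end

section \<open>Continuity in time, bounded variation and convergence in space-time\<close>

context convergent_schemes
begin


lemma L1_norm_corridor: 
  assumes [measurable]: "h \<in> borel_measurable borel"
  shows "L1_norm corridor h = (LINT z:{-1..1}|lborel. \<bar>h z\<bar>)"
proof -
  have "L1_norm corridor h = (LINT z:corridor|lborel. \<bar>h z\<bar>)"
    unfolding L1_norm_def set_lebesgue_integral_def by (rule lebesgue_integral_eq_lborel) measurable
  also have "\<dots> = (LINT z:{-1..1}|lborel. \<bar>h z\<bar>)"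
    unfolding set_lebesgue_integral_def
  proof (rule integral_cong_AE)
    show "AE y in lborel. indicat_real corridor y *\<^sub>R \<bar>h y\<bar> = indicat_real {-1..1} y *\<^sub>R \<bar>h y\<bar>"
      using AE_lborel_singleton[of "-1"] AE_lborel_singleton[of 1] by eventually_elim (auto simp: indicator_def)
  qed measurable
  finally show ?thesis .
qed

lemma corridor_integrable: "set_integrable lebesgue corridor (\<rho> t)"
proof -
  have "set_integrable lborel corridor (\<rho> t)"
    by (rule set_integrable_subset[OF set_integrable_Icc_bounded[OF \<rho>_slices(1) \<rho>_abs_le, of "-1" 1]]) auto
  then show ?thesis unfolding set_integrable_def by (subst integrable_completion) auto
qed

text \<open>The bound \<open>2 C h + 4 V \<bar>s - t\<bar> / h\<close> becomes small if first \<open>h\<close> and then \<open>\<bar>s - t\<bar>\<close> is small.\<close>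

lemma L1_continuous_limit: "L1_continuous_with_initial_datum \<rho>0 \<rho>"
  unfolding L1_continuous_with_initial_datum_def
proof (intro exI[of _ \<rho>] conjI allI impI)
  show "set_integrable lebesgue corridor (\<rho> t)" for t by (rule corridor_integrable)
  show "AE x in lebesgue. x \<in> corridor \<longrightarrow> \<rho> 0 x = \<rho>0 x"
    using initial_density by eventually_elim (auto simp: zero_extension_def)
  fix t :: real assume t: "0 \<le> t"
  define C where "C = tv_bound (t + 1)"
  have C: "0 < C" unfolding C_def using t by (intro tv_bound) simp
  define V where "V = \<rho>max * v 0"
  have V: "0 < V" using \<rho>max_pos v_0_pos by (simp add: V_def)
  have dist: "L1_norm corridor (\<lambda>z. \<rho> s z - \<rho> t z) \<le> 2 * C * h + 4 * (V * \<bar>s - t\<bar>) / h"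
    if "0 \<le> s" "s \<le> t + 1" "0 < h" "h \<le> 1" for s h
    using \<rho>_L1_distance[of s "t + 1" t h] that t by (subst L1_norm_corridor) (auto simp: C_def V_def)
  show "((\<lambda>s. L1_norm corridor (\<lambda>x. \<rho> s x - \<rho> t x)) \<longlongrightarrow> 0) (at t within {0..})"
  proof (rule tendstoI)
    fix e :: real assume e: "0 < e"
    define h where "h = min 1 (e / (8 * C))"
    have h: "0 < h" "h \<le> 1" "2 * C * h \<le> e / 4"
      using C e by (auto simp: h_def min_def field_simps)
    define \<delta> where "\<delta> = min 1 (e * h / (16 * V))"
    have \<delta>: "0 < \<delta>" "\<delta> \<le> 1" "4 * (V * \<delta>) / h \<le> e / 4"
      using e h V by (auto simp: \<delta>_def min_def field_simps)
    have "dist (L1_norm corridor (\<lambda>x. \<rho> s x - \<rho> t x)) 0 < e" if s: "0 \<le> s" "dist s t < \<delta>" for s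
    proof -
      have "V * \<bar>s - t\<bar> \<le> V * \<delta>" using s V by (intro mult_left_mono) (auto simp: dist_real_def)
      then have "4 * (V * \<bar>s - t\<bar>) / h \<le> 4 * (V * \<delta>) / h" using h by (intro divide_right_mono) auto
      then have "L1_norm corridor (\<lambda>x. \<rho> s x - \<rho> t x) \<le> e / 4 + e / 4"
      proof -
        have "s \<le> t + 1" using s \<delta>(2) by (auto simp: dist_real_def)
        from dist[OF s(1) this h(1,2)] \<open>4 * (V * \<bar>s - t\<bar>) / h \<le> 4 * (V * \<delta>) / h\<close> h(3) \<delta>(3)
        show ?thesis by linarith
      qed
      moreover have "0 \<le> L1_norm corridor (\<lambda>x. \<rho> s x - \<rho> t x)"
        unfolding L1_norm_def set_lebesgue_integral_def by (intro integral_nonneg_AE AE_I2) auto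
      ultimately show ?thesis using e by (simp add: dist_real_def)
    qed
    then show "\<forall>\<^sub>F s in at t within {0..}. dist (L1_norm corridor (\<lambda>x. \<rho> s x - \<rho> t x)) 0 < e"
      unfolding eventually_at using \<delta>(1) by (intro exI[of _ \<delta>]) auto
  qed
qed (auto intro: AE_I2)


lemma \<rho>_total_variation: assumes t: "t \<in> {0..T}" "0 < T" shows "total_variation corridor (\<rho> t) \<le> ereal (tv_bound T)"
  unfolding total_variation_def
proof (rule SUP_least)
  fix \<phi> :: "real \<Rightarrow> real"
  assume "\<phi> \<in> {\<phi>. Ck 1 \<phi> \<and> compactly_supported_in corridor \<phi> \<and> (\<forall>x. \<bar>\<phi> x\<bar> \<le> 1)}"
  then have \<phi>: "Ck 1 \<phi>" "compactly_supported_in corridor \<phi>" "\<And>x. \<bar>\<phi> x\<bar> \<le> 1" by auto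
  have Ck: "(\<forall>x. \<phi> differentiable (at x)) \<and> (\<forall>h. Ck 0 (\<lambda>x. frechet_derivative \<phi> (at x) h))"
    using \<phi>(1) unfolding One_nat_def Ck.simps(2) .
  have diff: "\<phi> differentiable (at x)" for x using Ck by simp
  have cont: "continuous_on UNIV (\<lambda>x. frechet_derivative \<phi> (at x) 1)"
    using conjunct2[OF Ck, rule_format, of 1] by simp
  have d: "(\<phi> has_real_derivative frechet_derivative \<phi> (at x) 1) (at x)" for x
  proof -
    have hd: "(\<phi> has_derivative frechet_derivative \<phi> (at x)) (at x)"
      using diff[of x] unfolding frechet_derivative_works .
    interpret bounded_linear "frechet_derivative \<phi> (at x)" using hd by (rule has_derivative_bounded_linear)
    have "frechet_derivative \<phi> (at x) h = frechet_derivative \<phi> (at x) 1 * h" for h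
      using scaleR[of h 1] by simp
    then show ?thesis unfolding has_field_derivative_def by (intro has_derivative_eq_rhs[OF hd] ext)
  qed
  have deriv_eq: "deriv \<phi> x = frechet_derivative \<phi> (at x) 1" for x using d by (rule DERIV_imp_deriv)
  have dcont: "continuous_on UNIV (deriv \<phi>)" using cont unfolding deriv_eq[symmetric] .
  then have [measurable]: "deriv \<phi> \<in> borel_measurable borel" by (rule borel_measurable_continuous_onI)
  have out: "deriv \<phi> x = 0" if "x \<notin> corridor" for x
  proof -
    let ?S = "closure {x. \<phi> x \<noteq> 0}"
    have "?S \<subseteq> corridor" using \<phi>(2) unfolding compactly_supported_in_def by (rule conjunct2)
    then have x: "x \<in> - ?S" using that by blast
    have z: "0 = \<phi> z" if "z \<in> - ?S" for z
    proof (rule ccontr)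
      assume "0 \<noteq> \<phi> z"
      then have "z \<in> {x. \<phi> x \<noteq> 0}" by simp
      then have "z \<in> ?S" by (rule closure_subset[THEN subsetD])
      with that show False by simp
    qed
    have "(\<phi> has_real_derivative 0) (at x)"
    proof (rule has_field_derivative_transform_within_open[of "\<lambda>x. 0" 0 x "- ?S" \<phi>])
      show "((\<lambda>x. 0) has_real_derivative 0) (at x)" by simp
      show "open (- ?S)" by (rule open_Compl) (rule closed_closure)
    qed (fact x, fact z)
    then show ?thesis by (rule DERIV_imp_deriv)
  qed
  have "bounded (deriv \<phi> ` {-1..1})"
    by (intro compact_imp_bounded compact_continuous_image continuous_on_subset[OF dcont]) auto
  then obtain B where B: "0 < B" "\<forall>y\<in>deriv \<phi> ` {-1..1}. norm y \<le> B" unfolding bounded_pos by blast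
  have dB: "\<bar>deriv \<phi> x\<bar> \<le> B" for x
  proof (cases "x \<in> {-1..1}")
    case True then show ?thesis using B(2) by simp
  next
    case False
    then have "deriv \<phi> x = 0" by (intro out) auto
    then show ?thesis using B(1) by simp
  qed
  have conv: "(LINT x:A|lebesgue. u x * deriv \<phi> x) = (LINT x:{-1..1}|lborel. u x * deriv \<phi> x)"
    if [measurable]: "u \<in> borel_measurable borel" "A \<in> sets borel" and A: "corridor \<subseteq> A" for A and u :: "real \<Rightarrow> real"
  proof -
    have "(LINT x:A|lebesgue. u x * deriv \<phi> x) = (LINT x:A|lborel. u x * deriv \<phi> x)"
      unfolding set_lebesgue_integral_def by (rule lebesgue_integral_eq_lborel) measurable
    also have "\<dots> = (LINT x:{-1..1}|lborel. u x * deriv \<phi> x)"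
      unfolding set_lebesgue_integral_def
    proof (rule Bochner_Integration.integral_cong[OF refl])
      fix x show "indicat_real A x *\<^sub>R (u x * deriv \<phi> x) = indicat_real {-1..1} x *\<^sub>R (u x * deriv \<phi> x)"
        using out[of x] A by (cases "x \<in> corridor") (auto simp: indicator_def)
    qed
    finally show ?thesis .
  qed
  have lim: "(\<lambda>k. LINT x:{-1..1}|lborel. dens (r k) t x * deriv \<phi> x) \<longlonglongrightarrow> (LINT x:{-1..1}|lborel. \<rho> t x * deriv \<phi> x)"
  proof (rule window_tendsto)
    show "\<bar>dens (r k) t x * deriv \<phi> x\<bar> \<le> \<rho>max * B" for k x
      unfolding abs_mult using dens_abs_le dB \<rho>max_pos by (intro mult_mono) auto
    show "AE z in lborel. (\<lambda>k. dens (r k) t z * deriv \<phi> z) \<longlonglongrightarrow> \<rho> t z * deriv \<phi> z"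
      using AE_tendsto[of t] by eventually_elim (intro tendsto_intros)
  qed measurable
  have "(LINT x:{-1..1}|lborel. dens (r k) t x * deriv \<phi> x) \<le> tv_bound T" for k
  proof -
    have "compactly_supported_in UNIV \<phi>" using \<phi>(2) by (simp add: compactly_supported_in_def)
    then have "ereal (LINT x:UNIV|lebesgue. dens (r k) t x * deriv \<phi> x) \<le> total_variation UNIV (dens (r k) t)"
      unfolding total_variation_def using \<phi>(1,3) by (intro SUP_upper) simp
    also have "\<dots> \<le> ereal (tv_bound T)" by (rule dens_total_variation[OF r_pos t])
    finally show ?thesis using conv[OF dens_slice, of UNIV "r k" t] by simp
  qed
  then have "(LINT x:{-1..1}|lborel. \<rho> t x * deriv \<phi> x) \<le> tv_bound T"
    by (intro LIMSEQ_le_const2[OF lim]) blast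
  then show "ereal (LINT x:corridor|lebesgue. \<rho> t x * deriv \<phi> x) \<le> ereal (tv_bound T)"
    using conv[OF \<rho>_slices(1), of corridor t] by simp
qed

lemma BV_regular_limit: "BV_regular \<rho>"
  unfolding BV_regular_def
proof (intro allI impI)
  fix T :: real assume T: "0 < T"
  have "BV_on corridor (\<rho> t) \<and> BV_norm corridor (\<rho> t) \<le> ereal (2 * \<rho>max + tv_bound T)" if t: "t \<in> {0<..<T}" for t
  proof -
    have tv: "total_variation corridor (\<rho> t) \<le> ereal (tv_bound T)" using t T by (intro \<rho>_total_variation) auto
    have "L1_norm corridor (\<rho> t) = (LINT z:{-1..1}|lborel. \<bar>\<rho> t z\<bar>)" by (rule L1_norm_corridor) measurable
    also have "\<dots> \<le> (LINT z:{-1..1::real}|lborel. \<rho>max)"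
    proof (rule set_integral_mono)
      show "set_integrable lborel {-1..1} (\<lambda>z. \<bar>\<rho> t z\<bar>)"
        by (rule set_integrable_Icc_bounded[where B="\<rho>max"]) (use \<rho>_abs_le in auto)
      show "set_integrable lborel {-1..1} (\<lambda>z::real. \<rho>max)"
        by (rule set_integrable_Icc_bounded[where B="\<rho>max"]) (use \<rho>max_pos in auto)
    qed (use \<rho>_abs_le in auto)
    also have "\<dots> = 2 * \<rho>max" by (simp add: set_lebesgue_integral_def)
    finally have "ereal (L1_norm corridor (\<rho> t)) \<le> ereal (2 * \<rho>max)" by simp
    then have "BV_norm corridor (\<rho> t) \<le> ereal (2 * \<rho>max) + ereal (tv_bound T)"
      unfolding BV_norm_def using tv by (rule add_mono)
    moreover have "BV_on corridor (\<rho> t)" unfolding BV_on_def using corridor_integrable order_le_less_trans[OF tv, of \<infinity>] by simp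
    ultimately show ?thesis by simp
  qed
  then show "\<exists>C. AE t in lebesgue. t \<in> {0<..<T} \<longrightarrow> BV_on corridor (\<rho> t) \<and> BV_norm corridor (\<rho> t) \<le> ereal C"
    by (intro exI[of _ "2 * \<rho>max + tv_bound T"] AE_I2) auto
qed


lemma planar_integrable:
  fixes h :: "real \<times> real \<Rightarrow> real"
  assumes [measurable]: "h \<in> borel_measurable borel" "S \<in> sets borel" and S: "bounded S" and h: "\<And>p. p \<in> S \<Longrightarrow> \<bar>h p\<bar> \<le> B"
  shows "integrable lborel (\<lambda>p. indicator S p * h p)" "set_integrable lebesgue S h"
proof -
  have "emeasure lborel S < \<infinity>" by (rule emeasure_bounded_finite[OF S])
  then have "integrable lborel (\<lambda>p. B * indicator S p)"
    by (intro integrable_mult_right integrable_real_indicator) auto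
  then show 1: "integrable lborel (\<lambda>p. indicator S p * h p)"
  proof (rule Bochner_Integration.integrable_bound)
    show "AE p in lborel. norm (indicator S p * h p) \<le> norm (B * indicator S p)"
    proof (rule AE_I2)
      fix p show "norm (indicator S p * h p) \<le> norm (B * indicator S p)"
        using h[of p] by (cases "p \<in> S") auto
    qed
  qed measurable
  show "set_integrable lebesgue S h"
    unfolding set_integrable_def using 1 by (subst integrable_completion) auto
qed

lemma space_time_convergence:
  "converges_in_L1 ({0<..<T} \<times> corridor) (\<lambda>k (t, y). approximate_density \<rho>0 (r k) (x (r k)) t y) (\<lambda>(t, y). \<rho> t y)"
proof -
  let ?S = "{0<..<T} \<times> corridor"
  define a where "a k p = (case p of (t, y) \<Rightarrow> approximate_density \<rho>0 (r k) (x (r k)) t y)" for k and p :: "real \<times> real"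
  define d where "d k p = dens (r k) (fst p) (snd p)" for k p
  define q where "q p = (case p of (t, y) \<Rightarrow> \<rho> t y)" for p :: "real \<times> real"
  have a_d: "a k p = d k p" if "p \<in> ?S" for k p using that dens_eq by (auto simp: a_def d_def)
  have d_meas [measurable]: "d k \<in> borel_measurable borel" for k
    using dens_measurable[OF r_pos, of k] unfolding borel_prod d_def[abs_def] .
  have q_eq: "q = (\<lambda>p. \<rho> (fst p) (snd p))" by (auto simp: q_def)
  have q_meas [measurable]: "q \<in> borel_measurable borel" unfolding q_eq using \<rho>_measurable unfolding borel_prod .
  have S: "bounded ?S" by (intro bounded_Times) auto
  have S_meas [measurable]: "?S \<in> sets borel" by (intro borel_open open_Times) auto
  have d_le: "\<bar>d k p\<bar> \<le> \<rho>max" for k p unfolding d_def by (rule dens_abs_le)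
  have q_le: "\<bar>q p\<bar> \<le> \<rho>max" for p unfolding q_eq by (rule \<rho>_abs_le)
  have a_int: "set_integrable lebesgue ?S (a k)" for k
  proof -
    have "set_integrable lebesgue ?S (d k)" by (rule planar_integrable(2)[OF d_meas S_meas S]) (rule d_le)
    moreover have "set_integrable lebesgue ?S (d k) = set_integrable lebesgue ?S (a k)"
      by (rule set_integrable_cong) (use a_d in auto)
    ultimately show ?thesis by simp
  qed
  have q_int: "set_integrable lebesgue ?S q" by (rule planar_integrable(2)[OF q_meas S_meas S]) (rule q_le)
  define D where "D k p = indicator ?S p * \<bar>d k p - q p\<bar>" for k p
  have D_int: "integrable lborel (D k)" for k
    unfolding D_def[abs_def]
  proof (rule planar_integrable(1)[OF _ S_meas S])
    show "\<bar>\<bar>d k p - q p\<bar>\<bar> \<le> 2 * \<rho>max" for p using d_le[of k p] q_le[of p] by linarith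
  qed measurable
  have norm_eq: "L1_norm ?S (\<lambda>p. a k p - q p) = (LINT t|lborel. LINT y|lborel. D k (t, y))" for k
  proof -
    have "L1_norm ?S (\<lambda>p. a k p - q p) = (LINT p|lebesgue. D k p)"
      unfolding L1_norm_def set_lebesgue_integral_def
    proof (rule Bochner_Integration.integral_cong[OF refl])
      fix p show "indicat_real ?S p *\<^sub>R \<bar>a k p - q p\<bar> = D k p"
        using a_d[of p k] by (cases "p \<in> ?S") (simp_all add: D_def)
    qed
    also have "\<dots> = (LINT p|lborel. D k p)" by (rule lebesgue_integral_eq_lborel) (use D_int[of k] in auto)
    also have "\<dots> = (LINT p|(lborel \<Otimes>\<^sub>M lborel). D k p)" by (simp only: lborel_prod)
    also have "\<dots> = (LINT t|lborel. LINT y|lborel. D k (t, y))"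
      by (rule lborel_pair.integral_fst'[symmetric]) (use D_int[of k] in \<open>simp only: lborel_prod\<close>)
    finally show ?thesis .
  qed
  have D_split: "D k (t, y) = indicator {0<..<T} t * (indicator corridor y * \<bar>dens (r k) t y - \<rho> t y\<bar>)" for k t y
    by (auto simp: D_def d_def q_def indicator_def)
  have inner: "(\<lambda>k. LINT y|lborel. D k (t, y)) \<longlonglongrightarrow> 0" for t
  proof -
    have "(\<lambda>k. LINT y|lborel. indicator corridor y * \<bar>dens (r k) t y - \<rho> t y\<bar>) \<longlonglongrightarrow> (LINT y|lborel. indicator corridor y * 0 :: real)"
    proof (rule integral_dominated_convergence)
      show "integrable lborel (\<lambda>y. 2 * \<rho>max * indicator {-1..1::real} y)" by (intro integrable_mult_right integrable_indicator_Icc)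
      show "AE y in lborel. norm (indicator corridor y * \<bar>dens (r k) t y - \<rho> t y\<bar>) \<le> 2 * \<rho>max * indicator {-1..1::real} y" for k
      proof (rule AE_I2)
        fix y show "norm (indicator corridor y * \<bar>dens (r k) t y - \<rho> t y\<bar>) \<le> 2 * \<rho>max * indicator {-1..1::real} y"
          using dens_abs_le[of k t y] \<rho>_abs_le[of t y] by (cases "y \<in> corridor") (auto simp: indicator_def)
      qed
      show "AE y in lborel. (\<lambda>k. indicator corridor y * \<bar>dens (r k) t y - \<rho> t y\<bar>) \<longlonglongrightarrow> indicator corridor y * 0"
        using AE_tendsto[of t] by eventually_elim (intro tendsto_mult tendsto_const, simp add: LIM_zero tendsto_rabs_zero)
    qed measurable
    then show ?thesis unfolding D_split by (simp add: tendsto_mult_right_zero)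
  qed
  have inner_le: "\<bar>LINT y|lborel. D k (t, y)\<bar> \<le> 4 * \<rho>max * indicator {0..T} t" for k t
  proof (cases "t \<in> {0<..<T}")
    case True
    have "\<bar>LINT y|lborel. D k (t, y)\<bar> \<le> (LINT y|lborel. 2 * \<rho>max * indicator {-1..1::real} y)"
    proof (rule order_trans[OF integral_abs_bound], rule integral_mono')
      show "integrable lborel (\<lambda>y. 2 * \<rho>max * indicator {-1..1::real} y)" by (intro integrable_mult_right integrable_indicator_Icc)
      show "\<bar>D k (t, y)\<bar> \<le> 2 * \<rho>max * indicator {-1..1::real} y" for y
        unfolding D_split using dens_abs_le[of k t y] \<rho>_abs_le[of t y] by (cases "y \<in> corridor") (auto simp: indicator_def)
    qed (use \<rho>max_pos in auto)
    then show ?thesis using True by simp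
  next
    case False
    then have "D k (t, y) = 0" for y unfolding D_split by simp
    then show ?thesis using \<rho>max_pos by simp
  qed
  have "(\<lambda>k. LINT t|lborel. LINT y|lborel. D k (t, y)) \<longlonglongrightarrow> (LINT t::real|lborel. 0::real)"
  proof (rule integral_dominated_convergence)
    show "integrable lborel (\<lambda>t. 4 * \<rho>max * indicator {0..T::real} t)" by (intro integrable_mult_right integrable_indicator_Icc)
    show "(\<lambda>t. LINT y|lborel. D k (t, y)) \<in> borel_measurable lborel" for k
      using lborel_pair.integrable_fst'[of "D k"] D_int[of k] by (simp add: lborel_prod)
  qed (use inner inner_le in auto)
  then have "(\<lambda>k. L1_norm ?S (\<lambda>p. a k p - q p)) \<longlonglongrightarrow> 0" unfolding norm_eq by simp
  then show ?thesis
    unfolding converges_in_L1_def using a_int q_int unfolding a_def[abs_def] q_def[abs_def] by blast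
qed

end

section \<open>Traces at the exits\<close>

context convergent_schemes
begin

text \<open>Limits in space are taken along these positions, where the bound on the pointwise variation of \<open>\<rho>\<close> is available
at almost every time.\<close>

definition good_lines :: "real set" where
  "good_lines = {z. AE t in lborel. good t z}"

lemma AE_good_lines: "AE z in lborel. z \<in> good_lines"
proof -
  have [measurable]: "(\<lambda>p. dens (r k) (fst p) (snd p)) \<in> borel_measurable (lborel \<Otimes>\<^sub>M lborel)" for k
    using dens_measurable[OF r_pos, of k] by simp
  have "{p \<in> space (lborel \<Otimes>\<^sub>M lborel). good (fst p) (snd p)} \<in> sets (lborel \<Otimes>\<^sub>M lborel)"
    unfolding good_def by (rule sets_Collect_Cauchy) measurable
  from lborel_pair.AE_commute[OF this] show ?thesis
    using AE_good by (simp add: good_lines_def)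
qed

lemma good_lines_dense: assumes "a < b" shows "\<exists>z\<in>good_lines. a < z \<and> z < b"
proof (rule ccontr)
  assume "\<not> ?thesis"
  then have "AE z in lborel. z \<notin> {a<..<b}" using AE_good_lines by (auto elim!: eventually_mono)
  then have "{a<..<b} \<in> null_sets lborel" by (subst AE_iff_null_sets) auto
  then have "emeasure lborel {a<..<b} = 0" by auto
  with assms show False by simp
qed

definition line_distance :: "real \<Rightarrow> real \<Rightarrow> real \<Rightarrow> real" where
  "line_distance T y z = (LINT t:{0..T}|lborel. \<bar>\<rho> t y - \<rho> t z\<bar>)"

lemma line_distance_integrable: "set_integrable lborel {0..T} (\<lambda>t. \<bar>\<rho> t y - \<rho> t z\<bar>)"
proof (rule set_integrable_Icc_bounded)
  show "\<bar>\<bar>\<rho> t y - \<rho> t z\<bar>\<bar> \<le> 2 * \<rho>max" for t using \<rho>_abs_le[of t y] \<rho>_abs_le[of t z] by linarith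
qed measurable

lemma line_distance_nonneg: "0 \<le> line_distance T y z"
  unfolding line_distance_def set_lebesgue_integral_def by (intro integral_nonneg_AE AE_I2) auto

lemma line_distance_commute: "line_distance T y z = line_distance T z y"
  unfolding line_distance_def by (simp add: abs_minus_commute)

text \<open>The bound on the jumps of the approximate densities passes to the limit at finitely many points of convergence.\<close>

lemma \<rho>_variation:
  assumes "t \<in> {0..T}" "0 < T" "\<And>j. j < m \<Longrightarrow> z j \<le> z (Suc j)" "\<And>j. j \<le> m \<Longrightarrow> good t (z j)"
  shows "(\<Sum>j<m. \<bar>\<rho> t (z j) - \<rho> t (z (Suc j))\<bar>) \<le> tv_bound T"
proof (rule LIMSEQ_le_const2)
  show "(\<lambda>k. \<Sum>j<m. \<bar>dens (r k) t (z j) - dens (r k) t (z (Suc j))\<bar>) \<longlonglongrightarrow> (\<Sum>j<m. \<bar>\<rho> t (z j) - \<rho> t (z (Suc j))\<bar>)"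
    by (intro tendsto_sum tendsto_rabs tendsto_diff good_tendsto assms(4)) auto
  have "(\<Sum>j<m. \<bar>dens (r k) t (z j) - dens (r k) t (z (Suc j))\<bar>) \<le> tv_bound T" for k
  proof -
    have "(\<Sum>j<m. \<bar>dens (r k) t (z (Suc j)) - dens (r k) t (z j)\<bar>) \<le> tv_bound T"
      by (rule dens_variation[OF r_pos assms(1,2)]) (rule assms(3))
    then show ?thesis by (simp add: abs_minus_commute)
  qed
  then show "\<exists>N. \<forall>k\<ge>N. (\<Sum>j<m. \<bar>dens (r k) t (z j) - dens (r k) t (z (Suc j))\<bar>) \<le> tv_bound T" by blast
qed

lemma line_distance_chain:
  assumes T: "0 < T" and z: "\<And>j. j < m \<Longrightarrow> z j \<le> z (Suc j)" "\<And>j. j \<le> m \<Longrightarrow> z j \<in> good_lines"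
  shows "(\<Sum>j<m. line_distance T (z j) (z (Suc j))) \<le> T * tv_bound T"
proof -
  have int: "integrable lborel (\<lambda>t. indicat_real {0..T} t *\<^sub>R \<bar>\<rho> t (z j) - \<rho> t (z (Suc j))\<bar>)" for j
    using line_distance_integrable by (simp add: set_integrable_def)
  have "(\<Sum>j<m. line_distance T (z j) (z (Suc j)))
      = (LINT t|lborel. (\<Sum>j<m. indicat_real {0..T} t *\<^sub>R \<bar>\<rho> t (z j) - \<rho> t (z (Suc j))\<bar>))"
    unfolding line_distance_def set_lebesgue_integral_def
    by (rule Bochner_Integration.integral_sum[symmetric]) (rule int)
  also have "\<dots> \<le> (LINT t|lborel. tv_bound T * indicator {0..T} t)"
  proof (rule integral_mono_AE)
    show "integrable lborel (\<lambda>t. \<Sum>j<m. indicat_real {0..T} t *\<^sub>R \<bar>\<rho> t (z j) - \<rho> t (z (Suc j))\<bar>)"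
      by (intro Bochner_Integration.integrable_sum int)
    show "integrable lborel (\<lambda>t::real. tv_bound T * indicator {0..T} t)" by (intro integrable_mult_right integrable_indicator_Icc)
    have "\<forall>j\<in>{..m}. AE t in lborel. good t (z j)" using z(2) by (simp add: good_lines_def)
    then have "AE t in lborel. \<forall>j\<in>{..m}. good t (z j)" by (intro eventually_ball_finite) auto
    then show "AE t in lborel. (\<Sum>j<m. indicat_real {0..T} t *\<^sub>R \<bar>\<rho> t (z j) - \<rho> t (z (Suc j))\<bar>) \<le> tv_bound T * indicator {0..T} t"
    proof eventually_elim
      case (elim t)
      show ?case
      proof (cases "t \<in> {0..T}")
        case True
        then show ?thesis using \<rho>_variation[OF True T, of m z] z(1) elim by simp
      qed simp
    qed
  qed
  also have "\<dots> = T * tv_bound T" using T by simp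
  finally show ?thesis .
qed

definition line_chains :: "real \<Rightarrow> real \<Rightarrow> real set" where
  "line_chains T y = {s. \<exists>m z. (\<forall>j<m. z j \<le> z (Suc j)) \<and> (\<forall>j\<le>m. z j \<in> good_lines) \<and> z m = y
      \<and> s = (\<Sum>j<m. line_distance T (z j) (z (Suc j)))}"

text \<open>The variation of \<open>z \<mapsto> \<rho>(\<cdot>, z)\<close>, as a function with values in \<open>L\<^sup>1(0, T)\<close>, along chains of good lines that end at
\<open>y\<close>.\<close>

definition line_variation :: "real \<Rightarrow> real \<Rightarrow> real" where
  "line_variation T y = Sup (line_chains T y)"

lemma line_variation:
  assumes T: "0 < T" and y: "y \<in> good_lines"
  shows "0 \<le> line_variation T y" "line_variation T y \<le> T * tv_bound T"
    "\<And>z. z \<in> good_lines \<Longrightarrow> y \<le> z \<Longrightarrow> line_variation T y + line_distance T y z \<le> line_variation T z"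
proof -
  have bound: "s \<le> T * tv_bound T" if sc: "s \<in> line_chains T z" for s z
  proof -
    obtain m q where q: "\<forall>j<m. q j \<le> q (Suc j)" "\<forall>j\<le>m. q j \<in> good_lines"
      "s = (\<Sum>j<m. line_distance T (q j) (q (Suc j)))"
      using sc unfolding line_chains_def mem_Collect_eq by (elim exE conjE)
    show ?thesis unfolding q(3) by (rule line_distance_chain[OF T]) (use q(1,2) in auto)
  qed
  then have bdd: "bdd_above (line_chains T z)" for z by (rule bdd_aboveI)
  have zero: "0 \<in> line_chains T y" unfolding line_chains_def mem_Collect_eq
    by (rule exI[of _ 0], rule exI[of _ "\<lambda>_. y"]) (use y in simp)
  show "0 \<le> line_variation T y" unfolding line_variation_def by (rule cSup_upper[OF zero bdd])
  show "line_variation T y \<le> T * tv_bound T" unfolding line_variation_def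
  proof (rule cSup_least)
    show "line_chains T y \<noteq> {}" using zero by blast
  qed (rule bound)
  fix z assume z: "z \<in> good_lines" "y \<le> z"
  have "s \<le> line_variation T z - line_distance T y z" if sc: "s \<in> line_chains T y" for s
  proof -
    obtain m q where q: "\<forall>j<m. q j \<le> q (Suc j)" "\<forall>j\<le>m. q j \<in> good_lines" "q m = y"
      "s = (\<Sum>j<m. line_distance T (q j) (q (Suc j)))"
      using sc unfolding line_chains_def mem_Collect_eq by (elim exE conjE)
    define q' where "q' j = (if j \<le> m then q j else z)" for j
    have "(\<Sum>j<Suc m. line_distance T (q' j) (q' (Suc j))) = s + line_distance T y z"
      using q(3,4) by (simp add: q'_def)
    moreover have "(\<Sum>j<Suc m. line_distance T (q' j) (q' (Suc j))) \<in> line_chains T z"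
    proof -
      have "\<forall>j<Suc m. q' j \<le> q' (Suc j)"
      proof (intro allI impI)
        fix j assume "j < Suc m"
        then consider "j < m" | "j = m" by linarith
        then show "q' j \<le> q' (Suc j)"
        proof cases
          case 1 then show ?thesis using q(1) by (simp add: q'_def)
        next
          case 2 then show ?thesis using q(3) z(2) by (simp add: q'_def)
        qed
      qed
      moreover have "\<forall>j\<le>Suc m. q' j \<in> good_lines" using q(2) z(1) by (auto simp: q'_def)
      moreover have "q' (Suc m) = z" by (simp add: q'_def)
      ultimately show ?thesis unfolding line_chains_def mem_Collect_eq
        by (intro exI[of _ "Suc m"] exI[of _ q'] conjI refl)
    qed
    ultimately have "s + line_distance T y z \<in> line_chains T z" by simp
    then have "s + line_distance T y z \<le> line_variation T z"
      unfolding line_variation_def by (rule cSup_upper[OF _ bdd])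
    then show ?thesis by linarith
  qed
  then have "line_variation T y \<le> line_variation T z - line_distance T y z"
    unfolding line_variation_def[of T y]
  proof (intro cSup_least)
    show "line_chains T y \<noteq> {}" using zero by blast
  qed
  then show "line_variation T y + line_distance T y z \<le> line_variation T z" by linarith
qed

text \<open>The variation up to \<open>y\<close> is monotone and bounded in \<open>y\<close>, and it dominates distances; so it converges at both exits.\<close>

lemma line_distance_Cauchy:
  assumes b: "b \<in> {-1, 1}" and T: "0 < T" and e: "0 < e"
  shows "\<exists>\<delta>>0. \<forall>y z. y \<in> good_lines \<and> z \<in> good_lines \<and> y \<in> corridor \<and> z \<in> corridor
      \<and> \<bar>y - b\<bar> < \<delta> \<and> \<bar>z - b\<bar> < \<delta> \<longrightarrow> line_distance T y z \<le> e"
proof -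
  have mono: "line_variation T y \<le> line_variation T z" if "y \<in> good_lines" "z \<in> good_lines" "y \<le> z" for y z
    using line_variation(3)[OF T that] line_distance_nonneg[of T y z] by linarith
  have between: "line_distance T y z \<le> e"
    if "y \<in> good_lines" "z \<in> good_lines" "A \<le> line_variation T y" "A \<le> line_variation T z"
      "line_variation T y \<le> A + e" "line_variation T z \<le> A + e" for y z A
  proof (cases "y \<le> z")
    case True then show ?thesis using line_variation(3)[OF T that(1,2)] that by linarith
  next
    case False then show ?thesis using line_variation(3)[OF T that(2,1)] that line_distance_commute[of T y z] by linarith
  qed
  from b consider "b = 1" | "b = -1" by blast
  then show ?thesis
  proof cases
    case 1
    let ?A = "line_variation T ` (good_lines \<inter> {..<1})"
    have ne: "?A \<noteq> {}" using good_lines_dense[of 0 1] by auto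
    have bdd: "bdd_above ?A" using line_variation(2)[OF T] by (intro bdd_aboveI[of _ "T * tv_bound T"]) auto
    obtain y0 where y0: "y0 \<in> good_lines" "y0 < 1" "Sup ?A - e < line_variation T y0"
      using less_cSup_iff[OF ne bdd, of "Sup ?A - e"] e by auto
    have "line_distance T y z \<le> e" if "y \<in> good_lines" "z \<in> good_lines" "y \<in> corridor" "z \<in> corridor"
      "\<bar>y - b\<bar> < 1 - y0" "\<bar>z - b\<bar> < 1 - y0" for y z
    proof (rule between[of y z "line_variation T y0"])
      show "line_variation T y0 \<le> line_variation T y" "line_variation T y0 \<le> line_variation T z"
        using that 1 y0 by (auto intro!: mono)
      have "line_variation T y \<le> Sup ?A" "line_variation T z \<le> Sup ?A"
        using that by (auto intro!: cSup_upper bdd)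
      then show "line_variation T y \<le> line_variation T y0 + e" "line_variation T z \<le> line_variation T y0 + e"
        using y0(3) by linarith+
    qed (use that in auto)
    then show ?thesis using y0(2) by (intro exI[of _ "1 - y0"]) auto
  next
    case 2
    let ?A = "line_variation T ` (good_lines \<inter> {-1<..})"
    have ne: "?A \<noteq> {}" using good_lines_dense[of 0 1] by auto
    have bdd: "bdd_below ?A" using line_variation(1)[OF T] by (intro bdd_belowI[of _ 0]) auto
    obtain y0 where y0: "y0 \<in> good_lines" "-1 < y0" "line_variation T y0 < Inf ?A + e"
      using cInf_less_iff[OF ne bdd, of "Inf ?A + e"] e by auto
    have "line_distance T y z \<le> e" if "y \<in> good_lines" "z \<in> good_lines" "y \<in> corridor" "z \<in> corridor"
      "\<bar>y - b\<bar> < y0 + 1" "\<bar>z - b\<bar> < y0 + 1" for y z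
    proof (rule between[of y z "Inf ?A"])
      show "Inf ?A \<le> line_variation T y" "Inf ?A \<le> line_variation T z"
        using that by (auto intro!: cInf_lower bdd)
      have "line_variation T y \<le> line_variation T y0" "line_variation T z \<le> line_variation T y0"
        using that 2 y0 by (auto intro!: mono)
      then show "line_variation T y \<le> Inf ?A + e" "line_variation T z \<le> Inf ?A + e"
        using y0(3) by linarith+
    qed (use that in auto)
    then show ?thesis using y0(2) by (intro exI[of _ "y0 + 1"]) auto
  qed
qed

text \<open>Along a sequence of good lines whose distances are summable \<open>\<rho>(t, X m)\<close> converges for almost every \<open>t\<close>; the limit is
also the limit in \<open>L\<^sup>1(0, T)\<close>.\<close>

lemma trace_exists:
  assumes b: "b \<in> {-1, 1}"
  obtains \<gamma> where "\<gamma> \<in> borel_measurable borel" "\<And>t. \<gamma> t \<in> {0..\<rho>max}"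
    "\<And>T e. 0 < T \<Longrightarrow> 0 < e \<Longrightarrow> \<exists>\<delta>>0. \<forall>z. z \<in> good_lines \<and> z \<in> corridor \<and> \<bar>z - b\<bar> < \<delta> \<longrightarrow>
        (LINT t:{0..T}|lborel. \<bar>\<rho> t z - \<gamma> t\<bar>) \<le> e"
proof -
  have near: "\<exists>z\<in>good_lines. z \<in> corridor \<and> \<bar>z - b\<bar> < d" if "0 < d" for d
  proof (cases "b = 1")
    case True
    then show ?thesis using good_lines_dense[of "max (-1) (1 - d)" 1] that by force
  next
    case False
    then have "b = -1" using b by simp
    then show ?thesis using good_lines_dense[of "-1" "min 1 (d - 1)"] that by force
  qed
  have "\<forall>m. \<exists>\<delta>>0. \<forall>y z. y \<in> good_lines \<and> z \<in> good_lines \<and> y \<in> corridor \<and> z \<in> corridor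
      \<and> \<bar>y - b\<bar> < \<delta> \<and> \<bar>z - b\<bar> < \<delta> \<longrightarrow> line_distance (real (Suc m)) y z \<le> (1/2)^m"
    using line_distance_Cauchy[OF b] by simp
  then obtain \<delta> :: "nat \<Rightarrow> real" where \<delta>: "\<And>m. 0 < \<delta> m" "\<And>m y z. y \<in> good_lines \<Longrightarrow> z \<in> good_lines \<Longrightarrow> y \<in> corridor \<Longrightarrow> z \<in> corridor
      \<Longrightarrow> \<bar>y - b\<bar> < \<delta> m \<Longrightarrow> \<bar>z - b\<bar> < \<delta> m \<Longrightarrow> line_distance (real (Suc m)) y z \<le> (1/2)^m"
    by metis
  \<comment> \<open>The minimum makes d decreasing, so that consecutive lines are both within the distance for which the bound with index m holds.\<close>
  define d where "d m = Min ((\<lambda>i. min (\<delta> i) (1 / real (Suc i))) ` {..m})" for m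
  have d_pos: "0 < d m" for m unfolding d_def using \<delta>(1) by (subst Min_gr_iff) auto
  have d_le: "d m \<le> min (\<delta> i) (1 / real (Suc i))" if "i \<le> m" for i m
    unfolding d_def using that by (intro Min_le) auto
  obtain X where X: "\<And>m. X m \<in> good_lines" "\<And>m. X m \<in> corridor" "\<And>m. \<bar>X m - b\<bar> < d m"
    using near[OF d_pos] by metis
  define f where "f m t = indicator {0..} t * \<rho> t (X m)" for m t
  have f_meas [measurable]: "f m \<in> borel_measurable borel" for m unfolding f_def[abs_def] by measurable
  have f_range: "f m t \<in> {0..\<rho>max}" for m t using \<rho>_range[of t "X m"] \<rho>max_pos by (auto simp: f_def indicator_def)
  have f_le: "\<bar>f m t\<bar> \<le> \<rho>max" for m t using f_range[of m t] by auto
  have AE_f: "AE t in lborel. Cauchy (\<lambda>m. f m t)"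
  proof (rule AE_Cauchy_of_fast_windows)
    show "integrable lborel (\<lambda>t. indicator {-M..M} t * f k t)" for k M
      using set_integrable_Icc_bounded[OF f_meas f_le, of "-M" M k] by (simp add: set_integrable_def)
    fix m
    have "(LINT t:{-real m..real m}|lborel. \<bar>f (Suc m) t - f m t\<bar>) \<le> line_distance (real (Suc m)) (X (Suc m)) (X m)"
      unfolding line_distance_def set_lebesgue_integral_def
    proof (rule integral_mono)
      have "set_integrable lborel {-real m..real m} (\<lambda>t. \<bar>f (Suc m) t - f m t\<bar>)"
      proof (rule set_integrable_Icc_bounded)
        show "\<bar>\<bar>f (Suc m) t - f m t\<bar>\<bar> \<le> 2 * \<rho>max" for t using f_le[of m t] f_le[of "Suc m" t] by linarith
      qed measurable
      then show "integrable lborel (\<lambda>t. indicat_real {-real m..real m} t *\<^sub>R \<bar>f (Suc m) t - f m t\<bar>)"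
        by (simp add: set_integrable_def)
      show "integrable lborel (\<lambda>t. indicat_real {0..real (Suc m)} t *\<^sub>R \<bar>\<rho> t (X (Suc m)) - \<rho> t (X m)\<bar>)"
        using line_distance_integrable[of "real (Suc m)"] by (simp add: set_integrable_def)
      fix t
      show "indicat_real {-real m..real m} t *\<^sub>R \<bar>f (Suc m) t - f m t\<bar>
        \<le> indicat_real {0..real (Suc m)} t *\<^sub>R \<bar>\<rho> t (X (Suc m)) - \<rho> t (X m)\<bar>"
        by (cases "0 \<le> t \<and> t \<le> real m") (auto simp: f_def indicator_def)
    qed
    also have "\<dots> \<le> (1/2)^m"
      using X[of m] X[of "Suc m"] d_le[of m m] d_le[of m "Suc m"] by (intro \<delta>(2)) auto
    finally show "(LINT t:{-real m..real m}|lborel. \<bar>f (Suc m) t - f m t\<bar>) \<le> (1/2)^m" .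
  qed
  define \<gamma> where "\<gamma> t = max 0 (min \<rho>max (lim (\<lambda>m. f m t)))" for t
  have \<gamma>_meas [measurable]: "\<gamma> \<in> borel_measurable borel" unfolding \<gamma>_def[abs_def] by measurable
  have \<gamma>_range: "\<gamma> t \<in> {0..\<rho>max}" for t using \<rho>max_pos by (auto simp: \<gamma>_def)
  have AE_\<gamma>: "AE t in lborel. (\<lambda>m. f m t) \<longlonglongrightarrow> \<gamma> t"
    using AE_f
  proof eventually_elim
    case (elim t)
    then have lim: "(\<lambda>m. f m t) \<longlonglongrightarrow> lim (\<lambda>m. f m t)" by (simp add: Cauchy_convergent_iff convergent_LIMSEQ_iff)
    moreover have "lim (\<lambda>m. f m t) \<in> {0..\<rho>max}"
      using closed_sequentially[OF closed_atLeastAtMost _ lim] f_range by blast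
    ultimately show ?case by (simp add: \<gamma>_def)
  qed
  have "\<exists>\<delta>>0. \<forall>z. z \<in> good_lines \<and> z \<in> corridor \<and> \<bar>z - b\<bar> < \<delta> \<longrightarrow>
        (LINT t:{0..T}|lborel. \<bar>\<rho> t z - \<gamma> t\<bar>) \<le> e" if T: "0 < T" and e: "0 < e" for T e
  proof -
    obtain \<eta> where \<eta>: "0 < \<eta>" "\<And>y z. y \<in> good_lines \<Longrightarrow> z \<in> good_lines \<Longrightarrow> y \<in> corridor \<Longrightarrow> z \<in> corridor
      \<Longrightarrow> \<bar>y - b\<bar> < \<eta> \<Longrightarrow> \<bar>z - b\<bar> < \<eta> \<Longrightarrow> line_distance T y z \<le> e"
      using line_distance_Cauchy[OF b T e] by blast
    obtain m0 where m0: "1 / real (Suc m0) < \<eta>" using \<eta>(1) nat_approx_posE by metis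
    have "(LINT t:{0..T}|lborel. \<bar>\<rho> t z - \<gamma> t\<bar>) \<le> e"
      if z: "z \<in> good_lines" "z \<in> corridor" "\<bar>z - b\<bar> < \<eta>" for z
    proof (rule LIMSEQ_le_const2)
      let ?a = "\<lambda>t. indicator {0..} t * \<rho> t z"
      have "(\<lambda>m. LINT t:{0..T}|lborel. \<bar>?a t - f m t\<bar>) \<longlonglongrightarrow> (LINT t:{0..T}|lborel. \<bar>?a t - \<gamma> t\<bar>)"
      proof (rule window_tendsto)
        show "\<bar>\<bar>?a t - f m t\<bar>\<bar> \<le> 2 * \<rho>max" for m t
          using \<rho>_abs_le[of t z] f_le[of m t] \<rho>max_pos by (cases "0 \<le> t") (auto simp: indicator_def)
        show "AE t in lborel. (\<lambda>m. \<bar>?a t - f m t\<bar>) \<longlonglongrightarrow> \<bar>?a t - \<gamma> t\<bar>"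
          using AE_\<gamma> by eventually_elim (intro tendsto_intros)
      qed measurable
      moreover have "(LINT t:{0..T}|lborel. \<bar>?a t - \<gamma> t\<bar>) = (LINT t:{0..T}|lborel. \<bar>\<rho> t z - \<gamma> t\<bar>)"
        by (intro set_lebesgue_integral_cong) auto
      moreover have "(LINT t:{0..T}|lborel. \<bar>?a t - f m t\<bar>) = line_distance T z (X m)" for m
        unfolding line_distance_def by (intro set_lebesgue_integral_cong) (auto simp: f_def)
      ultimately show "(\<lambda>m. line_distance T z (X m)) \<longlonglongrightarrow> (LINT t:{0..T}|lborel. \<bar>\<rho> t z - \<gamma> t\<bar>)" by simp
      have "line_distance T z (X m) \<le> e" if "m0 \<le> m" for m
        using X[of m] d_le[OF that] m0 z by (intro \<eta>(2)) auto
      then show "\<exists>N. \<forall>m\<ge>N. line_distance T z (X m) \<le> e" by blast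
    qed
    then show ?thesis using \<eta>(1) by blast
  qed
  with \<gamma>_meas \<gamma>_range that show thesis by blast
qed

end


text \<open>A continuously differentiable function that increases from \<open>0\<close> to \<open>1\<close> on the unit interval and is constant elsewhere;
its derivative is a hat function with integral \<open>1\<close>.\<close>

definition ramp :: "real \<Rightarrow> real" where
  "ramp s = 2 * (max 0 s)\<^sup>2 - 4 * (max 0 (s - 1/2))\<^sup>2 + 2 * (max 0 (s - 1))\<^sup>2"

definition ramp' :: "real \<Rightarrow> real" where
  "ramp' s = 4 * max 0 s - 8 * max 0 (s - 1/2) + 4 * max 0 (s - 1)"

lemma ramp_has_derivative: "(ramp has_real_derivative ramp' s) (at s)"
proof -
  have shift: "((\<lambda>s. (max 0 (s - c))\<^sup>2) has_real_derivative 2 * max 0 (s - c)) (at s)" for c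
  proof -
    have d: "((\<lambda>s. s - c) has_real_derivative 1) (at s)" by (auto intro!: derivative_eq_intros)
    show ?thesis using DERIV_chain2[OF has_derivative_pos_part_squared d] by simp
  qed
  show ?thesis
    unfolding ramp_def[abs_def]
    by (rule DERIV_cong[OF DERIV_add[OF DERIV_diff[OF DERIV_cmult[OF shift[of 0, simplified]] DERIV_cmult[OF shift]] DERIV_cmult[OF shift]]])
      (simp add: ramp'_def)
qed

lemma ramp'_continuous: "continuous_on S ramp'"
  unfolding ramp'_def[abs_def] by (intro continuous_intros)

lemma ramp_continuous: "continuous_on S ramp"
  unfolding ramp_def[abs_def] by (intro continuous_intros)

lemma ramp'_nonneg: "0 \<le> ramp' s"
  unfolding ramp'_def by (simp add: max_def)

lemma ramp'_outside: "s \<le> 0 \<or> 1 \<le> s \<Longrightarrow> ramp' s = 0"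
  unfolding ramp'_def by (auto simp: max_def)

lemma ramp_low: "s \<le> 0 \<Longrightarrow> ramp s = 0"
  unfolding ramp_def by (simp add: max_def)

lemma ramp_high: "1 \<le> s \<Longrightarrow> ramp s = 1"
  unfolding ramp_def by (simp add: max_def power2_eq_square algebra_simps)

lemma ramp_mono: "s \<le> s' \<Longrightarrow> ramp s \<le> ramp s'"
  by (rule DERIV_nonneg_imp_nondecreasing) (use ramp_has_derivative ramp'_nonneg in blast)+

lemma ramp_bounds: "0 \<le> ramp s" "ramp s \<le> 1"
  using ramp_mono[of "min s 0" s] ramp_low[of "min s 0"] ramp_mono[of s "max s 1"] ramp_high[of "max s 1"] by simp_all

section \<open>The flux through the exits\<close>

context velocity
begin

abbreviation "\<rho>c \<equiv> critical_density \<rho>max v"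

text \<open>The inward flux of \<open>(r - \<rho>c)\<^sup>+\<close> through an exit; it vanishes exactly for densities up to \<open>\<rho>c\<close>.\<close>

definition excess :: "real \<Rightarrow> real" where
  "excess s = flux v \<rho>c - flux v (max \<rho>c s)"

lemma max_\<rho>c_range: "s \<in> {0..\<rho>max} \<Longrightarrow> max \<rho>c s \<in> {0..\<rho>max}"
  using critical_density(1) by (simp add: max_def)

lemma excess_nonneg: "s \<in> {0..\<rho>max} \<Longrightarrow> 0 \<le> excess s"
  unfolding excess_def using critical_density(2)[OF max_\<rho>c_range] by simp

lemma excess_0: "excess 0 = 0"
proof -
  have "max \<rho>c 0 = \<rho>c" using critical_density(1) by simp
  then show ?thesis by (simp add: excess_def)
qed

lemma excess_eq_0: "s \<in> {0..\<rho>max} \<Longrightarrow> excess s = 0 \<Longrightarrow> s \<le> \<rho>c"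
  unfolding excess_def using critical_density(3)[OF max_\<rho>c_range, of s] by simp

lemma excess_le: "s \<in> {0..\<rho>max} \<Longrightarrow> \<bar>excess s\<bar> \<le> \<rho>max * v 0"
  using excess_nonneg[of s] flux_bounds[OF max_\<rho>c_range, of s] flux_bounds[OF critical_density(1)]
  by (simp add: excess_def)

lemma excess_continuous: "continuous_on {0..\<rho>max} excess"
proof -
  have "continuous_on {0..\<rho>max} (\<lambda>s. flux v (max \<rho>c s))"
    by (rule continuous_on_compose2[OF flux_continuous]) (use max_\<rho>c_range in \<open>auto intro!: continuous_intros\<close>)
  then show ?thesis unfolding excess_def[abs_def] by (intro continuous_intros)
qed

lemma excess_Lipschitz:
  obtains K where "0 \<le> K" "\<And>r s. r \<in> {0..\<rho>max} \<Longrightarrow> s \<in> {0..\<rho>max} \<Longrightarrow> \<bar>excess r - excess s\<bar> \<le> K * \<bar>r - s\<bar>"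
proof -
  obtain K where K: "0 \<le> K" "\<forall>r\<in>{0..\<rho>max}. \<forall>s\<in>{0..\<rho>max}. \<bar>v r - v s\<bar> \<le> K * \<bar>r - s\<bar>"
    using v_Lipschitz by blast
  have f: "\<bar>flux v r - flux v s\<bar> \<le> (v 0 + \<rho>max * K) * \<bar>r - s\<bar>" if "r \<in> {0..\<rho>max}" "s \<in> {0..\<rho>max}" for r s
  proof -
    have "flux v r - flux v s = (r - s) * v r + s * (v r - v s)" by (simp add: flux_def algebra_simps)
    moreover have "\<bar>(r - s) * v r\<bar> \<le> \<bar>r - s\<bar> * v 0"
      unfolding abs_mult using v_abs_le[OF that(1)] by (intro mult_left_mono) auto
    moreover have "\<bar>s * (v r - v s)\<bar> \<le> \<rho>max * (K * \<bar>r - s\<bar>)"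
      unfolding abs_mult using K that by (intro mult_mono) auto
    ultimately show ?thesis by (simp add: algebra_simps)
  qed
  have "\<bar>excess r - excess s\<bar> \<le> (v 0 + \<rho>max * K) * \<bar>r - s\<bar>" if "r \<in> {0..\<rho>max}" "s \<in> {0..\<rho>max}" for r s
  proof -
    have "\<bar>excess r - excess s\<bar> = \<bar>flux v (max \<rho>c r) - flux v (max \<rho>c s)\<bar>" by (simp add: excess_def abs_minus_commute)
    also have "\<dots> \<le> (v 0 + \<rho>max * K) * \<bar>max \<rho>c r - max \<rho>c s\<bar>" by (intro f max_\<rho>c_range that)
    also have "\<dots> \<le> (v 0 + \<rho>max * K) * \<bar>r - s\<bar>"
      using K(1) v_0_pos \<rho>max_pos by (intro mult_left_mono) auto
    finally show ?thesis .
  qed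
  then show thesis using that[of "v 0 + \<rho>max * K"] K(1) v_0_pos \<rho>max_pos by auto
qed

text \<open>Up to constants, the entropies for \<open>\<rho>c\<close> and \<open>0\<close> add up to twice the positive part of \<open>s - \<rho>c\<close>; this is the flux
of their sum.\<close>

lemma kruzkov_flux_pair:
  assumes "s \<in> {0..\<rho>max}"
  shows "kruzkov_flux v \<rho>c s + kruzkov_flux v 0 s = flux v \<rho>c - 2 * excess s"
proof -
  have "kruzkov_flux v 0 s = flux v s"
    using assms by (cases "s = 0") (auto simp: kruzkov_flux_def flux_def)
  then show ?thesis
    by (cases s "\<rho>c" rule: linorder_cases) (auto simp: kruzkov_flux_def excess_def max_def)
qed

end

context convergent_schemes
begin

text \<open>The test function is a decreasing function of time multiplied by a cutoff which rises from \<open>0\<close> to \<open>1\<close> between the distance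
\<open>\<epsilon>\<close> from the exit and the exit itself and falls back to \<open>0\<close> so far outside that no mass arrives there
before the time \<open>T\<close>.  In the sum of the inequalities for \<open>\<rho>c\<close> and \<open>0\<close> the time derivative has a favourable sign, and the initial datum enters only
within the distance \<open>\<epsilon>\<close> from the exit.  The factor \<open>b\<close> treats both exits at once.\<close>

lemma boundary_flux_estimate:
  assumes b: "b \<in> {-1, 1}" and T: "0 < T" and \<epsilon>: "0 < \<epsilon>" "\<epsilon> < 1"
    and inside: "\<And>t. t \<in> {0..T} \<Longrightarrow> b * \<xi> t \<le> 1 - \<epsilon>"
  shows "(LINT t:{0..T}|lborel. (1 - t / T)\<^sup>2 * (LINT z|lborel. excess (\<rho> t z) * (ramp' ((b * z - 1) / \<epsilon> + 1) / \<epsilon>))) \<le> \<rho>max * \<epsilon>"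
proof -
  have bb: "b * b = 1" "\<bar>b\<bar> = 1" "b \<noteq> 0" using b by auto
  \<comment> \<open>No mass is found beyond this distance from the origin before the time T.\<close>
  define N where "N = 2 + v 0 * T"
  have N: "2 \<le> N" using v_0_pos T by (simp add: N_def)
  define \<psi> where "\<psi> t = (max 0 (1 - t / T))\<^sup>2" for t
  define \<psi>' where "\<psi>' t = 2 * max 0 (1 - t / T) * (- 1 / T)" for t
  define \<eta> where "\<eta> y = ramp ((y - 1) / \<epsilon> + 1) - ramp (y - N)" for y
  define \<eta>' where "\<eta>' y = ramp' ((y - 1) / \<epsilon> + 1) / \<epsilon> - ramp' (y - N)" for y
  define M where "M = N + 2"
  have \<psi>_d: "(\<psi> has_real_derivative \<psi>' t) (at t)" for t
  proof -
    have d: "((\<lambda>t. 1 - t / T) has_real_derivative - 1 / T) (at t)" using T by (auto intro!: derivative_eq_intros)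
    show ?thesis unfolding \<psi>_def[abs_def] \<psi>'_def by (rule DERIV_chain2[OF has_derivative_pos_part_squared d])
  qed
  have \<eta>_d: "(\<eta> has_real_derivative \<eta>' y) (at y)" for y
  proof -
    have d1: "((\<lambda>y. (y - 1) / \<epsilon> + 1) has_real_derivative 1 / \<epsilon>) (at y)"
      by (rule DERIV_cong[OF DERIV_add[OF DERIV_cdivide[OF DERIV_diff[OF DERIV_ident DERIV_const]] DERIV_const]]) simp
    have d2: "((\<lambda>y. y - N) has_real_derivative 1) (at y)"
      by (rule DERIV_cong[OF DERIV_diff[OF DERIV_ident DERIV_const]]) simp
    show ?thesis unfolding \<eta>_def[abs_def] \<eta>'_def
      by (rule DERIV_cong[OF DERIV_diff[OF DERIV_chain2[OF ramp_has_derivative d1] DERIV_chain2[OF ramp_has_derivative d2]]]) simp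
  qed
  have \<psi>_cont: "continuous_on UNIV \<psi>" "continuous_on UNIV \<psi>'"
    unfolding \<psi>_def[abs_def] \<psi>'_def[abs_def] using T by (auto intro!: continuous_intros)
  have \<eta>_cont: "continuous_on UNIV \<eta>" "continuous_on UNIV \<eta>'"
    unfolding \<eta>_def[abs_def] \<eta>'_def[abs_def] using \<epsilon>
    by (auto intro!: continuous_intros continuous_on_compose2[OF ramp_continuous[of UNIV]] continuous_on_compose2[OF ramp'_continuous[of UNIV]])
  have \<psi>_nonneg: "0 \<le> \<psi> t" for t by (simp add: \<psi>_def)
  have low: "(y - 1) / \<epsilon> + 1 \<le> 0" if "y \<le> 1 - \<epsilon>" for y using that \<epsilon> by (simp add: field_simps)
  have high: "1 \<le> (y - 1) / \<epsilon> + 1" if "1 \<le> y" for y using that \<epsilon> by simp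
  have \<eta>_low: "\<eta> y = 0" "\<eta>' y = 0" if "y \<le> 1 - \<epsilon>" for y
    using low[OF that] N \<epsilon> that by (auto simp: \<eta>_def \<eta>'_def ramp_low ramp'_outside)
  have \<eta>_nonneg: "0 \<le> \<eta> y" for y
  proof (cases "1 \<le> y")
    case True then show ?thesis using ramp_high[OF high[OF True]] ramp_bounds(2)[of "y - N"] by (simp add: \<eta>_def)
  next
    case False then show ?thesis using ramp_bounds(1) N by (simp add: \<eta>_def ramp_low)
  qed
  have \<eta>_le: "\<eta> y \<le> 1" for y using ramp_bounds(2)[of "(y - 1) / \<epsilon> + 1"] ramp_bounds(1)[of "y - N"] by (simp add: \<eta>_def)
  have \<eta>_out: "\<eta> y = 0 \<and> \<eta>' y = 0" if "M \<le> \<bar>y\<bar>" for y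
  proof (cases "0 \<le> y")
    case True
    then have "1 \<le> y" "1 \<le> y - N" using that N by (auto simp: M_def)
    then show ?thesis using high[of y] by (simp add: \<eta>_def \<eta>'_def ramp_high ramp'_outside)
  next
    case False
    then have "y \<le> 1 - \<epsilon>" using \<epsilon> by simp
    then show ?thesis using \<eta>_low by simp
  qed
  define \<phi> where "\<phi> t z = \<psi> t * \<eta> (b * z)" for t z
  define \<phi>t where "\<phi>t t z = \<psi>' t * \<eta> (b * z)" for t z
  define \<phi>x where "\<phi>x t z = \<psi> t * (\<eta>' (b * z) * b)" for t z
  have tf: "test_function \<phi> \<phi>t \<phi>x T M"
  proof
    show "0 < T" by fact
    show "0 < M" using N by (simp add: M_def)
    show "((\<lambda>s. \<phi> s z) has_real_derivative \<phi>t t z) (at t)" for t z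
      unfolding \<phi>_def \<phi>t_def by (rule DERIV_cmult_right[OF \<psi>_d])
    show "((\<lambda>z. \<phi> t z) has_real_derivative \<phi>x t z) (at z)" for t z
    proof -
      have d: "((\<lambda>z. b * z) has_real_derivative b) (at z)" by (rule DERIV_cong[OF DERIV_cmult[OF DERIV_ident]]) simp
      show ?thesis unfolding \<phi>_def \<phi>x_def by (rule DERIV_cmult[OF DERIV_chain2[OF \<eta>_d d]])
    qed
    show "continuous_on UNIV (\<lambda>(t, z). \<phi> t z)" "continuous_on UNIV (\<lambda>(t, z). \<phi>t t z)" "continuous_on UNIV (\<lambda>(t, z). \<phi>x t z)"
      unfolding \<phi>_def \<phi>t_def \<phi>x_def split_beta
      by (intro continuous_intros continuous_on_compose2[OF \<psi>_cont(1)] continuous_on_compose2[OF \<psi>_cont(2)]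
          continuous_on_compose2[OF \<eta>_cont(1)] continuous_on_compose2[OF \<eta>_cont(2)]; simp)+
    show "0 \<le> \<phi> t z" for t z using \<psi>_nonneg \<eta>_nonneg by (simp add: \<phi>_def)
    show "\<phi> t z = 0 \<and> \<phi>t t z = 0 \<and> \<phi>x t z = 0" if "T \<le> t \<or> M \<le> \<bar>z\<bar>" for t z
      using that
    proof
      assume "T \<le> t"
      then have "max 0 (1 - t / T) = 0" using T by (simp add: field_simps)
      then show ?thesis by (simp add: \<phi>_def \<phi>t_def \<phi>x_def \<psi>_def \<psi>'_def)
    next
      assume "M \<le> \<bar>z\<bar>"
      then have "M \<le> \<bar>b * z\<bar>" using bb by (simp add: abs_mult)
      then show ?thesis using \<eta>_out[of "b * z"] by (simp add: \<phi>_def \<phi>t_def \<phi>x_def)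
    qed
  qed
  interpret tf: test_function \<phi> \<phi>t \<phi>x T M by (rule tf)
  have e1: "entropy_test \<rho>max v \<phi> \<phi>t \<phi>x T M \<rho>c"
    unfolding entropy_test_def entropy_test_axioms_def using velocity_axioms tf critical_density(1) by blast
  have e0: "entropy_test \<rho>max v \<phi> \<phi>t \<phi>x T M 0"
    unfolding entropy_test_def entropy_test_axioms_def using velocity_axioms tf \<rho>max_pos by simp
  interpret c: entropy_test \<rho>max v \<phi> \<phi>t \<phi>x T M \<rho>c by (rule e1)
  interpret z: entropy_test \<rho>max v \<phi> \<phi>t \<phi>x T M 0 by (rule e0)
  obtain B where B: "0 < B" "\<And>t x. t \<in> {0..T} \<Longrightarrow> \<bar>\<phi> t x\<bar> \<le> B \<and> \<bar>\<phi>t t x\<bar> \<le> B \<and> \<bar>\<phi>x t x\<bar> \<le> B"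
    by (rule tf.test_bound) (rule that)
  define kk where "kk z = ramp' ((b * z - 1) / \<epsilon> + 1) / \<epsilon>" for z
  have ex_meas: "(\<lambda>z. excess (\<rho> t z)) \<in> borel_measurable borel" for t
    by (rule measurable_compose_range[OF excess_continuous \<rho>_slices(1) \<rho>_range])
  have k_cont: "continuous_on UNIV kk"
    unfolding kk_def[abs_def] using \<epsilon> by (intro continuous_intros continuous_on_compose2[OF ramp'_continuous[of UNIV]]) auto
  then have k_meas [measurable]: "kk \<in> borel_measurable borel" by (rule borel_measurable_continuous_onI)
  have k_nonneg: "0 \<le> kk z" for z using ramp'_nonneg \<epsilon> by (simp add: kk_def)
  have k_out: "kk z = 0" if "z \<notin> {-1..1}" for z
  proof -
    have "1 \<le> b * z \<or> b * z \<le> 1 - \<epsilon>" using that b \<epsilon> by auto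
    then show ?thesis using low[of "b * z"] high[of "b * z"] ramp'_outside by (auto simp: kk_def)
  qed
  have "bounded (kk ` {-1..1})"
    by (intro compact_imp_bounded compact_continuous_image continuous_on_subset[OF k_cont]) auto
  then obtain Bk where Bk0: "0 < Bk" "\<forall>y\<in>kk ` {-1..1}. norm y \<le> Bk" unfolding bounded_pos by (elim exE conjE)
  have k_le: "kk z \<le> Bk" for z
  proof (cases "z \<in> {-1..1}")
    case True
    have "norm (kk z) \<le> Bk" by (rule bspec[OF Bk0(2)]) (rule imageI[OF True])
    from order_trans[OF abs_ge_self this[unfolded real_norm_def]] show ?thesis .
  next
    case False
    show ?thesis by (subst k_out[OF False]) (rule less_imp_le[OF Bk0(1)])
  qed
  have k_abs: "\<bar>kk z\<bar> \<le> Bk" for z using k_le[of z] k_nonneg[of z] by simp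
  note Bk = Bk0(1) k_le
  have exk: "\<bar>excess (\<rho> t z) * kk z\<bar> \<le> (\<rho>max * v 0) * Bk" for t z
    by (subst abs_mult) (rule mult_mono[OF excess_le[OF \<rho>_range] k_abs], use \<rho>max_pos v_0_pos in auto)
  have Y_int: "integrable lborel (\<lambda>z. excess (\<rho> t z) * kk z)" for t
  proof -
    have [measurable]: "(\<lambda>z. excess (\<rho> t z)) \<in> borel_measurable borel" by (rule ex_meas)
    have "set_integrable lborel {-1..1} (\<lambda>z. excess (\<rho> t z) * kk z)"
    proof (rule set_integrable_Icc_bounded)
      show "\<bar>excess (\<rho> t z) * kk z\<bar> \<le> (\<rho>max * v 0) * Bk" for z by (rule exk)
    qed measurable
    moreover have "(\<lambda>z. indicat_real {-1..1} z *\<^sub>R (excess (\<rho> t z) * kk z)) = (\<lambda>z. excess (\<rho> t z) * kk z)"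
    proof
      fix z show "indicat_real {-1..1} z *\<^sub>R (excess (\<rho> t z) * kk z) = excess (\<rho> t z) * kk z"
        using k_out[of z] by (cases "z \<in> {-1..1}") auto
    qed
    ultimately show ?thesis by (simp only: set_integrable_def)
  qed
  have production_le: "c.production (\<rho> t) (\<xi> t) t + z.production (\<rho> t) (\<xi> t) t
      \<le> - 2 * ((1 - t / T)\<^sup>2 * (LINT z|lborel. excess (\<rho> t z) * kk z))" if t: "t \<in> {0..T}" for t
  proof -
    have \<psi>_t: "\<psi> t = (1 - t / T)\<^sup>2" using t T by (simp add: \<psi>_def max_def field_simps)
    have \<psi>'_t: "\<psi>' t \<le> 0" using T by (simp add: \<psi>'_def mult_nonneg_nonneg)
    have \<phi>\<xi>: "\<phi> t (\<xi> t) = 0" using \<eta>_low[OF inside[OF t]] by (simp add: \<phi>_def)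
    let ?Ic = "\<lambda>z. (\<bar>\<rho> t z - \<rho>c\<bar> - \<rho>c) * \<phi>t t z + sgn (z - \<xi> t) * kruzkov_flux v \<rho>c (\<rho> t z) * \<phi>x t z"
    let ?Iz = "\<lambda>z. (\<bar>\<rho> t z - 0\<bar> - 0) * \<phi>t t z + sgn (z - \<xi> t) * kruzkov_flux v 0 (\<rho> t z) * \<phi>x t z"
    have ic: "integrable lborel ?Ic" by (rule c.production_bound(1)[OF \<rho>_range \<rho>_slices(1) B(2)[OF t]])
    have iz: "integrable lborel ?Iz" by (rule z.production_bound(1)[OF \<rho>_range \<rho>_slices(1) B(2)[OF t]])
    have "c.production (\<rho> t) (\<xi> t) t + z.production (\<rho> t) (\<xi> t) t = (LINT z|lborel. ?Ic z + ?Iz z)"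
      unfolding c.production_def z.production_def \<phi>\<xi> Bochner_Integration.integral_add[OF ic iz] by simp
    also have "\<dots> \<le> (LINT z|lborel. flux v \<rho>c * (sgn (z - \<xi> t) * \<phi>x t z) - 2 * (\<psi> t * (excess (\<rho> t z) * kk z)))"
    proof (rule integral_mono_AE)
      show "integrable lborel (\<lambda>z. ?Ic z + ?Iz z)" by (intro Bochner_Integration.integrable_add ic iz)
      show "integrable lborel (\<lambda>z. flux v \<rho>c * (sgn (z - \<xi> t) * \<phi>x t z) - 2 * (\<psi> t * (excess (\<rho> t z) * kk z)))"
        by (intro Bochner_Integration.integrable_diff integrable_mult_right tf.integrable_\<phi>x_sign Y_int)
      have "0 \<le> t" "t \<le> T" using t by auto
      have "AE z in lborel. 1 + v 0 * t < \<bar>z\<bar> \<longrightarrow> \<rho> t z = 0" by (rule \<rho>_outside) fact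
      then show "AE z in lborel. ?Ic z + ?Iz z \<le> flux v \<rho>c * (sgn (z - \<xi> t) * \<phi>x t z) - 2 * (\<psi> t * (excess (\<rho> t z) * kk z))"
      proof eventually_elim
        case (elim z)
        have sg: "sgn (z - \<xi> t) * \<phi>x t z = \<psi> t * \<eta>' (b * z)"
        proof (cases "b * z \<le> 1 - \<epsilon>")
          case True then show ?thesis using \<eta>_low[OF True] by (simp add: \<phi>x_def)
        next
          case False
          then have "b * \<xi> t < b * z" using inside[OF t] by linarith
          then have "sgn (z - \<xi> t) = b" using b by (auto simp: sgn_if)
          then show ?thesis using bb(1) by (simp add: \<phi>x_def mult_ac)
        qed
        \<comment> \<open>The descent of the cutoff does not contribute since the density vanishes there.\<close>
        have far: "excess (\<rho> t z) * \<eta>' (b * z) = excess (\<rho> t z) * kk z"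
        proof (cases "b * z \<le> N")
          case True then show ?thesis by (simp add: \<eta>'_def kk_def ramp'_outside)
        next
          case False
          have "v 0 * t \<le> v 0 * T" using \<open>t \<le> T\<close> v_0_pos by (intro mult_left_mono) auto
          moreover have "b * z \<le> \<bar>z\<bar>" using abs_ge_self[of "b * z"] bb(2) by (simp add: abs_mult)
          ultimately have "1 + v 0 * t < \<bar>z\<bar>" using False by (simp add: N_def)
          then show ?thesis using elim excess_0 by simp
        qed
        have pos: "(\<bar>\<rho> t z - \<rho>c\<bar> - \<rho>c) + (\<bar>\<rho> t z - 0\<bar> - 0) = 2 * max 0 (\<rho> t z - \<rho>c)"
          using \<rho>_range[of t z] by (auto simp: max_def abs_if)
        have "?Ic z + ?Iz z = ((\<bar>\<rho> t z - \<rho>c\<bar> - \<rho>c) + (\<bar>\<rho> t z - 0\<bar> - 0)) * \<phi>t t z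
            + (kruzkov_flux v \<rho>c (\<rho> t z) + kruzkov_flux v 0 (\<rho> t z)) * (sgn (z - \<xi> t) * \<phi>x t z)"
          by (simp add: algebra_simps)
        also have "\<dots> = 2 * max 0 (\<rho> t z - \<rho>c) * \<phi>t t z + (flux v \<rho>c - 2 * excess (\<rho> t z)) * (\<psi> t * \<eta>' (b * z))"
          by (simp only: pos kruzkov_flux_pair[OF \<rho>_range] sg)
        also have "\<dots> \<le> 0 + (flux v \<rho>c - 2 * excess (\<rho> t z)) * (\<psi> t * \<eta>' (b * z))"
          using \<psi>'_t \<eta>_nonneg[of "b * z"] by (intro add_right_mono mult_nonneg_nonpos) (auto simp: \<phi>t_def mult_nonpos_nonneg)
        also have "\<dots> = flux v \<rho>c * (sgn (z - \<xi> t) * \<phi>x t z) - 2 * (\<psi> t * (excess (\<rho> t z) * \<eta>' (b * z)))"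
          unfolding sg by (simp add: algebra_simps)
        finally show ?case unfolding far .
      qed
    qed
    also have "\<dots> = flux v \<rho>c * (- 2 * \<phi> t (\<xi> t)) - 2 * (\<psi> t * (LINT z|lborel. excess (\<rho> t z) * kk z))"
      by (subst Bochner_Integration.integral_diff, (intro integrable_mult_right tf.integrable_\<phi>x_sign Y_int)+)
        (simp only: integral_mult_right_zero tf.LINT_\<phi>x_sign_line)
    also have "\<dots> = - 2 * ((1 - t / T)\<^sup>2 * (LINT z|lborel. excess (\<rho> t z) * kk z))" by (simp add: \<phi>\<xi> \<psi>_t)
    finally show ?thesis .
  qed
  let ?Y = "\<lambda>t. (1 - t / T)\<^sup>2 * (LINT z|lborel. excess (\<rho> t z) * kk z)"
  have pc_meas [measurable]: "(\<lambda>t. c.production (\<rho> t) (\<xi> t) t) \<in> borel_measurable borel"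
    by (rule c.production_measurable[OF \<rho>_range \<rho>_measurable \<xi>_measurable])
  have pz_meas [measurable]: "(\<lambda>t. z.production (\<rho> t) (\<xi> t) t) \<in> borel_measurable borel"
    by (rule z.production_measurable[OF \<rho>_range \<rho>_measurable \<xi>_measurable])
  have ex2_meas: "(\<lambda>p. excess (\<rho> (fst p) (snd p))) \<in> borel_measurable (borel \<Otimes>\<^sub>M borel)"
    by (rule measurable_compose_range[OF excess_continuous \<rho>_measurable \<rho>_range])
  have Y_meas [measurable]: "(\<lambda>t. LINT z|lborel. excess (\<rho> t z) * kk z) \<in> borel_measurable borel"
  proof -
    have "(\<lambda>(t, z). excess (\<rho> t z) * kk z) \<in> borel_measurable (borel \<Otimes>\<^sub>M lborel)"
      using ex2_meas unfolding split_beta by measurable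
    from lborel.borel_measurable_lebesgue_integral[OF this] show ?thesis by simp
  qed
  have pc_int: "set_integrable lborel {0..T} (\<lambda>t. c.production (\<rho> t) (\<xi> t) t)"
    by (rule set_integrable_Icc_bounded[OF pc_meas c.production_bound(2)[OF \<rho>_range \<rho>_slices(1) B(2)]])
  have pz_int: "set_integrable lborel {0..T} (\<lambda>t. z.production (\<rho> t) (\<xi> t) t)"
    by (rule set_integrable_Icc_bounded[OF pz_meas z.production_bound(2)[OF \<rho>_range \<rho>_slices(1) B(2)]])
  have Yint: "set_integrable lborel {0..T} ?Y"
  proof (rule set_integrable_Icc_bounded)
    show "\<bar>?Y t\<bar> \<le> 1 * ((\<rho>max * v 0 * Bk) * 2)" if t: "t \<in> {0..T}" for t
    proof -
      have "\<bar>LINT z|lborel. excess (\<rho> t z) * kk z\<bar> \<le> (LINT z|lborel. (\<rho>max * v 0 * Bk) * indicator {-1..1::real} z)"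
      proof (rule order_trans[OF integral_abs_bound], rule integral_mono)
        show "integrable lborel (\<lambda>z. \<bar>excess (\<rho> t z) * kk z\<bar>)" by (intro integrable_abs Y_int)
        show "integrable lborel (\<lambda>z. (\<rho>max * v 0 * Bk) * indicator {-1..1::real} z)" by (intro integrable_mult_right integrable_indicator_Icc)
        fix z
        show "\<bar>excess (\<rho> t z) * kk z\<bar> \<le> (\<rho>max * v 0 * Bk) * indicator {-1..1::real} z"
        proof (cases "z \<in> {-1..1}")
          case True
          then show ?thesis using exk[of t z] by simp
        next
          case False then show ?thesis using k_out[OF False] by simp
        qed
      qed
      also have "\<dots> = (\<rho>max * v 0 * Bk) * 2" by simp
      finally have 1: "\<bar>LINT z|lborel. excess (\<rho> t z) * kk z\<bar> \<le> (\<rho>max * v 0 * Bk) * 2" .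
      have "0 \<le> 1 - t / T" "1 - t / T \<le> 1" using t T by (auto simp: field_simps)
      then have 2: "\<bar>(1 - t / T)\<^sup>2\<bar> \<le> 1" by (simp add: power_le_one)
      show ?thesis unfolding abs_mult[of "(1 - t / T)\<^sup>2"] by (rule mult_mono[OF 2 1]) auto
    qed
  qed measurable
  have ineq_c: "0 \<le> (LINT t:{0..T}|lborel. c.production (\<rho> t) (\<xi> t) t) + (LINT z|lborel. (\<bar>\<rho> 0 z - \<rho>c\<bar> - \<rho>c) * \<phi> 0 z)"
    by (rule limit_entropy_inequality[OF e1])
  have ineq_z: "0 \<le> (LINT t:{0..T}|lborel. z.production (\<rho> t) (\<xi> t) t) + (LINT z|lborel. (\<bar>\<rho> 0 z - 0\<bar> - 0) * \<phi> 0 z)"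
    by (rule limit_entropy_inequality[OF e0])
  have "(LINT t:{0..T}|lborel. c.production (\<rho> t) (\<xi> t) t) + (LINT t:{0..T}|lborel. z.production (\<rho> t) (\<xi> t) t)
      = (LINT t:{0..T}|lborel. c.production (\<rho> t) (\<xi> t) t + z.production (\<rho> t) (\<xi> t) t)"
    by (rule set_integral_add(2)[symmetric, OF pc_int pz_int])
  also have "\<dots> \<le> (LINT t:{0..T}|lborel. - 2 * ?Y t)"
    by (rule set_integral_mono[OF set_integral_add(1)[OF pc_int pz_int]])
      (intro set_integrable_mult_right Yint, rule production_le)
  also have "\<dots> = - 2 * (LINT t:{0..T}|lborel. ?Y t)" by (rule set_integral_mult_right)
  finally have prod: "(LINT t:{0..T}|lborel. c.production (\<rho> t) (\<xi> t) t) + (LINT t:{0..T}|lborel. z.production (\<rho> t) (\<xi> t) t)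
      \<le> - 2 * (LINT t:{0..T}|lborel. ?Y t)" .
  define J where "J = (if b = 1 then {1 - \<epsilon>..1} else {-1..-(1 - \<epsilon>)})"
  have J_int: "integrable lborel (indicator J :: real \<Rightarrow> real)" unfolding J_def using integrable_indicator_Icc by auto
  have J_meas: "(LINT z|lborel. indicator J z) = \<epsilon>" using \<epsilon> by (auto simp: J_def)
  have init_int: "integrable lborel (\<lambda>z. (\<bar>\<rho> 0 z - \<kappa>\<bar> - \<kappa>) * \<phi> 0 z)" if \<kappa>: "\<kappa> \<in> {0..\<rho>max}" for \<kappa>
  proof -
    have [measurable]: "\<phi> 0 \<in> borel_measurable borel" by (rule c.test_borel_slice)
    have "set_integrable lborel {-M..M} (\<lambda>z. (\<bar>\<rho> 0 z - \<kappa>\<bar> - \<kappa>) * \<phi> 0 z)"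
    proof (rule set_integrable_Icc_bounded)
      show "\<bar>(\<bar>\<rho> 0 z - \<kappa>\<bar> - \<kappa>) * \<phi> 0 z\<bar> \<le> (2 * \<rho>max) * B" for z
        unfolding abs_mult using \<rho>_range[of 0 z] \<kappa> B(2)[of 0 z] T by (intro mult_mono) auto
    qed measurable
    moreover have "(\<lambda>z. indicat_real {-M..M} z *\<^sub>R ((\<bar>\<rho> 0 z - \<kappa>\<bar> - \<kappa>) * \<phi> 0 z)) = (\<lambda>z. (\<bar>\<rho> 0 z - \<kappa>\<bar> - \<kappa>) * \<phi> 0 z)"
    proof
      fix z show "indicat_real {-M..M} z *\<^sub>R ((\<bar>\<rho> 0 z - \<kappa>\<bar> - \<kappa>) * \<phi> 0 z) = (\<bar>\<rho> 0 z - \<kappa>\<bar> - \<kappa>) * \<phi> 0 z"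
        using tf.outside_window[of z 0] by (cases "z \<in> {-M..M}") simp_all
    qed
    ultimately show ?thesis by (simp only: set_integrable_def)
  qed
  have zero_in: "(0::real) \<in> {0..\<rho>max}" using \<rho>max_pos by simp
  have "(LINT z|lborel. (\<bar>\<rho> 0 z - \<rho>c\<bar> - \<rho>c) * \<phi> 0 z) + (LINT z|lborel. (\<bar>\<rho> 0 z - 0\<bar> - 0) * \<phi> 0 z)
      = (LINT z|lborel. (\<bar>\<rho> 0 z - \<rho>c\<bar> - \<rho>c) * \<phi> 0 z + (\<bar>\<rho> 0 z - 0\<bar> - 0) * \<phi> 0 z)"
    by (rule Bochner_Integration.integral_add[symmetric, OF init_int[OF critical_density(1)] init_int[OF zero_in]])
  also have "\<dots> \<le> (LINT z|lborel. 2 * \<rho>max * indicator J z)"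
  proof (rule integral_mono_AE)
    show "integrable lborel (\<lambda>z. (\<bar>\<rho> 0 z - \<rho>c\<bar> - \<rho>c) * \<phi> 0 z + (\<bar>\<rho> 0 z - 0\<bar> - 0) * \<phi> 0 z)"
      by (rule Bochner_Integration.integrable_add[OF init_int[OF critical_density(1)] init_int[OF zero_in]])
    show "integrable lborel (\<lambda>z. 2 * \<rho>max * indicator J z)" by (intro integrable_mult_right J_int)
    have "AE z in lborel. 1 + v 0 * 0 < \<bar>z\<bar> \<longrightarrow> \<rho> 0 z = 0" by (rule \<rho>_outside) simp
    then show "AE z in lborel. (\<bar>\<rho> 0 z - \<rho>c\<bar> - \<rho>c) * \<phi> 0 z + (\<bar>\<rho> 0 z - 0\<bar> - 0) * \<phi> 0 z \<le> 2 * \<rho>max * indicator J z"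
    proof eventually_elim
      case (elim z)
      have pos: "(\<bar>\<rho> 0 z - \<rho>c\<bar> - \<rho>c) + (\<bar>\<rho> 0 z - 0\<bar> - 0) = 2 * max 0 (\<rho> 0 z - \<rho>c)"
        using \<rho>_range[of 0 z] by (auto simp: max_def abs_if)
      have eq: "(\<bar>\<rho> 0 z - \<rho>c\<bar> - \<rho>c) * \<phi> 0 z + (\<bar>\<rho> 0 z - 0\<bar> - 0) * \<phi> 0 z = 2 * max 0 (\<rho> 0 z - \<rho>c) * \<phi> 0 z"
        unfolding pos[symmetric] by (simp add: distrib_right)
      have \<phi>0: "0 \<le> \<phi> 0 z" "\<phi> 0 z \<le> 1" using \<eta>_nonneg \<eta>_le by (simp_all add: \<phi>_def \<psi>_def)
      consider "z \<in> J" | "b * z \<le> 1 - \<epsilon>" | "1 < \<bar>z\<bar>" using b unfolding J_def by fastforce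
      then show ?case
      proof cases
        case 1
        have "2 * max 0 (\<rho> 0 z - \<rho>c) * \<phi> 0 z \<le> (2 * \<rho>max) * 1"
          using \<rho>_range[of 0 z] critical_density(1) \<phi>0 by (intro mult_mono) auto
        then show ?thesis unfolding eq using 1 by simp
      next
        case 2
        then have "\<phi> 0 z = 0" using \<eta>_low by (simp add: \<phi>_def)
        then show ?thesis using \<rho>max_pos by simp
      next
        case 3
        then have "\<rho> 0 z = 0" using elim by simp
        then show ?thesis unfolding eq using critical_density(1) \<rho>max_pos by simp
      qed
    qed
  qed
  also have "\<dots> = 2 * \<rho>max * \<epsilon>" using J_meas by simp
  finally show ?thesis using ineq_c ineq_z prod unfolding kk_def[symmetric] by linarith
qed

end

section \<open>Boundary condition and convergence\<close>

lemma ramp'_le: "ramp' s \<le> 2"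
  unfolding ramp'_def by (simp add: max_def)

text \<open>A probability density concentrated within the distance \<open>\<epsilon>\<close> of the exit \<open>b\<close>, inside of the corridor.\<close>

lemma ramp_kernel:
  fixes b \<epsilon> :: real
  assumes b: "b \<in> {-1, 1}" and \<epsilon>: "0 < \<epsilon>" "\<epsilon> < 1"
  defines "k \<equiv> \<lambda>z. ramp' ((b * z - 1) / \<epsilon> + 1) / \<epsilon>"
  shows "\<And>z. 0 \<le> k z" "\<And>z. k z \<le> 2 / \<epsilon>" "\<And>z. k z \<noteq> 0 \<Longrightarrow> z \<in> corridor \<and> \<bar>z - b\<bar> < \<epsilon>"
    "k \<in> borel_measurable borel" "integrable lborel k" "(LINT z|lborel. k z) = 1"
proof -
  show nonneg: "0 \<le> k z" for z using ramp'_nonneg \<epsilon> by (simp add: k_def)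
  show le: "k z \<le> 2 / \<epsilon>" for z unfolding k_def using ramp'_le \<epsilon> by (intro divide_right_mono) auto
  show out: "z \<in> corridor \<and> \<bar>z - b\<bar> < \<epsilon>" if "k z \<noteq> 0" for z
  proof -
    have "\<not> ((b * z - 1) / \<epsilon> + 1 \<le> 0 \<or> 1 \<le> (b * z - 1) / \<epsilon> + 1)"
      using that ramp'_outside[of "(b * z - 1) / \<epsilon> + 1"] by (auto simp: k_def)
    then have "1 - \<epsilon> < b * z" "b * z < 1" using \<epsilon> by (auto simp: not_le field_simps)
    then show ?thesis using b \<epsilon> by auto
  qed
  have cont: "continuous_on UNIV k" unfolding k_def
    using \<epsilon> by (intro continuous_intros continuous_on_compose2[OF ramp'_continuous[of UNIV]]) auto
  then show [measurable]: "k \<in> borel_measurable borel" by (rule borel_measurable_continuous_onI)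
  have int: "set_integrable lborel {-1..1} k" by (intro borel_integrable_atLeastAtMost' continuous_on_subset[OF cont]) auto
  have win: "(\<lambda>z. indicat_real {-1..1} z *\<^sub>R k z) = k"
  proof
    fix z show "indicat_real {-1..1} z *\<^sub>R k z = k z"
      using out[of z] by (cases "k z = 0") auto
  qed
  show "integrable lborel k" using int unfolding set_integrable_def win .
  have d: "((\<lambda>z. b * ramp ((b * z - 1) / \<epsilon> + 1)) has_real_derivative k z) (at z)" for z
  proof -
    have d1: "((\<lambda>z. (b * z - 1) / \<epsilon> + 1) has_real_derivative b / \<epsilon>) (at z)"
      by (rule DERIV_cong[OF DERIV_add[OF DERIV_cdivide[OF DERIV_diff[OF DERIV_cmult[OF DERIV_ident] DERIV_const]] DERIV_const]]) simp
    show ?thesis unfolding k_def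
      by (rule DERIV_cong[OF DERIV_cmult[OF DERIV_chain2[OF ramp_has_derivative d1]]]) (use b in auto)
  qed
  have "(k has_integral b * ramp ((b * 1 - 1) / \<epsilon> + 1) - b * ramp ((b * (-1) - 1) / \<epsilon> + 1)) {-1..1}"
    by (rule fundamental_theorem_of_calculus)
      (use d in \<open>auto simp: has_real_derivative_iff_has_vector_derivative[symmetric] intro: has_field_derivative_at_within\<close>)
  moreover have "b * ramp ((b * 1 - 1) / \<epsilon> + 1) - b * ramp ((b * (-1) - 1) / \<epsilon> + 1) = 1"
  proof -
    have "ramp (- 2 / \<epsilon> + 1) = 0" using \<epsilon> by (intro ramp_low) (simp add: field_simps)
    moreover have "ramp 1 = 1" by (rule ramp_high) simp
    ultimately show ?thesis using b by auto
  qed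
  ultimately have "(LINT z:{-1..1}|lborel. k z) = 1"
    using set_borel_integral_eq_integral(2)[OF int] by (simp add: integral_unique)
  then show "(LINT z|lborel. k z) = 1" unfolding set_lebesgue_integral_def win .
qed

context convergent_schemes
begin

text \<open>As \<open>\<epsilon>\<close> tends to \<open>0\<close>, the estimate of the flux near the exit becomes \<open>\<integral> (1 - t / T)\<^sup>2 excess (\<gamma> t) dt \<le> 0\<close>, because
\<open>\<rho>(\<cdot>, z)\<close> is close to \<open>\<gamma>\<close> in \<open>L\<^sup>1\<close> for almost every \<open>z\<close> near the exit.  The integrand is nonnegative.\<close>

lemma trace_le_critical:
  assumes b: "b \<in> {-1, 1}" and \<gamma>_meas [measurable]: "\<gamma> \<in> borel_measurable borel" and \<gamma>_range: "\<And>t. \<gamma> t \<in> {0..\<rho>max}"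
    and trace: "\<And>T e. 0 < T \<Longrightarrow> 0 < e \<Longrightarrow> \<exists>\<delta>>0. \<forall>z. z \<in> good_lines \<and> z \<in> corridor \<and> \<bar>z - b\<bar> < \<delta> \<longrightarrow>
        (LINT t:{0..T}|lborel. \<bar>\<rho> t z - \<gamma> t\<bar>) \<le> e"
  shows "AE t in lborel. 0 < t \<longrightarrow> \<gamma> t \<le> \<rho>c"
proof -
  obtain K where K: "0 \<le> K" "\<And>r s. r \<in> {0..\<rho>max} \<Longrightarrow> s \<in> {0..\<rho>max} \<Longrightarrow> \<bar>excess r - excess s\<bar> \<le> K * \<bar>r - s\<bar>"
    using excess_Lipschitz by blast
  have ex2_meas: "(\<lambda>p. excess (\<rho> (fst p) (snd p))) \<in> borel_measurable (borel \<Otimes>\<^sub>M borel)"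
    by (rule measurable_compose_range[OF excess_continuous \<rho>_measurable \<rho>_range])
  have ex_meas [measurable]: "(\<lambda>t. excess (\<rho> t z)) \<in> borel_measurable borel" for z
    by (rule measurable_compose_range[OF excess_continuous \<rho>_slices(2) \<rho>_range])
  have ex\<gamma>_meas [measurable]: "(\<lambda>t. excess (\<gamma> t)) \<in> borel_measurable borel"
    by (rule measurable_compose_range[OF excess_continuous \<gamma>_meas \<gamma>_range])
  have on_interval: "AE t in lborel. t \<in> {0..T} \<longrightarrow> (1 - t / T)\<^sup>2 * excess (\<gamma> t) = 0" if T: "0 < T" for T
  proof -
    have weight: "0 \<le> (1 - t / T)\<^sup>2" "(1 - t / T)\<^sup>2 \<le> 1" if "t \<in> {0..T}" for t
    proof -
      have "0 \<le> 1 - t / T" "1 - t / T \<le> 1" using that T by (auto simp: field_simps)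
      then show "(1 - t / T)\<^sup>2 \<le> 1" by (simp add: power_le_one)
    qed simp
    have wbound: "\<bar>indicator {0..T} t * (1 - t / T)\<^sup>2\<bar> \<le> 1" for t
      using weight[of t] by (cases "t \<in> {0..T}") (simp_all del: atLeastAtMost_iff)
    have wint: "set_integrable lborel {0..T} (\<lambda>t. (1 - t / T)\<^sup>2 * h t)"
      if [measurable]: "h \<in> borel_measurable borel" and h: "\<And>t. \<bar>h t\<bar> \<le> D" for h :: "real \<Rightarrow> real" and D
    proof -
      have "set_integrable lborel {0..T} (\<lambda>t. (indicator {0..T} t * (1 - t / T)\<^sup>2) * h t)"
      proof (rule set_integrable_Icc_bounded)
        have "0 \<le> D" using h[of 0] by linarith
        then show "\<bar>(indicator {0..T} t * (1 - t / T)\<^sup>2) * h t\<bar> \<le> 1 * D" for t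
          unfolding abs_mult[of "_ * _" "h t"] by (intro mult_mono wbound h) auto
      qed measurable
      moreover have "set_integrable lborel {0..T} (\<lambda>t. (indicator {0..T} t * (1 - t / T)\<^sup>2) * h t)
          = set_integrable lborel {0..T} (\<lambda>t. (1 - t / T)\<^sup>2 * h t)"
        by (rule set_integrable_cong) auto
      ultimately show ?thesis by (simp only:)
    qed
    have w\<gamma>: "set_integrable lborel {0..T} (\<lambda>t. (1 - t / T)\<^sup>2 * excess (\<gamma> t))"
      by (rule wint[OF ex\<gamma>_meas]) (rule excess_le[OF \<gamma>_range])
    have w\<rho>: "set_integrable lborel {0..T} (\<lambda>t. (1 - t / T)\<^sup>2 * excess (\<rho> t z))" for z
      by (rule wint[OF ex_meas]) (rule excess_le[OF \<rho>_range])
    define c where "c = (LINT t:{0..T}|lborel. (1 - t / T)\<^sup>2 * excess (\<gamma> t))"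
    have c_le: "c \<le> (K + \<rho>max) * e" if e: "0 < e" for e
    proof -
      obtain \<delta> where \<delta>: "0 < \<delta>" "\<And>z. z \<in> good_lines \<Longrightarrow> z \<in> corridor \<Longrightarrow> \<bar>z - b\<bar> < \<delta> \<Longrightarrow>
        (LINT t:{0..T}|lborel. \<bar>\<rho> t z - \<gamma> t\<bar>) \<le> e"
        using trace[OF T e] by blast
      have "continuous_on {0..T} (\<lambda>t. b * \<xi> t)"
      proof (intro continuous_intros)
        have "(2 * \<alpha> * (\<rho>max * v 0 + \<rho>max))-lipschitz_on {0..T} \<xi>"
          using \<xi>_Lipschitz \<alpha>0 \<rho>max_pos v_0_pos by (intro lipschitz_onI) (auto simp: dist_real_def)
        then show "continuous_on {0..T} \<xi>" by (rule lipschitz_on_continuous_on)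
      qed
      then obtain t1 where t1: "t1 \<in> {0..T}" "\<And>t. t \<in> {0..T} \<Longrightarrow> b * \<xi> t \<le> b * \<xi> t1"
        using continuous_attains_sup[of "{0..T}" "\<lambda>t. b * \<xi> t"] T by auto
      \<comment> \<open>The turning curve keeps this distance from the exit up to the time T.\<close>
      define \<epsilon>0 where "\<epsilon>0 = 1 - b * \<xi> t1"
      have \<epsilon>0: "0 < \<epsilon>0" using \<xi>_range[of t1] b by (auto simp: \<epsilon>0_def)
      define \<epsilon> where "\<epsilon> = min (min \<epsilon>0 \<delta>) (min e (1/2))"
      have \<epsilon>: "0 < \<epsilon>" "\<epsilon> < 1" "\<epsilon> \<le> \<epsilon>0" "\<epsilon> \<le> \<delta>" "\<epsilon> \<le> e" using \<epsilon>0 \<delta>(1) e by (auto simp: \<epsilon>_def)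
      define k where "k z = ramp' ((b * z - 1) / \<epsilon> + 1) / \<epsilon>" for z
      note kern = ramp_kernel[OF b \<epsilon>(1,2), folded k_def[abs_def], folded k_def]
      have [measurable]: "k \<in> borel_measurable borel" by (rule kern(4))
      have est: "(LINT t:{0..T}|lborel. (1 - t / T)\<^sup>2 * (LINT z|lborel. excess (\<rho> t z) * k z)) \<le> \<rho>max * \<epsilon>"
        unfolding k_def
      proof (rule boundary_flux_estimate[OF b T \<epsilon>(1,2)])
        show "b * \<xi> t \<le> 1 - \<epsilon>" if "t \<in> {0..T}" for t using t1(2)[OF that] \<epsilon>(3) by (simp add: \<epsilon>0_def)
      qed
      define q where "q t z = (indicator {0..T} t * (1 - t / T)\<^sup>2) * (excess (\<rho> t z) * k z)" for t z
      have q_int: "integrable (lborel \<Otimes>\<^sub>M lborel) (case_prod q)"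
      proof -
        let ?S = "{0..T} \<times> {-1..1::real}"
        let ?h = "\<lambda>p. (indicator {0..T} (fst p) * (1 - fst p / T)\<^sup>2) * (excess (\<rho> (fst p) (snd p)) * k (snd p))"
        have hm: "?h \<in> borel_measurable borel"
          using ex2_meas unfolding borel_prod[symmetric] by measurable
        have hb: "\<bar>?h p\<bar> \<le> 1 * ((\<rho>max * v 0) * (2 / \<epsilon>))" for p
        proof -
          have "\<bar>excess (\<rho> (fst p) (snd p)) * k (snd p)\<bar> \<le> (\<rho>max * v 0) * (2 / \<epsilon>)"
          proof (subst abs_mult, rule mult_mono[OF excess_le[OF \<rho>_range]])
            show "\<bar>k (snd p)\<bar> \<le> 2 / \<epsilon>" using kern(1,2)[of "snd p"] by simp
          qed (use \<rho>max_pos v_0_pos in auto)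
          then show ?thesis by (subst abs_mult) (rule mult_mono[OF wbound], auto)
        qed
        have "integrable lborel (\<lambda>p. indicator ?S p * ?h p)"
          by (rule planar_integrable(1)[OF hm _ _ hb]) (auto intro!: bounded_Times borel_closed closed_Times)
        moreover have "(\<lambda>p. indicator ?S p * ?h p) = case_prod q"
        proof
          fix p :: "real \<times> real"
          show "indicator ?S p * ?h p = case_prod q p"
            using kern(3)[of "snd p"] by (cases p; cases "k (snd p) = 0"; cases "fst p \<in> {0..T}") (auto simp: q_def)
        qed
        ultimately show ?thesis by (simp only: lborel_prod)
      qed
      have E1: "(LINT t:{0..T}|lborel. (1 - t / T)\<^sup>2 * (LINT z|lborel. excess (\<rho> t z) * k z)) = (LINT t|lborel. LINT z|lborel. q t z)"
        unfolding set_lebesgue_integral_def q_def by (simp add: mult.assoc)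
      also have "\<dots> = (LINT z|lborel. LINT t|lborel. q t z)" by (rule lborel_pair.Fubini_integral[OF q_int, symmetric])
      finally have E2: "(LINT z|lborel. LINT t|lborel. q t z) \<le> \<rho>max * \<epsilon>" using est by simp
      have inner: "(LINT t|lborel. q t z) = k z * (LINT t:{0..T}|lborel. (1 - t / T)\<^sup>2 * excess (\<rho> t z))" for z
      proof -
        have "(LINT t|lborel. q t z) = (LINT t|lborel. k z * (indicator {0..T} t *\<^sub>R ((1 - t / T)\<^sup>2 * excess (\<rho> t z))))"
          by (rule Bochner_Integration.integral_cong) (auto simp: q_def)
        then show ?thesis by (simp add: set_lebesgue_integral_def)
      qed
      have "(c - K * e) * 1 = (LINT z|lborel. (c - K * e) * k z)" using kern(6) by simp
      also have "\<dots> \<le> (LINT z|lborel. LINT t|lborel. q t z)"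
      proof (rule integral_mono_AE)
        show "integrable lborel (\<lambda>z. (c - K * e) * k z)" by (intro integrable_mult_right kern(5))
        show "integrable lborel (\<lambda>z. LINT t|lborel. q t z)" by (rule lborel_pair.integrable_snd[OF q_int])
        show "AE z in lborel. (c - K * e) * k z \<le> (LINT t|lborel. q t z)"
          using AE_good_lines
        proof eventually_elim
          case (elim z)
          show ?case
          proof (cases "k z = 0")
            case True then show ?thesis unfolding inner by simp
          next
            case False
            then have z: "z \<in> corridor" "\<bar>z - b\<bar> < \<delta>" using kern(3)[OF False] \<epsilon>(4) by auto
            have abs_int: "set_integrable lborel {0..T} (\<lambda>t. K * \<bar>\<rho> t z - \<gamma> t\<bar>)"
            proof (rule set_integrable_mult_right, rule set_integrable_Icc_bounded)
              show "\<bar>\<bar>\<rho> t z - \<gamma> t\<bar>\<bar> \<le> \<rho>max" for t using \<rho>_range[of t z] \<gamma>_range[of t] by auto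
            qed measurable
            have "c \<le> (LINT t:{0..T}|lborel. (1 - t / T)\<^sup>2 * excess (\<rho> t z) + K * \<bar>\<rho> t z - \<gamma> t\<bar>)"
              unfolding c_def
            proof (rule set_integral_mono[OF w\<gamma> set_integral_add(1)[OF w\<rho> abs_int]])
              fix t assume t: "t \<in> {0..T}"
              have "excess (\<gamma> t) - excess (\<rho> t z) \<le> K * \<bar>\<rho> t z - \<gamma> t\<bar>"
                using K(2)[OF \<gamma>_range \<rho>_range, of t t z] by (simp add: abs_minus_commute)
              from mult_left_mono[OF this weight(1)[OF t]]
              have "(1 - t / T)\<^sup>2 * (excess (\<gamma> t) - excess (\<rho> t z)) \<le> (1 - t / T)\<^sup>2 * (K * \<bar>\<rho> t z - \<gamma> t\<bar>)" .
              also have "\<dots> \<le> 1 * (K * \<bar>\<rho> t z - \<gamma> t\<bar>)"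
                by (rule mult_right_mono[OF weight(2)[OF t]]) (use K(1) in simp)
              finally have "(1 - t / T)\<^sup>2 * (excess (\<gamma> t) - excess (\<rho> t z)) \<le> 1 * (K * \<bar>\<rho> t z - \<gamma> t\<bar>)" .
              then show "(1 - t / T)\<^sup>2 * excess (\<gamma> t) \<le> (1 - t / T)\<^sup>2 * excess (\<rho> t z) + K * \<bar>\<rho> t z - \<gamma> t\<bar>"
                by (simp add: right_diff_distrib)
            qed
            also have "\<dots> = (LINT t:{0..T}|lborel. (1 - t / T)\<^sup>2 * excess (\<rho> t z)) + K * (LINT t:{0..T}|lborel. \<bar>\<rho> t z - \<gamma> t\<bar>)"
              by (subst set_integral_add(2)[OF w\<rho> abs_int]) simp
            also have "\<dots> \<le> (LINT t:{0..T}|lborel. (1 - t / T)\<^sup>2 * excess (\<rho> t z)) + K * e"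
              by (rule add_left_mono) (rule mult_left_mono[OF \<delta>(2)[OF elim z] K(1)])
            finally have "c - K * e \<le> (LINT t:{0..T}|lborel. (1 - t / T)\<^sup>2 * excess (\<rho> t z))" by simp
            from mult_left_mono[OF this kern(1)] show ?thesis unfolding inner by (simp add: mult.commute)
          qed
        qed
      qed
      finally have "c - K * e \<le> \<rho>max * \<epsilon>" using E2 by simp
      moreover have "\<rho>max * \<epsilon> \<le> \<rho>max * e" using \<epsilon>(5) \<rho>max_pos by (intro mult_left_mono) auto
      ultimately show ?thesis by (simp add: algebra_simps)
    qed
    have "c \<le> 0"
    proof (rule ccontr)
      assume "\<not> c \<le> 0"
      then have pos: "0 < c" by simp
      have Kp: "0 < K + \<rho>max" using K(1) \<rho>max_pos by simp
      have "c \<le> (K + \<rho>max) * (c / (2 * (K + \<rho>max)))" using pos Kp by (intro c_le) auto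
      also have "\<dots> = c / 2"
      proof -
        have "p * (c / (2 * p)) = c / 2" if "p \<noteq> 0" for p :: real using that by simp
        then show ?thesis using Kp by (metis less_irrefl)
      qed
      finally show False using pos by simp
    qed
    moreover have nn: "0 \<le> indicator {0..T} t *\<^sub>R ((1 - t / T)\<^sup>2 * excess (\<gamma> t))" for t
      using excess_nonneg[OF \<gamma>_range[of t]] by (auto simp: indicator_def)
    moreover have "0 \<le> c" unfolding c_def set_lebesgue_integral_def by (intro integral_nonneg_AE AE_I2 nn)
    ultimately have "(LINT t|lborel. indicator {0..T} t *\<^sub>R ((1 - t / T)\<^sup>2 * excess (\<gamma> t))) = 0"
      unfolding c_def set_lebesgue_integral_def by (intro order_antisym)
    then have "AE t in lborel. indicator {0..T} t *\<^sub>R ((1 - t / T)\<^sup>2 * excess (\<gamma> t)) = 0"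
      using integral_nonneg_eq_0_iff_AE[OF w\<gamma>[unfolded set_integrable_def]] nn by auto
    then show ?thesis by eventually_elim (auto simp: indicator_def)
  qed
  have "AE t in lborel. \<forall>n. t \<in> {0..real (Suc n)} \<longrightarrow> (1 - t / real (Suc n))\<^sup>2 * excess (\<gamma> t) = 0"
    unfolding AE_all_countable using on_interval by (intro allI) simp
  then show ?thesis
  proof eventually_elim
    case (elim t)
    show ?case
    proof
      assume t: "0 < t"
      obtain n where n: "t < real n" using reals_Archimedean2 by blast
      then have "t < real (Suc n)" by simp
      then have "t \<in> {0..real (Suc n)}" "1 - t / real (Suc n) \<noteq> 0" using t by auto
      with elim have "excess (\<gamma> t) = 0" by (metis mult_eq_0_iff power_eq_0_iff)
      then show "\<gamma> t \<le> \<rho>c" by (rule excess_eq_0[OF \<gamma>_range])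
    qed
  qed
qed

lemma boundary_condition_limit: "boundary_condition \<rho>c \<rho>"
  unfolding boundary_condition_def
proof
  fix b :: real assume b: "b \<in> {-1, 1}"
  obtain \<gamma> where \<gamma>: "\<gamma> \<in> borel_measurable borel" "\<And>t. \<gamma> t \<in> {0..\<rho>max}"
    "\<And>T e. 0 < T \<Longrightarrow> 0 < e \<Longrightarrow> \<exists>\<delta>>0. \<forall>z. z \<in> good_lines \<and> z \<in> corridor \<and> \<bar>z - b\<bar> < \<delta> \<longrightarrow>
        (LINT t:{0..T}|lborel. \<bar>\<rho> t z - \<gamma> t\<bar>) \<le> e"
    using trace_exists[OF b] by blast
  have [measurable]: "\<gamma> \<in> borel_measurable borel" by (rule \<gamma>(1))
  have "strong_trace \<rho> b \<gamma>"
    unfolding strong_trace_def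
  proof (intro conjI allI impI)
    have "\<gamma> \<in> borel_measurable lebesgue" by (rule measurable_completion) simp
    then show "\<gamma> \<in> borel_measurable (lebesgue_on {0<..})" by (rule measurable_restrict_space1)
    fix T e :: real assume T: "0 < T" and e: "0 < e"
    obtain \<delta> where \<delta>: "0 < \<delta>" "\<And>z. z \<in> good_lines \<Longrightarrow> z \<in> corridor \<Longrightarrow> \<bar>z - b\<bar> < \<delta> \<Longrightarrow>
        (LINT t:{0..T}|lborel. \<bar>\<rho> t z - \<gamma> t\<bar>) \<le> e / 2"
      using \<gamma>(3)[OF T, of "e / 2"] e by auto
    have le: "\<bar>\<rho> t z - \<gamma> t\<bar> \<le> \<rho>max" for t z using \<rho>_range[of t z] \<gamma>(2)[of t] by auto
    have int: "set_integrable lebesgue {0<..<T} (\<lambda>t. \<rho> t z - \<gamma> t)" for z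
    proof -
      have "set_integrable lborel {0..T} (\<lambda>t. \<rho> t z - \<gamma> t)" by (rule set_integrable_Icc_bounded[OF _ le]) measurable
      then have "set_integrable lborel {0<..<T} (\<lambda>t. \<rho> t z - \<gamma> t)" by (rule set_integrable_subset) auto
      then show ?thesis unfolding set_integrable_def by (subst integrable_completion) auto
    qed
    have norm: "L1_norm {0<..<T} (\<lambda>t. \<rho> t z - \<gamma> t) = (LINT t:{0..T}|lborel. \<bar>\<rho> t z - \<gamma> t\<bar>)" for z
    proof -
      have "L1_norm {0<..<T} (\<lambda>t. \<rho> t z - \<gamma> t) = (LINT t:{0<..<T}|lborel. \<bar>\<rho> t z - \<gamma> t\<bar>)"
        unfolding L1_norm_def set_lebesgue_integral_def by (rule lebesgue_integral_eq_lborel) measurable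
      also have "\<dots> = (LINT t:{0..T}|lborel. \<bar>\<rho> t z - \<gamma> t\<bar>)"
        unfolding set_lebesgue_integral_def
      proof (rule integral_cong_AE)
        show "AE t in lborel. indicat_real {0<..<T} t *\<^sub>R \<bar>\<rho> t z - \<gamma> t\<bar> = indicat_real {0..T} t *\<^sub>R \<bar>\<rho> t z - \<gamma> t\<bar>"
          using AE_lborel_singleton[of 0] AE_lborel_singleton[of T] by eventually_elim (auto simp: indicator_def)
      qed measurable
      finally show ?thesis .
    qed
    have "AE z in lebesgue. z \<in> good_lines" by (rule AE_completion) (rule AE_good_lines)
    then have "AE z in lebesgue. z \<in> corridor \<and> \<bar>z - b\<bar> < \<delta> \<longrightarrow>
        set_integrable lebesgue {0<..<T} (\<lambda>t. \<rho> t z - \<gamma> t) \<and> L1_norm {0<..<T} (\<lambda>t. \<rho> t z - \<gamma> t) < e"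
    proof eventually_elim
      case (elim z)
      show ?case
      proof (intro impI conjI int)
        assume "z \<in> corridor \<and> \<bar>z - b\<bar> < \<delta>"
        then have "(LINT t:{0..T}|lborel. \<bar>\<rho> t z - \<gamma> t\<bar>) \<le> e / 2" using elim by (intro \<delta>(2)) auto
        then show "L1_norm {0<..<T} (\<lambda>t. \<rho> t z - \<gamma> t) < e" unfolding norm using e by simp
      qed
    qed
    then show "\<exists>\<delta>>0. AE z in lebesgue. z \<in> corridor \<and> \<bar>z - b\<bar> < \<delta> \<longrightarrow>
        set_integrable lebesgue {0<..<T} (\<lambda>t. \<rho> t z - \<gamma> t) \<and> L1_norm {0<..<T} (\<lambda>t. \<rho> t z - \<gamma> t) < e"
      using \<delta>(1) by blast
  qed
  moreover have "AE t in lebesgue. 0 < t \<longrightarrow> \<gamma> t \<in> {0..\<rho>c}"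
  proof -
    have "AE t in lborel. 0 < t \<longrightarrow> \<gamma> t \<le> \<rho>c" by (rule trace_le_critical[OF b \<gamma>])
    then have "AE t in lebesgue. 0 < t \<longrightarrow> \<gamma> t \<le> \<rho>c" by (rule AE_completion)
    then show ?thesis by eventually_elim (use \<gamma>(2) in auto)
  qed
  ultimately show "\<exists>\<gamma>. strong_trace \<rho> b \<gamma> \<and> (AE t in lebesgue. 0 < t \<longrightarrow> \<gamma> t \<in> {0..\<rho>c})" by blast
qed

lemma limit_entropy_solution: "entropy_solution \<rho>max v (\<lambda>u. 1 + \<alpha> * u) \<rho>0 \<rho> \<xi>"
  unfolding entropy_solution_def
proof (intro conjI allI impI)
  fix K :: "(real \<times> real) set" assume K: "compact K \<and> K \<subseteq> {0..} \<times> corridor"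
  have "(\<lambda>p. \<rho> (fst p) (snd p)) \<in> borel_measurable borel" using \<rho>_measurable unfolding borel_prod .
  moreover have "K \<in> sets borel" using K by (intro borel_closed compact_imp_closed) simp
  ultimately have "set_integrable lebesgue K (\<lambda>p. \<rho> (fst p) (snd p))"
    by (rule planar_integrable(2)) (use K compact_imp_bounded \<rho>_abs_le in auto)
  moreover have "(\<lambda>p. \<rho> (fst p) (snd p)) = (\<lambda>(t, x). \<rho> t x)" by auto
  ultimately show "set_integrable lebesgue K (\<lambda>(t, x). \<rho> t x)" by (simp only:)
next
  show "AE (t, x) in lebesgue. 0 \<le> t \<and> x \<in> corridor \<longrightarrow> \<rho> t x \<in> {0..\<rho>max}"
    using \<rho>_range by (intro AE_I2) (simp only: split_beta, blast)
next
  have "(2 * \<alpha> * (\<rho>max * v 0 + \<rho>max))-lipschitz_on {0..} \<xi>"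
    using \<xi>_Lipschitz \<alpha>0 \<rho>max_pos v_0_pos by (intro lipschitz_onI) (auto simp: dist_real_def)
  then show "\<exists>C. C-lipschitz_on {0..} \<xi>" by blast
next
  show "\<xi> ` {0..} \<subseteq> corridor" using \<xi>_range by auto
qed (rule turning_condition_limit entropy_inequality_limit L1_continuous_limit boundary_condition_limit)+

lemma turning_curve_convergence: "uniform_limit {0..T} (\<lambda>k. \<zeta> (r k)) \<xi> sequentially"
proof -
  have "uniform_limit {0..T} (\<lambda>k. turn (r k)) \<xi> sequentially = uniform_limit {0..T} (\<lambda>k. \<zeta> (r k)) \<xi> sequentially"
    by (rule uniform_limit_cong') (auto simp: turn_def)
  then show ?thesis using turn_uniform by simp
qed

end

theorem theorem2:
  fixes \<rho>max \<alpha> :: real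
    and v \<rho>0 :: "real \<Rightarrow> real"
    and x :: "nat \<Rightarrow> nat \<Rightarrow> real \<Rightarrow> real"
    and \<zeta> :: "nat \<Rightarrow> real \<Rightarrow> real"
  assumes "0 < \<rho>max" and "admissible_velocity \<rho>max v" and "0 \<le> \<alpha>"
    and "BV_on corridor \<rho>0"
    and "AE y in lebesgue. y \<in> corridor \<longrightarrow> \<rho>0 y \<in> {0..\<rho>max}"
    and "0 < L1_norm corridor \<rho>0"
    and "\<And>n. 1 \<le> n \<Longrightarrow> scheme_solution \<rho>max v \<alpha> \<rho>0 n (x n) (\<zeta> n)"
    and "\<And>T. 0 < T \<Longrightarrow> \<exists>TV>0. \<forall>t\<in>{0..T}. \<forall>n\<ge>1.
           total_variation UNIV (approximate_density \<rho>0 n (x n) t) \<le> ereal TV"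
  shows "\<exists>(r :: nat \<Rightarrow> nat) \<rho> \<xi>.
           strict_mono r \<and> 1 \<le> r 0 \<and>
           (\<forall>T>0.
              converges_in_L1 ({0<..<T} \<times> corridor)
                (\<lambda>k (t, y). approximate_density \<rho>0 (r k) (x (r k)) t y) (\<lambda>(t, y). \<rho> t y) \<and>
              uniform_limit {0..T} (\<lambda>k. \<zeta> (r k)) \<xi> sequentially) \<and>
           entropy_solution \<rho>max v (\<lambda>u. 1 + \<alpha> * u) \<rho>0 \<rho> \<xi> \<and> BV_regular \<rho>"
proof -
  interpret particle_schemes \<rho>max v \<rho>0 \<alpha> x \<zeta>
  proof
    show "set_integrable lebesgue corridor \<rho>0" using assms(4) unfolding BV_on_def by (rule conjunct1)
  qed (fact assms)+
  obtain s g where s: "strict_mono (s :: nat \<Rightarrow> nat)"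
    and g: "\<And>p q :: real \<times> real. \<bar>g p - g q\<bar> \<le> (\<rho>max * v 0 + \<rho>max) * dist p q"
    and unif: "\<And>S. compact S \<Longrightarrow> uniform_limit S (\<lambda>k p. mass (Suc (s k)) (fst p) (snd p)) g sequentially"
    by (rule mass_subsequence) (rule that)
  obtain s' where s': "strict_mono (s' :: nat \<Rightarrow> nat)"
    and fast: "\<And>m t. t \<in> {0..real m} \<Longrightarrow>
      (LINT z:{-real m..real m}|lborel. \<bar>dens (Suc (s (s' (Suc m)))) t z - dens (Suc (s (s' m))) t z\<bar>) \<le> (1/2)^m"
    by (rule fast_subsequence[OF s unif]) (assumption, rule that)
  define r where "r k = Suc (s (s' k))" for k
  have r: "strict_mono r" using s s' by (auto simp: strict_mono_def r_def)
  interpret convergent_schemes \<rho>max v \<rho>0 \<alpha> x \<zeta> r g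
  proof
    show "uniform_limit S (\<lambda>k p. mass (r k) (fst p) (snd p)) g sequentially" if "compact S" for S
      unfolding uniform_limit_iff r_def
    proof (intro allI impI)
      fix e :: real assume "0 < e"
      then have "\<forall>\<^sub>F k in sequentially. \<forall>p\<in>S. dist (mass (Suc (s k)) (fst p) (snd p)) (g p) < e"
        using unif[OF that] unfolding uniform_limit_iff by blast
      from eventually_subseq[OF s' this]
      show "\<forall>\<^sub>F k in sequentially. \<forall>p\<in>S. dist (mass (Suc (s (s' k))) (fst p) (snd p)) (g p) < e" .
    qed
  qed (use r g fast in \<open>simp_all add: r_def\<close>)
  show ?thesis
  proof (intro exI conjI allI impI)
    show "strict_mono r" by (rule r)
    show "1 \<le> r 0" by (rule r_pos)
    fix T :: real
    show "converges_in_L1 ({0<..<T} \<times> corridor)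
        (\<lambda>k (t, y). approximate_density \<rho>0 (r k) (x (r k)) t y) (\<lambda>(t, y). \<rho> t y)"
      by (rule space_time_convergence)
    show "uniform_limit {0..T} (\<lambda>k. \<zeta> (r k)) \<xi> sequentially" by (rule turning_curve_convergence)
    show "entropy_solution \<rho>max v (\<lambda>u. 1 + \<alpha> * u) \<rho>0 \<rho> \<xi>" by (rule limit_entropy_solution)
    show "BV_regular \<rho>" by (rule BV_regular_limit)
  qed
qed

end
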